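(* Let $i\in I$ and $f(i)=j$. Then $$\Psi^{\ast,(i)}(q)=\Psi^{(i)}(\psi^{(j)}(q))\quad(q\ge0).$$ Here $\psi^{(j)}$ is the Laplace exponent of $Z^{(j)}$, $\Psi^{\ast,(i)}$ is the Laplace exponent of the cumulative excursion lifetime process $\Gamma^{(i)}_s=\int_{[0,s]\times D_0}\zeta(e)\,N^{\ast,(i)}(du\,de)$ of the time-changed process, and $\Psi^{(i)}(q)=\int_0^\infty(1-e^{-qt})\,n^{(i)}(\zeta\in dt)$ is the Laplace exponent of the cumulative excursion lifetime associated with $N^{(i)}$.
   Context: Regenerative process. $(\Omega,\mathcal A,\mathbb P)$ is a probability space, $S$ is a Polish space with a distinguished state $o$, and $D$ is the space of $S$-valued càdlàg paths on $[0,\infty)$ with shifts $(\theta_t x)(s)=x(t+s)$. $X=(X_t)_{t\ge0}$ is an $S$-valued càdlàg process adapted to a right-continuous complete filtration $\mathcal F=(\mathcal F_t)$ with $\mathbb P[X_0=o]=1$. It is regenerative at $o$: there is a probability measure $P_o$ on $D$ such that for every $\mathcal F$-optional time $\tau$ the regular conditional law of $\theta_\tau X$ given $\mathcal F_\tau$ equals $P_o$ a.s. on $\{\tau<\infty, X_\tau=o\}$. Put $\Xi=\{t\ge0\mid X_t=o\}$; almost surely $\overline\Xi$ is perfect, $\Xi$ is not locally finite, and $\Xi\ne[0,\infty)$. Excursions. $D_0=\{e\in D\mid \zeta(e)>0,\ e_t=o\text{ for all }t\ge\zeta(e)\}$, where $\zeta(e)=\inf\{t>0\mid e_t=o\}$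 ($\inf\emptyset=\infty$). By standard excursion theory the following are fixed: a measure $n$ on $D_0$ (excursion measure), a Poisson point process $N$ on $[0,\infty)\times D_0$ with intensity $dt\otimes n$, a non-negative non-decreasing continuous adapted process $L$ (local time at $o$), and a constant $c\ge0$ (stagnancy rate), such that: $n(\zeta>h)<\infty$ for all $h>0$; with $\eta_s=cs+\int_{[0,s]\times D_0}\zeta(e)\,N(du\,de)$ (right-continuous, strictly increasing), $L_\infty=\inf\{s\ge0\mid\eta_s=\infty\}$; for every $(s,e)\in\operatorname{Supp}N$ with $s\le L_\infty$, $X_t=e_{t-\eta_{s-}}$ for $t\in[\eta_{s-},\eta_s)$; the measure $dL$ is a.s. supported on $\overline\Xi$; and $\lambda(\Xi\cap[0,t])=cL_t$ a.s. for every $t$ ($\lambda$ is Lebesgue measure). Partition. $I=\{1,\dots,N\}$ or $\{1,2,\dots\}$, $I_0=I\cup\{0\}$, and $(D_0^{(i)})_{i\in I}$ are measurable subsets of $D_0$ with $n(D_0\setminus\bigcup_i D_0^{(i)})=0$ and $n(D_0^{(i)}\cap D_0^{(j)})=0$ for $i\ne j$. $N^{(i)}=N(\cdot\cap([0,\infty)\times D_0^{(i)}))$, $n^{(i)}=n(\cdot\cap D_0^{(i)})$. Clock. $J$ is finite or countable; $(Z^{(j)})_{j\in J}$ are independent subordinators, independent of $X$, each with a.s. strictly increasing paths; $f:I_0\to J$ is a map. The Laplace exponent of a subordinator $Y$ is $q\mapsto-\log E[e^{-qY_1}]$. For $i\in I$, $O^{(i)}(t)=\int_{[0,L(t))\times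 D_0}\zeta(e)\,N^{(i)}(ds\,de)+(t-\eta(L(t)-))1\{N^{(i)}(\{L(t)\}\times D_0)=1\}$, and $O^{(0)}(t)=\int_0^t1\{X_s=o\}ds$. $\tilde O^{(j)}(t)=\sum_{i\in I_0,f(i)=j}O^{(i)}(t)$, $T_t=\sum_{j\in J}Z^{(j)}(\tilde O^{(j)}(t))$, and it is assumed that $T_t<\infty$ for every $t\ge0$ a.s. $A_u=\inf\{t\ge0\mid T_t>u\}$ and $X^\ast_u=X_{A_u}$. Transformed excursions. For $j\in J$, $a,\ell\ge0$, $M^{(j)}_{a,\ell}(u)=Z^{(j)}((u+a)\wedge(a+\ell))-Z^{(j)}(a)$. For a non-decreasing càdlàg $m:[0,\infty)\to[0,\infty)$ with right-continuous inverse $m^{-1}(t)=\inf\{u\ge0\mid m(u)>t\}$, $\Theta(e,m)_t=e_{m^{-1}(t)}$ with $e_\infty=o$. For $(s,e)\in\operatorname{Supp}N$ with $e\in D_0^{(i)}$, $f(i)=j$, $e^\ast=\Theta(e,M^{(j)}_{\tilde O^{(j)}(\eta_{s-}),\zeta(e)})$. $N^{\ast,(i)}=\sum_{(s,e)\in\operatorname{Supp}N^{(i)}}\delta_{(s,e^\ast)}$. The kernel $\nu(e,\cdot)$ is the law of $\Theta(e,M^{(j)}_{0,\zeta(e)})$ for $e\in D_0^{(i)}$, $f(i)=j$. It is assumed that the partition is preserved by the time change: $\nu(e,D_0^{(i)})=1$ for $n$-almost every $e\in D_0^{(i)}$, for every $i\in I$.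
   Formalization: Points of N after L_∞ (where η_{s-}=∞, so e* is undefined) are dropped, and Ψ^{*,(i)} is taken under P conditioned on no infinite excursion outside class i up to local time 1; infinite lifetimes count in Ψ^{(i)}; L is taken to be the inverse of η. *)

theory Defs
  imports "HOL-Probability.Probability"
begin

section \<open>Paths and excursions\<close>

definition cadlag :: "(real \<Rightarrow> 'a::topological_space) \<Rightarrow> bool" where
  "cadlag x \<longleftrightarrow> (\<forall>t\<ge>0. (x \<longlongrightarrow> x t) (at_right t)) \<and> (\<forall>t>0. \<exists>l. (x \<longlongrightarrow> l) (at_left t))"

text \<open>
  The space \<open>D\<close>. Paths are extensional on \<open>[0,\<infinity>)\<close>, so that a path is determined by its values at
  nonnegative times; the sigma-algebra is the one generated by the evaluations, which is the Borel
  sigma-algebra of the Skorokhod topology.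
\<close>

definition path_space :: "(real \<Rightarrow> 's::polish_space) measure" where
  "path_space = restrict_space (Pi\<^sub>M {0..} (\<lambda>_. borel)) {x. cadlag x}"

definition path_of :: "(real \<Rightarrow> 'w \<Rightarrow> 'a) \<Rightarrow> 'w \<Rightarrow> real \<Rightarrow> 'a" where
  "path_of X \<omega> = (\<lambda>t\<in>{0..}. X t \<omega>)"

definition shift :: "real \<Rightarrow> (real \<Rightarrow> 'a) \<Rightarrow> real \<Rightarrow> 'a" where
  "shift t x = (\<lambda>s\<in>{0..}. x (t + s))"

definition zeta :: "'s \<Rightarrow> (real \<Rightarrow> 's) \<Rightarrow> ennreal" where
  "zeta x\<^sub>o e = Inf {ennreal t | t. 0 < t \<and> e t = x\<^sub>o}"

definition exc_paths :: "'s::polish_space \<Rightarrow> (real \<Rightarrow> 's) set" where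
  "exc_paths x\<^sub>o = {e \<in> space path_space. 0 < zeta x\<^sub>o e \<and> (\<forall>t\<ge>0. zeta x\<^sub>o e \<le> ennreal t \<longrightarrow> e t = x\<^sub>o)}"

text \<open>\<open>exc_space\<close> is \<open>D\<^sub>0\<close> with the trace sigma-algebra; only its sets matter.\<close>

definition exc_space :: "'s::polish_space \<Rightarrow> (real \<Rightarrow> 's) measure" where
  "exc_space x\<^sub>o = restrict_space path_space (exc_paths x\<^sub>o)"


section \<open>Point processes\<close>

definition atoms :: "'a measure \<Rightarrow> 'a set" where
  "atoms \<mu> = {p \<in> space \<mu>. emeasure \<mu> {p} \<noteq> 0}"

definition point_measure :: "'a measure \<Rightarrow> bool" where
  "point_measure \<mu> \<longleftrightarrow> countable (atoms \<mu>)
     \<and> (\<forall>p\<in>atoms \<mu>. \<exists>k::nat. emeasure \<mu> {p} = of_nat k)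
     \<and> (\<forall>B\<in>sets \<mu>. emeasure \<mu> B = (\<integral>\<^sup>+p. emeasure \<mu> {p} \<partial>count_space (atoms \<mu> \<inter> B)))"

definition poisson_point_process :: "'w measure \<Rightarrow> 'a measure \<Rightarrow> ('w \<Rightarrow> 'a measure) \<Rightarrow> bool" where
  "poisson_point_process P \<mu> N \<longleftrightarrow>
     (\<forall>\<omega>\<in>space P. sets (N \<omega>) = sets \<mu> \<and> point_measure (N \<omega>))
   \<and> (\<forall>B\<in>sets \<mu>. (\<lambda>\<omega>. emeasure (N \<omega>) B) \<in> borel_measurable P)
   \<and> (\<forall>B\<in>sets \<mu>. emeasure \<mu> B < \<infinity> \<longrightarrow>
        (\<forall>k::nat. measure P {\<omega>\<in>space P. emeasure (N \<omega>) B = of_nat k}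
                    = measure \<mu> B ^ k / fact k * exp (- measure \<mu> B)))
   \<and> (\<forall>B\<in>sets \<mu>. emeasure \<mu> B = \<infinity> \<longrightarrow> (AE \<omega> in P. emeasure (N \<omega>) B = \<infinity>))
   \<and> (\<forall>B :: nat \<Rightarrow> 'a set. range B \<subseteq> sets \<mu> \<and> disjoint_family B \<longrightarrow>
        prob_space.indep_vars P (\<lambda>_. borel) (\<lambda>k \<omega>. emeasure (N \<omega>) (B k)) UNIV)"


section \<open>Subordinators\<close>

definition subordinator :: "'w measure \<Rightarrow> (real \<Rightarrow> 'w \<Rightarrow> real) \<Rightarrow> bool" where
  "subordinator P Y \<longleftrightarrow>
     (\<forall>t\<ge>0. Y t \<in> borel_measurable P)
   \<and> (AE \<omega> in P. Y 0 \<omega> = 0 \<and> mono_on {0..} (\<lambda>t. Y t \<omega>) \<and> cadlag (\<lambda>t. Y t \<omega>))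
   \<and> (\<forall>t :: nat \<Rightarrow> real. 0 \<le> t 0 \<and> incseq t \<longrightarrow>
        prob_space.indep_vars P (\<lambda>_. borel) (\<lambda>k \<omega>. Y (t (Suc k)) \<omega> - Y (t k) \<omega>) UNIV)
   \<and> (\<forall>s\<ge>0. \<forall>t\<ge>0. distr P borel (\<lambda>\<omega>. Y (s + t) \<omega> - Y s \<omega>) = distr P borel (Y t))"

text \<open>\<open>exp_neg q y\<close> is \<open>exp (- q y)\<close> for \<open>y \<in> [0,\<infinity>]\<close>, with \<open>0 * \<infinity> = 0\<close> and \<open>exp (-\<infinity>) = 0\<close>.\<close>

definition exp_neg :: "real \<Rightarrow> ennreal \<Rightarrow> real" where
  "exp_neg q y = (if ennreal q * y = \<infinity> then 0 else exp (- enn2real (ennreal q * y)))"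

definition laplace_exponent :: "'w measure \<Rightarrow> (real \<Rightarrow> 'w \<Rightarrow> ennreal) \<Rightarrow> real \<Rightarrow> real" where
  "laplace_exponent P Y q = - ln (\<integral>\<omega>. exp_neg q (Y 1 \<omega>) \<partial>P)"


section \<open>Regenerative processes\<close>

definition zero_set :: "'s \<Rightarrow> (real \<Rightarrow> 's) \<Rightarrow> real set" where
  "zero_set x\<^sub>o x = {t. 0 \<le> t \<and> x t = x\<^sub>o}"

text \<open>
  The filtration is indexed by \<open>[0,\<infinity>]\<close>, so that the library notions of stopping time and of the
  sigma-algebra of its past apply to optional times with values in \<open>[0,\<infinity>]\<close>. Nothing but
  monotonicity is required of \<open>F \<infinity>\<close>, which has no influence on \<open>F\<^sub>\<tau>\<close> on \<open>{\<tau> < \<infinity>}\<close>. Completeness: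
  all subsets of null sets belong to \<open>F 0\<close>.
\<close>

locale regenerative_process = prob_space P
  for P :: "'w measure" +
  fixes F :: "ennreal \<Rightarrow> 'w measure"
    and X :: "real \<Rightarrow> 'w \<Rightarrow> 's::polish_space"
    and x\<^sub>o :: 's
  assumes filtration_F: "filtration (space P) F"
    and F_le: "\<And>t. sets (F t) \<subseteq> sets P"
    and F_right_continuous: "\<And>t. t < \<infinity> \<Longrightarrow> sets (F t) = (\<Inter>s\<in>{t<..}. sets (F s))"
    and F_complete: "\<And>A B. B \<in> null_sets P \<Longrightarrow> A \<subseteq> B \<Longrightarrow> A \<in> sets (F 0)"
    and X_cadlag: "\<And>\<omega>. \<omega> \<in> space P \<Longrightarrow> cadlag (\<lambda>t. X t \<omega>)"
    and X_adapted: "\<And>t. 0 \<le> t \<Longrightarrow> X t \<in> measurable (F (ennreal t)) borel"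
    and X_start: "AE \<omega> in P. X 0 \<omega> = x\<^sub>o"
    and regenerative:
      "\<exists>P\<^sub>o. prob_space P\<^sub>o \<and> sets P\<^sub>o = sets path_space \<and>
        (\<forall>\<tau>. stopping_time F \<tau> \<longrightarrow>
          (\<forall>B\<in>sets path_space. AE \<omega> in P. \<tau> \<omega> < \<infinity> \<and> X (enn2real (\<tau> \<omega>)) \<omega> = x\<^sub>o \<longrightarrow>
             real_cond_exp P (filtration.pre_sigma (space P) F \<tau>)
               (\<lambda>\<omega>. indicator B (shift (enn2real (\<tau> \<omega>)) (path_of X \<omega>))) \<omega> = measure P\<^sub>o B))"
    and zeros_perfect: "AE \<omega> in P. \<forall>t\<in>closure (zero_set x\<^sub>o (\<lambda>t. X t \<omega>)).
        t islimpt closure (zero_set x\<^sub>o (\<lambda>t. X t \<omega>))"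
    and zeros_not_locally_finite: "AE \<omega> in P. \<not> (\<forall>t. finite (zero_set x\<^sub>o (\<lambda>t. X t \<omega>) \<inter> {0..t}))"
    and zeros_not_all: "AE \<omega> in P. zero_set x\<^sub>o (\<lambda>t. X t \<omega>) \<noteq> {0..}"


section \<open>Excursion data\<close>

text \<open>
  The following definitions are pathwise: \<open>\<mu>\<close> stands for \<open>N \<omega>\<close>, \<open>l\<close> for the path of \<open>L\<close>, \<open>x\<close> for
  the path of \<open>X\<close> and \<open>z j\<close> for the path of the \<open>j\<close>-th subordinator.
\<close>

definition eta :: "'s::polish_space \<Rightarrow> real \<Rightarrow> (real \<times> (real \<Rightarrow> 's)) measure \<Rightarrow> real \<Rightarrow> ennreal" where
  "eta x\<^sub>o c \<mu> s = ennreal (c * s) + (\<integral>\<^sup>+(u, e)\<in>{0..s} \<times> exc_paths x\<^sub>o. zeta x\<^sub>o e \<partial>\<mu>)"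

text \<open>The left limit of the nondecreasing function \<open>eta\<close>, with value \<open>0\<close> at \<open>s = 0\<close>.\<close>

definition eta_left :: "'s::polish_space \<Rightarrow> real \<Rightarrow> (real \<times> (real \<Rightarrow> 's)) measure \<Rightarrow> real \<Rightarrow> ennreal" where
  "eta_left x\<^sub>o c \<mu> s = (SUP r\<in>{0..<s}. eta x\<^sub>o c \<mu> r)"

definition L_inf :: "'s::polish_space \<Rightarrow> real \<Rightarrow> (real \<times> (real \<Rightarrow> 's)) measure \<Rightarrow> ennreal" where
  "L_inf x\<^sub>o c \<mu> = Inf {ennreal s | s. 0 \<le> s \<and> eta x\<^sub>o c \<mu> s = \<infinity>}"

text \<open>
  \<open>L_inverse\<close> makes explicit that \<open>\<eta>\<close> is the inverse local time: for \<open>c = 0\<close> the remaining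
  properties determine \<open>L\<close> only up to a positive factor.
\<close>

locale excursion_data = regenerative_process P F X x\<^sub>o
  for P :: "'w measure" and F and X :: "real \<Rightarrow> 'w \<Rightarrow> 's::polish_space" and x\<^sub>o +
  fixes n :: "(real \<Rightarrow> 's) measure"
    and N :: "'w \<Rightarrow> (real \<times> (real \<Rightarrow> 's)) measure"
    and L :: "real \<Rightarrow> 'w \<Rightarrow> real"
    and c :: real
  assumes sets_n: "sets n = sets (exc_space x\<^sub>o)"
    and n_finite: "\<And>h. 0 < h \<Longrightarrow> emeasure n {e \<in> space n. ennreal h < zeta x\<^sub>o e} < \<infinity>"
    and N_poisson: "poisson_point_process P (restrict_space lborel {0..} \<Otimes>\<^sub>M n) N"
    and c_nonneg: "0 \<le> c"
    and L_nonneg: "\<And>t \<omega>. 0 \<le> t \<Longrightarrow> \<omega> \<in> space P \<Longrightarrow> 0 \<le> L t \<omega>"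
    and L_mono: "\<And>\<omega>. \<omega> \<in> space P \<Longrightarrow> mono_on {0..} (\<lambda>t. L t \<omega>)"
    and L_continuous: "\<And>\<omega>. \<omega> \<in> space P \<Longrightarrow> continuous_on {0..} (\<lambda>t. L t \<omega>)"
    and L_adapted: "\<And>t. 0 \<le> t \<Longrightarrow> L t \<in> borel_measurable (F (ennreal t))"
    and eta_right_continuous:
      "AE \<omega> in P. \<forall>s\<ge>0. (eta x\<^sub>o c (N \<omega>) \<longlongrightarrow> eta x\<^sub>o c (N \<omega>) s) (at_right s)"
    and eta_strict_mono:
      "AE \<omega> in P. strict_mono_on {s. 0 \<le> s \<and> ennreal s < L_inf x\<^sub>o c (N \<omega>)} (eta x\<^sub>o c (N \<omega>))"
    and L_inverse:
      "AE \<omega> in P. \<forall>t\<ge>0. ennreal (L t \<omega>) = Inf {ennreal s | s. 0 \<le> s \<and> ennreal t < eta x\<^sub>o c (N \<omega>) s}"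
    and X_excursions:
      "AE \<omega> in P. \<forall>(s, e)\<in>atoms (N \<omega>). ennreal s \<le> L_inf x\<^sub>o c (N \<omega>) \<longrightarrow>
         (\<forall>t\<ge>0. eta_left x\<^sub>o c (N \<omega>) s \<le> ennreal t \<and> ennreal t < eta x\<^sub>o c (N \<omega>) s \<longrightarrow>
            X t \<omega> = e (t - enn2real (eta_left x\<^sub>o c (N \<omega>) s)))"
    and dL_support:
      "AE \<omega> in P. emeasure (interval_measure (\<lambda>t. L (max 0 t) \<omega>))
         (- closure (zero_set x\<^sub>o (\<lambda>t. X t \<omega>))) = 0"
    and zeros_occupation:
      "\<And>t. 0 \<le> t \<Longrightarrow>
         AE \<omega> in P. emeasure lborel (zero_set x\<^sub>o (\<lambda>t. X t \<omega>) \<inter> {0..t}) = ennreal (c * L t \<omega>)"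


section \<open>The partition and the clock\<close>

definition exc_class :: "(nat \<Rightarrow> (real \<Rightarrow> 's) set) \<Rightarrow> (real \<times> (real \<Rightarrow> 's)) measure \<Rightarrow> nat
    \<Rightarrow> (real \<times> (real \<Rightarrow> 's)) measure" where
  "exc_class D \<mu> i = density \<mu> (indicator ({0..} \<times> D i))"

definition occ :: "'s::polish_space \<Rightarrow> real \<Rightarrow> (nat \<Rightarrow> (real \<Rightarrow> 's) set)
    \<Rightarrow> (real \<times> (real \<Rightarrow> 's)) measure \<Rightarrow> (real \<Rightarrow> real) \<Rightarrow> (real \<Rightarrow> 's)
    \<Rightarrow> nat \<Rightarrow> real \<Rightarrow> ennreal" where
  "occ x\<^sub>o c D \<mu> l x i t =
     (if i = 0 then (\<integral>\<^sup>+s\<in>{0..t}. indicator {s. x s = x\<^sub>o} s \<partial>lborel)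
      else (\<integral>\<^sup>+(u, e)\<in>{0..<l t} \<times> exc_paths x\<^sub>o. zeta x\<^sub>o e \<partial>exc_class D \<mu> i)
           + (if emeasure (exc_class D \<mu> i) ({l t} \<times> exc_paths x\<^sub>o) = 1
              then ennreal t - eta_left x\<^sub>o c \<mu> (l t) else 0))"

definition clock_occ :: "'s::polish_space \<Rightarrow> real \<Rightarrow> (nat \<Rightarrow> (real \<Rightarrow> 's) set) \<Rightarrow> nat set
    \<Rightarrow> (nat \<Rightarrow> 'j) \<Rightarrow> (real \<times> (real \<Rightarrow> 's)) measure \<Rightarrow> (real \<Rightarrow> real) \<Rightarrow> (real \<Rightarrow> 's)
    \<Rightarrow> 'j \<Rightarrow> real \<Rightarrow> ennreal" where
  "clock_occ x\<^sub>o c D I f \<mu> l x j t =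
     (\<integral>\<^sup>+i. occ x\<^sub>o c D \<mu> l x i t \<partial>count_space {i \<in> insert 0 I. f i = j})"

text \<open>
  Almost surely \<open>clock_occ \<dots> j t \<le> t\<close>, so \<open>enn2real\<close> loses nothing.
\<close>

definition total_clock :: "'s::polish_space \<Rightarrow> real \<Rightarrow> (nat \<Rightarrow> (real \<Rightarrow> 's) set) \<Rightarrow> nat set
    \<Rightarrow> (nat \<Rightarrow> 'j) \<Rightarrow> 'j set \<Rightarrow> (real \<times> (real \<Rightarrow> 's)) measure \<Rightarrow> (real \<Rightarrow> real) \<Rightarrow> (real \<Rightarrow> 's)
    \<Rightarrow> ('j \<Rightarrow> real \<Rightarrow> real) \<Rightarrow> real \<Rightarrow> ennreal" where
  "total_clock x\<^sub>o c D I f J \<mu> l x z t =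
     (\<integral>\<^sup>+j. ennreal (z j (enn2real (clock_occ x\<^sub>o c D I f \<mu> l x j t))) \<partial>count_space J)"

text \<open>\<open>clock_incr z a d\<close> is \<open>M\<^bsub>a,d\<^esub>\<close>; the duration \<open>d\<close> may be infinite.\<close>

definition clock_incr :: "(real \<Rightarrow> real) \<Rightarrow> real \<Rightarrow> ennreal \<Rightarrow> real \<Rightarrow> real" where
  "clock_incr z a d u = z (enn2real (min (ennreal (u + a)) (ennreal a + d))) - z a"

definition rc_inverse :: "(real \<Rightarrow> real) \<Rightarrow> real \<Rightarrow> ennreal" where
  "rc_inverse m t = Inf {ennreal u | u. 0 \<le> u \<and> t < m u}"

definition time_change :: "'s \<Rightarrow> (real \<Rightarrow> 's) \<Rightarrow> (real \<Rightarrow> real) \<Rightarrow> real \<Rightarrow> 's" where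
  "time_change x\<^sub>o e m =
     (\<lambda>t\<in>{0..}. if rc_inverse m t = \<infinity> then x\<^sub>o else e (enn2real (rc_inverse m t)))"

text \<open>\<open>nu P x\<^sub>o Zj e B\<close> is \<open>\<nu>(e,B)\<close> for \<open>e\<close> in a class whose clock is the subordinator \<open>Zj\<close>.\<close>

definition nu :: "'w measure \<Rightarrow> 's \<Rightarrow> (real \<Rightarrow> 'w \<Rightarrow> real) \<Rightarrow> (real \<Rightarrow> 's) \<Rightarrow> (real \<Rightarrow> 's) set \<Rightarrow> real" where
  "nu P x\<^sub>o Zj e B =
     measure P {\<omega>\<in>space P. time_change x\<^sub>o e (clock_incr (\<lambda>t. Zj t \<omega>) 0 (zeta x\<^sub>o e)) \<in> B}"

locale time_changed_regenerative_process = excursion_data P F X x\<^sub>o n N L c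
  for P :: "'w measure" and F and X :: "real \<Rightarrow> 'w \<Rightarrow> 's::polish_space" and x\<^sub>o and n and N and L and c +
  fixes I :: "nat set"
    and D :: "nat \<Rightarrow> (real \<Rightarrow> 's) set"
    and J :: "'j set"
    and Z :: "'j \<Rightarrow> real \<Rightarrow> 'w \<Rightarrow> real"
    and f :: "nat \<Rightarrow> 'j"
  assumes I_cases: "(\<exists>m\<ge>1. I = {1..m}) \<or> I = {1..}"
    and D_sets: "\<And>i. i \<in> I \<Longrightarrow> D i \<in> sets n"
    and D_cover: "emeasure n (exc_paths x\<^sub>o - (\<Union>i\<in>I. D i)) = 0"
    and D_disjoint: "\<And>i i'. i \<in> I \<Longrightarrow> i' \<in> I \<Longrightarrow> i \<noteq> i' \<Longrightarrow> emeasure n (D i \<inter> D i') = 0"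
    and J_countable: "countable J"
    and f_range: "\<And>i. i \<in> insert 0 I \<Longrightarrow> f i \<in> J"
    and Z_subordinator: "\<And>j. j \<in> J \<Longrightarrow> subordinator P (Z j)"
    and Z_strict_mono: "\<And>j. j \<in> J \<Longrightarrow> AE \<omega> in P. strict_mono_on {0..} (\<lambda>t. Z j t \<omega>)"
    and Z_indep: "indep_vars (\<lambda>_. Pi\<^sub>M {0..} (\<lambda>_. borel)) (\<lambda>j. path_of (Z j)) J"
    and Z_indep_X: "indep_set (sets (vimage_algebra (space P) (path_of X) path_space))
          (sets (vimage_algebra (space P) (\<lambda>\<omega>. \<lambda>j\<in>J. path_of (Z j) \<omega>)
            (Pi\<^sub>M J (\<lambda>_. Pi\<^sub>M {0..} (\<lambda>_. borel)))))"
    and clock_finite: "AE \<omega> in P. \<forall>t\<ge>0.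
          total_clock x\<^sub>o c D I f J (N \<omega>) (\<lambda>t. L t \<omega>) (\<lambda>t. X t \<omega>) (\<lambda>j t. Z j t \<omega>) t < \<infinity>"
    and D_preserved: "\<And>i. i \<in> I \<Longrightarrow> AE e in n. e \<in> D i \<longrightarrow> nu P x\<^sub>o (Z (f i)) e (D i) = 1"


section \<open>Time-changed excursions and their lifetimes\<close>

definition star_exc :: "'s::polish_space \<Rightarrow> real \<Rightarrow> (nat \<Rightarrow> (real \<Rightarrow> 's) set) \<Rightarrow> nat set
    \<Rightarrow> (nat \<Rightarrow> 'j) \<Rightarrow> (real \<times> (real \<Rightarrow> 's)) measure \<Rightarrow> (real \<Rightarrow> real) \<Rightarrow> (real \<Rightarrow> 's)
    \<Rightarrow> ('j \<Rightarrow> real \<Rightarrow> real) \<Rightarrow> nat \<Rightarrow> real \<Rightarrow> (real \<Rightarrow> 's) \<Rightarrow> (real \<Rightarrow> 's)" where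
  "star_exc x\<^sub>o c D I f \<mu> l x z i s e =
     time_change x\<^sub>o e
       (clock_incr (z (f i))
          (enn2real (clock_occ x\<^sub>o c D I f \<mu> l x (f i) (enn2real (eta_left x\<^sub>o c \<mu> s))))
          (zeta x\<^sub>o e))"

text \<open>
  \<open>e\<^sup>*\<close> is built from \<open>\<eta>\<^bsub>s-\<^esub>\<close>, which is finite exactly for the points \<open>(s,e)\<close> of \<open>N\<close> with
  \<open>s \<le> L\<^sub>\<infinity>\<close>, up to null sets. Only those are transformed; this is no restriction if \<open>L\<^sub>\<infinity> = \<infinity>\<close>.
\<close>

definition star_process :: "'s::polish_space \<Rightarrow> real \<Rightarrow> (nat \<Rightarrow> (real \<Rightarrow> 's) set) \<Rightarrow> nat set
    \<Rightarrow> (nat \<Rightarrow> 'j) \<Rightarrow> (real \<times> (real \<Rightarrow> 's)) measure \<Rightarrow> (real \<Rightarrow> real) \<Rightarrow> (real \<Rightarrow> 's)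
    \<Rightarrow> ('j \<Rightarrow> real \<Rightarrow> real) \<Rightarrow> nat \<Rightarrow> (real \<times> (real \<Rightarrow> 's)) measure" where
  "star_process x\<^sub>o c D I f \<mu> l x z i =
     distr (count_space {(s, e) \<in> atoms (exc_class D \<mu> i). ennreal s \<le> L_inf x\<^sub>o c \<mu>})
       (restrict_space borel {0..} \<Otimes>\<^sub>M exc_space x\<^sub>o)
       (\<lambda>(s, e). (s, star_exc x\<^sub>o c D I f \<mu> l x z i s e))"

definition star_lifetime :: "'s::polish_space \<Rightarrow> real \<Rightarrow> (nat \<Rightarrow> (real \<Rightarrow> 's) set) \<Rightarrow> nat set
    \<Rightarrow> (nat \<Rightarrow> 'j) \<Rightarrow> ('w \<Rightarrow> (real \<times> (real \<Rightarrow> 's)) measure) \<Rightarrow> (real \<Rightarrow> 'w \<Rightarrow> real)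
    \<Rightarrow> (real \<Rightarrow> 'w \<Rightarrow> 's) \<Rightarrow> ('j \<Rightarrow> real \<Rightarrow> 'w \<Rightarrow> real) \<Rightarrow> nat \<Rightarrow> real \<Rightarrow> 'w \<Rightarrow> ennreal" where
  "star_lifetime x\<^sub>o c D I f N L X Z i s \<omega> =
     (\<integral>\<^sup>+(u, e)\<in>{0..s} \<times> exc_paths x\<^sub>o. zeta x\<^sub>o e
        \<partial>star_process x\<^sub>o c D I f (N \<omega>) (\<lambda>t. L t \<omega>) (\<lambda>t. X t \<omega>) (\<lambda>j t. Z j t \<omega>) i)"

text \<open>
  The law under which the Laplace exponent of the lifetime process of class \<open>i\<close> is taken. If an
  excursion of another class is infinite, it ends the process, and later transformed excursions
  of class \<open>i\<close> do not exist; the process of class \<open>i\<close> is then only known up to that independent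
  exponential local time. As the Laplace exponent is read off at local time \<open>1\<close>, we
  condition on no such excursion having occurred by then. If \<open>n\<close> does not charge the infinite
  excursions outside class \<open>i\<close> (in particular if \<open>L\<^sub>\<infinity> = \<infinity>\<close> almost surely), nothing is
  conditioned on, see \<open>laplace_exponent_class_law\<close>. An infinite excursion of class \<open>i\<close> itself
  needs no convention: it makes the lifetime process jump to \<open>\<infinity>\<close>.
\<close>

definition class_law :: "'w measure \<Rightarrow> 's::polish_space \<Rightarrow> (nat \<Rightarrow> (real \<Rightarrow> 's) set)
    \<Rightarrow> ('w \<Rightarrow> (real \<times> (real \<Rightarrow> 's)) measure) \<Rightarrow> nat \<Rightarrow> 'w measure" where
  "class_law P x\<^sub>o D N i = uniform_measure P
     {\<omega>\<in>space P. emeasure (N \<omega>) ({0..1} \<times> {e \<in> exc_paths x\<^sub>o. zeta x\<^sub>o e = \<infinity> \<and> e \<notin> D i}) = 0}"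

lemma zeta_le_iff:
  assumes e: "e \<in> exc_paths x\<^sub>o" and t: "0 < t"
  shows "zeta x\<^sub>o e \<le> ennreal t \<longleftrightarrow> e t = x\<^sub>o"
proof
  assume "zeta x\<^sub>o e \<le> ennreal t"
  then show "e t = x\<^sub>o" using e t by (simp add: exc_paths_def)
next
  assume "e t = x\<^sub>o"
  then show "zeta x\<^sub>o e \<le> ennreal t" unfolding zeta_def using t by (intro Inf_lower) auto
qed

lemma space_exc_space: "space (exc_space x\<^sub>o) = exc_paths x\<^sub>o"
  by (auto simp: exc_space_def exc_paths_def space_restrict_space)

lemma measurable_zeta: "zeta x\<^sub>o \<in> borel_measurable (exc_space x\<^sub>o)"
proof (rule borel_measurableI_le)
  fix y :: ennreal
  have ev: "(\<lambda>e. e t) \<in> measurable (exc_space x\<^sub>o) borel" if "0 < t" for t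
    unfolding exc_space_def path_space_def
    by (intro measurable_restrict_space1 measurable_component_singleton) (use that in simp)
  consider "y = \<infinity>" | "y = 0" | t where "0 < t" "y = ennreal t"
    by (cases y) (auto simp: less_le)
  then show "{e \<in> space (exc_space x\<^sub>o). zeta x\<^sub>o e \<le> y} \<in> sets (exc_space x\<^sub>o)"
  proof cases
    case 1
    then show ?thesis by simp
  next
    case 2
    then have "{e \<in> space (exc_space x\<^sub>o). zeta x\<^sub>o e \<le> y} = {}"
      by (auto simp: space_exc_space exc_paths_def)
    then show ?thesis by (metis sets.empty_sets)
  next
    case (3 t)
    have "{e \<in> space (exc_space x\<^sub>o). zeta x\<^sub>o e \<le> y} = (\<lambda>e. e t) -` {x\<^sub>o} \<inter> space (exc_space x\<^sub>o)"
      using 3 zeta_le_iff by (auto simp: space_exc_space)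
    then show ?thesis using measurable_sets[OF ev[OF \<open>0 < t\<close>], of "{x\<^sub>o}"] by simp
  qed
qed

lemma (in excursion_data) sigma_finite_n: "sigma_finite_measure n"
proof
  have sp: "space n = exc_paths x\<^sub>o"
    using sets_eq_imp_space_eq[OF sets_n] by (simp add: space_exc_space)
  have [measurable]: "zeta x\<^sub>o \<in> borel_measurable n"
    by (subst measurable_cong_sets[OF sets_n refl]) (rule measurable_zeta)
  let ?A = "\<lambda>k::nat. {e \<in> space n. ennreal (1 / real (Suc k)) < zeta x\<^sub>o e}"
  have "\<exists>k::nat. ennreal (1 / real (Suc k)) < zeta x\<^sub>o e" if "e \<in> space n" for e
  proof -
    have pos: "0 < zeta x\<^sub>o e" using that by (simp add: sp exc_paths_def)
    show ?thesis
    proof (cases "zeta x\<^sub>o e")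
      case (real r)
      then have "0 < r" using pos by simp
      then obtain k :: nat where "1 / real (Suc k) < r" using nat_approx_posE by blast
      then show ?thesis using real by (auto simp: ennreal_less_iff)
    qed auto
  qed
  then have "\<Union> (range ?A) = space n" by blast
  then show "\<exists>A. countable A \<and> A \<subseteq> sets n \<and> \<Union> A = space n \<and> (\<forall>a\<in>A. emeasure n a \<noteq> \<infinity>)"
    using n_finite by (intro exI[of _ "range ?A"]) (force simp: less_top[symmetric])
qed

lemma laplace_exponent_class_law:
  assumes "time_changed_regenerative_process P F X x\<^sub>o n N L c I D J Z f"
    and "i \<in> I" and in_D: "AE e in n. zeta x\<^sub>o e = \<infinity> \<longrightarrow> e \<in> D i"
  shows "laplace_exponent (class_law P x\<^sub>o D N i) Y q = laplace_exponent P Y q"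
proof -
  interpret time_changed_regenerative_process P F X x\<^sub>o n N L c I D J Z f by fact
  let ?E = "{e \<in> exc_paths x\<^sub>o. zeta x\<^sub>o e = \<infinity> \<and> e \<notin> D i}"
  let ?\<mu> = "restrict_space lborel {0..} \<Otimes>\<^sub>M n"
  define B where "B = {0..1::real} \<times> ?E"
  define A where "A = {\<omega>\<in>space P. emeasure (N \<omega>) B = 0}"
  interpret n: sigma_finite_measure n by (rule sigma_finite_n)
  have sp: "space n = exc_paths x\<^sub>o"
    using sets_eq_imp_space_eq[OF sets_n] by (simp add: space_exc_space)
  have [measurable]: "zeta x\<^sub>o \<in> borel_measurable n"
    by (subst measurable_cong_sets[OF sets_n refl]) (rule measurable_zeta)
  have "{e \<in> space n. zeta x\<^sub>o e = \<infinity>} - D i \<in> sets n"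
    by (intro sets.Diff D_sets \<open>i \<in> I\<close>) measurable
  moreover have "{e \<in> space n. zeta x\<^sub>o e = \<infinity>} - D i = ?E" by (auto simp: sp)
  ultimately have E: "?E \<in> sets n" by simp
  have E0: "emeasure n ?E = 0"
    using in_D by (subst AE_iff_measurable[OF E, symmetric]) (auto simp: sp)
  have I01: "{0..1::real} \<in> sets (restrict_space lborel {0..})"
    by (auto simp: sets_restrict_space_iff)
  have B: "B \<in> sets ?\<mu>" unfolding B_def using I01 E by simp
  have B0: "emeasure ?\<mu> B = 0"
    unfolding B_def using I01 E E0 by (simp add: n.emeasure_pair_measure_Times)
  have A: "A \<in> sets P"
  proof -
    have "(\<lambda>\<omega>. emeasure (N \<omega>) B) \<in> borel_measurable P"
      using N_poisson B unfolding poisson_point_process_def by blast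
    then show ?thesis unfolding A_def by measurable
  qed
  have "measure P {\<omega>\<in>space P. emeasure (N \<omega>) B = of_nat 0} = 1"
  proof -
    have "emeasure ?\<mu> B < \<infinity> \<longrightarrow>
        (\<forall>k::nat. measure P {\<omega>\<in>space P. emeasure (N \<omega>) B = of_nat k}
                    = measure ?\<mu> B ^ k / fact k * exp (- measure ?\<mu> B))"
      using N_poisson B unfolding poisson_point_process_def by blast
    moreover have "emeasure ?\<mu> B < \<infinity>" by (simp add: B0)
    ultimately have "measure P {\<omega>\<in>space P. emeasure (N \<omega>) B = of_nat 0}
                    = measure ?\<mu> B ^ 0 / fact 0 * exp (- measure ?\<mu> B)" by blast
    also have "measure ?\<mu> B = 0" by (simp add: measure_def B0)
    finally show ?thesis by simp
  qed
  then have A1: "emeasure P A = 1"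
    by (simp add: A_def emeasure_eq_measure)
  have "uniform_measure P A = P"
  proof (rule measure_eqI)
    fix C assume "C \<in> sets (uniform_measure P A)"
    then have C: "C \<in> sets P" by simp
    have "AE \<omega> in P. \<omega> \<in> A" using A1 A by (simp add: emeasure_eq_measure prob_eq_1)
    then have "emeasure P (A \<inter> C) = emeasure P C"
      using A C by (intro emeasure_eq_AE) auto
    then show "emeasure (uniform_measure P A) C = emeasure P C"
      using A C A1 by (simp add: divide_ennreal_def)
  qed simp
  then show ?thesis
    by (simp add: laplace_exponent_def class_law_def A_def B_def)
qed

text \<open>The integral runs over lifetimes in \<open>(0,\<infinity>]\<close>, with \<open>exp (- q * \<infinity>) = 0\<close> for \<open>q > 0\<close>.\<close>

definition lifetime_exponent :: "'s \<Rightarrow> (real \<Rightarrow> 's) measure \<Rightarrow> (nat \<Rightarrow> (real \<Rightarrow> 's) set) \<Rightarrow> nat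
    \<Rightarrow> real \<Rightarrow> real" where
  "lifetime_exponent x\<^sub>o n D i q =
     (\<integral>t. 1 - exp_neg q t \<partial>distr (density n (indicator (D i))) borel (zeta x\<^sub>o))"

end

theory Submission
  imports Defs
begin

text \<open>
  Put \<open>j = f i\<close>. An excursion of class \<open>i\<close> with local time \<open>s\<close> and lifetime \<open>\<zeta>\<close> occupies the interval
  \<open>(a, a + \<zeta>)\<close> on the time axis of the clock \<open>Z j\<close>, where \<open>a\<close> is the occupation time of the clock
  at \<open>\<eta>\<^bsub>s-\<^esub>\<close>; its transformed lifetime is \<open>Z\<^bsub>(a+\<zeta>)-\<^esub> - Z\<^bsub>a\<^esub>\<close>, the mass that \<open>dZ\<close> gives to this
  interval. The intervals are disjoint, so the total transformed lifetime up to local time \<open>1\<close> is the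
  \<open>dZ\<close>-mass of a random open set \<open>V\<close>. If \<open>V\<close> is independent of \<open>Z j\<close>, approximation of \<open>V\<close> by
  dyadic intervals gives \<open>E exp (- q dZ(V)) = E exp (- \<psi>(q) \<lambda>(V))\<close>, and \<open>\<lambda>(V)\<close> is the sum of the
  original lifetimes, whose Laplace transform is given by the exponential formula for Poisson
  point processes.

  Since \<open>Z\<close> is only assumed independent of \<open>X\<close>, one has to show that \<open>V\<close> is measurable with
  respect to the completion of \<open>\<sigma>(X)\<close>. The zeros of \<open>X\<close> are detected by a capacity argument, the
  local time is recovered from the occupation time of \<open>x\<^sub>o\<close> if \<open>c > 0\<close> and from the law of large
  numbers for the number of long excursions if \<open>c = 0\<close>.
\<close>

section \<open>Poisson point processes\<close>

text \<open>Infinite excursions shape the computation. After the first of them \<open>X\<close>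
  shows nothing more of \<open>N\<close>, so independence of the clock can only be exploited on the
  event \<open>\<eta> 1 < \<infinity>\<close>, which is recognised from the local time. Off this
  event, almost surely some excursion up to local time 1 is infinite; on the conditioning event of
  \<open>class_law\<close> it belongs to class \<open>i\<close>, and since the clock is unbounded
  its transformed lifetime is infinite too, so the integrand vanishes. To match this, the Poisson
  functional gives the value infinity to every infinite excursion, of whatever class. The
  exponential formula then produces the exponent of class \<open>i\<close> plus the
  \<open>n\<close>-mass of the infinite excursions outside class \<open>i\<close>, and this surplus
  is cancelled by the probability of the conditioning event. The case \<open>q = 0\<close> stands
  apart because of \<open>0 * \<infinity> = 0\<close>. Of the random set V, only the events that one
  of its intervals covers a given dyadic cell have to be measurable. Passing to the completion costs
  nothing, as \<open>P\<close> is complete and independence ignores null sets.\<close>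

lemma exp_neg_eq: "exp_neg q y = exp_neg 1 (ennreal q * y)"
  by (simp add: exp_neg_def)

lemma exp_neg_ennreal: "0 \<le> x \<Longrightarrow> exp_neg 1 (ennreal x) = exp (- x)"
  by (simp add: exp_neg_def)

lemma exp_neg_top [simp]: "exp_neg 1 \<infinity> = 0" "exp_neg 1 top = 0"
  by (simp_all add: exp_neg_def)

lemma exp_neg_zero [simp]: "exp_neg q 0 = 1"
  by (simp add: exp_neg_def)

lemma exp_neg_nonneg [simp]: "0 \<le> exp_neg q y" and exp_neg_le_1 [simp]: "exp_neg q y \<le> 1"
  by (simp_all add: exp_neg_def)

lemma exp_neg_antimono: "x \<le> y \<Longrightarrow> exp_neg 1 y \<le> exp_neg 1 x"
  unfolding exp_neg_def by (auto simp: top_unique intro!: enn2real_mono) (simp add: less_top)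

lemma measurable_exp_neg [measurable]: "exp_neg q \<in> borel_measurable borel"
  unfolding exp_neg_def by measurable

lemma exp_neg_add: "exp_neg 1 (x + y) = exp_neg 1 x * exp_neg 1 y"
  by (cases x; cases y) (simp_all add: exp_neg_def exp_add[symmetric] ennreal_plus[symmetric] del: ennreal_plus)

lemma exp_neg_sum: "finite A \<Longrightarrow> exp_neg 1 (\<Sum>a\<in>A. f a) = (\<Prod>a\<in>A. exp_neg 1 (f a))"
  by (induction A rule: finite_induct) (simp_all add: exp_neg_add)

lemma exp_neg_eq_0_iff: "exp_neg 1 y = 0 \<longleftrightarrow> y = \<infinity>"
  by (simp add: exp_neg_def)

text \<open>Continuity holds on all of [0,\<infinity>], the point \<infinity> included. Together
  with the bound 1 it lets every later limit pass through the expectation by dominated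
  convergence.\<close>

lemma tendsto_exp_neg:
  assumes "(f \<longlongrightarrow> y) F"
  shows "((\<lambda>x. exp_neg 1 (f x)) \<longlongrightarrow> exp_neg 1 y) F"
proof (cases "y = \<infinity>")
  case True
  have "\<forall>\<^sub>F x in F. exp_neg 1 (f x) < e" if "0 < e" for e
  proof -
    have "\<forall>\<^sub>F x in F. ennreal (max 0 (- ln e)) < f x"
      using assms True by (intro order_tendstoD(1)) auto
    then show ?thesis
    proof eventually_elim
      case (elim x)
      show ?case
      proof (cases "f x")
        case (real r)
        then have "ennreal (max 0 (- ln e)) < ennreal r" using elim by simp
        then have "- ln e < r" by (subst (asm) ennreal_less_iff) auto
        then have "- r < ln e" by simp
        then have "exp (- r) < e" using \<open>0 < e\<close> by (metis exp_less_mono exp_ln)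
        then show ?thesis using real by (simp add: exp_neg_ennreal)
      qed (use \<open>0 < e\<close> in simp)
    qed
  qed
  moreover have "\<forall>\<^sub>F x in F. a < exp_neg 1 (f x)" if "a < 0" for a
    using that by (intro always_eventually allI) (meson exp_neg_nonneg less_le_trans)
  ultimately show ?thesis using True by (auto intro!: order_tendstoI)
next
  case False
  have "\<forall>\<^sub>F x in F. f x < \<infinity>"
    using assms False by (intro order_tendstoD(2)) (auto simp: less_top)
  then have "\<forall>\<^sub>F x in F. exp (- enn2real (f x)) = exp_neg 1 (f x)"
    by eventually_elim (auto simp: exp_neg_def)
  moreover have "((\<lambda>x. exp (- enn2real (f x))) \<longlongrightarrow> exp (- enn2real y)) F"
    using False assms by (intro tendsto_exp tendsto_minus tendsto_enn2real) (auto simp: less_top)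
  ultimately show ?thesis using False by (simp add: exp_neg_def Lim_transform_eventually)
qed

section \<open>Poisson distributed variables: Laplace transform, variance, multiple points\<close>

context prob_space
begin

text \<open>The values lie in [0,\<infinity>] because the variables are numbers of points in a set;
  that they are almost surely natural numbers is a consequence of the weights.\<close>

definition poisson_variable :: "real \<Rightarrow> ('a \<Rightarrow> ennreal) \<Rightarrow> bool" where
  "poisson_variable r Y \<longleftrightarrow> 0 \<le> r \<and> Y \<in> borel_measurable M
     \<and> (\<forall>k::nat. prob {\<omega>\<in>space M. Y \<omega> = of_nat k} = r ^ k / fact k * exp (- r))"

text \<open>The Poisson weights sum to one, so no probability is left for other values.\<close>

lemma AE_poisson_variable_nat:
  assumes "poisson_variable r Y"
  shows "AE \<omega> in M. \<exists>k::nat. Y \<omega> = of_nat k"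
proof -
  have [measurable]: "Y \<in> borel_measurable M"
    and pr: "\<And>k::nat. prob {\<omega>\<in>space M. Y \<omega> = of_nat k} = r ^ k / fact k * exp (- r)"
    using assms by (auto simp: poisson_variable_def)
  let ?A = "\<lambda>k::nat. {\<omega>\<in>space M. Y \<omega> = of_nat k}"
  have "(\<lambda>k. prob (?A k)) sums prob (\<Union>k. ?A k)"
    by (intro finite_measure_UNION) (auto simp: disjoint_family_on_def)
  moreover have "(\<lambda>k. r ^ k / fact k * exp (- r)) sums (exp r * exp (- r))"
    using exp_converges[of r] by (intro sums_mult2) (simp add: divide_inverse mult.commute)
  ultimately have "prob (\<Union>k. ?A k) = 1"
    unfolding pr using sums_unique2 by (fastforce simp: exp_minus)
  then have "AE \<omega> in M. \<omega> \<in> (\<Union>k. ?A k)" by (subst (asm) prob_eq_1) auto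
  then show ?thesis by auto
qed

lemma nn_integral_poisson_variable:
  assumes Y: "poisson_variable r Y"
  shows "(\<integral>\<^sup>+\<omega>. g (Y \<omega>) \<partial>M) = (\<Sum>k::nat. ennreal (r ^ k / fact k * exp (- r)) * g (of_nat k))"
proof -
  have [measurable]: "Y \<in> borel_measurable M"
    and pr: "\<And>k::nat. prob {\<omega>\<in>space M. Y \<omega> = of_nat k} = r ^ k / fact k * exp (- r)"
    using assms by (auto simp: poisson_variable_def)
  have "(\<integral>\<^sup>+\<omega>. g (Y \<omega>) \<partial>M) = (\<integral>\<^sup>+\<omega>. (\<Sum>k::nat. g (of_nat k) * indicator {\<omega>\<in>space M. Y \<omega> = of_nat k} \<omega>) \<partial>M)"
  proof (rule nn_integral_cong_AE)
    show "AE \<omega> in M. g (Y \<omega>) = (\<Sum>k::nat. g (of_nat k) * indicator {\<omega>\<in>space M. Y \<omega> = of_nat k} \<omega>)"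
      using AE_poisson_variable_nat[OF Y] AE_space
    proof eventually_elim
      case (elim \<omega>)
      then obtain k :: nat where k: "Y \<omega> = of_nat k" by blast
      have "(\<Sum>m::nat. g (of_nat m) * indicator {\<omega>\<in>space M. Y \<omega> = of_nat m} \<omega>)
          = (\<Sum>m\<in>{k}. g (of_nat m) * indicator {\<omega>\<in>space M. Y \<omega> = of_nat m} \<omega>)"
        using k by (intro suminf_finite) auto
      then show ?case using k elim(2) by simp
    qed
  qed
  also have "\<dots> = (\<Sum>k::nat. g (of_nat k) * emeasure M {\<omega>\<in>space M. Y \<omega> = of_nat k})"
    by (subst nn_integral_suminf) (auto simp: nn_integral_cmult)
  finally show ?thesis by (simp add: emeasure_eq_measure pr mult.commute)
qed

lemma nn_integral_poisson_variable_real: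
  assumes Y: "poisson_variable r Y" and g: "\<And>k::nat. 0 \<le> g (of_nat k)"
    and s: "(\<lambda>k::nat. r ^ k / fact k * g (of_nat k)) sums x"
  shows "(\<integral>\<^sup>+\<omega>. ennreal (g (Y \<omega>)) \<partial>M) = ennreal (x * exp (- r))"
proof -
  have r: "0 \<le> r" using Y by (simp add: poisson_variable_def)
  have "(\<integral>\<^sup>+\<omega>. ennreal (g (Y \<omega>)) \<partial>M) = (\<Sum>k::nat. ennreal (r ^ k / fact k * g (of_nat k) * exp (- r)))"
    by (subst nn_integral_poisson_variable[OF Y])
       (intro suminf_cong, use r g in \<open>simp add: ennreal_mult'[symmetric] mult_ac\<close>)
  also have "\<dots> = ennreal (x * exp (- r))"
    using r g by (intro suminf_ennreal_eq sums_mult2[OF s]) auto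
  finally show ?thesis .
qed

lemma poisson_laplace:
  assumes Y: "poisson_variable r Y"
  shows "(\<integral>\<^sup>+\<omega>. ennreal (exp_neg 1 (a * Y \<omega>)) \<partial>M) = ennreal (exp (- r * (1 - exp_neg 1 a)))"
proof -
  \<comment> \<open>Valid for infinite \<open>a\<close> as well: then both sides are 1 for
    \<open>k = 0\<close> and 0 otherwise.\<close>
  have pw: "exp_neg 1 (a * of_nat k) = exp_neg 1 a ^ k" for k :: nat
    by (induction k) (simp_all add: distrib_left exp_neg_add)
  have "(\<lambda>k::nat. r ^ k / fact k * exp_neg 1 (a * of_nat k)) sums exp (r * exp_neg 1 a)"
    unfolding pw using exp_converges[of "r * exp_neg 1 a"]
    by (simp add: power_mult_distrib divide_inverse mult_ac)
  then have "(\<integral>\<^sup>+\<omega>. ennreal (exp_neg 1 (a * Y \<omega>)) \<partial>M) = ennreal (exp (r * exp_neg 1 a) * exp (- r))"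
    by (intro nn_integral_poisson_variable_real[OF Y, where g = "\<lambda>y. exp_neg 1 (a * y)"]) simp_all
  then show ?thesis
    by (simp add: exp_add[symmetric] algebra_simps)
qed

text \<open>This feeds the law of large numbers that recovers the local time. The moments come from
  shifting the index: p_k = r^k / k! satisfies k p_k = r p_{k-1}.\<close>

lemma poisson_variance:
  assumes Y: "poisson_variable r Y"
  shows "(\<integral>\<^sup>+\<omega>. ennreal ((enn2real (Y \<omega>) - r)\<^sup>2) \<partial>M) = ennreal r"
proof -
  let ?p = "\<lambda>k::nat. r ^ k / fact k"
  have 0: "?p sums exp r"
    using exp_converges[of r] by (simp add: divide_inverse mult.commute)
  have 1: "(\<lambda>k. real k * ?p k) sums (r * exp r)"
  proof -
    have "(\<lambda>k. real (Suc k) * ?p (Suc k)) = (\<lambda>k. r * ?p k)"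
      by (intro ext) (simp add: field_simps del: of_nat_Suc)
    then have "(\<lambda>k. real (Suc k) * ?p (Suc k)) sums (r * exp r)" using sums_mult[OF 0, of r] by simp
    from sums_Suc[OF this] show ?thesis by simp
  qed
  have 2: "(\<lambda>k. real k ^ 2 * ?p k) sums (r * (r * exp r + exp r))"
  proof -
    have "real (Suc k) ^ 2 * ?p (Suc k) = r * (real k * ?p k + ?p k)" for k
    proof -
      have "real (Suc k) ^ 2 * ?p (Suc k) = real (Suc k) * (real (Suc k) * ?p (Suc k))"
        by (simp only: power2_eq_square mult.assoc)
      also have "real (Suc k) * ?p (Suc k) = r * ?p k" by (simp add: field_simps del: of_nat_Suc)
      also have "real (Suc k) * (r * ?p k) = r * (real k * ?p k + ?p k)"
        by (simp only: of_nat_Suc distrib_left distrib_right mult_1 mult_1_right mult_ac add_ac)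
      finally show ?thesis .
    qed
    then have "(\<lambda>k. real (Suc k) ^ 2 * ?p (Suc k)) sums (r * (r * exp r + exp r))"
      using sums_mult[OF sums_add[OF 1 0], of r] by simp
    from sums_Suc[OF this] show ?thesis by simp
  qed
  have "(\<lambda>k. (real k ^ 2 * ?p k - 2 * r * (real k * ?p k)) + r\<^sup>2 * ?p k)
      sums ((r * (r * exp r + exp r) - 2 * r * (r * exp r)) + r\<^sup>2 * exp r)"
    by (intro sums_add sums_diff sums_mult 0 1 2)
  then have "(\<lambda>k::nat. ?p k * (enn2real (of_nat k) - r)\<^sup>2) sums (r * exp r)"
    by (simp add: power2_diff algebra_simps power2_eq_square)
  then have "(\<integral>\<^sup>+\<omega>. ennreal ((enn2real (Y \<omega>) - r)\<^sup>2) \<partial>M) = ennreal (r * exp r * exp (- r))"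
    by (intro nn_integral_poisson_variable_real[OF Y, where g = "\<lambda>y. (enn2real y - r)\<^sup>2"]) simp_all
  then show ?thesis
    by (simp add: mult.assoc exp_add[symmetric])
qed

text \<open>The bound is quadratic in r, so a grid of m cells with intensity r/m each contains a
  doubly occupied cell with probability at most r^2/m, which vanishes as the grid is
  refined.\<close>

lemma poisson_ge_2:
  assumes Y: "poisson_variable r Y"
  shows "prob {\<omega>\<in>space M. 2 \<le> Y \<omega>} \<le> r\<^sup>2"
proof -
  have [measurable]: "Y \<in> borel_measurable M" and r: "0 \<le> r"
    and pr: "\<And>k::nat. prob {\<omega>\<in>space M. Y \<omega> = of_nat k} = r ^ k / fact k * exp (- r)"
    using assms by (auto simp: poisson_variable_def)
  have two: "(2::ennreal) = of_nat 2" by simp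
  let ?A = "{\<omega>\<in>space M. 2 \<le> Y \<omega>}" and ?B = "\<lambda>k::nat. {\<omega>\<in>space M. Y \<omega> = of_nat k}"
  have "prob ?A + (prob (?B 0) + prob (?B 1)) = prob (?A \<union> (?B 0 \<union> ?B 1))"
    by (subst finite_measure_Union, simp, simp, force, subst finite_measure_Union) auto
  also have "\<dots> \<le> 1" by simp
  finally have "prob ?A \<le> 1 - exp (- r) * (1 + r)"
    using pr[of 0] pr[of 1] by (simp add: algebra_simps)
  also have "\<dots> \<le> 1 - (1 - r) * (1 + r)"
    using exp_ge_add_one_self[of "- r"] r by (intro diff_left_mono mult_right_mono) auto
  also have "\<dots> = r\<^sup>2" by (simp add: algebra_simps power2_eq_square)
  finally show ?thesis .
qed

end

section \<open>The Laplace functional of a Poisson point process and the absence of simultaneous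
  points\<close>

context prob_space
begin

lemma
  assumes "poisson_point_process M \<mu> N"
  shows sets_poisson_point_process: "\<And>\<omega>. \<omega> \<in> space M \<Longrightarrow> sets (N \<omega>) = sets \<mu>"
    and space_poisson_point_process: "\<And>\<omega>. \<omega> \<in> space M \<Longrightarrow> space (N \<omega>) = space \<mu>"
    and point_measure_poisson_point_process: "\<And>\<omega>. \<omega> \<in> space M \<Longrightarrow> point_measure (N \<omega>)"
    and measurable_poisson_point_process:
      "\<And>B. B \<in> sets \<mu> \<Longrightarrow> (\<lambda>\<omega>. emeasure (N \<omega>) B) \<in> borel_measurable M"
    and poisson_variable_poisson_point_process:
      "\<And>B. B \<in> sets \<mu> \<Longrightarrow> emeasure \<mu> B < \<infinity> \<Longrightarrow> poisson_variable (measure \<mu> B) (\<lambda>\<omega>. emeasure (N \<omega>) B)"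
    and indep_vars_poisson_point_process:
      "\<And>B. range B \<subseteq> sets \<mu> \<Longrightarrow> disjoint_family B \<Longrightarrow> indep_vars (\<lambda>_. borel) (\<lambda>k::nat. \<lambda>\<omega>. emeasure (N \<omega>) (B k)) UNIV"
  using assms unfolding poisson_point_process_def poisson_variable_def
  by (auto dest: sets_eq_imp_space_eq)

lemma AE_poisson_point_process_null:
  assumes N: "poisson_point_process M \<mu> N" and B: "B \<in> sets \<mu>" "emeasure \<mu> B = 0"
  shows "AE \<omega> in M. emeasure (N \<omega>) B = 0"
proof -
  have [measurable]: "(\<lambda>\<omega>. emeasure (N \<omega>) B) \<in> borel_measurable M"
    by (rule measurable_poisson_point_process[OF N B(1)])
  have "poisson_variable (measure \<mu> B) (\<lambda>\<omega>. emeasure (N \<omega>) B)"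
    by (rule poisson_variable_poisson_point_process[OF N B(1)]) (simp add: B)
  then have "prob {\<omega>\<in>space M. emeasure (N \<omega>) B = of_nat 0} = 1"
    unfolding poisson_variable_def by (metis B(2) measure_def enn2real_0 div_by_1 exp_zero fact_0 minus_zero mult_1 power_0)
  then show ?thesis by (subst (asm) prob_eq_1) auto
qed

lemma laplace_disjoint_sets:
  fixes B :: "nat \<Rightarrow> 'b set"
  assumes N: "poisson_point_process M \<mu> N"
    and B: "\<And>k. k < K \<Longrightarrow> B k \<in> sets \<mu>" "\<And>k. k < K \<Longrightarrow> emeasure \<mu> (B k) < \<infinity>"
    and disj: "disjoint_family_on B {..<K}"
  shows "(\<integral>\<^sup>+\<omega>. ennreal (exp_neg 1 (\<Sum>k<K. a k * emeasure (N \<omega>) (B k))) \<partial>M)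
       = ennreal (exp_neg 1 (\<Sum>k<K. ennreal (1 - exp_neg 1 (a k)) * emeasure \<mu> (B k)))"
proof -
  \<comment> \<open>The independence clause of a Poisson point process speaks of a whole sequence of
    disjoint sets, so the finite family is padded with empty sets.\<close>
  let ?B = "\<lambda>k. if k < K then B k else {}"
  have "indep_vars (\<lambda>_. borel) (\<lambda>k \<omega>. emeasure (N \<omega>) (?B k)) UNIV"
    using B(1) disj by (intro indep_vars_poisson_point_process[OF N])
      (auto simp: disjoint_family_on_def)
  then have "indep_vars (\<lambda>_. borel) (\<lambda>k \<omega>. emeasure (N \<omega>) (?B k)) {..<K}"
    by (rule indep_vars_subset) auto
  then have ind: "indep_vars (\<lambda>_. borel) (\<lambda>k \<omega>. ennreal (exp_neg 1 (a k * emeasure (N \<omega>) (?B k)))) {..<K}"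
    by (rule indep_vars_compose2) measurable
  have "(\<integral>\<^sup>+\<omega>. ennreal (exp_neg 1 (\<Sum>k<K. a k * emeasure (N \<omega>) (B k))) \<partial>M)
      = (\<integral>\<^sup>+\<omega>. (\<Prod>k<K. ennreal (exp_neg 1 (a k * emeasure (N \<omega>) (?B k)))) \<partial>M)"
  proof (intro nn_integral_cong)
    fix \<omega>
    have "exp_neg 1 (\<Sum>k<K. a k * emeasure (N \<omega>) (B k)) = (\<Prod>k<K. exp_neg 1 (a k * emeasure (N \<omega>) (?B k)))"
      by (subst exp_neg_sum) (auto intro: prod.cong)
    then show "ennreal (exp_neg 1 (\<Sum>k<K. a k * emeasure (N \<omega>) (B k)))
        = (\<Prod>k<K. ennreal (exp_neg 1 (a k * emeasure (N \<omega>) (?B k))))"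
      by (subst prod_ennreal) auto
  qed
  also have "\<dots> = (\<Prod>k<K. \<integral>\<^sup>+\<omega>. ennreal (exp_neg 1 (a k * emeasure (N \<omega>) (?B k))) \<partial>M)"
    by (intro indep_vars_nn_integral ind) auto
  also have "\<dots> = (\<Prod>k<K. ennreal (exp_neg 1 (ennreal (1 - exp_neg 1 (a k)) * emeasure \<mu> (B k))))"
  proof (intro prod.cong refl)
    fix k assume k: "k \<in> {..<K}"
    then have fin: "emeasure \<mu> (B k) = ennreal (measure \<mu> (B k))"
      using B(2)[of k] by (intro emeasure_eq_ennreal_measure) auto
    have "ennreal (1 - exp_neg 1 (a k)) * emeasure \<mu> (B k) = ennreal (measure \<mu> (B k) * (1 - exp_neg 1 (a k)))"
      by (simp add: fin ennreal_mult''[symmetric] mult.commute)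
    then have "exp_neg 1 (ennreal (1 - exp_neg 1 (a k)) * emeasure \<mu> (B k)) = exp (- measure \<mu> (B k) * (1 - exp_neg 1 (a k)))"
      by (simp add: exp_neg_ennreal)
    then show "(\<integral>\<^sup>+\<omega>. ennreal (exp_neg 1 (a k * emeasure (N \<omega>) (?B k))) \<partial>M)
       = ennreal (exp_neg 1 (ennreal (1 - exp_neg 1 (a k)) * emeasure \<mu> (B k)))"
      using poisson_laplace[OF poisson_variable_poisson_point_process[OF N B(1) B(2)], of k "a k"] k by simp
  qed
  finally show ?thesis by (simp add: exp_neg_sum prod_ennreal)
qed

text \<open>The level sets of \<open>g\<close> at its nonzero values are finitely many disjoint sets
  of finite intensity. The value 0 is dropped, as its level set may have infinite intensity.\<close>

lemma
  assumes N: "poisson_point_process M \<mu> N" and g: "simple_function \<mu> g"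
    and fin: "emeasure \<mu> {x\<in>space \<mu>. g x \<noteq> 0} < \<infinity>"
  shows laplace_functional_simple:
      "(\<integral>\<^sup>+\<omega>. ennreal (exp_neg 1 (\<integral>\<^sup>+x. g x \<partial>N \<omega>)) \<partial>M)
         = ennreal (exp_neg 1 (\<integral>\<^sup>+x. ennreal (1 - exp_neg 1 (g x)) \<partial>\<mu>))" (is ?thesis1)
    and measurable_nn_integral_poisson_simple:
      "(\<lambda>\<omega>. \<integral>\<^sup>+x. g x \<partial>N \<omega>) \<in> borel_measurable M" (is ?thesis2)
proof -
  let ?V = "g ` space \<mu> - {0}"
  have finV: "finite ?V" using g by (simp add: simple_function_def)
  then obtain b where b: "bij_betw b {..<card ?V} ?V"
    using bij_betw_from_nat_into_finite by blast
  define K where "K = card ?V"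
  define B where "B k = g -` {b k} \<inter> space \<mu>" for k
  have bV: "b k \<in> ?V" if "k < K" for k
    using b that by (auto simp: K_def bij_betw_def)
  have B: "B k \<in> sets \<mu>" for k
    unfolding B_def using g by (simp add: simple_functionD)
  have Bfin: "emeasure \<mu> (B k) < \<infinity>" if "k < K" for k
  proof -
    have "emeasure \<mu> (B k) \<le> emeasure \<mu> {x\<in>space \<mu>. g x \<noteq> 0}"
      using bV[OF that] borel_measurable_simple_function[OF g] by (intro emeasure_mono) (auto simp: B_def)
    then show ?thesis using fin by (rule le_less_trans)
  qed
  have disj: "disjoint_family_on B {..<K}"
    using b by (auto simp: disjoint_family_on_def B_def K_def bij_betw_def inj_on_def)
  \<comment> \<open>Used twice: with the identity for \<open>N \<omega>\<close>, and with 1 -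
    \<open>exp_neg 1\<close> for the intensity.\<close>
  have sum: "(\<integral>\<^sup>+x. h (g x) \<partial>\<nu>) = (\<Sum>k<K. h (b k) * emeasure \<nu> (B k))"
    if \<nu>: "sets \<nu> = sets \<mu>" and h: "h 0 = 0" for \<nu> and h :: "ennreal \<Rightarrow> ennreal"
  proof -
    have sp: "space \<nu> = space \<mu>" using \<nu> by (rule sets_eq_imp_space_eq)
    have "(\<integral>\<^sup>+x. h (g x) \<partial>\<nu>) = (\<integral>\<^sup>+x. (\<Sum>k<K. h (b k) * indicator (B k) x) \<partial>\<nu>)"
    proof (rule nn_integral_cong)
      fix x assume "x \<in> space \<nu>"
      then have x: "x \<in> space \<mu>" by (simp add: sp)
      show "h (g x) = (\<Sum>k<K. h (b k) * indicator (B k) x)"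
      proof (cases "g x = 0")
        case True
        then have "(\<Sum>k<K. h (b k) * indicator (B k) x) = 0"
          using bV by (intro sum.neutral) (auto simp: B_def)
        then show ?thesis using True h by simp
      next
        case False
        then have "g x \<in> b ` {..<K}" using x b by (simp add: bij_betw_def K_def)
        then obtain k where k: "k < K" "b k = g x" by fastforce
        have "(\<Sum>m<K. h (b m) * indicator (B m) x) = (\<Sum>m\<in>{k}. h (b m) * indicator (B m) x)"
        proof (rule sum.mono_neutral_right)
          show "\<forall>m\<in>{..<K} - {k}. h (b m) * indicator (B m) x = 0"
            using b k by (auto simp: B_def K_def bij_betw_def inj_on_def indicator_def)
        qed (use k in auto)
        then show ?thesis using k x by (simp add: B_def)
      qed
    qed
    also have "\<dots> = (\<Sum>k<K. h (b k) * emeasure \<nu> (B k))"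
      using B \<nu> by (subst nn_integral_sum) (auto simp: nn_integral_cmult_indicator)
    finally show ?thesis .
  qed
  have 1: "(\<integral>\<^sup>+x. g x \<partial>N \<omega>) = (\<Sum>k<K. b k * emeasure (N \<omega>) (B k))" if "\<omega> \<in> space M" for \<omega>
    using sum[of "N \<omega>" "\<lambda>x. x"] sets_poisson_point_process[OF N that] by simp
  have [measurable]: "(\<lambda>\<omega>. emeasure (N \<omega>) (B k)) \<in> borel_measurable M" for k
    by (rule measurable_poisson_point_process[OF N B])
  show ?thesis2
    by (rule measurable_cong[THEN iffD2, OF 1]) measurable
  show ?thesis1
    using laplace_disjoint_sets[OF N B Bfin disj, where a = b]
      sum[of \<mu> "\<lambda>x. ennreal (1 - exp_neg 1 x)"] by (simp add: 1 cong: nn_integral_cong)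
qed

text \<open>Monotone approximation by simple functions to which
  \<open>laplace_functional_simple\<close> applies. On the side of the expectation the limit is by
  domination, on the side of the intensity by monotonicity.\<close>

lemma
  assumes N: "poisson_point_process M \<mu> N" and \<mu>: "sigma_finite_measure \<mu>"
    and \<phi>: "\<phi> \<in> borel_measurable \<mu>"
  shows laplace_functional:
      "(\<integral>\<^sup>+\<omega>. ennreal (exp_neg 1 (\<integral>\<^sup>+x. \<phi> x \<partial>N \<omega>)) \<partial>M)
         = ennreal (exp_neg 1 (\<integral>\<^sup>+x. ennreal (1 - exp_neg 1 (\<phi> x)) \<partial>\<mu>))" (is ?thesis1)
    and measurable_nn_integral_poisson:
      "(\<lambda>\<omega>. \<integral>\<^sup>+x. \<phi> x \<partial>N \<omega>) \<in> borel_measurable M" (is ?thesis2)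
proof -
  obtain A :: "nat \<Rightarrow> 'b set" where A: "range A \<subseteq> sets \<mu>" "(\<Union>i. A i) = space \<mu>" "\<And>i. emeasure \<mu> (A i) \<noteq> \<infinity>" "incseq A"
    using sigma_finite_measure.sigma_finite_incseq[OF \<mu>] by metis
  obtain g where g: "\<And>i. simple_function \<mu> (g i)" "incseq g" "\<And>i x. g i x < top" "\<And>x. (SUP i. g i x) = \<phi> x"
    using borel_measurable_implies_simple_function_sequence'[OF \<phi>] by metis
  \<comment> \<open>The cut-off to a set of finite intensity provides the finite support that the
    simple case asks for.\<close>
  define u where "u i x = g i x * indicator (A i) x" for i x
  have [measurable]: "A i \<in> sets \<mu>" for i using A by auto
  have su: "simple_function \<mu> (u i)" for i
    unfolding u_def using g(1) by (intro simple_function_mult simple_function_indicator) auto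
  note [measurable] = borel_measurable_simple_function[OF su]
  have finu: "emeasure \<mu> {x\<in>space \<mu>. u i x \<noteq> 0} < \<infinity>" for i
  proof -
    have "emeasure \<mu> {x\<in>space \<mu>. u i x \<noteq> 0} \<le> emeasure \<mu> (A i)"
      by (intro emeasure_mono) (auto simp: u_def indicator_def split: if_splits)
    then show ?thesis using A(3)[of i] by (auto simp: less_top[symmetric] top_unique)
  qed
  have inc: "incseq (\<lambda>i. u i x)" for x
  proof (rule incseq_SucI)
    fix i
    have "g i x \<le> g (Suc i) x" using g(2) by (auto simp: incseq_Suc_iff le_fun_def)
    moreover have "A i \<subseteq> A (Suc i)" using A(4) by (auto simp: incseq_Suc_iff)
    ultimately show "u i x \<le> u (Suc i) x"
      unfolding u_def by (intro mult_mono) (auto simp: indicator_def)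
  qed
  have lim: "(\<lambda>i. u i x) \<longlonglongrightarrow> \<phi> x" if x: "x \<in> space \<mu>" for x
  proof -
    have "(\<lambda>i. g i x) \<longlonglongrightarrow> (SUP i. g i x)"
      using g(2) by (intro LIMSEQ_SUP) (auto simp: incseq_def le_fun_def)
    moreover have "\<forall>\<^sub>F i in sequentially. g i x = u i x"
    proof -
      obtain i0 where "x \<in> A i0" using x A(2) by auto
      then have "\<And>i. i \<ge> i0 \<Longrightarrow> x \<in> A i" using A(4) by (auto simp: incseq_def)
      then show ?thesis unfolding eventually_sequentially u_def by (intro exI[of _ i0]) auto
    qed
    ultimately show ?thesis unfolding g(4) by (rule Lim_transform_eventually)
  qed
  \<comment> \<open>The monotone limit rule wants convergence at every point, also outside the
    space; hence the indicator of the space.\<close>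
  have lim': "(\<lambda>i. u i x) \<longlonglongrightarrow> \<phi> x * indicator (space \<mu>) x" for x
  proof (cases "x \<in> space \<mu>")
    case False
    then have "u i x = 0" for i using A(2) by (auto simp: u_def)
    then show ?thesis using False by simp
  qed (use lim in simp)
  have *: "(\<lambda>i. \<integral>\<^sup>+x. u i x \<partial>N \<omega>) \<longlonglongrightarrow> (\<integral>\<^sup>+x. \<phi> x * indicator (space \<mu>) x \<partial>N \<omega>)" if "\<omega> \<in> space M" for \<omega>
  proof (rule nn_integral_LIMSEQ)
    show "incseq (\<lambda>i. u i)" using inc by (auto simp: incseq_def le_fun_def)
    show "u i \<in> borel_measurable (N \<omega>)" for i
      by (subst measurable_cong_sets[OF sets_poisson_point_process[OF N that] refl]) measurable
    show "(\<lambda>i. u i x) \<longlonglongrightarrow> \<phi> x * indicator (space \<mu>) x" for x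
      by (rule lim')
  qed
  have lim_int: "(\<lambda>i. \<integral>\<^sup>+x. u i x \<partial>N \<omega>) \<longlonglongrightarrow> (\<integral>\<^sup>+x. \<phi> x \<partial>N \<omega>)" if "\<omega> \<in> space M" for \<omega>
  proof -
    have "(\<integral>\<^sup>+x. \<phi> x * indicator (space \<mu>) x \<partial>N \<omega>) = (\<integral>\<^sup>+x. \<phi> x \<partial>N \<omega>)"
      by (intro nn_integral_cong) (simp add: space_poisson_point_process[OF N that])
    with * that show ?thesis by metis
  qed
  have meas: "(\<lambda>\<omega>. \<integral>\<^sup>+x. u i x \<partial>N \<omega>) \<in> borel_measurable M" for i
    by (rule measurable_nn_integral_poisson_simple[OF N su finu])
  note [measurable] = this
  show [measurable]: ?thesis2
    by (rule borel_measurable_LIMSEQ_order[OF lim_int meas])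
  have "(\<lambda>i. ennreal (exp_neg 1 (\<integral>\<^sup>+x. ennreal (1 - exp_neg 1 (u i x)) \<partial>\<mu>)))
      \<longlonglongrightarrow> (\<integral>\<^sup>+\<omega>. ennreal (exp_neg 1 (\<integral>\<^sup>+x. \<phi> x \<partial>N \<omega>)) \<partial>M)"
    unfolding laplace_functional_simple[OF N su finu, symmetric]
    by (intro nn_integral_dominated_convergence[where w = "\<lambda>_. 1"])
       (auto intro!: AE_I2 tendsto_ennrealI tendsto_exp_neg lim_int simp: emeasure_space_1)
  moreover have "(\<lambda>i. ennreal (exp_neg 1 (\<integral>\<^sup>+x. ennreal (1 - exp_neg 1 (u i x)) \<partial>\<mu>)))
      \<longlonglongrightarrow> ennreal (exp_neg 1 (\<integral>\<^sup>+x. ennreal (1 - exp_neg 1 (\<phi> x * indicator (space \<mu>) x)) \<partial>\<mu>))"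
    using inc by (intro tendsto_ennrealI tendsto_exp_neg nn_integral_LIMSEQ tendsto_diff tendsto_const lim')
      (auto simp: incseq_def le_fun_def intro!: ennreal_leI exp_neg_antimono)
  ultimately have "(\<integral>\<^sup>+\<omega>. ennreal (exp_neg 1 (\<integral>\<^sup>+x. \<phi> x \<partial>N \<omega>)) \<partial>M)
      = ennreal (exp_neg 1 (\<integral>\<^sup>+x. ennreal (1 - exp_neg 1 (\<phi> x * indicator (space \<mu>) x)) \<partial>\<mu>))"
    by (rule LIMSEQ_unique)
  also have "(\<integral>\<^sup>+x. ennreal (1 - exp_neg 1 (\<phi> x * indicator (space \<mu>) x)) \<partial>\<mu>)
      = (\<integral>\<^sup>+x. ennreal (1 - exp_neg 1 (\<phi> x)) \<partial>\<mu>)"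
    by (intro nn_integral_cong) simp
  finally show ?thesis1 .
qed

text \<open>Two points at one time share a cell of every grid of mesh 1/(m+1). By
  \<open>poisson_ge_2\<close> and a union bound, the probability that some cell before time K holds
  two points is at most K n(C)^2 / (m+1), which tends to 0.\<close>

lemma AE_poisson_no_double_time:
  assumes N: "poisson_point_process M (restrict_space lborel {0..} \<Otimes>\<^sub>M n) N"
    and n: "sigma_finite_measure n" and C: "C \<in> sets n" "emeasure n C < \<infinity>"
  shows "AE \<omega> in M. \<forall>s::real\<ge>0. emeasure (N \<omega>) ({s} \<times> C) < 2"
proof -
  interpret n: sigma_finite_measure n by fact
  let ?\<mu> = "restrict_space lborel {0..} \<Otimes>\<^sub>M n"
  let ?I = "\<lambda>m k. {real k / real (Suc m)..<real (Suc k) / real (Suc m)}"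
  have Isub: "?I m k \<subseteq> {0..}" for m k
  proof -
    have "0 \<le> real k / real (Suc m)" by simp
    then show ?thesis by (intro subsetI) (metis atLeastLessThan_iff atLeast_iff order_trans)
  qed
  then have I: "?I m k \<in> sets (restrict_space lborel {0..})" for m k
    by (simp add: sets_restrict_space_iff)
  have meas: "emeasure ?\<mu> (?I m k \<times> C) = ennreal (measure n C / real (Suc m))" for m k
  proof -
    have "emeasure ?\<mu> (?I m k \<times> C) = ennreal (real (Suc k) / real (Suc m) - real k / real (Suc m)) * emeasure n C"
      using I C(1) Isub
      by (simp add: n.emeasure_pair_measure_Times emeasure_restrict_space divide_right_mono del: of_nat_Suc)
    also have "real (Suc k) / real (Suc m) - real k / real (Suc m) = 1 / real (Suc m)"
      by (simp add: diff_divide_distrib[symmetric])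
    also have "emeasure n C = ennreal (measure n C)"
      using C(2) by (intro emeasure_eq_ennreal_measure) auto
    finally show ?thesis by (simp add: ennreal_mult''[symmetric])
  qed
  have set[measurable]: "?I m k \<times> C \<in> sets ?\<mu>" for m k
    using I C(1) by simp
  note [measurable] = measurable_poisson_point_process[OF N set]
  define U where "U K m = (\<Union>k<K * Suc m. {\<omega>\<in>space M. 2 \<le> emeasure (N \<omega>) (?I m k \<times> C)})" for K m :: nat
  have U[measurable]: "U K m \<in> sets M" for K m unfolding U_def by measurable
  have ev[measurable]: "{\<omega>\<in>space M. 2 \<le> emeasure (N \<omega>) (?I m k \<times> C)} \<in> sets M" for m k
    by measurable
  have UK: "AE \<omega> in M. \<exists>m. \<omega> \<notin> U K m" for K
  proof -
    have "prob (\<Inter>m. U K m) \<le> real K * (measure n C)\<^sup>2 / real (Suc m)" for m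
    proof -
      have "prob (\<Inter>m. U K m) \<le> prob (U K m)" by (intro finite_measure_mono) auto
      also have "\<dots> \<le> (\<Sum>k<K * Suc m. prob {\<omega>\<in>space M. 2 \<le> emeasure (N \<omega>) (?I m k \<times> C)})"
        unfolding U_def by (intro finite_measure_subadditive_finite image_subsetI ev finite_lessThan)
      also have "\<dots> \<le> (\<Sum>k<K * Suc m. (measure n C / real (Suc m))\<^sup>2)"
      proof (intro sum_mono)
        fix k
        have "poisson_variable (measure ?\<mu> (?I m k \<times> C)) (\<lambda>\<omega>. emeasure (N \<omega>) (?I m k \<times> C))"
          by (intro poisson_variable_poisson_point_process[OF N]) (simp_all add: meas del: of_nat_Suc)
        from poisson_ge_2[OF this]
        show "prob {\<omega>\<in>space M. 2 \<le> emeasure (N \<omega>) (?I m k \<times> C)} \<le> (measure n C / real (Suc m))\<^sup>2"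
          by (simp add: measure_def[of ?\<mu>] meas del: of_nat_Suc)
      qed
      also have "\<dots> = real K * (measure n C)\<^sup>2 / real (Suc m)"
      proof -
        have "x * y * (z / y)\<^sup>2 = x * z\<^sup>2 / y" if "y \<noteq> 0" for x y z :: real
          using that by (simp add: power2_eq_square)
        then show ?thesis by (simp only: sum_constant card_lessThan of_nat_mult)
      qed
      finally show ?thesis .
    qed
    moreover have "(\<lambda>m. real K * (measure n C)\<^sup>2 / real (Suc m)) \<longlonglongrightarrow> 0"
      using tendsto_mult[OF tendsto_const[of "real K * (measure n C)\<^sup>2"] LIMSEQ_inverse_real_of_nat]
      by (simp add: divide_inverse)
    ultimately have "prob (\<Inter>m. U K m) \<le> 0"
      by (intro LIMSEQ_le_const) auto
    then have "prob (\<Inter>m. U K m) = 0" by (simp add: measure_le_0_iff)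
    then have "(\<Inter>m. U K m) \<in> null_sets M" by (auto simp: emeasure_eq_measure)
    from AE_not_in[OF this] show ?thesis by simp
  qed
  then have "AE \<omega> in M. \<forall>K. \<exists>m. \<omega> \<notin> U K m" by (simp add: AE_all_countable)
  with AE_space show ?thesis
  proof eventually_elim
    case (elim \<omega>)
    show ?case
    proof (intro allI impI)
      fix s :: real assume s: "0 \<le> s"
      obtain K :: nat where K: "s < real K" using reals_Archimedean2 by blast
      obtain m where m: "\<omega> \<notin> U K m" using elim by blast
      \<comment> \<open>The cell of mesh 1/(m+1) that contains s.\<close>
      define k where "k = nat \<lfloor>s * real (Suc m)\<rfloor>"
      have k: "real k \<le> s * real (Suc m)" "s * real (Suc m) < real k + 1"
        using s by (simp_all add: k_def)
      have "s * real (Suc m) < real K * real (Suc m)" using K by (intro mult_strict_right_mono) auto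
      then have "real k < real (K * Suc m)" using k(1) by (simp only: of_nat_mult)
      then have kK: "k < K * Suc m" by (simp only: of_nat_less_iff)
      have "s \<in> ?I m k" using k by (simp add: field_simps)
      then have "emeasure (N \<omega>) ({s} \<times> C) \<le> emeasure (N \<omega>) (?I m k \<times> C)"
        using set sets_poisson_point_process[OF N \<open>\<omega> \<in> space M\<close>] by (intro emeasure_mono) auto
      also have "\<dots> < 2" using m kK elim(1) by (auto simp: U_def not_le simp del: of_nat_Suc)
      finally show "emeasure (N \<omega>) ({s} \<times> C) < 2" .
    qed
  qed
qed

end

section \<open>Hitting events of right-continuous processes\<close>

text \<open>
  A special case of the debut theorem, by the capacity argument: a path is at \<open>y\<close> at time \<open>t\<close> iff
  for every \<open>m\<close> there is a \<open>k\<close> such that the path stays within \<open>1/(m+1)\<close> of \<open>y\<close> at all rational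
  times in \<open>(t, t + 1/(k+1))\<close>. For fixed \<open>m\<close>, \<open>k\<close> the set of such \<open>t\<close> is closed, so after choosing
  \<open>k = \<kappa> m\<close> up to a small loss of outer measure, compactness of \<open>[a,b]\<close> reduces the event to
  finitely many rational times.
\<close>

lemma (in finite_measure) hitting_event_sandwich:
  fixes X :: "real \<Rightarrow> 'a \<Rightarrow> 's::{metric_space, second_countable_topology}"
  assumes meas: "\<And>t. 0 \<le> t \<Longrightarrow> X t \<in> borel_measurable M"
    and rc: "\<And>\<omega> t. \<omega> \<in> space M \<Longrightarrow> 0 \<le> t \<Longrightarrow> ((\<lambda>s. X s \<omega>) \<longlongrightarrow> X t \<omega>) (at_right t)"
    and a: "0 \<le> a"
  shows "\<exists>A\<in>sets M. \<exists>B\<in>sets M. A \<subseteq> {\<omega>\<in>space M. \<exists>t\<in>{a..b}. X t \<omega> = y}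
    \<and> {\<omega>\<in>space M. \<exists>t\<in>{a..b}. X t \<omega> = y} \<subseteq> B \<and> emeasure M (B - A) = 0"
proof -
  define H where "H = {\<omega>\<in>space M. \<exists>t\<in>{a..b}. X t \<omega> = y}"
  define rr :: "nat \<Rightarrow> real" where "rr = from_nat_into \<rat>"
  have rr: "range rr = \<rat>"
    unfolding rr_def using countable_rat by (intro range_from_nat_into) auto
  define near where "near m n \<omega> \<longleftrightarrow> dist (X (rr n) \<omega>) y \<le> 1 / real (Suc m)" for m n \<omega>
  define win where "win k n t \<longleftrightarrow> 0 \<le> rr n \<and> t < rr n \<and> rr n < t + 1 / real (Suc k)" for k n and t :: real
  have lim: "X t \<omega> = y \<longleftrightarrow> (\<forall>m. \<exists>k. \<forall>n. win k n t \<longrightarrow> near m n \<omega>)"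
    if \<omega>: "\<omega> \<in> space M" and t: "0 \<le> t" for t \<omega>
  proof
    assume "X t \<omega> = y"
    show "\<forall>m. \<exists>k. \<forall>n. win k n t \<longrightarrow> near m n \<omega>"
    proof
      fix m
      have "\<forall>\<^sub>F s in at_right t. dist (X s \<omega>) y < 1 / real (Suc m)"
        using rc[OF \<omega> t] \<open>X t \<omega> = y\<close> by (intro tendstoD) auto
      then obtain b' where b': "b' > t" "\<And>s. t < s \<Longrightarrow> s < b' \<Longrightarrow> dist (X s \<omega>) y < 1 / real (Suc m)"
        unfolding eventually_at_right_field by blast
      obtain k where k: "1 / real (Suc k) < b' - t" using nat_approx_posE[of "b' - t"] b'(1) by auto
      have "\<forall>n. win k n t \<longrightarrow> near m n \<omega>"
        using b'(2) k by (fastforce simp: win_def near_def simp del: of_nat_Suc)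
      then show "\<exists>k. \<forall>n. win k n t \<longrightarrow> near m n \<omega>" ..
    qed
  next
    assume *: "\<forall>m. \<exists>k. \<forall>n. win k n t \<longrightarrow> near m n \<omega>"
    have "dist (X t \<omega>) y \<le> 1 / real (Suc m)" for m
    proof (rule ccontr)
      assume "\<not> dist (X t \<omega>) y \<le> 1 / real (Suc m)"
      then have "1 / real (Suc m) < dist (X t \<omega>) y" by simp
      then have "\<forall>\<^sub>F s in at_right t. 1 / real (Suc m) < dist (X s \<omega>) y"
        using tendsto_dist[OF rc[OF \<omega> t] tendsto_const[of y]] by (rule order_tendstoD(1)[rotated])
      then obtain b' where b': "b' > t" "\<And>s. t < s \<Longrightarrow> s < b' \<Longrightarrow> 1 / real (Suc m) < dist (X s \<omega>) y"
        unfolding eventually_at_right_field by blast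
      obtain k where k: "\<forall>n. win k n t \<longrightarrow> near m n \<omega>" using * by blast
      have "t < min b' (t + 1 / real (Suc k))" using b' by simp
      then obtain r where r: "r \<in> \<rat>" "t < r" "r < min b' (t + 1 / real (Suc k))"
        using Rats_dense_in_real by blast
      then obtain n where n: "r = rr n" using rr by blast
      have "win k n t" using r t by (simp add: win_def n)
      then show False using k b'(2)[of r] r by (auto simp: near_def n)
    qed
    then have "(\<lambda>m. 1 / real (Suc m)) \<longlonglongrightarrow> 0 \<Longrightarrow> dist (X t \<omega>) y \<le> 0"
      by (intro LIMSEQ_le_const[where X = "\<lambda>m. 1 / real (Suc m)"]) (auto simp del: of_nat_Suc)
    then show "X t \<omega> = y" using LIMSEQ_inverse_real_of_nat by (simp add: inverse_eq_divide)
  qed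
  have approx: "\<exists>A\<in>sets M. A \<subseteq> H \<and> outer_measure_of M H \<le> emeasure M A + ennreal \<epsilon>"
    if \<epsilon>: "0 < \<epsilon>" for \<epsilon> :: real
  proof -
    \<comment> \<open>The list records the window sizes chosen so far for the first precisions. The
      finer precisions remain guaranteed by \<open>X t \<omega> = y\<close>.\<close>
    define G where "G ks = {\<omega>\<in>space M. \<exists>t\<in>{a..b}. X t \<omega> = y \<and>
      (\<forall>m<length ks. \<forall>n. win (ks ! m) n t \<longrightarrow> near m n \<omega>)}" for ks
    \<comment> \<open>Outer measure is continuous along increasing sequences of arbitrary sets, and
      \<open>G ks\<close> is the increasing union over the next window index. So some index loses at
      most the allotted amount; the amounts add up to at most \<epsilon>.\<close>
    have "\<exists>k. outer_measure_of M (G ks) \<le> outer_measure_of M (G (ks @ [k])) + ennreal (\<epsilon> * (1/2) ^ Suc (length ks))" for ks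
    proof -
      have "G ks = (\<Union>k. G (ks @ [k]))"
      proof safe
        fix \<omega> assume \<omega>: "\<omega> \<in> G ks"
        then obtain t where t: "t \<in> {a..b}" "X t \<omega> = y"
          "\<And>m n. m < length ks \<Longrightarrow> win (ks ! m) n t \<Longrightarrow> near m n \<omega>" by (auto simp: G_def)
        moreover have "\<omega> \<in> space M" "0 \<le> t" using \<omega> t a by (auto simp: G_def)
        ultimately obtain k where "\<forall>n. win k n t \<longrightarrow> near (length ks) n \<omega>"
          using lim by metis
        then have "\<omega> \<in> G (ks @ [k])"
          using t \<open>\<omega> \<in> space M\<close> unfolding G_def by (auto simp: less_Suc_eq nth_append intro!: bexI[of _ t])
        then show "\<omega> \<in> (\<Union>k. G (ks @ [k]))" by blast
      next
        fix \<omega> k assume "\<omega> \<in> G (ks @ [k])"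
        then show "\<omega> \<in> G ks" unfolding G_def
          by (auto simp: nth_append less_Suc_eq)
      qed
      moreover have "incseq (\<lambda>k. G (ks @ [k]))"
      proof (rule incseq_SucI)
        fix k
        have "win (Suc k) n t \<Longrightarrow> win k n t" for n t
          unfolding win_def using frac_le[of 1 1 "real (Suc k)" "real (Suc (Suc k))"] by auto
        then show "G (ks @ [k]) \<subseteq> G (ks @ [Suc k])"
          unfolding G_def by (auto simp: nth_append less_Suc_eq split: if_splits intro!: bexI)
      qed
      moreover have "G (ks @ [k]) \<subseteq> space M" for k by (auto simp: G_def)
      ultimately have sup: "(SUP k. outer_measure_of M (G (ks @ [k]))) = outer_measure_of M (G ks)"
        using SUP_outer_measure_of_incseq[of "\<lambda>k. G (ks @ [k])" M] by auto
      have "outer_measure_of M (G ks) \<le> emeasure M (space M)"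
        unfolding outer_measure_of_def by (intro INF_lower) (auto simp: G_def)
      then have fin: "outer_measure_of M (G ks) \<noteq> \<infinity>"
        using emeasure_finite by (auto simp: top_unique)
      show ?thesis
      proof (rule ccontr)
        assume "\<not> ?thesis"
        then have "outer_measure_of M (G (ks @ [k])) + ennreal (\<epsilon> * (1/2) ^ Suc (length ks)) \<le> outer_measure_of M (G ks)" for k
          by (meson linear)
        then have "(SUP k. outer_measure_of M (G (ks @ [k])) + ennreal (\<epsilon> * (1/2) ^ Suc (length ks))) \<le> outer_measure_of M (G ks)"
          by (intro SUP_least) auto
        then have "outer_measure_of M (G ks) + ennreal (\<epsilon> * (1/2) ^ Suc (length ks)) \<le> outer_measure_of M (G ks)"
          by (subst (asm) ennreal_SUP_add_left) (auto simp: sup)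
        moreover have "0 < ennreal (\<epsilon> * (1/2) ^ Suc (length ks))" using \<epsilon> by simp
        ultimately show False using fin
          by (metis add.right_neutral ennreal_add_left_cancel_less infinity_ennreal_def not_le top.not_eq_extremum)
      qed
    qed
    then obtain nxt where nxt: "\<And>ks. outer_measure_of M (G ks)
        \<le> outer_measure_of M (G (ks @ [nxt ks])) + ennreal (\<epsilon> * (1/2) ^ Suc (length ks))" by metis
    define l where "l = rec_nat [] (\<lambda>_ ks. ks @ [nxt ks])"
    have l_simps: "l 0 = []" "l (Suc n) = l n @ [nxt (l n)]" for n by (simp_all add: l_def)
    have len: "length (l n) = n" for n by (induction n) (simp_all add: l_simps)
    define \<kappa> where "\<kappa> m = nxt (l m)" for m
    have nth: "m < n \<Longrightarrow> l n ! m = \<kappa> m" for m n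
      by (induction n) (auto simp: l_simps nth_append len \<kappa>_def less_Suc_eq)
    have GH: "G [] = H" by (simp add: G_def H_def)
    have G_bound: "outer_measure_of M H \<le> outer_measure_of M (G (l n)) + ennreal (\<epsilon> * (1 - (1/2) ^ n))" for n
    proof (induction n)
      case 0 then show ?case by (simp add: l_simps GH)
    next
      case (Suc n)
      have "outer_measure_of M H \<le> outer_measure_of M (G (l n)) + ennreal (\<epsilon> * (1 - (1/2) ^ n))" by fact
      also have "\<dots> \<le> (outer_measure_of M (G (l (Suc n))) + ennreal (\<epsilon> * (1/2) ^ Suc n)) + ennreal (\<epsilon> * (1 - (1/2) ^ n))"
        using nxt[of "l n"] by (intro add_right_mono) (simp add: l_simps len)
      also have "\<dots> = outer_measure_of M (G (l (Suc n))) + ennreal (\<epsilon> * (1/2) ^ Suc n + \<epsilon> * (1 - (1/2) ^ n))"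
        using \<epsilon> by (subst ennreal_plus) (auto simp: add.assoc power_le_one)
      also have "\<epsilon> * (1/2) ^ Suc n + \<epsilon> * (1 - (1/2) ^ n) = \<epsilon> * (1 - (1/2) ^ Suc n)" by (simp add: field_simps)
      finally show ?case .
    qed
    \<comment> \<open>Only the first N precisions and the first N rational times are imposed, so
      that \<open>K N\<close> depends on finitely many of the random variables.\<close>
    define C where "C N \<omega> = {t\<in>{a..b}. \<forall>m<N. \<forall>n<N. win (\<kappa> m) n t \<longrightarrow> near m n \<omega>}" for N \<omega>
    define K where "K N = {\<omega>\<in>space M. C N \<omega> \<noteq> {}}" for N
    have K_sets: "K N \<in> sets M" for N
    proof -
      define F where "F = {..<N} \<times> {n. n < N \<and> 0 \<le> rr n}"
      define T where "T S = {\<omega>\<in>space M. \<forall>p\<in>S. near (fst p) (snd p) \<omega>}" for S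
      \<comment> \<open>The patterns of satisfied conditions that some t in [a,b] admits. This
        finite set does not depend on \<omega>, so the existential quantifier over real t disappears
        from the event.\<close>
      define OK where "OK = {S\<in>Pow F. \<exists>t\<in>{a..b}. \<forall>p\<in>F. win (\<kappa> (fst p)) (snd p) t \<longrightarrow> p \<in> S}"
      have "K N = (\<Union>S\<in>OK. T S)"
      proof safe
        fix \<omega> assume "\<omega> \<in> K N"
        then obtain t where t: "t \<in> C N \<omega>" and \<omega>: "\<omega> \<in> space M" by (auto simp: K_def)
        have "{p\<in>F. near (fst p) (snd p) \<omega>} \<in> OK"
          using t by (auto simp: OK_def C_def F_def intro!: bexI[of _ t])
        moreover have "\<omega> \<in> T {p\<in>F. near (fst p) (snd p) \<omega>}" using \<omega> by (auto simp: T_def)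
        ultimately show "\<omega> \<in> (\<Union>S\<in>OK. T S)" by blast
      next
        fix \<omega> S assume S: "S \<in> OK" and \<omega>: "\<omega> \<in> T S"
        then obtain t where t: "t \<in> {a..b}" "\<And>p. p \<in> F \<Longrightarrow> win (\<kappa> (fst p)) (snd p) t \<Longrightarrow> p \<in> S"
          by (auto simp: OK_def)
        have "near m n \<omega>" if "m < N" "n < N" "win (\<kappa> m) n t" for m n
        proof -
          have "(m, n) \<in> F" using that by (auto simp: F_def win_def)
          then show ?thesis using t(2)[of "(m, n)"] that \<omega> by (auto simp: T_def)
        qed
        then show "\<omega> \<in> K N" using t \<omega> by (auto simp: K_def C_def T_def)
      qed
      moreover have "finite OK" "OK \<subseteq> Pow F" "finite F" by (auto simp: OK_def F_def)
      moreover have "T S \<in> sets M" if "S \<subseteq> F" for S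
      proof -
        have "finite S" using that \<open>finite F\<close> by (rule finite_subset)
        moreover have "{\<omega>\<in>space M. near (fst p) (snd p) \<omega>} \<in> sets M" if "p \<in> S" for p
        proof -
          have [measurable]: "X (rr (snd p)) \<in> borel_measurable M"
            using \<open>S \<subseteq> F\<close> that by (intro meas) (auto simp: F_def)
          show ?thesis unfolding near_def by measurable
        qed
        ultimately show ?thesis unfolding T_def by (intro sets.sets_Collect_finite_All) auto
      qed
      ultimately show ?thesis by (auto intro!: sets.finite_UN)
    qed
    have C_compact: "compact (C N \<omega>)" for N \<omega>
    proof -
      \<comment> \<open>A violated condition at a rational time forbids exactly those t whose window
        contains it. As windows have strict bounds these t form an open interval, and what remains
        of [a,b] is compact.\<close>
      have eq: "C N \<omega> = {a..b} \<inter> (\<Inter>(m,n)\<in>{(m,n). m < N \<and> n < N \<and> 0 \<le> rr n \<and> \<not> near m n \<omega>}.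
          - {rr n - 1 / real (Suc (\<kappa> m))<..<rr n})"
        unfolding C_def win_def by (auto simp: algebra_simps simp del: of_nat_Suc)
      show ?thesis unfolding eq by (intro compact_Int_closed compact_Icc closed_INT) auto
    qed
    have C_dec: "C (Suc N) \<omega> \<subseteq> C N \<omega>" for N \<omega> by (auto simp: C_def)
    then have K_dec: "decseq K" by (intro decseq_SucI) (auto simp: K_def)
    have "(\<Inter>N. K N) \<subseteq> H"
    proof
      fix \<omega> assume "\<omega> \<in> (\<Inter>N. K N)"
      then have \<omega>: "\<omega> \<in> space M" and ne: "\<And>N. C N \<omega> \<noteq> {}" by (auto simp: K_def)
      have "\<And>m n. m \<le> n \<Longrightarrow> C n \<omega> \<subseteq> C m \<omega>" using C_dec by (rule lift_Suc_antimono_le)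
      then have "\<Inter> (range (\<lambda>N. C N \<omega>)) \<noteq> {}" by (intro compact_nest C_compact ne)
      then obtain t where t: "\<And>N. t \<in> C N \<omega>" by auto
      have "near m n \<omega>" if "win (\<kappa> m) n t" for m n
        using t[of "Suc (max m n)"] that by (auto simp: C_def)
      then have "X t \<omega> = y" using t[of 0] a by (subst lim[OF \<omega>]) (auto simp: C_def)
      then show "\<omega> \<in> H" using \<omega> t[of 0] by (auto simp: H_def C_def)
    qed
    moreover have "outer_measure_of M H \<le> emeasure M (\<Inter>N. K N) + ennreal \<epsilon>"
    proof -
      have "outer_measure_of M H \<le> emeasure M (K N) + ennreal \<epsilon>" for N
      proof -
        have "G (l N) \<subseteq> K N" by (auto simp: G_def K_def C_def len nth)
        then have "outer_measure_of M (G (l N)) \<le> emeasure M (K N)"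
          using outer_measure_of_mono[of "G (l N)" "K N" M] K_sets by simp
        moreover have "ennreal (\<epsilon> * (1 - (1/2) ^ N)) \<le> ennreal \<epsilon>"
          using \<epsilon> by (intro ennreal_leI) (simp add: mult_le_cancel_left1)
        ultimately show ?thesis using G_bound[of N] by (meson add_mono order_trans)
      qed
      then have "outer_measure_of M H \<le> (INF N. emeasure M (K N) + ennreal \<epsilon>)" by (intro INF_greatest) auto
      also have "\<dots> = (INF N. emeasure M (K N)) + ennreal \<epsilon>" by (subst INF_ennreal_add_const) simp
      also have "(INF N. emeasure M (K N)) = emeasure M (\<Inter>N. K N)"
        using K_sets K_dec by (intro INF_emeasure_decseq) auto
      finally show ?thesis .
    qed
    ultimately show ?thesis using K_sets by (intro bexI[of _ "\<Inter>N. K N"]) auto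
  qed
  have "\<forall>k. \<exists>A\<in>sets M. A \<subseteq> H \<and> outer_measure_of M H \<le> emeasure M A + ennreal (1 / real (Suc k))"
    by (intro allI approx) auto
  then obtain A where A: "\<And>k. A k \<in> sets M" "\<And>k. A k \<subseteq> H"
    "\<And>k. outer_measure_of M H \<le> emeasure M (A k) + ennreal (1 / real (Suc k))"
    by metis
  \<comment> \<open>A measurable hull of the hitting event, with the same outer measure.\<close>
  obtain B where B: "B \<in> sets M" "H \<subseteq> B" "outer_measure_of M H = emeasure M B"
    using outer_measure_of_attain[of H M] by (auto simp: H_def)
  let ?A = "\<Union>k. A k"
  have "emeasure M B \<le> emeasure M ?A + ennreal (1 / real (Suc k))" for k
  proof -
    have "emeasure M B \<le> emeasure M (A k) + ennreal (1 / real (Suc k))" using A(3) B(3) by simp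
    also have "emeasure M (A k) \<le> emeasure M ?A" using A(1) by (intro emeasure_mono) auto
    finally show ?thesis by (simp add: add_right_mono)
  qed
  moreover have "(\<lambda>k. emeasure M ?A + ennreal (1 / real (Suc k))) \<longlonglongrightarrow> emeasure M ?A + ennreal 0"
    using LIMSEQ_inverse_real_of_nat by (intro tendsto_add tendsto_ennrealI) (auto simp: inverse_eq_divide)
  ultimately have "emeasure M B \<le> emeasure M ?A"
    by (intro LIMSEQ_le_const[where X = "\<lambda>k. emeasure M ?A + ennreal (1 / real (Suc k))"]) auto
  moreover have "?A \<subseteq> B" using A(2) B(2) by auto
  ultimately have "emeasure M (B - ?A) = 0"
    using A(1) B(1) by (subst emeasure_Diff) (auto intro!: diff_eq_0_ennreal simp: less_top[symmetric])
  then show ?thesis using A B unfolding H_def[symmetric] by (intro bexI[of _ ?A] bexI[of _ B]) auto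
qed

section \<open>Subordinators\<close>

context prob_space
begin

lemma AE_subordinator:
  assumes "subordinator M Y"
  shows "AE \<omega> in M. Y 0 \<omega> = 0 \<and> mono_on {0..} (\<lambda>t. Y t \<omega>) \<and> cadlag (\<lambda>t. Y t \<omega>)"
  using assms by (simp add: subordinator_def)

lemma measurable_subordinator:
  assumes "subordinator M Y" "0 \<le> t"
  shows "Y t \<in> borel_measurable M"
  using assms by (simp add: subordinator_def)

lemma indep_vars_subordinator_grid:
  assumes "subordinator M Y" "0 \<le> h"
  shows "indep_vars (\<lambda>_. borel) (\<lambda>k \<omega>. Y (real (Suc k) * h) \<omega> - Y (real k * h) \<omega>) UNIV"
proof -
  have "\<forall>t :: nat \<Rightarrow> real. 0 \<le> t 0 \<and> incseq t \<longrightarrow>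
      indep_vars (\<lambda>_. borel) (\<lambda>k \<omega>. Y (t (Suc k)) \<omega> - Y (t k) \<omega>) UNIV"
    using assms by (simp add: subordinator_def)
  from spec[OF this, of "\<lambda>k. real k * h"] show ?thesis
    using assms(2) by (simp add: incseq_def mult_right_mono)
qed

lemma subordinator_laplace_grid:
  assumes Y: "subordinator M Y" and h: "0 \<le> h"
  shows "(\<integral>\<^sup>+\<omega>. ennreal (exp (- q * (Y (real (Suc k) * h) \<omega> - Y (real k * h) \<omega>))) \<partial>M)
       = (\<integral>\<^sup>+\<omega>. ennreal (exp (- q * Y h \<omega>)) \<partial>M)" (is ?thesis1)
    and "(\<integral>\<^sup>+\<omega>. ennreal (exp (- q * Y (real n * h) \<omega>)) \<partial>M)
       = (\<integral>\<^sup>+\<omega>. ennreal (exp (- q * Y h \<omega>)) \<partial>M) ^ n" (is ?thesis2)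
proof -
  have [measurable]: "Y (real k * h) \<in> borel_measurable M" "Y (real (Suc k) * h) \<in> borel_measurable M" "Y h \<in> borel_measurable M" for k
    using h by (auto intro!: measurable_subordinator[OF Y])
  have *: "(\<integral>\<^sup>+\<omega>. ennreal (exp (- q * (Y (real (Suc k) * h) \<omega> - Y (real k * h) \<omega>))) \<partial>M)
       = (\<integral>\<^sup>+\<omega>. ennreal (exp (- q * Y h \<omega>)) \<partial>M)" for k
  proof -
    have d: "distr M borel (\<lambda>\<omega>. Y (real k * h + h) \<omega> - Y (real k * h) \<omega>) = distr M borel (Y h)"
      using Y h by (simp add: subordinator_def)
    have hk: "real (Suc k) * h = real k * h + h" by (simp add: algebra_simps)
    have "(\<integral>\<^sup>+\<omega>. ennreal (exp (- q * (Y (real (Suc k) * h) \<omega> - Y (real k * h) \<omega>))) \<partial>M)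
        = (\<integral>\<^sup>+y. ennreal (exp (- q * y)) \<partial>distr M borel (\<lambda>\<omega>. Y (real (Suc k) * h) \<omega> - Y (real k * h) \<omega>))"
      by (subst nn_integral_distr) (simp_all del: of_nat_Suc)
    also have "\<dots> = (\<integral>\<^sup>+\<omega>. ennreal (exp (- q * Y h \<omega>)) \<partial>M)"
      unfolding hk d by (subst nn_integral_distr) simp_all
    finally show ?thesis .
  qed
  show ?thesis1 by (rule *)
  have "indep_vars (\<lambda>_. borel) (\<lambda>k \<omega>. Y (real (Suc k) * h) \<omega> - Y (real k * h) \<omega>) {..<n}"
    by (rule indep_vars_subset[OF indep_vars_subordinator_grid[OF Y h]]) simp
  then have ind: "indep_vars (\<lambda>_. borel) (\<lambda>k \<omega>. ennreal (exp (- q * (Y (real (Suc k) * h) \<omega> - Y (real k * h) \<omega>)))) {..<n}"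
    by (rule indep_vars_compose2) measurable
  have "(\<integral>\<^sup>+\<omega>. ennreal (exp (- q * Y (real n * h) \<omega>)) \<partial>M)
      = (\<integral>\<^sup>+\<omega>. (\<Prod>k<n. ennreal (exp (- q * (Y (real (Suc k) * h) \<omega> - Y (real k * h) \<omega>)))) \<partial>M)"
  proof (rule nn_integral_cong_AE)
    show "AE \<omega> in M. ennreal (exp (- q * Y (real n * h) \<omega>))
        = (\<Prod>k<n. ennreal (exp (- q * (Y (real (Suc k) * h) \<omega> - Y (real k * h) \<omega>))))"
      using AE_subordinator[OF Y]
    proof eventually_elim
      case (elim \<omega>)
      have "(\<Prod>k<n. exp (- q * (Y (real (Suc k) * h) \<omega> - Y (real k * h) \<omega>)))
          = exp (- q * (\<Sum>k<n. Y (real (Suc k) * h) \<omega> - Y (real k * h) \<omega>))"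
        by (simp add: exp_sum[symmetric] sum_distrib_left del: of_nat_Suc)
      also have "(\<Sum>k<n. Y (real (Suc k) * h) \<omega> - Y (real k * h) \<omega>) = Y (real n * h) \<omega>"
        using sum_lessThan_telescope[of "\<lambda>k. Y (real k * h) \<omega>" n] elim by simp
      finally show ?case by (subst prod_ennreal) (simp_all del: of_nat_Suc)
    qed
  qed
  also have "\<dots> = (\<Prod>k<n. \<integral>\<^sup>+\<omega>. ennreal (exp (- q * (Y (real (Suc k) * h) \<omega> - Y (real k * h) \<omega>))) \<partial>M)"
    by (intro indep_vars_nn_integral ind) auto
  finally show ?thesis2 unfolding * by simp
qed

lemma AE_subordinator_nonneg:
  assumes "subordinator M Y"
  shows "AE \<omega> in M. \<forall>t\<ge>0. 0 \<le> Y t \<omega>"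
  using AE_subordinator[OF assms]
proof eventually_elim
  case (elim \<omega>)
  then show ?case using mono_onD[of "{0..}" "\<lambda>t. Y t \<omega>" 0] by force
qed

lemma nn_integral_subordinator_1:
  assumes Y: "subordinator M Y" and q: "0 \<le> q"
  shows "(\<integral>\<^sup>+\<omega>. ennreal (exp (- q * Y 1 \<omega>)) \<partial>M)
       = ennreal (exp (- laplace_exponent M (\<lambda>t \<omega>. ennreal (Y t \<omega>)) q))"
proof -
  have [measurable]: "Y 1 \<in> borel_measurable M" by (intro measurable_subordinator[OF Y]) simp
  let ?\<phi> = "\<integral>\<omega>. exp_neg q (ennreal (Y 1 \<omega>)) \<partial>M"
  have int: "integrable M (\<lambda>\<omega>. exp_neg q (ennreal (Y 1 \<omega>)))"
    by (intro integrable_const_bound[where B = 1]) auto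
  have AE: "AE \<omega> in M. exp_neg q (ennreal (Y 1 \<omega>)) = exp (- q * Y 1 \<omega>)"
    using AE_subordinator_nonneg[OF Y]
    by eventually_elim (use q in \<open>simp add: exp_neg_def ennreal_mult''[symmetric]\<close>)
  have eq: "(\<integral>\<^sup>+\<omega>. ennreal (exp (- q * Y 1 \<omega>)) \<partial>M) = ennreal ?\<phi>"
    using AE by (subst nn_integral_eq_integral[OF int, symmetric]) (auto intro!: nn_integral_cong_AE)
  \<comment> \<open>\<open>ln\<close> can only be undone at a positive number; the integral of an
    everywhere positive function under a probability is positive.\<close>
  have "0 < ?\<phi>"
  proof (rule ccontr)
    assume "\<not> 0 < ?\<phi>"
    then have "(\<integral>\<^sup>+\<omega>. ennreal (exp (- q * Y 1 \<omega>)) \<partial>M) = 0" by (subst eq) (simp add: ennreal_neg)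
    then have "AE \<omega> in M. False" by (subst (asm) nn_integral_0_iff_AE) auto
    then show False by simp
  qed
  then show ?thesis unfolding eq laplace_exponent_def by simp
qed

text \<open>The 2^m-th power of the transform at time 2^-m is the transform at time 1, and
  nonnegative roots are unique. Restricting to dyadic times avoids a continuity argument in the time
  variable.\<close>

lemma subordinator_laplace_dyadic:
  assumes Y: "subordinator M Y" and q: "0 \<le> q"
  shows "(\<integral>\<^sup>+\<omega>. ennreal (exp (- q * (Y (real (Suc k) / 2 ^ m) \<omega> - Y (real k / 2 ^ m) \<omega>))) \<partial>M)
       = ennreal (exp (- laplace_exponent M (\<lambda>t \<omega>. ennreal (Y t \<omega>)) q / 2 ^ m))"
proof -
  let ?h = "1 / 2 ^ m :: real" and ?\<psi> = "laplace_exponent M (\<lambda>t \<omega>. ennreal (Y t \<omega>)) q"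
  let ?e = "\<integral>\<^sup>+\<omega>. ennreal (exp (- q * Y ?h \<omega>)) \<partial>M"
  have "?e ^ (2 ^ m) = ennreal (exp (- ?\<psi>))"
    using subordinator_laplace_grid(2)[OF Y, of ?h q "2 ^ m"] nn_integral_subordinator_1[OF Y q]
    by simp
  also have "exp (- ?\<psi>) = exp (- ?\<psi> / 2 ^ m) ^ (2 ^ m)"
    by (simp add: exp_of_nat_mult[symmetric])
  also have "ennreal \<dots> = ennreal (exp (- ?\<psi> / 2 ^ m)) ^ (2 ^ m)" by (simp add: ennreal_power)
  finally have eq: "?e ^ (2 ^ m) = ennreal (exp (- ?\<psi> / 2 ^ m)) ^ (2 ^ m)" .
  \<comment> \<open>An infinite value would have an infinite power, but the right side is
    finite.\<close>
  then have "?e \<noteq> top" 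
    by (auto simp: top_power_ennreal ennreal_power)
  then obtain r where r: "0 \<le> r" "?e = ennreal r" by (cases ?e) auto
  have "r ^ (2 ^ m) = exp (- ?\<psi> / 2 ^ m) ^ (2 ^ m)"
    using eq r by (simp add: ennreal_power)
  then have "r = exp (- ?\<psi> / 2 ^ m)"
    using r by (intro power_eq_imp_eq_base[of r "2 ^ m"]) auto
  then show ?thesis
    using r subordinator_laplace_grid(1)[OF Y, of ?h q k] by simp
qed

lemma laplace_exponent_0 [simp]: "laplace_exponent M Y 0 = 0"
  by (simp add: laplace_exponent_def exp_neg_def prob_space)

text \<open>Otherwise exp (- q Y_1) would have expectation at least 1 although it is almost surely
  below 1. Positivity is what sends an infinite lifetime to an infinite product with the
  exponent.\<close>

lemma laplace_exponent_subordinator_pos: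
  assumes Y: "subordinator M Y" and strict: "AE \<omega> in M. strict_mono_on {0..} (\<lambda>t. Y t \<omega>)" and q: "0 < q"
  shows "0 < laplace_exponent M (\<lambda>t \<omega>. ennreal (Y t \<omega>)) q"
proof (rule ccontr)
  assume neg: "\<not> ?thesis"
  have [measurable]: "Y 1 \<in> borel_measurable M" by (intro measurable_subordinator[OF Y]) simp
  have lt: "AE \<omega> in M. exp (- q * Y 1 \<omega>) < 1"
    using AE_subordinator[OF Y] strict
  proof eventually_elim
    case (elim \<omega>)
    then have "0 < Y 1 \<omega>" using strict_mono_onD[of "{0..}" "\<lambda>t. Y t \<omega>" 0 1] by simp
    then show ?case using q by simp
  qed
  have "1 \<le> exp (- laplace_exponent M (\<lambda>t \<omega>. ennreal (Y t \<omega>)) q)" using neg by simp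
  then have "1 \<le> (\<integral>\<^sup>+\<omega>. ennreal (exp (- q * Y 1 \<omega>)) \<partial>M)"
    using q by (subst nn_integral_subordinator_1[OF Y]) auto
  moreover have "(\<integral>\<^sup>+\<omega>. ennreal (exp (- q * Y 1 \<omega>)) \<partial>M) + (\<integral>\<^sup>+\<omega>. ennreal (1 - exp (- q * Y 1 \<omega>)) \<partial>M) = 1"
  proof -
    have "(\<integral>\<^sup>+\<omega>. ennreal (exp (- q * Y 1 \<omega>)) \<partial>M) + (\<integral>\<^sup>+\<omega>. ennreal (1 - exp (- q * Y 1 \<omega>)) \<partial>M)
      = (\<integral>\<^sup>+\<omega>. ennreal (exp (- q * Y 1 \<omega>)) + ennreal (1 - exp (- q * Y 1 \<omega>)) \<partial>M)"
      by (rule nn_integral_add[symmetric]) simp_all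
    also have "\<dots> = (\<integral>\<^sup>+\<omega>. 1 \<partial>M)"
      using lt by (intro nn_integral_cong_AE) (auto simp: ennreal_plus[symmetric] simp del: ennreal_plus)
    finally show ?thesis by (simp add: emeasure_space_1)
  qed
  ultimately have "(\<integral>\<^sup>+\<omega>. ennreal (1 - exp (- q * Y 1 \<omega>)) \<partial>M) = 0"
    by (metis add.right_neutral add_right_mono ennreal_add_left_cancel_le ennreal_one_neq_top
        infinity_ennreal_def le_zero_eq)
  then have "AE \<omega> in M. ennreal (1 - exp (- q * Y 1 \<omega>)) = 0"
    by (subst (asm) nn_integral_0_iff_AE) auto
  with lt have "AE \<omega> in M. False" by eventually_elim (simp add: ennreal_eq_0_iff)
  then show False by simp
qed

text \<open>The transforms at integer times k are the powers exp (- \<psi>)^k and tend to 0, whereas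
  a path bounded by c contributes at least exp (- c) for every k.\<close>

lemma AE_subordinator_unbounded:
  assumes Y: "subordinator M Y" and strict: "AE \<omega> in M. strict_mono_on {0..} (\<lambda>t. Y t \<omega>)"
  shows "AE \<omega> in M. \<forall>c. \<exists>t\<ge>0. c < Y t \<omega>"
proof -
  let ?\<psi> = "laplace_exponent M (\<lambda>t \<omega>. ennreal (Y t \<omega>)) 1"
  have \<psi>: "0 < ?\<psi>" by (rule laplace_exponent_subordinator_pos[OF Y strict]) simp
  have [measurable]: "Y (real k) \<in> borel_measurable M" for k by (intro measurable_subordinator[OF Y]) simp
  have "AE \<omega> in M. \<exists>k. real c < Y (real k) \<omega>" for c :: nat
  proof -
    let ?U = "{\<omega>\<in>space M. \<forall>k. Y (real k) \<omega> \<le> real c}"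
    have le: "ennreal (exp (- real c)) * emeasure M ?U \<le> ennreal (exp (- ?\<psi>) ^ k)" for k
    proof -
      have "ennreal (exp (- real c)) * emeasure M ?U = (\<integral>\<^sup>+\<omega>. ennreal (exp (- real c)) * indicator ?U \<omega> \<partial>M)"
        by (rule nn_integral_cmult_indicator[symmetric]) measurable
      also have "\<dots> \<le> (\<integral>\<^sup>+\<omega>. ennreal (exp (- 1 * Y (real k * 1) \<omega>)) \<partial>M)"
        by (intro nn_integral_mono) (auto simp: indicator_def intro!: ennreal_leI)
      also have "\<dots> = ennreal (exp (- ?\<psi>) ^ k)"
        by (subst subordinator_laplace_grid(2)[OF Y], simp, subst nn_integral_subordinator_1[OF Y])
           (simp_all add: ennreal_power)
      finally show ?thesis .
    qed
    have "(\<lambda>k. ennreal (exp (- ?\<psi>) ^ k)) \<longlonglongrightarrow> ennreal 0"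
      using \<psi> by (intro tendsto_ennrealI LIMSEQ_realpow_zero) auto
    then have "ennreal (exp (- real c)) * emeasure M ?U \<le> ennreal 0"
      using le by (intro LIMSEQ_le_const) auto
    then have "emeasure M ?U = 0" by (simp add: ennreal_eq_0_iff)
    then have "?U \<in> null_sets M" by (intro null_setsI) measurable
    from AE_not_in[OF this] AE_space show ?thesis by eventually_elim (auto simp: not_le)
  qed
  then have "AE \<omega> in M. \<forall>c::nat. \<exists>k. real c < Y (real k) \<omega>" by (simp add: AE_all_countable)
  then show ?thesis
  proof eventually_elim
    case (elim \<omega>)
    show ?case
    proof
      fix c :: real
      obtain n :: nat where "c < real n" using reals_Archimedean2 by blast
      moreover obtain k where "real n < Y (real k) \<omega>" using elim by blast
      ultimately show "\<exists>t\<ge>0. c < Y t \<omega>" by (intro exI[of _ "real k"]) auto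
    qed
  qed
qed

end

section \<open>Time change of an excursion\<close>

text \<open>As the argument approaches t from one side, a nondecreasing continuous \<rho> either is
  constant near t on that side or approaches its value at t strictly from the same side. In both
  cases the one-sided limits of e carry over.\<close>

lemma cadlag_compose:
  assumes e: "cadlag e" and mono: "mono_on {0..} \<rho>" and cont: "continuous_on {0..} \<rho>"
    and nonneg: "\<And>t::real. 0 \<le> t \<Longrightarrow> 0 \<le> \<rho> t" and y: "\<And>t. 0 \<le> t \<Longrightarrow> y t = e (\<rho> t)"
  shows "cadlag y"
  unfolding cadlag_def
proof (intro conjI allI impI)
  fix t :: real assume t: "0 \<le> t"
  have lim: "(\<rho> \<longlongrightarrow> \<rho> t) (at_right t)"
    using cont t by (auto simp: continuous_on_def intro: tendsto_within_subset)
  have "((\<lambda>s. e (\<rho> s)) \<longlongrightarrow> e (\<rho> t)) (at_right t)"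
  proof (cases "\<exists>s>t. \<rho> s = \<rho> t")
    case True
    then obtain s where s: "t < s" "\<rho> s = \<rho> t" by blast
    have "\<forall>\<^sub>F u in at_right t. e (\<rho> t) = e (\<rho> u)"
      using eventually_at_right_real[OF s(1)]
    proof eventually_elim
      case (elim u)
      then have "\<rho> t \<le> \<rho> u" "\<rho> u \<le> \<rho> s" using t s(1) by (auto intro!: mono_onD[OF mono])
      then show ?case using s by simp
    qed
    then show ?thesis by (rule Lim_transform_eventually[OF tendsto_const])
  next
    case False
    have "\<forall>\<^sub>F u in at_right t. \<rho> t < \<rho> u"
      using eventually_at_right_less[of t]
    proof eventually_elim
      case (elim u)
      then have "\<rho> t \<le> \<rho> u" using t by (auto intro!: mono_onD[OF mono])
      then show ?case using False elim by force
    qed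
    then have "filterlim \<rho> (at_right (\<rho> t)) (at_right t)"
      using lim by (auto simp: filterlim_at elim: eventually_mono)
    moreover have "(e \<longlongrightarrow> e (\<rho> t)) (at_right (\<rho> t))"
      using e nonneg[OF t] by (simp add: cadlag_def)
    ultimately show ?thesis by (rule filterlim_compose[rotated])
  qed
  moreover have "\<forall>\<^sub>F s in at_right t. e (\<rho> s) = y s"
    using eventually_at_right_less[of t] by eventually_elim (use t in \<open>simp add: y\<close>)
  ultimately show "(y \<longlongrightarrow> y t) (at_right t)"
    unfolding y[OF t] by (rule Lim_transform_eventually)
next
  fix t :: real assume t: "0 < t"
  have ev0: "\<forall>\<^sub>F s in at_left t. 0 < s" using t by (rule eventually_at_left_real[THEN eventually_mono]) auto
  have "(\<rho> \<longlongrightarrow> \<rho> t) (at t within {0..})"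
    using cont t by (auto simp: continuous_on_def)
  then have "(\<rho> \<longlongrightarrow> \<rho> t) (at t within {0..t})"
    by (rule tendsto_within_subset) auto
  then have lim: "(\<rho> \<longlongrightarrow> \<rho> t) (at_left t)"
    using t by (simp add: at_within_Icc_at_left)
  have "\<exists>l. ((\<lambda>s. e (\<rho> s)) \<longlongrightarrow> l) (at_left t)"
  proof (cases "\<exists>s\<ge>0. s < t \<and> \<rho> s = \<rho> t")
    case True
    then obtain s where s: "0 \<le> s" "s < t" "\<rho> s = \<rho> t" by blast
    have "\<forall>\<^sub>F u in at_left t. e (\<rho> t) = e (\<rho> u)"
      using eventually_at_left_real[OF s(2)]
    proof eventually_elim
      case (elim u)
      then have "\<rho> s \<le> \<rho> u" "\<rho> u \<le> \<rho> t" using t s(1,2) by (auto intro!: mono_onD[OF mono])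
      then show ?case using s by simp
    qed
    then have "((\<lambda>s. e (\<rho> s)) \<longlongrightarrow> e (\<rho> t)) (at_left t)"
      by (rule Lim_transform_eventually[OF tendsto_const])
    then show ?thesis ..
  next
    case False
    have ev: "\<forall>\<^sub>F u in at_left t. \<rho> u < \<rho> t"
      using eventually_at_left_real[OF t]
    proof eventually_elim
      case (elim u)
      then have "\<rho> u \<le> \<rho> t" using t by (auto intro!: mono_onD[OF mono])
      then show ?case using False elim by force
    qed
    then have flim: "filterlim \<rho> (at_left (\<rho> t)) (at_left t)"
      using lim by (auto simp: filterlim_at elim: eventually_mono)
    have "\<rho> 0 < \<rho> t"
    proof -
      have "\<rho> 0 \<le> \<rho> t" using t by (auto intro!: mono_onD[OF mono])
      then show ?thesis using False t by force
    qed
    then have "0 < \<rho> t" using nonneg[of 0] by simp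
    then obtain l where "(e \<longlongrightarrow> l) (at_left (\<rho> t))" using e by (auto simp: cadlag_def)
    from filterlim_compose[OF this flim] show ?thesis by blast
  qed
  then obtain l where "((\<lambda>s. e (\<rho> s)) \<longlongrightarrow> l) (at_left t)" by blast
  moreover have "\<forall>\<^sub>F s in at_left t. e (\<rho> s) = y s"
    using ev0 by eventually_elim (simp add: y)
  ultimately have "(y \<longlongrightarrow> l) (at_left t)" by (rule Lim_transform_eventually)
  then show "\<exists>l. (y \<longlongrightarrow> l) (at_left t)" ..
qed

lemma zeta_neq:
  assumes "0 < t" "ennreal t < zeta x\<^sub>o e"
  shows "e t \<noteq> x\<^sub>o"
  using assms unfolding zeta_def by (metis (mono_tags, lifting) Inf_lower leD mem_Collect_eq)

text \<open>A strictly increasing clock has a continuous inverse, so e' is e composed with a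
  continuous nondecreasing \<rho> and inherits its one-sided limits. It comes to rest at
  \<open>x\<^sub>o\<close> exactly when \<rho> reaches the old lifetime. A jump of the clock at the
  end of the excursion falls outside, hence the supremum over u strictly below the lifetime.\<close>

lemma
  fixes e :: "real \<Rightarrow> 's::polish_space"
  assumes e: "e \<in> exc_paths x\<^sub>o" and a: "0 \<le> a"
    and strict: "strict_mono_on {0..} z" and z: "cadlag z" and unb: "\<And>b. \<exists>t\<ge>0. b < z t"
  defines "e' \<equiv> time_change x\<^sub>o e (clock_incr z a (zeta x\<^sub>o e))"
  shows time_change_in_exc_paths: "e' \<in> exc_paths x\<^sub>o" (is ?thesis1)
    and zeta_time_change: "zeta x\<^sub>o e' = (SUP u\<in>{u. 0 \<le> u \<and> ennreal u < zeta x\<^sub>o e}. ennreal (z (a + u) - z a))" (is ?thesis2)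
proof -
  define w where "w u = z (a + u) - z a" for u
  let ?\<zeta> = "zeta x\<^sub>o e" and ?m = "clock_incr z a (zeta x\<^sub>o e)"
  define S where "S = (SUP u\<in>{u. 0 \<le> u \<and> ennreal u < ?\<zeta>}. ennreal (w u))"
  have \<zeta>pos: "0 < ?\<zeta>" and e0: "\<And>t. 0 \<le> t \<Longrightarrow> ?\<zeta> \<le> ennreal t \<Longrightarrow> e t = x\<^sub>o" and ecad: "cadlag e"
    using e by (auto simp: exc_paths_def path_space_def space_restrict_space)
  have w_less: "w u < w v" if "0 \<le> u" "u < v" for u v
    using that a strict_mono_onD[OF strict, of "a + u" "a + v"] by (simp add: w_def)
  have w_le: "w u \<le> w v" if "0 \<le> u" "u \<le> v" for u v
    using w_less[of u v] that by (cases "u = v") auto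
  have w0: "w 0 = 0" by (simp add: w_def)
  have w_nonneg: "0 \<le> w u" if "0 \<le> u" for u using w_le[of 0 u] that w0 by simp
  have w_unb: "\<exists>u\<ge>0. b < w u" for b
  proof -
    obtain t where t: "0 \<le> t" "b + z a < z t" using unb by blast
    have "z t \<le> z (a + t)"
    proof (cases "a = 0")
      case False
      then show ?thesis using strict_mono_onD[OF strict, of t "a + t"] a t by simp
    qed simp
    then show ?thesis using t by (intro exI[of _ t]) (auto simp: w_def)
  qed
  have m1: "?m u = w u" if "0 \<le> u" "ennreal u \<le> ?\<zeta>" for u
  proof -
    have "ennreal (u + a) \<le> ennreal a + ?\<zeta>" using that a by (simp add: add.commute add_left_mono)
    then show ?thesis using that a
      by (simp add: clock_incr_def w_def min_def add.commute ennreal_plus[symmetric] del: ennreal_plus)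
  qed
  \<comment> \<open>Beyond the lifetime the increment is frozen, so it takes no values other than
    those of w on the lifetime.\<close>
  have m2: "\<exists>v. 0 \<le> v \<and> v \<le> u \<and> ennreal v \<le> ?\<zeta> \<and> ?m u = w v" if "0 \<le> u" for u
  proof (cases "ennreal u \<le> ?\<zeta>")
    case True
    then show ?thesis using m1[OF that] that by blast
  next
    case False
    then obtain r where r: "0 \<le> r" "?\<zeta> = ennreal r" "r < u"
      using that by (cases ?\<zeta>) (auto simp: ennreal_less_iff not_le)
    then have "?m u = w r" using a that
      by (simp add: clock_incr_def w_def min_def add.commute ennreal_plus[symmetric] del: ennreal_plus)
    then show ?thesis using r by auto
  qed
  have R1: "rc_inverse ?m t \<le> ennreal u" if "0 \<le> u" "ennreal u < ?\<zeta>" "t < w u" for t u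
    unfolding rc_inverse_def using m1[of u] that by (intro Inf_lower) auto
  have R3: "ennreal u \<le> rc_inverse ?m t" if "0 \<le> u" "w u \<le> t" for t u
    unfolding rc_inverse_def
  proof (rule Inf_greatest, clarify)
    fix u' assume u': "0 \<le> u'" "t < ?m u'"
    obtain v where v: "0 \<le> v" "v \<le> u'" "?m u' = w v" using m2[OF u'(1)] by blast
    have "u \<le> v" using w_le[of v u] v u' that by force
    then show "ennreal u \<le> ennreal u'" using v by (intro ennreal_leI) simp
  qed
  have R2: "?\<zeta> \<le> rc_inverse ?m t" if "\<And>u. 0 \<le> u \<Longrightarrow> ennreal u < ?\<zeta> \<Longrightarrow> w u \<le> t" for t
    unfolding rc_inverse_def
  proof (rule Inf_greatest, clarify)
    fix u' assume u': "0 \<le> u'" "t < ?m u'"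
    show "?\<zeta> \<le> ennreal u'"
      using that[OF u'(1)] m1[OF u'(1)] u' by (metis leI less_imp_le not_less)
  qed
  \<comment> \<open>The clock exceeds t strictly before the old excursion ends; otherwise the new
    excursion is already over at time t.\<close>
  define hit where "hit t \<longleftrightarrow> (\<exists>u. 0 \<le> u \<and> ennreal u < ?\<zeta> \<and> t < w u)" for t
  \<comment> \<open>The inverse of the clock, stopped at the lifetime. The inverse itself becomes
    infinite or jumps past the lifetime once the clock is frozen, so the stopped version is the
    continuous one.\<close>
  define \<rho> where "\<rho> t = (if hit t then enn2real (rc_inverse ?m t) else enn2real ?\<zeta>)" for t
  have rc_hit: "rc_inverse ?m t < ?\<zeta>" if "hit t" for t
    using that R1 unfolding hit_def by (meson le_less_trans)
  \<comment> \<open>Unboundedness of the clock enters here: during an infinite excursion every time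
    is hit.\<close>
  have not_hit: "?\<zeta> \<noteq> \<infinity>" "?\<zeta> \<le> rc_inverse ?m t" if "\<not> hit t" for t
  proof -
    have *: "w u \<le> t" if "0 \<le> u" "ennreal u < ?\<zeta>" for u
      using that \<open>\<not> hit t\<close> by (auto simp: hit_def not_less)
    then show "?\<zeta> \<le> rc_inverse ?m t" by (rule R2)
    obtain u where "0 \<le> u" "t < w u" using w_unb[of t] by blast
    then show "?\<zeta> \<noteq> \<infinity>" using *[of u] by auto
  qed
  have \<rho>_nonneg: "0 \<le> \<rho> t" for t by (simp add: \<rho>_def)
  have \<rho>_hit: "ennreal (\<rho> t) = rc_inverse ?m t" if "hit t" for t
    using rc_hit[OF that] that by (simp add: \<rho>_def ennreal_enn2real_if) (metis top.not_eq_extremum top.extremum_strict)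
  have \<rho>_not_hit: "ennreal (\<rho> t) = ?\<zeta>" if "\<not> hit t" for t
    using not_hit[OF that] that by (simp add: \<rho>_def ennreal_enn2real_if)
  have \<rho>_le: "ennreal (\<rho> t) \<le> ?\<zeta>" for t
    using \<rho>_hit[of t] \<rho>_not_hit[of t] rc_hit[of t] by (cases "hit t") auto
  have \<rho>1: "v \<le> \<rho> t" if "0 \<le> v" "ennreal v \<le> ?\<zeta>" "w v \<le> t" for v t
  proof -
    have "ennreal v \<le> ennreal (\<rho> t)"
      using R3[of v t] that \<rho>_hit[of t] \<rho>_not_hit[of t] by (cases "hit t") auto
    then show ?thesis using \<rho>_nonneg by simp
  qed
  have \<rho>2: "\<rho> t \<le> v" if "0 \<le> v" "ennreal v < ?\<zeta>" "t < w v" for v t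
  proof -
    have "hit t" using that by (auto simp: hit_def)
    then have "ennreal (\<rho> t) \<le> ennreal v" using R1[OF that] by (simp add: \<rho>_hit)
    then show ?thesis using that by simp
  qed
  have below: "w v \<le> t" "ennreal v < ?\<zeta>" if "0 \<le> v" "v < \<rho> t" for v t
  proof -
    show "ennreal v < ?\<zeta>"
      using that \<rho>_le[of t] by (metis ennreal_lessI le_less_trans less_le_trans)
    then show "w v \<le> t" using \<rho>2[OF that(1), of t] that(2) by (meson not_le)
  qed
  have mono: "mono_on {0..} \<rho>"
  proof (rule mono_onI)
    fix t t' :: real assume t: "t \<le> t'"
    show "\<rho> t \<le> \<rho> t'"
    proof (rule ccontr)
      assume "\<not> ?thesis"
      then obtain v where v: "\<rho> t' < v" "v < \<rho> t" using dense[of "\<rho> t'" "\<rho> t"] by auto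
      then have "0 \<le> v" using \<rho>_nonneg[of t'] by simp
      then have "w v \<le> t" "ennreal v < ?\<zeta>" using below v by auto
      then have "v \<le> \<rho> t'" using \<open>0 \<le> v\<close> t by (intro \<rho>1) auto
      then show False using v by simp
    qed
  qed
  \<comment> \<open>A jump of \<rho> would be a flat stretch of the clock, which strict monotonicity
    excludes.\<close>
  have cont: "continuous_on {0..} \<rho>"
    unfolding continuous_on_def
  proof (intro ballI tendstoI)
    fix t and \<epsilon> :: real assume \<epsilon>: "0 < \<epsilon>"
    have "\<exists>d>0. \<forall>s. \<bar>s - t\<bar> < d \<longrightarrow> \<rho> s < \<rho> t + \<epsilon>"
    proof (cases "ennreal (\<rho> t + \<epsilon> / 2) < ?\<zeta>")
      case True
      have "t < w (\<rho> t + \<epsilon> / 2)"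
      proof (rule ccontr)
        assume "\<not> ?thesis"
        then have "\<rho> t + \<epsilon> / 2 \<le> \<rho> t" using True \<epsilon> \<rho>_nonneg[of t] by (intro \<rho>1) auto
        then show False using \<epsilon> by simp
      qed
      moreover have "\<rho> s < \<rho> t + \<epsilon>" if "s < w (\<rho> t + \<epsilon> / 2)" for s
      proof -
        have "\<rho> s \<le> \<rho> t + \<epsilon> / 2" using True \<epsilon> \<rho>_nonneg[of t] that by (intro \<rho>2) auto
        then show ?thesis using \<epsilon> by simp
      qed
      ultimately show ?thesis
        by (intro exI[of _ "w (\<rho> t + \<epsilon> / 2) - t"]) auto
    next
      case False
      have "\<rho> s < \<rho> t + \<epsilon>" for s
      proof -
        have "ennreal (\<rho> s) \<le> ennreal (\<rho> t + \<epsilon> / 2)" using \<rho>_le[of s] False by simp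
        moreover have "0 \<le> \<rho> t + \<epsilon> / 2" using \<epsilon> \<rho>_nonneg[of t] by simp
        ultimately have "\<rho> s \<le> \<rho> t + \<epsilon> / 2" using ennreal_le_iff by blast
        then show ?thesis using \<epsilon> by simp
      qed
      then show ?thesis by (intro exI[of _ 1]) auto
    qed
    then obtain d1 where d1: "0 < d1" "\<And>s. \<bar>s - t\<bar> < d1 \<Longrightarrow> \<rho> s < \<rho> t + \<epsilon>" by blast
    have "\<exists>d>0. \<forall>s. \<bar>s - t\<bar> < d \<longrightarrow> \<rho> t - \<epsilon> < \<rho> s"
    proof (cases "0 \<le> \<rho> t - \<epsilon> / 2")
      case True
      let ?v = "\<rho> t - \<epsilon> / 2"
      have "w ?v < w (\<rho> t - \<epsilon> / 4)" using True \<epsilon> by (intro w_less) auto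
      also have "\<dots> \<le> t" using True \<epsilon> by (intro below) auto
      finally have "w ?v < t" .
      moreover have "\<rho> t - \<epsilon> < \<rho> s" if "w ?v < s" for s
      proof -
        have "ennreal ?v < ?\<zeta>" using True \<epsilon> by (intro below(2)[of _ t]) auto
        then have "?v \<le> \<rho> s" using True that by (intro \<rho>1) auto
        then show ?thesis using \<epsilon> by simp
      qed
      ultimately show ?thesis by (intro exI[of _ "t - w ?v"]) auto
    next
      case False
      have "\<rho> t - \<epsilon> < \<rho> s" for s using False \<epsilon> \<rho>_nonneg[of s] by linarith
      then show ?thesis by (intro exI[of _ 1]) auto
    qed
    then obtain d2 where d2: "0 < d2" "\<And>s. \<bar>s - t\<bar> < d2 \<Longrightarrow> \<rho> t - \<epsilon> < \<rho> s" by blast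
    show "\<forall>\<^sub>F s in at t within {0..}. dist (\<rho> s) (\<rho> t) < \<epsilon>"
      unfolding eventually_at
    proof (intro exI[of _ "min d1 d2"] conjI ballI impI)
      fix s assume "s \<noteq> t \<and> dist s t < min d1 d2"
      then show "dist (\<rho> s) (\<rho> t) < \<epsilon>"
        using d1(2)[of s] d2(2)[of s] by (auto simp: dist_real_def abs_less_iff)
    qed (use d1 d2 in auto)
  qed
  have e'_eq: "e' t = e (\<rho> t)" if "0 \<le> t" for t
  proof (cases "hit t")
    case True
    then have "rc_inverse ?m t \<noteq> \<infinity>" using \<rho>_hit[of t] by (metis ennreal_neq_top infinity_ennreal_def)
    then show ?thesis using that True by (simp add: e'_def time_change_def \<rho>_def)
  next
    case False
    have "e (\<rho> t) = x\<^sub>o" using \<rho>_not_hit[OF False] \<rho>_nonneg by (intro e0) auto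
    moreover have "e' t = x\<^sub>o"
    proof (cases "rc_inverse ?m t = \<infinity>")
      case fin: False
      then have "?\<zeta> \<le> ennreal (enn2real (rc_inverse ?m t))"
        using not_hit[OF False] by (simp add: ennreal_enn2real_if)
      then show ?thesis using fin that by (simp add: e'_def time_change_def e0)
    qed (use that in \<open>simp add: e'_def time_change_def\<close>)
    ultimately show ?thesis by simp
  qed
  have cad: "cadlag e'"
    by (rule cadlag_compose[OF ecad mono cont \<rho>_nonneg e'_eq])
  have hit_iff: "hit t \<longleftrightarrow> ennreal t < S" if "0 \<le> t" for t
    unfolding S_def hit_def less_SUP_iff using that w_nonneg by (auto simp: ennreal_less_iff)
  have ge_S: "e' t = x\<^sub>o" if "0 \<le> t" "S \<le> ennreal t" for t
    using that hit_iff[of t] \<rho>_not_hit[of t] \<rho>_nonneg by (auto simp: e'_eq intro!: e0)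
  have small: "\<exists>r>0. ennreal r < ?\<zeta>"
  proof -
    obtain s where s: "0 < s" "s < ?\<zeta>" using dense[OF \<zeta>pos] by blast
    then show ?thesis by (cases s) auto
  qed
  have lt_S: "e' t \<noteq> x\<^sub>o" if "0 < t" "ennreal t < S" for t
  proof -
    have h: "hit t" using hit_iff[of t] that by simp
    \<comment> \<open>Right continuity of the clock at a makes \<rho> positive at every positive
      time. This matters because \<open>e 0\<close> may equal \<open>x\<^sub>o\<close>; only the
      values at times strictly between 0 and the lifetime are known to avoid it.\<close>
    have "\<exists>u>0. ennreal u < ?\<zeta> \<and> w u \<le> t"
    proof -
      have "(z \<longlongrightarrow> z a) (at_right a)" using z a by (simp add: cadlag_def)
      then have "\<forall>\<^sub>F s in at_right a. z s < z a + t" using that by (intro order_tendstoD(2)) auto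
      then obtain b where b: "a < b" "\<And>s. a < s \<Longrightarrow> s < b \<Longrightarrow> z s < z a + t"
        unfolding eventually_at_right_field by blast
      obtain r where r: "0 < r" "ennreal r < ?\<zeta>" using small by blast
      let ?u = "min r ((b - a) / 2)"
      have "0 < ?u" using r b by simp
      moreover have "ennreal ?u < ?\<zeta>" using r by (intro le_less_trans[OF _ r(2)] ennreal_leI) simp
      moreover have "w ?u \<le> t"
      proof -
        have "a + ?u \<le> a + (b - a) / 2" by (intro add_left_mono min.cobounded2)
        also have "\<dots> < b" using b(1) by (simp add: field_simps)
        finally have "a + ?u < b" .
        then have "z (a + ?u) < z a + t" using \<open>0 < ?u\<close> by (intro b(2)) auto
        then show ?thesis by (simp add: w_def)
      qed
      ultimately show ?thesis by blast
    qed
    then obtain u where "0 < u" "ennreal u < ?\<zeta>" "w u \<le> t" by blast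
    then have "0 < \<rho> t" using \<rho>1[of u t] by (simp add: less_imp_le)
    moreover have "ennreal (\<rho> t) < ?\<zeta>" using \<rho>_hit[OF h] rc_hit[OF h] by simp
    ultimately show ?thesis using that by (simp add: e'_eq zeta_neq)
  qed
  have S_pos: "0 < S"
  proof -
    have "hit 0" unfolding hit_def
    proof -
      obtain r where r: "0 < r" "ennreal r < ?\<zeta>" using small by blast
      then show "\<exists>u. 0 \<le> u \<and> ennreal u < ?\<zeta> \<and> 0 < w u"
        using w_less[of 0 r] w0 by (intro exI[of _ r]) auto
    qed
    then show ?thesis using hit_iff[of 0] by simp
  qed
  have zeta: "zeta x\<^sub>o e' = S"
  proof (rule antisym)
    show "S \<le> zeta x\<^sub>o e'"
      unfolding zeta_def using lt_S by (intro Inf_greatest) (auto simp: not_less[symmetric])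
    show "zeta x\<^sub>o e' \<le> S"
    proof (cases S)
      case (real r)
      then have "0 < r" using S_pos by simp
      moreover have "e' r = x\<^sub>o" using real by (intro ge_S) auto
      ultimately show ?thesis unfolding zeta_def using real by (intro Inf_lower) auto
    qed simp
  qed
  show ?thesis2 using zeta by (simp add: S_def w_def)
  have "e' \<in> space path_space"
    using cad by (auto simp: path_space_def space_restrict_space space_PiM e'_def time_change_def)
  then show ?thesis1
    using S_pos ge_S by (auto simp: exc_paths_def zeta)
qed

section \<open>The increment of a subordinator over an independent random open set\<close>

text \<open>Stieltjes measures are built from functions on the whole line. The constant extension to
  negative times keeps monotonicity and right continuity and places no mass there.\<close>

lemma
  fixes z :: "real \<Rightarrow> real"
  assumes "cadlag z" "mono_on {0..} z"
  shows mono_extend_left: "u \<le> v \<Longrightarrow> z (max 0 u) \<le> z (max 0 v)"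
    and right_continuous_extend_left: "continuous (at_right u) (\<lambda>t. z (max 0 t))"
proof -
  show "u \<le> v \<Longrightarrow> z (max 0 u) \<le> z (max 0 v)" by (intro mono_onD[OF assms(2)]) auto
  show "continuous (at_right u) (\<lambda>t. z (max 0 t))"
  proof (cases "0 \<le> u")
    case True
    then have "(z \<longlongrightarrow> z u) (at_right u)" using assms by (simp add: cadlag_def)
    moreover have "\<forall>\<^sub>F t in at_right u. z t = z (max 0 t)"
      using eventually_at_right_less[of u] by eventually_elim (use True in simp)
    ultimately show ?thesis using True by (simp add: continuous_within Lim_transform_eventually)
  next
    case False
    have "\<forall>\<^sub>F t in at_right u. z (max 0 u) = z (max 0 t)"
      using eventually_at_right_real[of u 0] False by (auto elim!: eventually_mono)
    then show ?thesis unfolding continuous_within by (rule Lim_transform_eventually[OF tendsto_const])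
  qed
qed

text \<open>The cells that fit into one of the intervals increase with the level and exhaust the
  union. They are closed on the right so that their measures are increments of the distribution
  function; the strict inequality at b keeps the closed end inside the open interval.\<close>

lemma tendsto_emeasure_dyadic:
  fixes a b :: "'i \<Rightarrow> real" and M :: "real measure"
  assumes M: "sets M = sets borel" and a: "\<And>p. p \<in> I \<Longrightarrow> 0 \<le> a p"
  shows "(\<lambda>m. \<Sum>k<m * 2 ^ m. (if \<exists>p\<in>I. a p \<le> real k / 2 ^ m \<and> real (Suc k) / 2 ^ m < b p
            then emeasure M {real k / 2 ^ m<..real (Suc k) / 2 ^ m} else 0))
     \<longlonglongrightarrow> emeasure M (\<Union>p\<in>I. {a p<..<b p})"
proof -
  define J where "J m k = {real k / 2 ^ m<..real (Suc k) / 2 ^ m}" for m k :: nat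
  define K where "K m = {k. k < m * 2 ^ m \<and> (\<exists>p\<in>I. a p \<le> real k / 2 ^ m \<and> real (Suc k) / 2 ^ m < b p)}" for m :: nat
  define V where "V m = (\<Union>k\<in>K m. J m k)" for m
  have finK: "finite (K m)" for m by (simp add: K_def)
  have J_sets: "J m k \<in> sets M" for m k by (simp add: J_def M)
  then have V_sets: "V m \<in> sets M" for m unfolding V_def using finK by (intro sets.finite_UN) auto
  have disj: "disjoint_family_on (J m) (K m)" for m
    unfolding disjoint_family_on_def
  proof (intro ballI impI)
    fix k l :: nat assume "k \<noteq> l"
    then consider "Suc k \<le> l" | "Suc l \<le> k" by linarith
    then show "J m k \<inter> J m l = {}"
    proof cases
      case 1
      then have "real (Suc k) / 2 ^ m \<le> real l / 2 ^ m" by (intro divide_right_mono) auto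
      then show ?thesis unfolding J_def by fastforce
    next
      case 2
      then have "real (Suc l) / 2 ^ m \<le> real k / 2 ^ m" by (intro divide_right_mono) auto
      then show ?thesis unfolding J_def by fastforce
    qed
  qed
  have sum: "(\<Sum>k<m * 2 ^ m. (if \<exists>p\<in>I. a p \<le> real k / 2 ^ m \<and> real (Suc k) / 2 ^ m < b p
            then emeasure M {real k / 2 ^ m<..real (Suc k) / 2 ^ m} else 0)) = emeasure M (V m)" for m
  proof -
    have "emeasure M (V m) = (\<Sum>k\<in>K m. emeasure M (J m k))"
      unfolding V_def using J_sets disj finK by (intro sum_emeasure[symmetric]) auto
    also have "\<dots> = (\<Sum>k<m * 2 ^ m. (if \<exists>p\<in>I. a p \<le> real k / 2 ^ m \<and> real (Suc k) / 2 ^ m < b p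
            then emeasure M (J m k) else 0))"
      unfolding K_def by (subst sum.If_cases) (auto intro!: sum.cong)
    finally show ?thesis by (simp only: J_def)
  qed
  have V_iff: "x \<in> V m \<longleftrightarrow> (\<exists>k. k < m * 2 ^ m \<and> real k < x * 2 ^ m \<and> x * 2 ^ m \<le> real (Suc k)
      \<and> (\<exists>p\<in>I. a p * 2 ^ m \<le> real k \<and> real (Suc k) < b p * 2 ^ m))" for x m
    by (auto simp: V_def K_def J_def divide_less_eq less_divide_eq le_divide_eq divide_le_eq simp del: of_nat_Suc)
  have inc: "incseq V"
  proof (intro incseq_SucI subsetI)
    fix m x assume "x \<in> V m"
    then obtain k p where k: "k < m * 2 ^ m" "real k < x * 2 ^ m" "x * 2 ^ m \<le> real (Suc k)"
      and p: "p \<in> I" "a p * 2 ^ m \<le> real k" "real (Suc k) < b p * 2 ^ m" unfolding V_iff by blast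
    have km: "2 * k + 1 < Suc m * 2 ^ Suc m"
    proof -
      have "2 * k + 2 \<le> 2 * (m * 2 ^ m)" using k(1) by linarith
      also have "\<dots> \<le> Suc m * 2 ^ Suc m" by simp
      finally show ?thesis by simp
    qed
    show "x \<in> V (Suc m)"
    proof (cases "x * 2 ^ Suc m \<le> real (2 * k + 1)")
      case True
      then show ?thesis unfolding V_iff using k p km by (intro exI[of _ "2 * k"] conjI bexI[of _ p]) auto
    next
      case False
      then show ?thesis unfolding V_iff using k p km by (intro exI[of _ "2 * k + 1"] conjI bexI[of _ p]) auto
    qed
  qed
  have UN: "(\<Union>m. V m) = (\<Union>p\<in>I. {a p<..<b p})"
  proof safe
    fix x m assume "x \<in> V m"
    then obtain k p where k: "real k < x * 2 ^ m" "x * 2 ^ m \<le> real (Suc k)"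
      and p: "p \<in> I" "a p * 2 ^ m \<le> real k" "real (Suc k) < b p * 2 ^ m" unfolding V_iff by blast
    have "a p * 2 ^ m < x * 2 ^ m" "x * 2 ^ m < b p * 2 ^ m" using k p by linarith+
    then show "x \<in> (\<Union>p\<in>I. {a p<..<b p})" using p(1) by auto
  next
    fix x p assume p: "p \<in> I" and x: "x \<in> {a p<..<b p}"
    define d where "d = min (x - a p) (b p - x)"
    have "0 < d" using x by (simp add: d_def)
    obtain m0 :: nat where m0: "1 / d < real m0" using reals_Archimedean2 by blast
    obtain m1 :: nat where m1: "x < real m1" using reals_Archimedean2 by blast
    \<comment> \<open>Large enough for a cell to be shorter than d, the distance of x to both ends,
      and for x to lie in the range [0,m] that level m covers.\<close>
    define m where "m = Suc (max m0 m1)"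
    have "real m < 2 ^ m" using of_nat_less_two_power[of m] by simp
    then have "1 / d < 2 ^ m" using m0 by (simp add: m_def)
    then have dm: "1 < d * 2 ^ m" using \<open>0 < d\<close> by (simp add: field_simps)
    have xpos: "0 < x" using a[OF p] x by simp
    \<comment> \<open>The cell containing x is closed on the right, hence the ceiling minus
      one.\<close>
    define k where "k = nat (\<lceil>x * 2 ^ m\<rceil> - 1)"
    have "0 < x * 2 ^ m" using xpos by simp
    then have c: "1 \<le> \<lceil>x * 2 ^ m\<rceil>" by simp
    then have rk: "real k = of_int \<lceil>x * 2 ^ m\<rceil> - 1" by (simp add: k_def)
    then have k: "real k < x * 2 ^ m" "x * 2 ^ m \<le> real (Suc k)" by linarith+
    have "x * 2 ^ m < real m * 2 ^ m" using m1 by (simp add: m_def)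
    then have "real k < real m * 2 ^ m" using k(1) by linarith
    then have "real k < real (m * 2 ^ m)" by simp
    then have km: "k < m * 2 ^ m" by (simp only: of_nat_less_iff)
    have "d * 2 ^ m \<le> (x - a p) * 2 ^ m" "d * 2 ^ m \<le> (b p - x) * 2 ^ m"
      by (intro mult_right_mono; simp add: d_def)+
    then have "a p * 2 ^ m \<le> real k" "real (Suc k) < b p * 2 ^ m"
      using k dm by (auto simp: left_diff_distrib)
    then have "x \<in> V m" unfolding V_iff using k km p by blast
    then show "x \<in> (\<Union>m. V m)" by blast
  qed
  show ?thesis
    unfolding sum UN[symmetric] by (intro Lim_emeasure_incseq inc) (use V_sets in auto)
qed

section \<open>Selection of increments by an independent sigma-algebra, and the dyadic limit\<close>

context prob_space
begin

text \<open>Independence is given as a product formula for events; the standard induction over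
  nonnegative measurable functions lifts it to functions on one of the two sides.\<close>

lemma nn_integral_indicator_mult_indep:
  assumes \<Sigma>: "sets \<Sigma> \<subseteq> events" "space \<Sigma> = space M" and W: "W \<in> borel_measurable \<Sigma>"
    and A: "A \<in> events" and ind: "\<And>C. C \<in> sets \<Sigma> \<Longrightarrow> prob (A \<inter> C) = prob A * prob C"
  shows "(\<integral>\<^sup>+\<omega>. indicator A \<omega> * W \<omega> \<partial>M) = emeasure M A * (\<integral>\<^sup>+\<omega>. W \<omega> \<partial>M)"
proof -
  have sub: "f \<in> borel_measurable \<Sigma> \<Longrightarrow> f \<in> borel_measurable M" for f :: "'a \<Rightarrow> ennreal"
    using \<Sigma> by (auto simp: measurable_def)
  note [measurable] = A
  show ?thesis using W
  proof (induction rule: borel_measurable_induct)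
    case (cong f g)
    then show ?case using \<Sigma> by (simp cong: nn_integral_cong)
  next
    case (set C)
    then have "C \<in> events" using \<Sigma> by blast
    have "(\<integral>\<^sup>+\<omega>. indicator A \<omega> * indicator C \<omega> \<partial>M) = emeasure M (A \<inter> C)"
      using A \<open>C \<in> events\<close> by (subst indicator_inter_arith[symmetric]) simp
    then show ?case using ind[OF set] \<open>C \<in> events\<close> by (simp add: emeasure_eq_measure ennreal_mult'')
  next
    case (mult u c)
    have [measurable]: "u \<in> borel_measurable M" using mult by (auto intro: sub)
    have "(\<integral>\<^sup>+\<omega>. indicator A \<omega> * (c * u \<omega>) \<partial>M) = c * (\<integral>\<^sup>+\<omega>. indicator A \<omega> * u \<omega> \<partial>M)"
      by (subst nn_integral_cmult[symmetric]) (auto simp: mult_ac)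
    then show ?case using mult by (simp add: nn_integral_cmult mult_ac)
  next
    case (add u v)
    have [measurable]: "u \<in> borel_measurable M" "v \<in> borel_measurable M" using add by (auto intro: sub)
    show ?case using add by (simp add: distrib_left nn_integral_add)
  next
    case (seq U)
    have [measurable]: "U i \<in> borel_measurable M" for i using seq by (auto intro: sub)
    have "(\<integral>\<^sup>+\<omega>. indicator A \<omega> * (SUP i. U i) \<omega> \<partial>M) = (\<integral>\<^sup>+\<omega>. (SUP i. indicator A \<omega> * U i \<omega>) \<partial>M)"
      by (intro nn_integral_cong) (simp add: SUP_mult_left_ennreal image_comp)
    also have "\<dots> = (SUP i. \<integral>\<^sup>+\<omega>. indicator A \<omega> * U i \<omega> \<partial>M)"
      using seq(3) by (intro nn_integral_monotone_convergence_SUP)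
        (auto simp: incseq_def le_fun_def intro!: mult_left_mono)
    also have "\<dots> = (SUP i. emeasure M A * (\<integral>\<^sup>+\<omega>. U i \<omega> \<partial>M))" by (simp only: seq.IH)
    also have "\<dots> = emeasure M A * (SUP i. \<integral>\<^sup>+\<omega>. U i \<omega> \<partial>M)" by (simp add: SUP_mult_left_ennreal)
    also have "(SUP i. \<integral>\<^sup>+\<omega>. U i \<omega> \<partial>M) = (\<integral>\<^sup>+\<omega>. (SUP i. U i \<omega>) \<partial>M)"
      using seq(3) by (intro nn_integral_monotone_convergence_SUP[symmetric]) auto
    finally show ?case by (simp add: image_comp)
  qed
qed

text \<open>Once the set of selected indices is fixed, the product is over a deterministic index
  set. The finitely many possible sets split H into events of \<open>G\<close>, and each of them is
  independent of all the factors.\<close>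

lemma nn_integral_prod_selected:
  fixes K :: nat
  assumes \<Sigma>: "sets \<Sigma> \<subseteq> events" "space \<Sigma> = space M" and G: "sets G \<subseteq> events" "space G = space M"
    and ind: "\<And>A C. A \<in> sets G \<Longrightarrow> C \<in> sets \<Sigma> \<Longrightarrow> prob (A \<inter> C) = prob A * prob C"
    and W: "\<And>k. k < K \<Longrightarrow> W k \<in> borel_measurable \<Sigma>"
    and indW: "indep_vars (\<lambda>_. borel) W {..<K}"
    and c: "\<And>k. k < K \<Longrightarrow> (\<integral>\<^sup>+\<omega>. W k \<omega> \<partial>M) = c k"
    and H: "H \<in> sets G" and B: "\<And>k. k < K \<Longrightarrow> B k \<in> sets G"
  shows "(\<integral>\<^sup>+\<omega>. indicator H \<omega> * (\<Prod>k<K. if \<omega> \<in> B k then W k \<omega> else 1) \<partial>M)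
       = (\<integral>\<^sup>+\<omega>. indicator H \<omega> * (\<Prod>k<K. if \<omega> \<in> B k then c k else 1 :: ennreal) \<partial>M)"
proof -
  define HS where "HS S = {\<omega>\<in>space G. \<omega> \<in> H \<and> (\<forall>k<K. \<omega> \<in> B k \<longleftrightarrow> k \<in> S)}" for S
  have HS: "HS S \<in> sets G" for S
  proof -
    have [measurable]: "H \<in> sets G" "k < K \<Longrightarrow> B k \<in> sets G" for k using H B by auto
    have "HS S = H \<inter> space G \<inter> (\<Inter>k\<in>{..<K}. if k \<in> S then B k else space G - B k) \<inter> space G"
      using sets.sets_into_space[OF H] by (auto simp: HS_def split: if_splits)
    also have "\<dots> \<in> sets G"
    proof (cases "K = 0")
      case False
      then show ?thesis using H B
        by (intro sets.Int sets.finite_INT) (auto split: if_splits)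
    qed (use H in auto)
    finally show ?thesis .
  qed
  \<comment> \<open>At each \<omega> only one S contributes: the set of indices actually
    selected.\<close>
  have split: "indicator H \<omega> * (\<Prod>k<K. if \<omega> \<in> B k then w k else 1)
      = (\<Sum>S\<in>Pow {..<K}. indicator (HS S) \<omega> * (\<Prod>k\<in>S. w k))" if \<omega>: "\<omega> \<in> space M" for \<omega> and w :: "nat \<Rightarrow> ennreal"
  proof -
    let ?S = "{k. k < K \<and> \<omega> \<in> B k}"
    have "(\<Sum>S\<in>Pow {..<K}. indicator (HS S) \<omega> * (\<Prod>k\<in>S. w k))
        = (\<Sum>S\<in>{?S}. indicator (HS S) \<omega> * (\<Prod>k\<in>S. w k))"
    proof (rule sum.mono_neutral_right)
      show "\<forall>S\<in>Pow {..<K} - {?S}. indicator (HS S) \<omega> * (\<Prod>k\<in>S. w k) = 0"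
        by (auto simp: HS_def indicator_def)
    qed auto
    also have "\<dots> = indicator H \<omega> * (\<Prod>k\<in>?S. w k)"
      using \<omega> G by (simp add: HS_def indicator_def)
    also have "(\<Prod>k\<in>?S. w k) = (\<Prod>k<K. if \<omega> \<in> B k then w k else 1)"
      by (simp add: prod.If_cases Int_def)
    finally show ?thesis by simp
  qed
  have WM: "W k \<in> borel_measurable M" if "k < K" for k
    using W[OF that] \<Sigma> by (auto simp: measurable_def)
  have "(\<integral>\<^sup>+\<omega>. indicator H \<omega> * (\<Prod>k<K. if \<omega> \<in> B k then W k \<omega> else 1) \<partial>M)
      = (\<Sum>S\<in>Pow {..<K}. \<integral>\<^sup>+\<omega>. indicator (HS S) \<omega> * (\<Prod>k\<in>S. W k \<omega>) \<partial>M)"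
    using HS G WM by (subst nn_integral_sum[symmetric])
      (auto simp: split intro!: nn_integral_cong borel_measurable_times_ennreal borel_measurable_prod_ennreal borel_measurable_indicator)
  also have "\<dots> = (\<Sum>S\<in>Pow {..<K}. \<integral>\<^sup>+\<omega>. indicator (HS S) \<omega> * (\<Prod>k\<in>S. c k) \<partial>M)"
  proof (intro sum.cong refl)
    fix S assume S: "S \<in> Pow {..<K}"
    have HSM: "HS S \<in> events" using HS G by auto
    have "(\<lambda>\<omega>. \<Prod>k\<in>S. W k \<omega>) \<in> borel_measurable \<Sigma>"
      using S W by (intro borel_measurable_prod_ennreal) auto
    then have "(\<integral>\<^sup>+\<omega>. indicator (HS S) \<omega> * (\<Prod>k\<in>S. W k \<omega>) \<partial>M) = emeasure M (HS S) * (\<integral>\<^sup>+\<omega>. (\<Prod>k\<in>S. W k \<omega>) \<partial>M)"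
      by (intro nn_integral_indicator_mult_indep[OF \<Sigma>] HSM ind HS)
    also have "(\<integral>\<^sup>+\<omega>. (\<Prod>k\<in>S. W k \<omega>) \<partial>M) = (\<Prod>k\<in>S. \<integral>\<^sup>+\<omega>. W k \<omega> \<partial>M)"
      using S by (intro indep_vars_nn_integral indep_vars_subset[OF indW]) (auto intro: finite_subset)
    also have "\<dots> = (\<Prod>k\<in>S. c k)" using S c by (intro prod.cong) auto
    finally show "(\<integral>\<^sup>+\<omega>. indicator (HS S) \<omega> * (\<Prod>k\<in>S. W k \<omega>) \<partial>M) = (\<integral>\<^sup>+\<omega>. indicator (HS S) \<omega> * (\<Prod>k\<in>S. c k) \<partial>M)"
      using HSM by (simp add: nn_integral_multc)
  qed
  also have "\<dots> = (\<integral>\<^sup>+\<omega>. indicator H \<omega> * (\<Prod>k<K. if \<omega> \<in> B k then c k else 1 :: ennreal) \<partial>M)"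
    using HS G by (subst nn_integral_sum[symmetric])
      (auto simp: split intro!: nn_integral_cong borel_measurable_times_ennreal borel_measurable_indicator)
  finally show ?thesis .
qed

text \<open>The limit s comes without measurability. It is replaced by the lower limit of the S m,
  which is measurable and agrees with it almost surely on H.\<close>

lemma nn_integral_exp_neg_liminf:
  assumes H: "H \<in> events" and S: "\<And>m::nat. S m \<in> borel_measurable M"
    and lim: "AE \<omega> in M. \<omega> \<in> H \<longrightarrow> (\<lambda>m. S m \<omega>) \<longlonglongrightarrow> s \<omega>"
  shows "(\<lambda>m. \<integral>\<^sup>+\<omega>. indicator H \<omega> * ennreal (exp_neg 1 (S m \<omega>)) \<partial>M)
      \<longlonglongrightarrow> (\<integral>\<^sup>+\<omega>. indicator H \<omega> * ennreal (exp_neg 1 (s \<omega>)) \<partial>M)"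
proof -
  note [measurable] = H S
  define s' where "s' \<omega> = liminf (\<lambda>m. S m \<omega>)" for \<omega>
  have [measurable]: "s' \<in> borel_measurable M" unfolding s'_def by measurable
  have lim': "AE \<omega> in M. \<omega> \<in> H \<longrightarrow> (\<lambda>m. S m \<omega>) \<longlonglongrightarrow> s' \<omega> \<and> s' \<omega> = s \<omega>"
    using lim by eventually_elim (auto simp: s'_def lim_imp_Liminf)
  have "(\<lambda>m. \<integral>\<^sup>+\<omega>. indicator H \<omega> * ennreal (exp_neg 1 (S m \<omega>)) \<partial>M)
      \<longlonglongrightarrow> (\<integral>\<^sup>+\<omega>. indicator H \<omega> * ennreal (exp_neg 1 (s' \<omega>)) \<partial>M)"
  proof (rule nn_integral_dominated_convergence[where w = "\<lambda>_. 1"])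
    show "AE \<omega> in M. (\<lambda>m. indicator H \<omega> * ennreal (exp_neg 1 (S m \<omega>))) \<longlonglongrightarrow> indicator H \<omega> * ennreal (exp_neg 1 (s' \<omega>))"
      using lim' by eventually_elim (auto simp: indicator_def intro!: tendsto_ennrealI tendsto_exp_neg)
  qed (auto simp: indicator_def emeasure_space_1)
  also have "(\<integral>\<^sup>+\<omega>. indicator H \<omega> * ennreal (exp_neg 1 (s' \<omega>)) \<partial>M) = (\<integral>\<^sup>+\<omega>. indicator H \<omega> * ennreal (exp_neg 1 (s \<omega>)) \<partial>M)"
    using lim' by (intro nn_integral_cong_AE, eventually_elim) (auto simp: indicator_def)
  finally show ?thesis .
qed

text \<open>Which cells of level m are covered by an interval of V is decided in \<open>G\<close>,
  so each selected increment may be replaced by its transform, whose exponent is \<psi> times the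
  length of the cell. As m grows the selected cells exhaust V, and the two sums tend to the dY-mass
  and to the Lebesgue measure of the same set.\<close>

lemma laplace_subordinator_random_open_set:
  fixes Y :: "real \<Rightarrow> 'a \<Rightarrow> real" and a b :: "'a \<Rightarrow> 'i \<Rightarrow> real"
  assumes Y: "subordinator M Y" and q: "0 \<le> q"
    and \<Sigma>: "sets \<Sigma> \<subseteq> events" "space \<Sigma> = space M" and G: "sets G \<subseteq> events" "space G = space M"
    and ind: "\<And>A C. A \<in> sets G \<Longrightarrow> C \<in> sets \<Sigma> \<Longrightarrow> prob (A \<inter> C) = prob A * prob C"
    and Y\<Sigma>: "\<And>t. 0 \<le> t \<Longrightarrow> Y t \<in> borel_measurable \<Sigma>"
    and H: "H \<in> sets G"
    and a: "\<And>\<omega> p. \<omega> \<in> H \<Longrightarrow> p \<in> I \<omega> \<Longrightarrow> 0 \<le> a \<omega> p"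
    and B: "\<And>r r'. 0 \<le> r \<Longrightarrow> {\<omega>\<in>H. \<exists>p\<in>I \<omega>. a \<omega> p \<le> r \<and> r' < b \<omega> p} \<in> sets G"
  defines "V \<equiv> \<lambda>\<omega>. \<Union>p\<in>I \<omega>. {a \<omega> p<..<b \<omega> p}"
  defines "\<psi> \<equiv> laplace_exponent M (\<lambda>t \<omega>. ennreal (Y t \<omega>)) q"
  assumes \<psi>: "0 \<le> \<psi>"
  shows "(\<integral>\<^sup>+\<omega>. indicator H \<omega> * ennreal (exp_neg 1 (ennreal q * emeasure (interval_measure (\<lambda>t. Y (max 0 t) \<omega>)) (V \<omega>))) \<partial>M)
       = (\<integral>\<^sup>+\<omega>. indicator H \<omega> * ennreal (exp_neg 1 (ennreal \<psi> * emeasure lborel (V \<omega>))) \<partial>M)"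
proof -
  define \<Delta> where "\<Delta> m k \<omega> = Y (real (Suc k) / 2 ^ m) \<omega> - Y (real k / 2 ^ m) \<omega>" for m k :: nat and \<omega>
  define BB where "BB m k = {\<omega>\<in>H. \<exists>p\<in>I \<omega>. a \<omega> p \<le> real k / 2 ^ m \<and> real (Suc k) / 2 ^ m < b \<omega> p}" for m k :: nat
  have BB: "BB m k \<in> sets G" for m k unfolding BB_def by (rule B) simp
  have HM[measurable]: "H \<in> events" using H G by auto
  have BBM[measurable]: "BB m k \<in> events" for m k using BB G by auto
  have \<Delta>\<Sigma>: "\<Delta> m k \<in> borel_measurable \<Sigma>" for m k
    unfolding \<Delta>_def by (intro borel_measurable_diff Y\<Sigma>) auto
  have [measurable]: "\<Delta> m k \<in> borel_measurable M" for m k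
    using \<Delta>\<Sigma>[of m k] \<Sigma> by (auto simp: measurable_def)
  define SY where "SY m \<omega> = (\<Sum>k<m * 2 ^ m. if \<omega> \<in> BB m k then ennreal (q * \<Delta> m k \<omega>) else 0)" for m \<omega>
  define SL where "SL m \<omega> = (\<Sum>k<m * 2 ^ m. if \<omega> \<in> BB m k then ennreal (\<psi> / 2 ^ m) else 0)" for m \<omega>
  have pos: "AE \<omega> in M. \<forall>m k. 0 \<le> \<Delta> m k \<omega>"
    using AE_subordinator[OF Y]
  proof eventually_elim
    case (elim \<omega>)
    then show ?case by (auto simp: \<Delta>_def divide_right_mono intro!: mono_onD[of "{0..}" "\<lambda>t. Y t \<omega>"] simp del: of_nat_Suc)
  qed
  have eqm: "(\<integral>\<^sup>+\<omega>. indicator H \<omega> * ennreal (exp_neg 1 (SY m \<omega>)) \<partial>M) = (\<integral>\<^sup>+\<omega>. indicator H \<omega> * ennreal (exp_neg 1 (SL m \<omega>)) \<partial>M)" for m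
  proof -
    let ?K = "m * 2 ^ m"
    have "indep_vars (\<lambda>_. borel) (\<Delta> m) UNIV"
      using indep_vars_subordinator_grid[OF Y, of "1 / 2 ^ m"] unfolding \<Delta>_def by simp
    then have "indep_vars (\<lambda>_. borel) (\<Delta> m) {..<?K}" by (rule indep_vars_subset) simp
    then have indep: "indep_vars (\<lambda>_. borel) (\<lambda>k \<omega>. ennreal (exp (- q * \<Delta> m k \<omega>))) {..<?K}"
      by (rule indep_vars_compose2) measurable
    have "(\<integral>\<^sup>+\<omega>. indicator H \<omega> * ennreal (exp_neg 1 (SY m \<omega>)) \<partial>M)
        = (\<integral>\<^sup>+\<omega>. indicator H \<omega> * (\<Prod>k<?K. if \<omega> \<in> BB m k then ennreal (exp (- q * \<Delta> m k \<omega>)) else 1) \<partial>M)"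
    proof (intro nn_integral_cong_AE)
      show "AE \<omega> in M. indicator H \<omega> * ennreal (exp_neg 1 (SY m \<omega>))
          = indicator H \<omega> * (\<Prod>k<?K. if \<omega> \<in> BB m k then ennreal (exp (- q * \<Delta> m k \<omega>)) else 1)"
        using pos
      proof eventually_elim
        case (elim \<omega>)
        have "exp_neg 1 (SY m \<omega>) = (\<Prod>k<?K. if \<omega> \<in> BB m k then exp (- q * \<Delta> m k \<omega>) else 1)"
          unfolding SY_def using elim q by (subst exp_neg_sum) (auto intro!: prod.cong simp: exp_neg_ennreal)
        also have "ennreal \<dots> = (\<Prod>k<?K. ennreal (if \<omega> \<in> BB m k then exp (- q * \<Delta> m k \<omega>) else 1))"
          by (rule prod_ennreal[symmetric]) auto
        also have "\<dots> = (\<Prod>k<?K. if \<omega> \<in> BB m k then ennreal (exp (- q * \<Delta> m k \<omega>)) else 1)"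
          by (intro prod.cong) auto
        finally show ?case by simp
      qed
    qed
    also have "\<dots> = (\<integral>\<^sup>+\<omega>. indicator H \<omega> * (\<Prod>k<?K. if \<omega> \<in> BB m k then ennreal (exp (- \<psi> / 2 ^ m)) else 1) \<partial>M)"
    proof (rule nn_integral_prod_selected[OF \<Sigma> G ind _ indep _ H BB])
      show "(\<lambda>\<omega>. ennreal (exp (- q * \<Delta> m k \<omega>))) \<in> borel_measurable \<Sigma>" for k
        using \<Delta>\<Sigma>[of m k] by measurable
      show "(\<integral>\<^sup>+\<omega>. ennreal (exp (- q * \<Delta> m k \<omega>)) \<partial>M) = ennreal (exp (- \<psi> / 2 ^ m))" for k
        unfolding \<Delta>_def \<psi>_def by (rule subordinator_laplace_dyadic[OF Y q])
    qed auto
    also have "\<dots> = (\<integral>\<^sup>+\<omega>. indicator H \<omega> * ennreal (exp_neg 1 (SL m \<omega>)) \<partial>M)"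
    proof (intro nn_integral_cong)
      fix \<omega>
      have "exp_neg 1 (SL m \<omega>) = (\<Prod>k<?K. if \<omega> \<in> BB m k then exp (- \<psi> / 2 ^ m) else 1)"
        unfolding SL_def using \<psi> by (subst exp_neg_sum) (auto intro!: prod.cong simp: exp_neg_ennreal)
      also have "ennreal \<dots> = (\<Prod>k<?K. ennreal (if \<omega> \<in> BB m k then exp (- \<psi> / 2 ^ m) else 1))"
        by (rule prod_ennreal[symmetric]) auto
      also have "\<dots> = (\<Prod>k<?K. if \<omega> \<in> BB m k then ennreal (exp (- \<psi> / 2 ^ m)) else 1)"
        by (intro prod.cong) auto
      finally show "indicator H \<omega> * (\<Prod>k<?K. if \<omega> \<in> BB m k then ennreal (exp (- \<psi> / 2 ^ m)) else 1)
          = indicator H \<omega> * ennreal (exp_neg 1 (SL m \<omega>))" by simp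
    qed
    finally show ?thesis .
  qed
  have limY: "AE \<omega> in M. \<omega> \<in> H \<longrightarrow> (\<lambda>m. SY m \<omega>) \<longlonglongrightarrow> ennreal q * emeasure (interval_measure (\<lambda>t. Y (max 0 t) \<omega>)) (V \<omega>)"
    using AE_subordinator[OF Y]
  proof eventually_elim
    case (elim \<omega>)
    let ?F = "\<lambda>t. Y (max 0 t) \<omega>"
    note mono = mono_extend_left[of "\<lambda>t. Y t \<omega>"] and rc = right_continuous_extend_left[of "\<lambda>t. Y t \<omega>"]
    show ?case
    proof
      assume \<omega>: "\<omega> \<in> H"
      have "SY m \<omega> = ennreal q * (\<Sum>k<m * 2 ^ m. (if \<exists>p\<in>I \<omega>. a \<omega> p \<le> real k / 2 ^ m \<and> real (Suc k) / 2 ^ m < b \<omega> p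
            then emeasure (interval_measure ?F) {real k / 2 ^ m<..real (Suc k) / 2 ^ m} else 0))" for m
        unfolding SY_def sum_distrib_left
      proof (intro sum.cong refl)
        fix k
        have "emeasure (interval_measure ?F) {real k / 2 ^ m<..real (Suc k) / 2 ^ m} = ennreal (\<Delta> m k \<omega>)"
          using elim mono rc by (subst emeasure_interval_measure_Ioc) (auto simp: \<Delta>_def divide_right_mono simp del: of_nat_Suc)
        then show "(if \<omega> \<in> BB m k then ennreal (q * \<Delta> m k \<omega>) else 0) = ennreal q *
            (if \<exists>p\<in>I \<omega>. a \<omega> p \<le> real k / 2 ^ m \<and> real (Suc k) / 2 ^ m < b \<omega> p
            then emeasure (interval_measure ?F) {real k / 2 ^ m<..real (Suc k) / 2 ^ m} else 0)"
          using \<omega> q by (auto simp: BB_def ennreal_mult' simp del: of_nat_Suc)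
      qed
      then show "(\<lambda>m. SY m \<omega>) \<longlonglongrightarrow> ennreal q * emeasure (interval_measure ?F) (V \<omega>)"
        unfolding V_def using a[OF \<omega>]
        by (simp only:) (intro ennreal_tendsto_cmult tendsto_emeasure_dyadic, auto)
    qed
  qed
  have limL: "(\<lambda>m. SL m \<omega>) \<longlonglongrightarrow> ennreal \<psi> * emeasure lborel (V \<omega>)" if \<omega>: "\<omega> \<in> H" for \<omega>
  proof -
    have "SL m \<omega> = ennreal \<psi> * (\<Sum>k<m * 2 ^ m. (if \<exists>p\<in>I \<omega>. a \<omega> p \<le> real k / 2 ^ m \<and> real (Suc k) / 2 ^ m < b \<omega> p
          then emeasure lborel {real k / 2 ^ m<..real (Suc k) / 2 ^ m} else 0))" for m
      unfolding SL_def sum_distrib_left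
    proof (intro sum.cong refl)
      fix k
      have "emeasure lborel {real k / 2 ^ m<..real (Suc k) / 2 ^ m} = ennreal (1 / 2 ^ m)"
        by (simp add: divide_right_mono diff_divide_distrib[symmetric])
      then show "(if \<omega> \<in> BB m k then ennreal (\<psi> / 2 ^ m) else 0) = ennreal \<psi> *
          (if \<exists>p\<in>I \<omega>. a \<omega> p \<le> real k / 2 ^ m \<and> real (Suc k) / 2 ^ m < b \<omega> p
          then emeasure lborel {real k / 2 ^ m<..real (Suc k) / 2 ^ m} else 0)"
        using \<omega> \<psi> by (auto simp: BB_def ennreal_mult'[symmetric] simp del: of_nat_Suc)
    qed
    then show ?thesis
      unfolding V_def using a[OF \<omega>]
      by (simp only:) (intro ennreal_tendsto_cmult tendsto_emeasure_dyadic, auto)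
  qed
  have "(\<lambda>m. \<integral>\<^sup>+\<omega>. indicator H \<omega> * ennreal (exp_neg 1 (SY m \<omega>)) \<partial>M)
      \<longlonglongrightarrow> (\<integral>\<^sup>+\<omega>. indicator H \<omega> * ennreal (exp_neg 1 (ennreal q * emeasure (interval_measure (\<lambda>t. Y (max 0 t) \<omega>)) (V \<omega>))) \<partial>M)"
    by (intro nn_integral_exp_neg_liminf limY HM) (simp add: SY_def)
  moreover have "(\<lambda>m. \<integral>\<^sup>+\<omega>. indicator H \<omega> * ennreal (exp_neg 1 (SL m \<omega>)) \<partial>M)
      \<longlonglongrightarrow> (\<integral>\<^sup>+\<omega>. indicator H \<omega> * ennreal (exp_neg 1 (ennreal \<psi> * emeasure lborel (V \<omega>))) \<partial>M)"
    by (intro nn_integral_exp_neg_liminf HM AE_I2 impI limL) (simp_all add: SL_def)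
  ultimately show ?thesis unfolding eqm by (rule LIMSEQ_unique)
qed

end

section \<open>The structure of a single path\<close>

definition avoids :: "'s \<Rightarrow> (real \<Rightarrow> 's) \<Rightarrow> real \<Rightarrow> real \<Rightarrow> bool" where
  "avoids x\<^sub>o x a b \<longleftrightarrow> (\<forall>u\<in>{a..b}. x u \<noteq> x\<^sub>o)"

text \<open>The almost sure properties of a single path, collected so that its structure can be
  studied without a probability space. \<open>no_double\<close> and \<open>none_at_0\<close> are
  what the Poisson property contributes; \<open>AE_good_path\<close> shows that almost every path
  qualifies.\<close>

locale excursion_path =
  fixes x\<^sub>o :: "'s::polish_space" and c :: real and \<mu> :: "(real \<times> (real \<Rightarrow> 's)) measure"
    and l :: "real \<Rightarrow> real" and x :: "real \<Rightarrow> 's"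
  assumes sets_\<mu>: "sets \<mu> = sets (restrict_space borel {0..} \<Otimes>\<^sub>M exc_space x\<^sub>o)"
    and point_measure: "point_measure \<mu>"
    and no_double: "\<And>k s. 0 \<le> s \<Longrightarrow>
      emeasure \<mu> ({s} \<times> {e\<in>exc_paths x\<^sub>o. ennreal (1 / real (Suc k)) < zeta x\<^sub>o e}) < 2"
    and none_at_0: "emeasure \<mu> ({0} \<times> exc_paths x\<^sub>o) = 0"
    and c_nonneg: "0 \<le> c"
    and eta_rc: "\<And>s. 0 \<le> s \<Longrightarrow> (eta x\<^sub>o c \<mu> \<longlongrightarrow> eta x\<^sub>o c \<mu> s) (at_right s)"
    and eta_strict: "strict_mono_on {s. 0 \<le> s \<and> ennreal s < L_inf x\<^sub>o c \<mu>} (eta x\<^sub>o c \<mu>)"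
    and l_nonneg: "\<And>t. 0 \<le> t \<Longrightarrow> 0 \<le> l t"
    and l_mono: "mono_on {0..} l"
    and l_continuous: "continuous_on {0..} l"
    and l_inverse: "\<And>t. 0 \<le> t \<Longrightarrow> ennreal (l t) = Inf {ennreal s | s. 0 \<le> s \<and> ennreal t < eta x\<^sub>o c \<mu> s}"
    and x_excursion: "\<And>s e t. (s, e) \<in> atoms \<mu> \<Longrightarrow> ennreal s \<le> L_inf x\<^sub>o c \<mu> \<Longrightarrow> 0 \<le> t \<Longrightarrow>
      eta_left x\<^sub>o c \<mu> s \<le> ennreal t \<Longrightarrow> ennreal t < eta x\<^sub>o c \<mu> s \<Longrightarrow> x t = e (t - enn2real (eta_left x\<^sub>o c \<mu> s))"
    and dl_support: "emeasure (interval_measure (\<lambda>t. l (max 0 t))) (- closure (zero_set x\<^sub>o x)) = 0"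
    and x_cadlag: "cadlag x"
begin

abbreviation "\<zeta> \<equiv> zeta x\<^sub>o"
abbreviation "\<eta> \<equiv> eta x\<^sub>o c \<mu>"
abbreviation "\<eta>l \<equiv> eta_left x\<^sub>o c \<mu>"
abbreviation "A \<equiv> atoms \<mu>"

section \<open>The point measure of a path as counting measure on its atoms\<close>

lemma space_\<mu>: "space \<mu> = {0..} \<times> exc_paths x\<^sub>o"
  using sets_eq_imp_space_eq[OF sets_\<mu>] by (simp add: space_pair_measure space_exc_space space_restrict_space)

lemma atomsD: "(s, e) \<in> A \<Longrightarrow> 0 \<le> s \<and> e \<in> exc_paths x\<^sub>o"
  by (auto simp: atoms_def space_\<mu>)

lemma zeta_pos: "e \<in> exc_paths x\<^sub>o \<Longrightarrow> 0 < \<zeta> e"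
  by (simp add: exc_paths_def)

lemma measurable_zeta_snd [measurable]: "(\<lambda>p. \<zeta> (snd p)) \<in> borel_measurable \<mu>"
  unfolding measurable_cong_sets[OF sets_\<mu> refl] using measurable_zeta[of x\<^sub>o] by measurable

lemma times_sets:
  assumes "S \<in> sets borel" "S \<subseteq> {0..}" "C \<in> sets (exc_space x\<^sub>o)"
  shows "S \<times> C \<in> sets \<mu>"
  unfolding sets_\<mu> using assms by (intro pair_measureI) (auto simp: sets_restrict_space_iff)

lemma exc_paths_sets: "exc_paths x\<^sub>o \<in> sets (exc_space x\<^sub>o)"
  using sets.top[of "exc_space x\<^sub>o"] by (simp add: space_exc_space)

lemma long_sets: "{e\<in>exc_paths x\<^sub>o. h < \<zeta> e} \<in> sets (exc_space x\<^sub>o)"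
  using measurable_sets[OF measurable_zeta[of x\<^sub>o], of "{h<..}"]
  by (simp add: space_exc_space vimage_def Int_def conj_commute)

lemma emeasure_eq_count:
  assumes "B \<in> sets \<mu>"
  shows "emeasure \<mu> B = (\<integral>\<^sup>+p. emeasure \<mu> {p} \<partial>count_space (A \<inter> B))"
  using point_measure assms by (simp add: point_measure_def)

lemma emeasure_atom_ge_1:
  assumes "p \<in> A" shows "1 \<le> emeasure \<mu> {p}"
proof -
  obtain k :: nat where "emeasure \<mu> {p} = of_nat k" using point_measure assms by (auto simp: point_measure_def)
  then show ?thesis using assms by (cases k) (auto simp: atoms_def)
qed

lemma atoms_long:
  assumes "e \<in> exc_paths x\<^sub>o"
  shows "\<exists>k::nat. \<forall>m\<ge>k. ennreal (1 / real (Suc m)) < \<zeta> e"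
proof -
  have pos: "0 < \<zeta> e" by (rule zeta_pos[OF assms])
  show ?thesis
  proof (cases "\<zeta> e")
    case (real r)
    then have "0 < r" using pos by simp
    then obtain k :: nat where k: "1 / real (Suc k) < r" using nat_approx_posE by blast
    have "1 / real (Suc m) < r" if "k \<le> m" for m
      using that by (intro le_less_trans[OF _ k] divide_left_mono) auto
    then show ?thesis using real by (auto simp: ennreal_less_iff)
  qed auto
qed

text \<open>For large m all excursions in question are longer than 1/(m+1). Two atoms at the same
  time, or an atom of mass two, would give the slice of such excursions mass at least 2, against
  \<open>no_double\<close>.\<close>

lemma atom_unique:
  assumes "(s, e) \<in> A" "(s, e') \<in> A"
  shows "e = e'" "emeasure \<mu> {(s, e)} = 1"
proof -
  obtain k k' where k: "\<forall>m\<ge>k. ennreal (1 / real (Suc m)) < \<zeta> e" "\<forall>m\<ge>k'. ennreal (1 / real (Suc m)) < \<zeta> e'"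
    using atoms_long assms atomsD by meson
  let ?m = "max k k'"
  let ?C = "{e\<in>exc_paths x\<^sub>o. ennreal (1 / real (Suc ?m)) < \<zeta> e}"
  have B: "{s} \<times> ?C \<in> sets \<mu>"
    using atomsD[OF assms(1)] by (intro times_sets long_sets) auto
  have less: "(\<Sum>p\<in>S. emeasure \<mu> {p}) < 2" if "S \<subseteq> {(s, e), (s, e')}" for S
  proof -
    have "S \<subseteq> A \<inter> ({s} \<times> ?C)" using that assms k atomsD by auto
    have "finite S" using that by (rule finite_subset) simp
    then have "(\<Sum>p\<in>S. emeasure \<mu> {p}) = (\<integral>\<^sup>+p. emeasure \<mu> {p} \<partial>count_space S)"
      by (simp add: nn_integral_count_space_finite)
    also have "\<dots> \<le> (\<integral>\<^sup>+p. emeasure \<mu> {p} \<partial>count_space (A \<inter> ({s} \<times> ?C)))"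
      using \<open>S \<subseteq> A \<inter> ({s} \<times> ?C)\<close>
      by (subst (1 2) nn_integral_count_space_indicator)
         (simp_all, intro nn_integral_mono, auto simp: indicator_def)
    also have "\<dots> < 2" using no_double[of s ?m] atomsD[OF assms(1)] emeasure_eq_count[OF B] by simp
    finally show ?thesis .
  qed
  show "e = e'"
  proof (rule ccontr)
    assume "e \<noteq> e'"
    then have "emeasure \<mu> {(s, e)} + emeasure \<mu> {(s, e')} < 2" using less[of "{(s, e), (s, e')}"] by simp
    moreover have "1 + 1 \<le> emeasure \<mu> {(s, e)} + emeasure \<mu> {(s, e')}"
      using assms by (intro add_mono emeasure_atom_ge_1)
    ultimately show False by simp
  qed
  obtain n :: nat where n: "emeasure \<mu> {(s, e)} = of_nat n" using point_measure assms by (auto simp: point_measure_def)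
  then have "of_nat n < (of_nat 2 :: ennreal)" using less[of "{(s, e)}"] by simp
  then have "n < 2" by (simp only: of_nat_less_iff)
  moreover have "n \<noteq> 0" using n assms by (auto simp: atoms_def)
  ultimately show "emeasure \<mu> {(s, e)} = 1" using n by (cases n) auto
qed

lemma emeasure_atom: "p \<in> A \<Longrightarrow> emeasure \<mu> {p} = 1"
  using atom_unique(2)[of "fst p" "snd p" "snd p"] by simp

lemma emeasure_count:
  assumes "B \<in> sets \<mu>" shows "emeasure \<mu> B = emeasure (count_space A) (A \<inter> B)"
proof -
  have "emeasure \<mu> B = (\<integral>\<^sup>+p. 1 \<partial>count_space (A \<inter> B))"
    unfolding emeasure_eq_count[OF assms] by (intro nn_integral_cong) (simp add: emeasure_atom)
  then show ?thesis by (simp add: emeasure_count_space)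
qed

text \<open>Atoms have mass one, so integrals become sums over the atoms. On
  \<open>count_space\<close> every further manipulation is free of measurability conditions.\<close>

lemma nn_integral_atoms:
  assumes f: "f \<in> borel_measurable \<mu>"
  shows "(\<integral>\<^sup>+p. f p \<partial>\<mu>) = (\<integral>\<^sup>+p. f p \<partial>count_space A)"
proof -
  have id: "(\<lambda>p. p) \<in> measurable (count_space A) \<mu>" by (auto simp: atoms_def)
  have "\<mu> = distr (count_space A) \<mu> (\<lambda>p. p)"
  proof (rule measure_eqI)
    fix B assume B: "B \<in> sets \<mu>"
    then show "emeasure \<mu> B = emeasure (distr (count_space A) \<mu> (\<lambda>p. p)) B"
      using emeasure_count[OF B] by (subst emeasure_distr[OF id]) (auto simp: Int_commute vimage_def)
  qed simp
  then have "(\<integral>\<^sup>+p. f p \<partial>\<mu>) = (\<integral>\<^sup>+p. f p \<partial>distr (count_space A) \<mu> (\<lambda>p. p))" by simp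
  also have "\<dots> = (\<integral>\<^sup>+p. f p \<partial>count_space A)" by (subst nn_integral_distr[OF id]) (use f in simp_all)
  finally show ?thesis .
qed

section \<open>The inverse local time and its jumps\<close>

lemma eta_eq: "\<eta> s = ennreal (c * s) + (\<integral>\<^sup>+p. \<zeta> (snd p) * indicator {..s} (fst p) \<partial>count_space A)"
proof -
  have [measurable]: "{0..s} \<times> exc_paths x\<^sub>o \<in> sets \<mu>"
    by (intro times_sets exc_paths_sets) auto
  have "(\<integral>\<^sup>+(u, e)\<in>{0..s} \<times> exc_paths x\<^sub>o. \<zeta> e \<partial>\<mu>) = (\<integral>\<^sup>+p. \<zeta> (snd p) * indicator ({0..s} \<times> exc_paths x\<^sub>o) p \<partial>\<mu>)"
    by (simp add: case_prod_beta)
  also have "\<dots> = (\<integral>\<^sup>+p. \<zeta> (snd p) * indicator ({0..s} \<times> exc_paths x\<^sub>o) p \<partial>count_space A)"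
    by (rule nn_integral_atoms) measurable
  also have "\<dots> = (\<integral>\<^sup>+p. \<zeta> (snd p) * indicator {..s} (fst p) \<partial>count_space A)"
    using atomsD by (intro nn_integral_cong) (auto simp: indicator_def)
  finally show ?thesis unfolding eta_def by simp
qed

lemma eta_left_eq:
  assumes s: "0 \<le> s"
  shows "\<eta>l s = ennreal (c * s) + (\<integral>\<^sup>+p. \<zeta> (snd p) * indicator {..<s} (fst p) \<partial>count_space A)"
proof (cases "s = 0")
  case True
  have "(\<integral>\<^sup>+p. \<zeta> (snd p) * indicator {..<s} (fst p) \<partial>count_space A) = (\<integral>\<^sup>+p. 0 \<partial>count_space A)"
    using True atomsD by (intro nn_integral_cong) (force simp: indicator_def)
  then show ?thesis using True by (simp add: eta_left_def bot_ennreal)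
next
  case False
  then have s: "0 < s" using s by simp
  \<comment> \<open>A sequence that starts at 0, increases to s and stays strictly below it, so that
    the atoms at time s itself never enter.\<close>
  define r where "r n = s * (1 - 1 / real (Suc n))" for n
  have r: "0 \<le> r n" "r n < s" "r n \<le> r (Suc n)" for n
  proof -
    show "0 \<le> r n" using s by (simp add: r_def)
    show "r n < s" using s by (simp add: r_def field_simps)
    have "1 / real (Suc (Suc n)) \<le> 1 / real (Suc n)" by (intro divide_left_mono) auto
    then show "r n \<le> r (Suc n)" using s unfolding r_def by (intro mult_left_mono) auto
  qed
  have rlim: "r \<longlonglongrightarrow> s"
  proof -
    have "(\<lambda>n. s * (1 - 1 / real (Suc n))) \<longlonglongrightarrow> s * (1 - 0)"
      using LIMSEQ_inverse_real_of_nat by (intro tendsto_intros) (simp add: inverse_eq_divide)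
    then show ?thesis by (simp add: r_def[abs_def])
  qed
  have rmono: "incseq r" using r by (intro incseq_SucI)
  show ?thesis
  proof (rule antisym)
    show "\<eta>l s \<le> ennreal (c * s) + (\<integral>\<^sup>+p. \<zeta> (snd p) * indicator {..<s} (fst p) \<partial>count_space A)"
      unfolding eta_left_def eta_eq using c_nonneg
      by (intro SUP_least add_mono ennreal_leI mult_left_mono nn_integral_mono) (auto simp: indicator_def)
    have "(\<lambda>n. \<eta> (r n)) \<longlonglongrightarrow> ennreal (c * s) + (\<integral>\<^sup>+p. \<zeta> (snd p) * indicator {..<s} (fst p) \<partial>count_space A)"
      unfolding eta_eq
    proof (intro tendsto_add tendsto_ennrealI tendsto_mult tendsto_const rlim nn_integral_LIMSEQ)
      show "incseq (\<lambda>n p. \<zeta> (snd p) * indicator {..r n} (fst p))"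
        using r(3) by (intro incseq_SucI le_funI mult_left_mono) (auto simp: indicator_def intro: order_trans)
      show "(\<lambda>n. \<zeta> (snd p) * indicator {..r n} (fst p)) \<longlonglongrightarrow> \<zeta> (snd p) * indicator {..<s} (fst p)" for p :: "real \<times> (real \<Rightarrow> 's)"
      proof (rule tendsto_eventually)
        show "\<forall>\<^sub>F n in sequentially. \<zeta> (snd p) * indicator {..r n} (fst p) = \<zeta> (snd p) * indicator {..<s} (fst p)"
        proof (cases "fst p < s")
          case True
          then have "\<forall>\<^sub>F n in sequentially. fst p < r n" using order_tendstoD(1)[OF rlim] by blast
          then show ?thesis by eventually_elim (use True in simp)
        next
          case False
          then show ?thesis using r(2) by (intro always_eventually) (auto simp: indicator_def dest: le_less_trans)
        qed
      qed
    qed auto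
    then show "ennreal (c * s) + (\<integral>\<^sup>+p. \<zeta> (snd p) * indicator {..<s} (fst p) \<partial>count_space A) \<le> \<eta>l s"
      by (rule LIMSEQ_le_const2) (use r in \<open>auto simp: eta_left_def intro!: SUP_upper exI[of _ 0]\<close>)
  qed
qed

lemma eta_mono: "s \<le> s' \<Longrightarrow> \<eta> s \<le> \<eta> s'"
  unfolding eta_eq using c_nonneg
  by (intro add_mono ennreal_leI mult_left_mono nn_integral_mono) (auto simp: indicator_def)

lemma eta_le_eta_left: "0 \<le> r \<Longrightarrow> r < s \<Longrightarrow> \<eta> r \<le> \<eta>l s"
  unfolding eta_left_def by (intro SUP_upper) auto

lemma eta_left_mono: "s \<le> s' \<Longrightarrow> \<eta>l s \<le> \<eta>l s'"
  unfolding eta_left_def by (intro SUP_subset_mono) auto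

lemma eta_left_le_eta: "\<eta>l s \<le> \<eta> s"
  unfolding eta_left_def by (intro SUP_least eta_mono) auto

lemma eta_split:
  assumes "0 \<le> s"
  shows "\<eta> s = \<eta>l s + (\<integral>\<^sup>+p. \<zeta> (snd p) * indicator {s} (fst p) \<partial>count_space A)"
proof -
  have "(\<integral>\<^sup>+p. \<zeta> (snd p) * indicator {..s} (fst p) \<partial>count_space A)
      = (\<integral>\<^sup>+p. \<zeta> (snd p) * indicator {..<s} (fst p) + \<zeta> (snd p) * indicator {s} (fst p) \<partial>count_space A)"
    by (intro nn_integral_cong) (auto simp: indicator_def)
  then show ?thesis unfolding eta_eq eta_left_eq[OF assms] by (simp add: nn_integral_add add.assoc)
qed

lemma eta_jump:
  assumes "(s, e) \<in> A" shows "\<eta> s = \<eta>l s + \<zeta> e"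
proof -
  have "(\<integral>\<^sup>+p. \<zeta> (snd p) * indicator {s} (fst p) \<partial>count_space A)
      = (\<integral>\<^sup>+p. \<zeta> e * indicator {(s, e)} p \<partial>count_space A)"
    using atom_unique(1)[OF assms] by (intro nn_integral_cong) (auto simp: indicator_def)
  also have "\<dots> = \<zeta> e"
    using assms by (subst nn_integral_cmult_indicator) (auto simp: emeasure_count_space)
  finally show ?thesis using eta_split[of s] atomsD[OF assms] by simp
qed

lemma eta_no_jump:
  assumes "0 \<le> s" "\<And>e. (s, e) \<notin> A" shows "\<eta> s = \<eta>l s"
proof -
  have "(\<integral>\<^sup>+p. \<zeta> (snd p) * indicator {s} (fst p) \<partial>count_space A) = (\<integral>\<^sup>+p. 0 \<partial>count_space A)"
    using assms(2) by (intro nn_integral_cong) (auto simp: indicator_def)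
  then show ?thesis using eta_split[OF assms(1)] by simp
qed

section \<open>Duality between the local time and its inverse\<close>

lemma eta_less_iff:
  assumes t: "0 \<le> t" and r: "0 \<le> r"
  shows "r < l t \<Longrightarrow> \<eta> r \<le> ennreal t" and "l t < r \<Longrightarrow> ennreal t < \<eta> r"
proof -
  assume "r < l t"
  show "\<eta> r \<le> ennreal t"
  proof (rule ccontr)
    assume "\<not> ?thesis"
    then have "ennreal (l t) \<le> ennreal r"
      unfolding l_inverse[OF t] using r by (intro Inf_lower) auto
    then show False using \<open>r < l t\<close> r by (simp add: ennreal_le_iff)
  qed
next
  assume "l t < r"
  then have "ennreal (l t) < ennreal r" using l_nonneg[OF t] by (simp add: ennreal_less_iff)
  then obtain s where s: "0 \<le> s" "ennreal t < \<eta> s" "ennreal s < ennreal r"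
    unfolding l_inverse[OF t] Inf_less_iff by auto
  then have "s < r" by (simp add: ennreal_less_iff)
  then show "ennreal t < \<eta> r" using s(2) eta_mono[of s r] by simp
qed

lemma eta_left_l_le:
  assumes "0 \<le> t" shows "\<eta>l (l t) \<le> ennreal t"
  unfolding eta_left_def using eta_less_iff(1)[OF assms] by (intro SUP_least) auto

lemma le_eta_l:
  assumes t: "0 \<le> t" shows "ennreal t \<le> \<eta> (l t)"
proof (rule tendsto_lowerbound[OF eta_rc[OF l_nonneg[OF t]]])
  show "\<forall>\<^sub>F r in at_right (l t). ennreal t \<le> \<eta> r"
    using eventually_at_right_less[of "l t"]
    by eventually_elim (use eta_less_iff(2)[OF t] l_nonneg[OF t] in \<open>force intro: less_imp_le\<close>)
qed simp

lemma l_eqI: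
  assumes t: "0 \<le> t" and s: "0 \<le> s" and le: "\<eta>l s \<le> ennreal t" and less: "\<And>r. s < r \<Longrightarrow> ennreal t < \<eta> r"
  shows "l t = s"
proof (rule antisym)
  show "l t \<le> s"
  proof (rule ccontr)
    assume "\<not> ?thesis"
    then obtain r where "s < r" "r < l t" using dense[of s "l t"] by auto
    then show False using less[of r] eta_less_iff(1)[OF t, of r] s by simp
  qed
  show "s \<le> l t"
  proof (rule ccontr)
    assume "\<not> ?thesis"
    then obtain r where r: "l t < r" "r < s" using dense[of "l t" s] by auto
    then have "0 \<le> r" using l_nonneg[OF t] by simp
    then have "ennreal t < \<eta> r" "\<eta> r \<le> \<eta>l s" using r eta_less_iff(2)[OF t, of r] eta_le_eta_left[of r s] by auto
    then show False using le by simp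
  qed
qed

lemma l_eq_in_jump:
  assumes "0 \<le> t" "0 \<le> s" "\<eta>l s \<le> ennreal t" "ennreal t < \<eta> s"
  shows "l t = s"
  using assms eta_mono[of s] by (intro l_eqI) (auto intro: less_le_trans)

text \<open>Right continuity of \<open>\<eta>\<close> carries finiteness at s a little beyond s,
  which makes the inequality strict.\<close>

lemma less_L_infI:
  assumes "0 \<le> s" "\<eta> s < \<infinity>" shows "ennreal s < L_inf x\<^sub>o c \<mu>"
proof -
  have "\<forall>\<^sub>F r in at_right s. \<eta> r < \<infinity>" using eta_rc[OF assms(1)] assms(2) by (rule order_tendstoD(2))
  then obtain b where b: "s < b" "\<And>r. s < r \<Longrightarrow> r < b \<Longrightarrow> \<eta> r < \<infinity>"
    unfolding eventually_at_right_field by blast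
  let ?r = "(s + b) / 2"
  have r: "s < ?r" "?r < b" using b by auto
  have "ennreal ?r \<le> L_inf x\<^sub>o c \<mu>"
    unfolding L_inf_def
  proof (rule Inf_greatest, clarify)
    fix u assume u: "0 \<le> u" "\<eta> u = \<infinity>"
    have "?r \<le> u" using b(2)[OF r] eta_mono[of u ?r] u(2) by (cases "u \<le> ?r") auto
    then show "ennreal ?r \<le> ennreal u" by (rule ennreal_leI)
  qed
  moreover have "ennreal s < ennreal ?r" using r assms by (simp add: ennreal_less_iff)
  ultimately show ?thesis by simp
qed

lemma eta_finite_below_L_inf:
  assumes "0 \<le> s" "ennreal s < L_inf x\<^sub>o c \<mu>" shows "\<eta> s < \<infinity>"
proof (rule ccontr)
  assume "\<not> ?thesis"
  then have "L_inf x\<^sub>o c \<mu> \<le> ennreal s" unfolding L_inf_def using assms by (intro Inf_lower) (auto simp: less_top[symmetric])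
  then show False using assms by simp
qed

lemma le_L_infI:
  assumes "0 \<le> s" "\<eta>l s < \<infinity>" shows "ennreal s \<le> L_inf x\<^sub>o c \<mu>"
  unfolding L_inf_def
proof (rule Inf_greatest, clarify)
  fix u assume u: "0 \<le> u" "\<eta> u = \<infinity>"
  have "s \<le> u"
  proof (rule ccontr)
    assume "\<not> s \<le> u"
    then have "\<eta> u \<le> \<eta>l s" using u by (intro eta_le_eta_left) auto
    then show False using u assms by simp
  qed
  then show "ennreal s \<le> ennreal u" by (rule ennreal_leI)
qed

text \<open>\<open>eta_strict\<close> speaks only of arguments below \<open>L_inf\<close>; where
  \<open>\<eta>\<close> is infinite the inequality is trivial.\<close>

lemma eta_less:
  assumes "0 \<le> s" "\<eta> s < \<infinity>" "s < r" shows "\<eta> s < \<eta> r"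
proof (cases "\<eta> r < \<infinity>")
  case True
  then show ?thesis using less_L_infI[of s] less_L_infI[of r] assms
    by (intro strict_mono_onD[OF eta_strict]) auto
qed (use assms in \<open>auto simp: less_top[symmetric]\<close>)

lemma l_eta:
  assumes "0 \<le> s" "0 \<le> t" "\<eta> s = ennreal t" shows "l t = s"
  using assms eta_less[of s] eta_left_le_eta[of s] by (intro l_eqI) auto

text \<open>Points of right increase of the local time are limits from the right of zeros.\<close>

lemma zero_at_eta:
  assumes s: "0 \<le> s" and t: "0 \<le> t" "\<eta> s = ennreal t"
  shows "x t = x\<^sub>o"
proof (rule ccontr)
  assume "x t \<noteq> x\<^sub>o"
  have "(x \<longlongrightarrow> x t) (at_right t)" using x_cadlag t by (simp add: cadlag_def)
  then have "\<forall>\<^sub>F u in at_right t. x u \<noteq> x\<^sub>o" using \<open>x t \<noteq> x\<^sub>o\<close> by (rule tendsto_imp_eventually_ne)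
  then obtain b where b: "t < b" "\<And>u. t < u \<Longrightarrow> u < b \<Longrightarrow> x u \<noteq> x\<^sub>o"
    unfolding eventually_at_right_field by blast
  have "\<forall>\<^sub>F r in at_right s. \<eta> r < ennreal b"
    using eta_rc[OF s] b t by (intro order_tendstoD(2)) (auto simp: ennreal_less_iff)
  then obtain r0 where r0: "s < r0" "\<And>r. s < r \<Longrightarrow> r < r0 \<Longrightarrow> \<eta> r < ennreal b"
    unfolding eventually_at_right_field by blast
  \<comment> \<open>A later local time whose inverse t' still lies before b. From t to t' the local
    time grows from s to r, while the path has no zeros in (t,b): a contradiction to the support of
    dL.\<close>
  define r where "r = (s + r0) / 2"
  have r: "s < r" "r < r0" "0 \<le> r" using r0 s by (auto simp: r_def)
  obtain t' where t': "0 \<le> t'" "\<eta> r = ennreal t'" "t' < b"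
    using r0(2)[OF r(1,2)] by (cases "\<eta> r") (auto simp: ennreal_less_iff)
  have tt': "t < t'" using eta_less[of s r] s t r t' by (simp add: ennreal_less_iff)
  have l: "l t = s" "l t' = r" using l_eta s t r t' by auto
  let ?M = "interval_measure (\<lambda>t. l (max 0 t))"
  have "emeasure ?M {t<..t'} = ennreal (l (max 0 t') - l (max 0 t))"
  proof (rule emeasure_interval_measure_Ioc)
    show "l (max 0 u) \<le> l (max 0 v)" if "u \<le> v" for u v
      using that by (intro mono_onD[OF l_mono]) auto
    have "continuous_on UNIV (\<lambda>u. l (max 0 u))"
      by (intro continuous_on_compose2[OF l_continuous] continuous_intros) auto
    then show "continuous (at_right u) (\<lambda>u. l (max 0 u))" for u
      by (auto simp: continuous_on_eq_continuous_within intro: continuous_within_subset)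
  qed (use tt' in simp)
  then have "0 < emeasure ?M {t<..t'}" using l t t' r by simp
  moreover have "{t<..t'} \<subseteq> - closure (zero_set x\<^sub>o x)"
  proof
    fix u assume u: "u \<in> {t<..t'}"
    have "{t<..<b} \<inter> zero_set x\<^sub>o x = {}" unfolding zero_set_def using b(2) by fastforce
    then have "{t<..<b} \<inter> closure (zero_set x\<^sub>o x) = {}" by (subst open_Int_closure_eq_empty) auto
    moreover have "u \<in> {t<..<b}" using u t' by auto
    ultimately show "u \<in> - closure (zero_set x\<^sub>o x)" by blast
  qed
  then have "emeasure ?M {t<..t'} \<le> emeasure ?M (- closure (zero_set x\<^sub>o x))"
    by (intro emeasure_mono) auto
  ultimately show False using dl_support by simp
qed

section \<open>Excursion intervals and stretches without zeros\<close>

abbreviation "nohit \<equiv> avoids x\<^sub>o x"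

text \<open>If the jump of \<open>\<eta>\<close> at local time \<open>l a\<close> ended by time b,
  its end point would be a zero in [a,b] by \<open>zero_at_eta\<close>. So [a,b] lies within the
  jump, and jumps occur only at atoms.\<close>

lemma nohit_imp_excursion:
  assumes a: "0 \<le> a" "a \<le> b" and nohit: "nohit a b"
  shows "\<exists>e. (l a, e) \<in> A" "\<eta>l (l a) \<le> ennreal a" "ennreal b < \<eta> (l a)"
proof -
  let ?s = "l a"
  have s: "0 \<le> ?s" using l_nonneg a by simp
  show left: "\<eta>l ?s \<le> ennreal a" using eta_left_l_le a by simp
  show right: "ennreal b < \<eta> ?s"
  proof (rule ccontr)
    assume "\<not> ?thesis"
    then have le: "\<eta> ?s \<le> ennreal b" by simp
    then have "\<eta> ?s < \<infinity>" by (simp add: le_less_trans)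
    then obtain t where t: "0 \<le> t" "\<eta> ?s = ennreal t" by (cases "\<eta> ?s") auto
    then have "t \<le> b" using le a by (simp add: ennreal_le_iff)
    moreover have "a \<le> t" using le_eta_l[OF a(1)] t by (simp add: ennreal_le_iff)
    ultimately show False using zero_at_eta[OF s t] nohit by (auto simp: avoids_def)
  qed
  have "\<eta>l ?s < \<eta> ?s" using left right a(2) by (metis ennreal_leI le_less_trans)
  then show "\<exists>e. (?s, e) \<in> A" using eta_no_jump[OF s] by fastforce
qed

lemma excursion_x:
  assumes A: "(s, e) \<in> A" and t: "0 \<le> t" "\<eta>l s \<le> ennreal t" "ennreal t < \<eta> s"
  shows "x t = e (t - enn2real (\<eta>l s))"
proof -
  have "\<eta>l s < \<infinity>" using t(2) by (simp add: le_less_trans)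
  then show ?thesis using atomsD[OF A] t by (intro x_excursion[OF A] le_L_infI) auto
qed

text \<open>The left end of the excursion interval is excluded, because an excursion path may start
  at \<open>x\<^sub>o\<close>.\<close>

lemma excursion_imp_nohit:
  assumes A: "(s, e) \<in> A" and ab: "\<eta>l s < ennreal a" "ennreal b < \<eta> s"
  shows "nohit a b"
  unfolding avoids_def
proof
  fix u assume u: "u \<in> {a..b}"
  obtain g where g: "0 \<le> g" "\<eta>l s = ennreal g" using ab by (cases "\<eta>l s") auto
  have "g < a" using ab g by (simp add: ennreal_less_iff)
  then have gu: "g < u" using u by simp
  have us: "ennreal u < \<eta> s" using u ab(2) by (auto intro: le_less_trans ennreal_leI)
  have "x u = e (u - g)"
    using excursion_x[OF A, of u] g gu us by (simp add: ennreal_leI)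
  moreover have "ennreal (u - g) < \<zeta> e"
  proof (rule ccontr)
    assume "\<not> ?thesis"
    then have "\<eta> s \<le> ennreal g + ennreal (u - g)" using eta_jump[OF A] g by (simp add: add_left_mono)
    also have "\<dots> = ennreal u" using g gu by (simp add: ennreal_plus[symmetric] del: ennreal_plus)
    finally show False using us by simp
  qed
  ultimately show "x u \<noteq> x\<^sub>o" using gu zeta_neq[of "u - g" x\<^sub>o e] by simp
qed

end

text \<open>
  The excursions of a path \<open>x\<close> away from \<open>x\<^sub>o\<close>, read off from the events \<open>avoids x\<^sub>o x a b\<close> for
  rational \<open>a\<close>, \<open>b\<close> only. \<open>exc_new x\<^sub>o x n\<close> selects one rational time for every excursion.
\<close>

definition in_exc :: "'s \<Rightarrow> (real \<Rightarrow> 's) \<Rightarrow> real \<Rightarrow> bool" where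
  "in_exc x\<^sub>o x t \<longleftrightarrow> (\<exists>a\<in>\<rat>. 0 < a \<and> a < t \<and> avoids x\<^sub>o x a t)"

definition exc_begin :: "'s \<Rightarrow> (real \<Rightarrow> 's) \<Rightarrow> real \<Rightarrow> real" where
  "exc_begin x\<^sub>o x t = Inf {a\<in>\<rat>. 0 < a \<and> a < t \<and> avoids x\<^sub>o x a t}"

definition exc_end :: "'s \<Rightarrow> (real \<Rightarrow> 's) \<Rightarrow> real \<Rightarrow> ennreal" where
  "exc_end x\<^sub>o x t = (SUP b\<in>{b\<in>\<rat>. t \<le> b \<and> avoids x\<^sub>o x t b}. ennreal b)"

definition exc_from :: "'s \<Rightarrow> (real \<Rightarrow> 's) \<Rightarrow> real \<Rightarrow> real \<Rightarrow> 's" where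
  "exc_from x\<^sub>o x t = (\<lambda>u\<in>{0..}. if ennreal (exc_begin x\<^sub>o x t + u) < exc_end x\<^sub>o x t then x (exc_begin x\<^sub>o x t + u) else x\<^sub>o)"

definition pos_rat :: "nat \<Rightarrow> real" where
  "pos_rat = from_nat_into {r\<in>\<rat>. 0 < r}"

lemma range_pos_rat: "range pos_rat = {r\<in>\<rat>. 0 < r}"
proof -
  have "(1::real) \<in> {r\<in>\<rat>. 0 < r}" by simp
  then show ?thesis unfolding pos_rat_def
    by (intro range_from_nat_into countable_subset[OF _ countable_rat]) auto
qed

lemma pos_rat_pos: "0 < pos_rat n"
  using range_pos_rat by (auto simp: set_eq_iff)

definition exc_new :: "'s \<Rightarrow> (real \<Rightarrow> 's) \<Rightarrow> nat \<Rightarrow> bool" where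
  "exc_new x\<^sub>o x n \<longleftrightarrow> in_exc x\<^sub>o x (pos_rat n) \<and>
     (\<forall>m<n. in_exc x\<^sub>o x (pos_rat m) \<longrightarrow> \<not> avoids x\<^sub>o x (min (pos_rat m) (pos_rat n)) (max (pos_rat m) (pos_rat n)))"

section \<open>Reading the excursions off rational times\<close>

context excursion_path
begin

text \<open>The bridge from \<open>X\<close> to \<open>N\<close>: what the events
  \<open>avoids\<close> determine around t are the interval and the path of the one atom whose
  excursion straddles t.\<close>

lemma in_excD:
  assumes t: "in_exc x\<^sub>o x t"
  obtains e where "(l t, e) \<in> A" "\<eta>l (l t) < ennreal t" "ennreal t < \<eta> (l t)"
    "\<eta>l (l t) = ennreal (exc_begin x\<^sub>o x t)" "0 \<le> exc_begin x\<^sub>o x t" "exc_end x\<^sub>o x t = \<eta> (l t)"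
    "exc_from x\<^sub>o x t = e" "\<zeta> e = exc_end x\<^sub>o x t - ennreal (exc_begin x\<^sub>o x t)"
proof -
  obtain a where a: "a \<in> \<rat>" "0 < a" "a < t" "nohit a t" using t by (auto simp: in_exc_def)
  have t0: "0 < t" using a by simp
  obtain e where e: "(l a, e) \<in> A" and le: "\<eta>l (l a) \<le> ennreal a" and less: "ennreal t < \<eta> (l a)"
    using nohit_imp_excursion[of a t] a by auto
  have lt: "l t = l a"
    using le less a by (intro l_eq_in_jump l_nonneg) (auto intro: order_trans[OF _ ennreal_leI])
  have eA: "(l t, e) \<in> A" using e lt by simp
  have lessl: "\<eta>l (l t) < ennreal t" using le lt a by (auto intro: le_less_trans simp: ennreal_less_iff)
  have lesst: "ennreal t < \<eta> (l t)" using less lt by simp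
  obtain g where g: "0 \<le> g" "\<eta>l (l t) = ennreal g" using lessl by (cases "\<eta>l (l t)") auto
  have gt: "g < t" using lessl g by (simp add: ennreal_less_iff)
  have beg: "exc_begin x\<^sub>o x t = g"
    unfolding exc_begin_def
  proof (rule cInf_eq)
    fix a' assume "a' \<in> {a\<in>\<rat>. 0 < a \<and> a < t \<and> nohit a t}"
    then have a': "0 < a'" "a' < t" "nohit a' t" by auto
    have "l t = l a'"
      using nohit_imp_excursion[of a' t] a' by (intro l_eq_in_jump l_nonneg) (auto intro: order_trans[OF _ ennreal_leI])
    then have "ennreal g \<le> ennreal a'" using nohit_imp_excursion(2)[of a' t] a' g by simp
    then show "g \<le> a'" using a' by simp
  next
    fix y assume y: "\<And>a. a \<in> {a\<in>\<rat>. 0 < a \<and> a < t \<and> nohit a t} \<Longrightarrow> y \<le> a"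
    show "y \<le> g"
    proof (rule ccontr)
      assume "\<not> y \<le> g"
      then have "g < min y t" using gt by simp
      then obtain a' where a': "a' \<in> \<rat>" "g < a'" "a' < min y t" using Rats_dense_in_real by blast
      have "nohit a' t"
        using a' g lesst by (intro excursion_imp_nohit[OF eA]) (auto simp: ennreal_less_iff)
      then show False using y[of a'] a' g by auto
    qed
  qed
  have en: "exc_end x\<^sub>o x t = \<eta> (l t)"
    unfolding exc_end_def
  proof (rule antisym)
    show "(SUP b\<in>{b\<in>\<rat>. t \<le> b \<and> nohit t b}. ennreal b) \<le> \<eta> (l t)"
      using nohit_imp_excursion(3)[of t] t0 by (intro SUP_least) (auto intro: less_imp_le)
    show "\<eta> (l t) \<le> (SUP b\<in>{b\<in>\<rat>. t \<le> b \<and> nohit t b}. ennreal b)"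
    proof (rule dense_le)
      fix y assume y: "y < \<eta> (l t)"
      \<comment> \<open>Two intermediate values v < w below the end of the excursion leave room for
        a rational b between them, and [t,b] is still free of zeros.\<close>
      obtain w where w: "max y (ennreal t) < w" "w < \<eta> (l t)" using dense[of "max y (ennreal t)" "\<eta> (l t)"] y lesst by auto
      then obtain r where r: "0 \<le> r" "w = ennreal r" by (cases w) auto
      obtain v where v: "max y (ennreal t) < v" "v < w" using dense w(1) by blast
      then obtain r' where r': "0 \<le> r'" "v = ennreal r'" using r by (cases v) auto
      have "r' < r" using v r r' by (simp add: ennreal_less_iff)
      then obtain b where b: "b \<in> \<rat>" "r' < b" "b < r" using Rats_dense_in_real by blast
      have "ennreal t < ennreal r'" using v r' by simp
      then have "t < r'" using t0 by (simp add: ennreal_less_iff)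
      moreover have "ennreal b < ennreal r" using b r' by (simp add: ennreal_less_iff)
      then have "ennreal b < \<eta> (l t)" using r w by simp
      ultimately have "nohit t b" by (intro excursion_imp_nohit[OF eA] lessl)
      then have upper: "ennreal b \<le> (SUP b\<in>{b\<in>\<rat>. t \<le> b \<and> nohit t b}. ennreal b)"
        using b \<open>t < r'\<close> by (intro SUP_upper) auto
      have "ennreal r' \<le> ennreal b" using b by (intro ennreal_leI) simp
      moreover have "y < ennreal r'" using v r' by simp
      ultimately have "y \<le> ennreal b" by (meson less_imp_le less_le_trans)
      then show "y \<le> (SUP b\<in>{b\<in>\<rat>. t \<le> b \<and> nohit t b}. ennreal b)" using upper by (rule order_trans)
    qed
  qed
  have e_exc: "e \<in> exc_paths x\<^sub>o" using atomsD[OF eA] by simp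
  have jump: "\<eta> (l t) = ennreal g + \<zeta> e" using eta_jump[OF eA] g by simp
  have "exc_from x\<^sub>o x t = e"
  proof
    fix u
    show "exc_from x\<^sub>o x t u = e u"
    \<comment> \<open>Paths are extensional, so the two functions have to agree at negative
      arguments too.\<close>
    proof (cases "0 \<le> u")
      case False
      then have "e u = undefined"
        using e_exc by (auto simp: exc_paths_def path_space_def space_restrict_space space_PiM PiE_def extensional_def)
      then show ?thesis using False by (simp add: exc_from_def)
    next
      case u: True
      show ?thesis
      proof (cases "ennreal (g + u) < \<eta> (l t)")
        case True
        have "x (g + u) = e (g + u - enn2real (\<eta>l (l t)))"
          using True g u by (intro excursion_x[OF eA]) (auto intro: ennreal_leI)
        then show ?thesis using True u g by (simp add: exc_from_def beg en)
      next
        case False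
        have "\<zeta> e \<le> ennreal u"
          using False jump g u by (simp add: not_less ennreal_plus)
        then have "e u = x\<^sub>o" using e_exc u by (simp add: exc_paths_def)
        then show ?thesis using False u by (simp add: exc_from_def beg en)
      qed
    qed
  qed
  moreover have "\<zeta> e = exc_end x\<^sub>o x t - ennreal (exc_begin x\<^sub>o x t)"
    unfolding en beg jump by simp
  ultimately show ?thesis using that eA lessl lesst g beg en by simp
qed

lemma in_excI:
  assumes A: "(s, e) \<in> A" and t: "\<eta>l s < ennreal t" "ennreal t < \<eta> s"
  shows "in_exc x\<^sub>o x t" "l t = s"
proof -
  obtain g where g: "0 \<le> g" "\<eta>l s = ennreal g" using t by (cases "\<eta>l s") auto
  have "g < t" using t g by (simp add: ennreal_less_iff)
  then obtain a where a: "a \<in> \<rat>" "g < a" "a < t" using Rats_dense_in_real by blast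
  have "nohit a t" using a g t by (intro excursion_imp_nohit[OF A]) (auto simp: ennreal_less_iff)
  then show "in_exc x\<^sub>o x t" using a g by (auto simp: in_exc_def intro!: bexI[of _ a])
  show "l t = s" using t atomsD[OF A] g \<open>g < t\<close> by (intro l_eq_in_jump) auto
qed

lemma same_excursion_iff:
  assumes "in_exc x\<^sub>o x t" "in_exc x\<^sub>o x t'"
  shows "nohit (min t t') (max t t') \<longleftrightarrow> l t = l t'"
proof -
  have *: "nohit t t' \<longleftrightarrow> l t = l t'" if t: "in_exc x\<^sub>o x t" "in_exc x\<^sub>o x t'" and le: "t \<le> t'" for t t'
  proof
    have t0: "0 < t" using t by (auto simp: in_exc_def)
    assume "nohit t t'"
    then have "\<eta>l (l t) \<le> ennreal t" "ennreal t' < \<eta> (l t)" using nohit_imp_excursion[of t t'] t0 le by auto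
    then have "l t' = l t" using t0 le by (intro l_eq_in_jump l_nonneg) (auto intro: order_trans[OF _ ennreal_leI])
    then show "l t = l t'" ..
  next
    assume eq: "l t = l t'"
    obtain e where "(l t, e) \<in> A" "\<eta>l (l t) < ennreal t" using in_excD[OF t(1)] by metis
    moreover have "ennreal t' < \<eta> (l t)" using in_excD[OF t(2)] eq by metis
    ultimately show "nohit t t'" by (rule excursion_imp_nohit)
  qed
  show ?thesis using *[of t t'] *[of t' t] assms by (cases "t \<le> t'") (auto simp: min_def max_def)
qed

abbreviation "tq \<equiv> pos_rat"

text \<open>An atom that the path reaches, that is one with finite \<open>\<eta>l\<close>, occupies
  an open interval of positive length. Of the enumerated rationals inside it, the one with least
  index is its representative.\<close>

lemma bij_betw_new:
  "bij_betw (\<lambda>n. (l (tq n), exc_from x\<^sub>o x (tq n))) {n. exc_new x\<^sub>o x n} {p\<in>A. \<eta>l (fst p) < \<infinity>}"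
proof (rule bij_betwI')
  have in_exc: "in_exc x\<^sub>o x (tq n)" if "exc_new x\<^sub>o x n" for n using that by (simp add: exc_new_def)
  fix n m assume nm: "n \<in> {n. exc_new x\<^sub>o x n}" "m \<in> {n. exc_new x\<^sub>o x n}"
  have "l (tq n) \<noteq> l (tq m)" if "n < m" "exc_new x\<^sub>o x n" "exc_new x\<^sub>o x m" for n m
    using that same_excursion_iff[OF in_exc in_exc, of n m] by (auto simp: exc_new_def)
  then show "((l (tq n), exc_from x\<^sub>o x (tq n)) = (l (tq m), exc_from x\<^sub>o x (tq m))) = (n = m)"
    using nm by (metis (no_types, lifting) mem_Collect_eq nat_neq_iff prod.inject)
next
  fix n assume "n \<in> {n. exc_new x\<^sub>o x n}"
  then have "in_exc x\<^sub>o x (tq n)" by (simp add: exc_new_def)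
  then show "(l (tq n), exc_from x\<^sub>o x (tq n)) \<in> {p\<in>A. \<eta>l (fst p) < \<infinity>}"
    by (rule in_excD) auto
next
  fix p assume p: "p \<in> {p\<in>A. \<eta>l (fst p) < \<infinity>}"
  obtain s e where se: "p = (s, e)" by (cases p)
  then have A: "(s, e) \<in> A" and fin: "\<eta>l s < \<infinity>" using p by auto
  obtain g where g: "0 \<le> g" "\<eta>l s = ennreal g" using fin by (cases "\<eta>l s") auto
  have less: "ennreal g < \<eta> s"
    using eta_jump[OF A] g zeta_pos[of e] atomsD[OF A] by (metis add.right_neutral ennreal_add_left_cancel_less ennreal_neq_top infinity_ennreal_def)
  obtain w where w: "ennreal g < w" "w < \<eta> s" using dense[OF less] by blast
  then obtain r where r: "0 \<le> r" "w = ennreal r" by (cases w) auto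
  have "g < r" using w r g by (simp add: ennreal_less_iff)
  then obtain b where b: "b \<in> \<rat>" "g < b" "b < r" using Rats_dense_in_real by blast
  define S where "S = {n. \<eta>l s < ennreal (tq n) \<and> ennreal (tq n) < \<eta> s}"
  have "b \<in> range pos_rat" using b g by (simp add: range_pos_rat)
  then obtain n0 where "b = tq n0" by blast
  moreover have "ennreal b < ennreal r" using b g by (simp add: ennreal_less_iff)
  then have "ennreal b < \<eta> s" using r w by simp
  ultimately have "n0 \<in> S" using b g by (auto simp: S_def ennreal_less_iff)
  define n where "n = (LEAST n. n \<in> S)"
  have n: "n \<in> S" unfolding n_def using \<open>n0 \<in> S\<close> by (rule LeastI)
  have min: "m \<notin> S" if "m < n" for m using that unfolding n_def by (rule not_less_Least)
  have in_n: "in_exc x\<^sub>o x (tq n)" "l (tq n) = s" using in_excI[OF A] n by (auto simp: S_def)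
  have "exc_new x\<^sub>o x n"
    unfolding exc_new_def
  proof (intro conjI allI impI in_n(1) notI)
    fix m assume m: "m < n" "in_exc x\<^sub>o x (tq m)" "nohit (min (tq m) (tq n)) (max (tq m) (tq n))"
    then have "l (tq m) = s" using same_excursion_iff[OF m(2) in_n(1)] in_n(2) by simp
    obtain e where "\<eta>l (l (tq m)) < ennreal (tq m)" "ennreal (tq m) < \<eta> (l (tq m))"
      using m(2) by (rule in_excD)
    then have "m \<in> S" using \<open>l (tq m) = s\<close> by (simp add: S_def)
    then show False using min m by simp
  qed
  moreover have "exc_from x\<^sub>o x (tq n) = e"
  proof -
    obtain e' where "(l (tq n), e') \<in> A" "exc_from x\<^sub>o x (tq n) = e'" using in_excD[OF in_n(1)] by metis
    then show ?thesis using atom_unique(1)[OF A, of e'] in_n(2) by simp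
  qed
  ultimately show "\<exists>n\<in>{n. exc_new x\<^sub>o x n}. p = (l (tq n), exc_from x\<^sub>o x (tq n))"
    using in_n(2) se by (intro bexI[of _ n]) auto
qed

text \<open>Sums over the random set of atoms turn into series over a fixed index set whose terms
  can be expressed by \<open>X\<close> and \<open>L\<close>. Atoms with infinite
  \<open>\<eta>l\<close> leave no trace in the path, so they must not contribute.\<close>

lemma sum_new:
  fixes \<phi> :: "real \<times> (real \<Rightarrow> 's) \<Rightarrow> ennreal"
  assumes "\<And>p. p \<in> A \<Longrightarrow> \<eta>l (fst p) = \<infinity> \<Longrightarrow> \<phi> p = 0"
  shows "(\<integral>\<^sup>+p. \<phi> p \<partial>count_space A) = (\<Sum>n. if exc_new x\<^sub>o x n then \<phi> (l (tq n), exc_from x\<^sub>o x (tq n)) else 0)"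
proof -
  have "(\<integral>\<^sup>+p. \<phi> p \<partial>count_space A) = (\<integral>\<^sup>+p. \<phi> p \<partial>count_space {p\<in>A. \<eta>l (fst p) < \<infinity>})"
    using assms by (intro nn_integral_count_space_eq) (auto simp: less_top[symmetric])
  also have "\<dots> = (\<integral>\<^sup>+n. \<phi> (l (tq n), exc_from x\<^sub>o x (tq n)) \<partial>count_space {n. exc_new x\<^sub>o x n})"
    by (rule nn_integral_bij_count_space[OF bij_betw_new, symmetric])
  also have "\<dots> = (\<integral>\<^sup>+n. (if exc_new x\<^sub>o x n then \<phi> (l (tq n), exc_from x\<^sub>o x (tq n)) else 0) \<partial>count_space UNIV)"
    by (subst nn_integral_count_space_indicator) (auto intro!: nn_integral_cong)
  finally show ?thesis by (simp add: nn_integral_count_space_nat)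
qed

text \<open>K counts the long excursions begun before t and is observable from the path. It is
  squeezed between two counts of \<open>N\<close>, so a law of large numbers for \<open>N\<close>
  yields \<open>l t\<close> as the limit of normalised values of K.\<close>

lemma long_excursions_before:
  fixes h :: ennreal
  assumes t: "0 \<le> t"
  defines "K \<equiv> (\<Sum>n. if exc_new x\<^sub>o x n \<and> exc_begin x\<^sub>o x (tq n) < t \<and>
      h < exc_end x\<^sub>o x (tq n) - ennreal (exc_begin x\<^sub>o x (tq n)) then 1 else 0 :: ennreal)"
  shows "emeasure \<mu> ({0..<l t} \<times> {e\<in>exc_paths x\<^sub>o. h < \<zeta> e}) \<le> K"
    and "K \<le> emeasure \<mu> ({0..l t} \<times> {e\<in>exc_paths x\<^sub>o. h < \<zeta> e})"
proof -
  define B where "B = {p\<in>A. \<eta>l (fst p) < ennreal t \<and> h < \<zeta> (snd p)}"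
  have "emeasure (count_space A) B = (\<integral>\<^sup>+p. indicator B p \<partial>count_space A)"
    by (rule nn_integral_indicator[symmetric]) (simp add: B_def)
  also have "\<dots> = K"
  proof (subst sum_new)
    show "indicator B p = (0::ennreal)" if "\<eta>l (fst p) = \<infinity>" for p using that by (simp add: B_def)
    show "(\<Sum>n. if exc_new x\<^sub>o x n then indicator B (l (tq n), exc_from x\<^sub>o x (tq n)) else 0) = K"
      unfolding K_def
    proof (intro suminf_cong)
      fix n
      show "(if exc_new x\<^sub>o x n then indicator B (l (tq n), exc_from x\<^sub>o x (tq n)) else 0) =
        (if exc_new x\<^sub>o x n \<and> exc_begin x\<^sub>o x (tq n) < t \<and> h < exc_end x\<^sub>o x (tq n) - ennreal (exc_begin x\<^sub>o x (tq n)) then 1 else 0 :: ennreal)"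
      proof (cases "exc_new x\<^sub>o x n")
        case True
        then have "in_exc x\<^sub>o x (tq n)" by (simp add: exc_new_def)
        then show ?thesis
          by (rule in_excD) (use True in \<open>auto simp: B_def ennreal_less_iff indicator_def\<close>)
      qed simp
    qed
  qed
  finally have K: "K = emeasure (count_space A) B" ..
  have sub1: "A \<inter> ({0..<l t} \<times> {e\<in>exc_paths x\<^sub>o. h < \<zeta> e}) \<subseteq> B"
  proof
    fix p assume p: "p \<in> A \<inter> ({0..<l t} \<times> {e\<in>exc_paths x\<^sub>o. h < \<zeta> e})"
    obtain s e where se: "p = (s, e)" by (cases p)
    have A: "(s, e) \<in> A" and s: "0 \<le> s" "s < l t" and e: "e \<in> exc_paths x\<^sub>o" "h < \<zeta> e" using p se by auto
    have le: "\<eta> s \<le> ennreal t" using eta_less_iff(1)[OF t s(1)] s by simp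
    have "\<eta>l s < \<eta> s"
      unfolding eta_jump[OF A]
      using le zeta_pos[OF e(1)] eta_left_le_eta[of s]
      by (metis add.right_neutral ennreal_add_left_cancel_less ennreal_neq_top infinity_ennreal_def order.trans top.extremum_unique)
    then have "\<eta>l s < ennreal t" using le by (rule less_le_trans)
    then show "p \<in> B" using A e se by (simp add: B_def)
  qed
  have sub2: "B \<subseteq> A \<inter> ({0..l t} \<times> {e\<in>exc_paths x\<^sub>o. h < \<zeta> e})"
  proof
    fix p assume p: "p \<in> B"
    obtain s e where se: "p = (s, e)" by (cases p)
    have A: "(s, e) \<in> A" and g: "\<eta>l s < ennreal t" "h < \<zeta> e" using p se by (auto simp: B_def)
    have "s \<le> l t"
    proof (rule ccontr)
      assume "\<not> s \<le> l t"
      then obtain r where r: "l t < r" "r < s" using dense[of "l t" s] by auto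
      then have "0 \<le> r" using l_nonneg[OF t] by simp
      then have "ennreal t < \<eta>l s" using eta_less_iff(2)[OF t, of r] eta_le_eta_left[of r s] r by auto
      then show False using g by simp
    qed
    then show "p \<in> A \<inter> ({0..l t} \<times> {e\<in>exc_paths x\<^sub>o. h < \<zeta> e})" using A g atomsD[OF A] se by auto
  qed
  have "{0..<l t} \<times> {e\<in>exc_paths x\<^sub>o. h < \<zeta> e} \<in> sets \<mu>" "{0..l t} \<times> {e\<in>exc_paths x\<^sub>o. h < \<zeta> e} \<in> sets \<mu>"
    by (intro times_sets long_sets; auto)+
  then show "emeasure \<mu> ({0..<l t} \<times> {e\<in>exc_paths x\<^sub>o. h < \<zeta> e}) \<le> K"
    and "K \<le> emeasure \<mu> ({0..l t} \<times> {e\<in>exc_paths x\<^sub>o. h < \<zeta> e})"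
    unfolding K using sub1 sub2
    by (auto simp: emeasure_count intro!: emeasure_mono)
qed

end

section \<open>Joint measurability in time, and Stieltjes measures of open intervals\<close>

lemma measurable_right_continuous_process:
  fixes X :: "real \<Rightarrow> 'a \<Rightarrow> 's::{metric_space, second_countable_topology}"
  assumes meas: "\<And>t. 0 \<le> t \<Longrightarrow> X t \<in> borel_measurable M"
    and rc: "\<And>\<omega> t. \<omega> \<in> space M \<Longrightarrow> 0 \<le> t \<Longrightarrow> ((\<lambda>s. X s \<omega>) \<longlongrightarrow> X t \<omega>) (at_right t)"
  shows "(\<lambda>p. X (max 0 (snd p)) (fst p)) \<in> borel_measurable (M \<Otimes>\<^sub>M borel)"
proof -
  define k where "k n t = nat \<lfloor>max 0 t * 2 ^ n\<rfloor>" for n :: nat and t :: real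
  \<comment> \<open>The successor makes the dyadic time strictly greater than t, so that right
    continuity alone gives the limit.\<close>
  define r where "r n t = real (Suc (k n t)) / 2 ^ n" for n t
  have k: "real (k n t) \<le> max 0 t * 2 ^ n" "max 0 t * 2 ^ n < real (k n t) + 1" for n t
    by (simp_all add: k_def)
  have r: "max 0 t < r n t" "r n t \<le> max 0 t + (1/2) ^ n" for n t
  proof -
    show "max 0 t < r n t"
      unfolding r_def by (subst pos_less_divide_eq) (use k(2)[of t n] in simp_all)
    have "real (k n t) / 2 ^ n \<le> max 0 t"
      by (subst pos_divide_le_eq) (use k(1)[of n t] in simp_all)
    then show "r n t \<le> max 0 t + (1/2) ^ n"
      by (simp add: r_def add_divide_distrib power_one_over)
  qed
  show ?thesis
  proof (rule borel_measurable_LIMSEQ_metric)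
    fix n
    have [measurable]: "X (real (Suc i) / 2 ^ n) \<in> borel_measurable M" for i by (intro meas) simp
    have [measurable]: "(\<lambda>p. k n (snd p)) \<in> measurable (M \<Otimes>\<^sub>M borel) (count_space UNIV)"
      unfolding k_def by measurable
    show "(\<lambda>p. X (r n (snd p)) (fst p)) \<in> borel_measurable (M \<Otimes>\<^sub>M borel)"
      unfolding r_def by (rule measurable_compose_countable[where g = "\<lambda>p. k n (snd p)"]) measurable
  next
    fix p :: "'a \<times> real" assume "p \<in> space (M \<Otimes>\<^sub>M borel)"
    then have \<omega>: "fst p \<in> space M" by (auto simp: space_pair_measure)
    let ?t = "max 0 (snd p)"
    have "(\<lambda>n. r n (snd p)) \<longlonglongrightarrow> ?t"
    proof (rule tendsto_sandwich[OF _ _ tendsto_const])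
      show "(\<lambda>n. ?t + (1/2) ^ n) \<longlonglongrightarrow> ?t"
        using tendsto_add[OF tendsto_const[of ?t] LIMSEQ_realpow_zero[of "1/2"]] by simp
    qed (use r in \<open>auto intro!: always_eventually less_imp_le\<close>)
    then have "filterlim (\<lambda>n. r n (snd p)) (at_right ?t) sequentially"
    proof -
      have less: "?t < r n (snd p)" for n by (rule r(1))
      then have "\<forall>\<^sub>F n in sequentially. r n (snd p) \<in> {?t<..} \<and> r n (snd p) \<noteq> ?t"
        by (intro always_eventually allI conjI) (metis greaterThan_iff, metis less_irrefl)
      then show ?thesis
        using \<open>(\<lambda>n. r n (snd p)) \<longlonglongrightarrow> ?t\<close> unfolding filterlim_at by blast
    qed
    from filterlim_compose[OF rc[OF \<omega>] this]
    show "(\<lambda>n. X (r n (snd p)) (fst p)) \<longlonglongrightarrow> X ?t (fst p)" by simp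
  qed
qed

lemma zero_set_borel:
  fixes x :: "real \<Rightarrow> 's::polish_space"
  assumes "cadlag x" shows "zero_set x\<^sub>o x \<inter> {0..t} \<in> sets borel"
proof -
  \<comment> \<open>A deterministic path is a process on a one-point space.\<close>
  have "(\<lambda>p. x (max 0 (snd p))) \<in> borel_measurable (count_space (UNIV :: unit set) \<Otimes>\<^sub>M borel)"
    using assms by (intro measurable_right_continuous_process[where X = "\<lambda>t _. x t"]) (auto simp: cadlag_def)
  from measurable_compose[OF measurable_Pair1'[of "()"] this]
  have [measurable]: "(\<lambda>t. x (max 0 t)) \<in> borel_measurable borel" by simp
  have "zero_set x\<^sub>o x \<inter> {0..t} = {t'. x (max 0 t') = x\<^sub>o} \<inter> {0..t}"
    by (auto simp: zero_set_def)
  also have "\<dots> \<in> sets borel" by (intro sets.Int) measurable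
  finally show ?thesis .
qed

text \<open>The open right end omits a jump of z at a + r. This is the same supremum as in
  \<open>zeta_time_change\<close>, so a transformed lifetime is a mass of dz.\<close>

lemma emeasure_interval_measure_Ioo:
  assumes z: "cadlag z" "mono_on {0..} z" and a: "0 \<le> a"
  shows "emeasure (interval_measure (\<lambda>t. z (max 0 t))) {a<..<a + r} = (SUP u\<in>{u. 0 \<le> u \<and> u < r}. ennreal (z (a + u) - z a))"
proof -
  let ?F = "\<lambda>t. z (max 0 t)"
  let ?M = "interval_measure ?F"
  have Ioc: "emeasure ?M {a<..a + u} = ennreal (z (a + u) - z a)" if "0 \<le> u" for u
    using mono_extend_left[OF z] right_continuous_extend_left[OF z] that a
    by (subst emeasure_interval_measure_Ioc) auto
  show ?thesis
  proof (cases "0 < r")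
    case True
    define u where "u n = r * (1 - 1 / real (Suc n))" for n
    have u: "0 \<le> u n" "u n < r" "u n \<le> u (Suc n)" for n
    proof -
      show "0 \<le> u n" using True by (simp add: u_def)
      show "u n < r" using True by (simp add: u_def field_simps)
      have "1 / real (Suc (Suc n)) \<le> 1 / real (Suc n)" by (intro divide_left_mono) auto
      then show "u n \<le> u (Suc n)" using True unfolding u_def by (intro mult_left_mono) auto
    qed
    have "(\<lambda>n. r * (1 - 1 / real (Suc n))) \<longlonglongrightarrow> r * (1 - 0)"
      using LIMSEQ_inverse_real_of_nat by (intro tendsto_intros) (simp add: inverse_eq_divide)
    then have ulim: "u \<longlonglongrightarrow> r" by (simp add: u_def[abs_def])
    have "(\<lambda>n. emeasure ?M {a<..a + u n}) \<longlonglongrightarrow> emeasure ?M (\<Union>n. {a<..a + u n})"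
      by (intro Lim_emeasure_incseq incseq_SucI) (auto intro: order_trans[OF _ add_left_mono[OF u(3)]])
    also have "(\<Union>n. {a<..a + u n}) = {a<..<a + r}"
    proof safe
      fix v n assume "v \<in> {a<..a + u n}"
      then show "v \<in> {a<..<a + r}" using u(2)[of n] by auto
    next
      fix v assume v: "v \<in> {a<..<a + r}"
      then have "v - a < r" by simp
      then have "\<forall>\<^sub>F n in sequentially. v - a < u n" using order_tendstoD(1)[OF ulim] by blast
      then obtain n where "v - a < u n" by (auto simp: eventually_sequentially)
      then show "v \<in> (\<Union>n. {a<..a + u n})" using v by (auto intro!: exI[of _ n])
    qed
    finally have lim: "(\<lambda>n. ennreal (z (a + u n) - z a)) \<longlonglongrightarrow> emeasure ?M {a<..<a + r}"
      using u(1) by (simp add: Ioc)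
    show ?thesis
    proof (rule antisym)
      show "emeasure ?M {a<..<a + r} \<le> (SUP u\<in>{u. 0 \<le> u \<and> u < r}. ennreal (z (a + u) - z a))"
        by (rule LIMSEQ_le_const2[OF lim]) (use u in \<open>auto intro!: SUP_upper\<close>)
      show "(SUP u\<in>{u. 0 \<le> u \<and> u < r}. ennreal (z (a + u) - z a)) \<le> emeasure ?M {a<..<a + r}"
        by (intro SUP_least) (auto simp: Ioc[symmetric] intro!: emeasure_mono)
    qed
  qed (auto simp: bot_ennreal[symmetric] intro!: SUP_bot_conv(1)[THEN iffD2])
qed

section \<open>Classes of excursions and their intervals on the time axis of the clock\<close>

locale excursion_path_classes = excursion_path x\<^sub>o c \<mu> l x
  for x\<^sub>o :: "'s::polish_space" and c \<mu> l x +
  fixes I :: "nat set" and D :: "nat \<Rightarrow> (real \<Rightarrow> 's) set" and f :: "nat \<Rightarrow> 'j"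
  assumes D_sets: "\<And>i. i \<in> I \<Longrightarrow> D i \<in> sets (exc_space x\<^sub>o)"
    and I_pos: "0 \<notin> I"
    and D_unique: "\<And>p i i'. p \<in> A \<Longrightarrow> i \<in> I \<Longrightarrow> i' \<in> I \<Longrightarrow> snd p \<in> D i \<Longrightarrow> snd p \<in> D i' \<Longrightarrow> i = i'"
    and occupation: "\<And>t. 0 \<le> t \<Longrightarrow> emeasure lborel (zero_set x\<^sub>o x \<inter> {0..t}) = ennreal (c * l t)"
begin

definition class_sum :: "nat \<Rightarrow> real \<Rightarrow> ennreal" where
  "class_sum i s = (\<integral>\<^sup>+p. \<zeta> (snd p) * indicator {..<s} (fst p) * indicator (D i) (snd p) \<partial>count_space A)"

text \<open>The occupation time of clock j as a function of the local time: the stagnancy part if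
  class 0 runs on this clock, and the lifetimes of the atoms strictly before local time s.\<close>

definition alpha :: "'j \<Rightarrow> real \<Rightarrow> ennreal" where
  "alpha j s = (if f 0 = j then ennreal (c * s) else 0) + (\<integral>\<^sup>+i. class_sum i s \<partial>count_space {i\<in>I. f i = j})"

lemma D_times_sets: "i \<in> I \<Longrightarrow> {0..} \<times> D i \<in> sets \<mu>"
  by (intro times_sets D_sets) auto

lemma measurable_fst_indicator [measurable]:
  assumes "S \<in> sets borel" shows "(\<lambda>p. indicator S (fst p) :: ennreal) \<in> borel_measurable \<mu>"
proof -
  have "(\<lambda>u. indicator S u :: ennreal) \<in> borel_measurable (restrict_space borel {0..})"
    using assms by (intro measurable_restrict_space1) simp
  then show ?thesis unfolding measurable_cong_sets[OF sets_\<mu> refl] by (rule measurable_compose[OF measurable_fst])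
qed

lemma nn_integral_exc_class:
  assumes i: "i \<in> I" and S: "S \<in> sets borel" "S \<subseteq> {0..}"
  shows "(\<integral>\<^sup>+(u, e)\<in>S \<times> exc_paths x\<^sub>o. \<zeta> e \<partial>exc_class D \<mu> i)
      = (\<integral>\<^sup>+p. \<zeta> (snd p) * indicator S (fst p) * indicator (D i) (snd p) \<partial>count_space A)"
proof -
  note [measurable] = D_times_sets[OF i]
  have [measurable]: "S \<times> exc_paths x\<^sub>o \<in> sets \<mu>" by (intro times_sets S exc_paths_sets)
  have "(\<integral>\<^sup>+(u, e)\<in>S \<times> exc_paths x\<^sub>o. \<zeta> e \<partial>exc_class D \<mu> i)
      = (\<integral>\<^sup>+p. indicator ({0..} \<times> D i) p * (\<zeta> (snd p) * indicator (S \<times> exc_paths x\<^sub>o) p) \<partial>\<mu>)"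
    unfolding exc_class_def case_prod_beta by (rule nn_integral_density) measurable
  also have "\<dots> = (\<integral>\<^sup>+p. indicator ({0..} \<times> D i) p * (\<zeta> (snd p) * indicator (S \<times> exc_paths x\<^sub>o) p) \<partial>count_space A)"
    by (rule nn_integral_atoms) measurable
  also have "\<dots> = (\<integral>\<^sup>+p. \<zeta> (snd p) * indicator S (fst p) * indicator (D i) (snd p) \<partial>count_space A)"
    using atomsD S by (intro nn_integral_cong) (auto simp: indicator_def)
  finally show ?thesis .
qed

text \<open>At real time \<open>\<eta>l s\<close> the local time equals s and the current excursion
  has age 0, so only completed excursions count. The occupation time of \<open>x\<^sub>o\<close> is
  c s.\<close>

lemma clock_occ_eq_alpha:
  assumes A: "(s, e) \<in> A" and fin: "\<eta>l s < \<infinity>"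
  shows "clock_occ x\<^sub>o c D I f \<mu> l x j (enn2real (\<eta>l s)) = alpha j s"
proof -
  define t where "t = enn2real (\<eta>l s)"
  have t: "0 \<le> t" "ennreal t = \<eta>l s" using fin by (simp_all add: t_def ennreal_enn2real_if)
  have s: "0 \<le> s" using atomsD[OF A] by simp
  have "\<eta>l s < \<eta> s"
    using eta_jump[OF A] fin zeta_pos[of e] atomsD[OF A]
    by (metis add.right_neutral ennreal_add_left_cancel_less infinity_ennreal_def less_irrefl)
  then have lt: "l t = s" using t s by (intro l_eq_in_jump) auto
  have occ0: "occ x\<^sub>o c D \<mu> l x 0 t = ennreal (c * s)"
  proof -
    have "occ x\<^sub>o c D \<mu> l x 0 t = (\<integral>\<^sup>+u. indicator (zero_set x\<^sub>o x \<inter> {0..t}) u \<partial>lborel)"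
      unfolding occ_def by (auto intro!: nn_integral_cong simp: indicator_def zero_set_def)
    then show ?thesis using occupation[OF t(1)] zero_set_borel[OF x_cadlag] by (simp add: lt)
  qed
  have occ: "occ x\<^sub>o c D \<mu> l x i t = class_sum i s" if i: "i \<in> I" for i
  proof -
    have "i \<noteq> 0" using i I_pos by metis
    have "(\<integral>\<^sup>+(u, e)\<in>{0..<s} \<times> exc_paths x\<^sub>o. \<zeta> e \<partial>exc_class D \<mu> i) = class_sum i s"
      using atomsD unfolding class_sum_def
      by (subst nn_integral_exc_class[OF i]) (auto intro!: nn_integral_cong simp: indicator_def)
    moreover have "ennreal t - \<eta>l s = 0" unfolding t(2)[symmetric] by (simp add: ennreal_minus)
    ultimately show ?thesis using \<open>i \<noteq> 0\<close> by (simp add: occ_def lt)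
  qed
  let ?S = "{i \<in> insert 0 I. f i = j}"
  have "clock_occ x\<^sub>o c D I f \<mu> l x j t
      = (\<integral>\<^sup>+i. (if i = 0 then ennreal (c * s) else 0) + (if i = 0 then 0 else class_sum i s) \<partial>count_space ?S)"
    unfolding clock_occ_def by (intro nn_integral_cong) (auto simp: occ0 occ)
  also have "\<dots> = (\<integral>\<^sup>+i. (if i = 0 then ennreal (c * s) else 0) \<partial>count_space ?S) + (\<integral>\<^sup>+i. (if i = 0 then 0 else class_sum i s) \<partial>count_space ?S)"
    by (rule nn_integral_add) auto
  also have "(\<integral>\<^sup>+i. (if i = 0 then ennreal (c * s) else 0) \<partial>count_space ?S) = (if f 0 = j then ennreal (c * s) else 0)"
    by (subst nn_integral_count_space'[of "{0} \<inter> ?S"]) auto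
  also have "(\<integral>\<^sup>+i. (if i = 0 then 0 else class_sum i s) \<partial>count_space ?S) = (\<integral>\<^sup>+i. (if i = 0 then 0 else class_sum i s) \<partial>count_space {i\<in>I. f i = j})"
    by (rule nn_integral_count_space_eq) auto
  also have "\<dots> = (\<integral>\<^sup>+i. class_sum i s \<partial>count_space {i\<in>I. f i = j})"
    using I_pos by (intro nn_integral_cong) auto
  finally show ?thesis by (simp add: alpha_def t_def)
qed

text \<open>By \<open>D_unique\<close> every atom is counted for at most one class. This bound
  supplies the finiteness of \<open>alpha\<close>.\<close>

lemma alpha_le:
  assumes s: "0 \<le> s" shows "alpha j s \<le> \<eta>l s"
proof -
  have "(\<integral>\<^sup>+i. class_sum i s \<partial>count_space {i\<in>I. f i = j})
      = (\<integral>\<^sup>+p. (\<integral>\<^sup>+i. \<zeta> (snd p) * indicator {..<s} (fst p) * indicator (D i) (snd p) \<partial>count_space {i\<in>I. f i = j}) \<partial>count_space A)"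
    unfolding class_sum_def by (rule nn_integral_count_space_nn_integral[symmetric]) auto
  also have "\<dots> \<le> (\<integral>\<^sup>+p. \<zeta> (snd p) * indicator {..<s} (fst p) \<partial>count_space A)"
  proof (rule nn_integral_mono)
    fix p assume "p \<in> space (count_space A)"
    then have p: "p \<in> A" by simp
    let ?g = "\<zeta> (snd p) * indicator {..<s} (fst p)"
    show "(\<integral>\<^sup>+i. ?g * indicator (D i) (snd p) \<partial>count_space {i\<in>I. f i = j}) \<le> ?g"
    proof (cases "\<exists>i\<in>I. snd p \<in> D i")
      case True
      then obtain i where i: "i \<in> I" "snd p \<in> D i" by blast
      have "(\<integral>\<^sup>+i. ?g * indicator (D i) (snd p) \<partial>count_space {i\<in>I. f i = j})
          = (\<Sum>i\<in>{i} \<inter> {i\<in>I. f i = j}. ?g * indicator (D i) (snd p))"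
      proof (rule nn_integral_count_space')
        fix i' assume "i' \<in> {i\<in>I. f i = j}" "i' \<notin> {i} \<inter> {i\<in>I. f i = j}"
        then have "i' \<in> I" "i' \<noteq> i" by auto
        then have "snd p \<notin> D i'" using D_unique[OF p i(1) _ i(2), of i'] by blast
        then show "?g * indicator (D i') (snd p) = 0" by simp
      qed auto
      also have "\<dots> \<le> (\<Sum>i\<in>{i}. ?g * indicator (D i) (snd p))"
        by (intro sum_mono2) auto
      also have "\<dots> = ?g" using i by simp
      finally show ?thesis .
    next
      case False
      then have "(\<integral>\<^sup>+i. ?g * indicator (D i) (snd p) \<partial>count_space {i\<in>I. f i = j}) = (\<integral>\<^sup>+i. 0 \<partial>count_space {i\<in>I. f i = j})"
        by (intro nn_integral_cong) (auto simp: indicator_def)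
      then show ?thesis by simp
    qed
  qed
  finally show ?thesis unfolding alpha_def eta_left_eq[OF s] by (intro add_mono) auto
qed

text \<open>Already the atom itself contributes its lifetime to the occupation time at any later
  local time. This is why the intervals on the clock's axis do not overlap.\<close>

lemma alpha_jump:
  assumes A: "(s, e) \<in> A" and i: "i \<in> I" "e \<in> D i" and s': "s < s'"
  shows "alpha (f i) s + \<zeta> e \<le> alpha (f i) s'"
proof -
  let ?S = "{i'\<in>I. f i' = f i}"
  have cs: "class_sum i' s + (if i' = i then \<zeta> e else 0) \<le> class_sum i' s'" for i'
  proof -
    have "class_sum i' s + (if i' = i then \<zeta> e else 0) = (\<integral>\<^sup>+p. \<zeta> (snd p) * indicator {..<s} (fst p) * indicator (D i') (snd p)
          + (if i' = i then \<zeta> e else 0) * indicator {(s, e)} p \<partial>count_space A)"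
      unfolding class_sum_def using A
      by (subst nn_integral_add) (auto simp: nn_integral_cmult_indicator emeasure_count_space)
    also have "\<dots> \<le> class_sum i' s'"
      unfolding class_sum_def using s' i(2) by (intro nn_integral_mono) (auto simp: indicator_def)
    finally show ?thesis .
  qed
  have "(\<integral>\<^sup>+i'. class_sum i' s \<partial>count_space ?S) + \<zeta> e
      = (\<integral>\<^sup>+i'. class_sum i' s \<partial>count_space ?S) + (\<integral>\<^sup>+i'. (if i' = i then \<zeta> e else 0) \<partial>count_space ?S)"
    using i by (subst (2) nn_integral_count_space'[of "{i}"]) auto
  also have "\<dots> = (\<integral>\<^sup>+i'. class_sum i' s + (if i' = i then \<zeta> e else 0) \<partial>count_space ?S)"
    by (rule nn_integral_add[symmetric]) auto
  also have "\<dots> \<le> (\<integral>\<^sup>+i'. class_sum i' s' \<partial>count_space ?S)"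
    by (intro nn_integral_mono cs)
  finally have le: "(\<integral>\<^sup>+i'. class_sum i' s \<partial>count_space ?S) + \<zeta> e \<le> (\<integral>\<^sup>+i'. class_sum i' s' \<partial>count_space ?S)" .
  show ?thesis unfolding alpha_def add.assoc
    using s' c_nonneg by (intro add_mono le) (auto intro!: ennreal_leI mult_left_mono)
qed

lemma atoms_exc_class:
  assumes i: "i \<in> I" shows "atoms (exc_class D \<mu> i) = {p\<in>A. snd p \<in> D i}"
proof -
  note [measurable] = D_times_sets[OF i]
  have sp: "space (exc_class D \<mu> i) = space \<mu>" "sets (exc_class D \<mu> i) = sets \<mu>"
    by (simp_all add: exc_class_def)
  have em: "emeasure (exc_class D \<mu> i) {p} = indicator (D i) (snd p) * emeasure \<mu> {p}" if p: "p \<in> space \<mu>" for p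
  \<comment> \<open>For a singleton that is not measurable both sides are 0 by convention.\<close>
  proof (cases "{p} \<in> sets \<mu>")
    case True
    then have "emeasure (exc_class D \<mu> i) {p} = (\<integral>\<^sup>+p'. indicator ({0..} \<times> D i) p' * indicator {p} p' \<partial>\<mu>)"
      unfolding exc_class_def by (intro emeasure_density borel_measurable_indicator D_times_sets i)
    also have "\<dots> = (\<integral>\<^sup>+p'. indicator (D i) (snd p) * indicator {p} p' \<partial>\<mu>)"
      using p by (intro nn_integral_cong) (auto simp: indicator_def space_\<mu>)
    finally show ?thesis using True by (simp add: nn_integral_cmult_indicator)
  next
    case False
    then show ?thesis using sp by (simp add: emeasure_notin_sets)
  qed
  show ?thesis unfolding atoms_def sp(1) by (auto simp: em indicator_def split: if_splits)
qed

text \<open>The integral over the image measure is pulled back to the atoms of \<open>N\<close>.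
  \<open>clock_occ\<close> is kept as it is, since an atom up to \<open>L_inf\<close> may still have
  infinite \<open>\<eta>l\<close> at this stage.\<close>

lemma star_lifetime_sum:
  assumes i: "i \<in> I" and z: "cadlag (zz (f i))" "strict_mono_on {0..} (zz (f i))" "\<And>b. \<exists>t\<ge>0. b < zz (f i) t"
  shows "(\<integral>\<^sup>+(u, e)\<in>{0..1} \<times> exc_paths x\<^sub>o. \<zeta> e \<partial>star_process x\<^sub>o c D I f \<mu> l x zz i)
      = (\<integral>\<^sup>+p. (SUP u\<in>{u. 0 \<le> u \<and> ennreal u < \<zeta> (snd p)}.
            ennreal (zz (f i) (enn2real (clock_occ x\<^sub>o c D I f \<mu> l x (f i) (enn2real (\<eta>l (fst p)))) + u)
              - zz (f i) (enn2real (clock_occ x\<^sub>o c D I f \<mu> l x (f i) (enn2real (\<eta>l (fst p)))))))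
          \<partial>count_space {p\<in>A. snd p \<in> D i \<and> ennreal (fst p) \<le> L_inf x\<^sub>o c \<mu> \<and> fst p \<le> 1})"
proof -
  let ?T = "restrict_space (borel :: real measure) {0..} \<Otimes>\<^sub>M exc_space x\<^sub>o"
  let ?S = "{p\<in>A. snd p \<in> D i \<and> ennreal (fst p) \<le> L_inf x\<^sub>o c \<mu>}"
  let ?st = "star_exc x\<^sub>o c D I f \<mu> l x zz i"
  have Seq: "{(s, e) \<in> atoms (exc_class D \<mu> i). ennreal s \<le> L_inf x\<^sub>o c \<mu>} = ?S"
    unfolding atoms_exc_class[OF i] by auto
  \<comment> \<open>A good clock sends atoms to genuine excursion paths; without this the map would
    not be measurable into the target of \<open>distr\<close>.\<close>
  have st: "?st s e \<in> exc_paths x\<^sub>o" if "(s, e) \<in> ?S" for s e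
    unfolding star_exc_def using that atomsD z by (intro time_change_in_exc_paths) auto
  have map: "(\<lambda>(s, e). (s, ?st s e)) \<in> measurable (count_space ?S) ?T"
    using st atomsD by (auto simp: space_pair_measure space_exc_space space_restrict_space)
  have sets: "{0..1} \<times> exc_paths x\<^sub>o \<in> sets ?T"
    using times_sets[of "{0..1}" "exc_paths x\<^sub>o"] exc_paths_sets sets_\<mu> by auto
  have meas: "(\<lambda>p. \<zeta> (snd p) * indicator ({0..1} \<times> exc_paths x\<^sub>o) p) \<in> borel_measurable ?T"
    using measurable_zeta[of x\<^sub>o] sets by measurable
  have "(\<integral>\<^sup>+(u, e)\<in>{0..1} \<times> exc_paths x\<^sub>o. \<zeta> e \<partial>star_process x\<^sub>o c D I f \<mu> l x zz i)
      = (\<integral>\<^sup>+p. \<zeta> (snd p) * indicator ({0..1} \<times> exc_paths x\<^sub>o) p \<partial>distr (count_space ?S) ?T (\<lambda>(s, e). (s, ?st s e)))"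
    unfolding star_process_def Seq by (simp add: case_prod_beta)
  also have "\<dots> = (\<integral>\<^sup>+p. \<zeta> (?st (fst p) (snd p)) * indicator ({0..1} \<times> exc_paths x\<^sub>o) (fst p, ?st (fst p) (snd p)) \<partial>count_space ?S)"
    by (subst nn_integral_distr[OF map]) (use meas in \<open>simp_all add: case_prod_beta\<close>)
  also have "\<dots> = (\<integral>\<^sup>+p. \<zeta> (?st (fst p) (snd p)) \<partial>count_space {p\<in>A. snd p \<in> D i \<and> ennreal (fst p) \<le> L_inf x\<^sub>o c \<mu> \<and> fst p \<le> 1})"
    using st atomsD by (subst (1 2) nn_integral_count_space_indicator) (simp_all, intro nn_integral_cong, auto simp: indicator_def)
  also have "\<dots> = (\<integral>\<^sup>+p. (SUP u\<in>{u. 0 \<le> u \<and> ennreal u < \<zeta> (snd p)}.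
            ennreal (zz (f i) (enn2real (clock_occ x\<^sub>o c D I f \<mu> l x (f i) (enn2real (\<eta>l (fst p)))) + u)
              - zz (f i) (enn2real (clock_occ x\<^sub>o c D I f \<mu> l x (f i) (enn2real (\<eta>l (fst p)))))))
          \<partial>count_space {p\<in>A. snd p \<in> D i \<and> ennreal (fst p) \<le> L_inf x\<^sub>o c \<mu> \<and> fst p \<le> 1})"
    unfolding star_exc_def using atomsD z by (intro nn_integral_cong zeta_time_change) auto
  finally show ?thesis .
qed

text \<open>An unbounded clock gives an infinite excursion an infinite transformed lifetime, and a
  single summand is enough.\<close>

lemma star_lifetime_infinite:
  assumes i: "i \<in> I" and z: "cadlag (zz (f i))" "strict_mono_on {0..} (zz (f i))" "\<And>b. \<exists>t\<ge>0. b < zz (f i) t"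
    and A: "(s, e) \<in> A" "e \<in> D i" "s \<le> 1" "\<zeta> e = \<infinity>" and fin: "\<eta>l s < \<infinity>"
  shows "(\<integral>\<^sup>+(u, e)\<in>{0..1} \<times> exc_paths x\<^sub>o. \<zeta> e \<partial>star_process x\<^sub>o c D I f \<mu> l x zz i) = \<infinity>"
proof -
  define a where "a = enn2real (clock_occ x\<^sub>o c D I f \<mu> l x (f i) (enn2real (\<eta>l s)))"
  have a: "0 \<le> a" by (simp add: a_def)
  let ?z = "zz (f i)"
  let ?g = "\<lambda>p. (SUP u\<in>{u. 0 \<le> u \<and> ennreal u < \<zeta> (snd p)}.
            ennreal (?z (enn2real (clock_occ x\<^sub>o c D I f \<mu> l x (f i) (enn2real (\<eta>l (fst p)))) + u)
              - ?z (enn2real (clock_occ x\<^sub>o c D I f \<mu> l x (f i) (enn2real (\<eta>l (fst p)))))))"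
  let ?S = "{p\<in>A. snd p \<in> D i \<and> ennreal (fst p) \<le> L_inf x\<^sub>o c \<mu> \<and> fst p \<le> 1}"
  have "?g (s, e) = \<infinity>"
    unfolding infinity_ennreal_def
  proof (rule ennreal_SUP_eq_top)
    fix n :: nat
    obtain t where t: "0 \<le> t" "real n + ?z a < ?z t" using z(3) by blast
    have "?z t \<le> ?z (a + t)"
    proof (cases "a = 0")
      case False
      then show ?thesis using strict_mono_onD[OF z(2), of t "a + t"] a t by simp
    qed simp
    then have "real n \<le> ?z (a + t) - ?z a" using t by simp
    then show "\<exists>u\<in>{u. 0 \<le> u \<and> ennreal u < \<zeta> (snd (s, e))}. of_nat n \<le> ennreal (?z (enn2real (clock_occ x\<^sub>o c D I f \<mu> l x (f i) (enn2real (\<eta>l (fst (s, e))))) + u)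
              - ?z (enn2real (clock_occ x\<^sub>o c D I f \<mu> l x (f i) (enn2real (\<eta>l (fst (s, e)))))))"
      using t A(4) by (intro bexI[of _ t]) (auto simp: a_def[symmetric] ennreal_of_nat_eq_real_of_nat intro!: ennreal_leI)
  qed
  have "(s, e) \<in> ?S" using A fin atomsD[OF A(1)] by (auto intro: le_L_infI)
  then have "?g (s, e) \<le> (\<integral>\<^sup>+p. ?g p \<partial>count_space ?S)"
    by (intro nn_integral_ge_point) auto
  then have "(\<integral>\<^sup>+p. ?g p \<partial>count_space ?S) = \<infinity>"
    unfolding \<open>?g (s, e) = \<infinity>\<close> infinity_ennreal_def by (rule top_unique[THEN iffD1])
  then show ?thesis unfolding star_lifetime_sum[OF i, of zz, OF z] .
qed

text \<open>If \<open>\<eta> 1\<close> is finite, all quantities are finite and the same disjoint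
  intervals describe both processes: their dz-mass is the transformed lifetime, their Lebesgue
  measure the original one.\<close>

lemma
  assumes i: "i \<in> I" and fin: "\<eta> 1 < \<infinity>"
  defines "P1 \<equiv> {p\<in>A. snd p \<in> D i \<and> fst p \<le> 1}"
    and "a \<equiv> \<lambda>p. enn2real (alpha (f i) (fst p))"
    and "b \<equiv> \<lambda>p. enn2real (alpha (f i) (fst p)) + enn2real (\<zeta> (snd p))"
  shows star_lifetime_eq: "\<And>zz. cadlag (zz (f i)) \<Longrightarrow> strict_mono_on {0..} (zz (f i)) \<Longrightarrow> (\<And>b. \<exists>t\<ge>0. b < zz (f i) t) \<Longrightarrow>
      (\<integral>\<^sup>+(u, e)\<in>{0..1} \<times> exc_paths x\<^sub>o. \<zeta> e \<partial>star_process x\<^sub>o c D I f \<mu> l x zz i)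
        = emeasure (interval_measure (\<lambda>t. zz (f i) (max 0 t))) (\<Union>p\<in>P1. {a p<..<b p})"
    and lifetime_eq: "(\<integral>\<^sup>+p. \<zeta> (snd p) * indicator ({0..1} \<times> D i) p \<partial>\<mu>) = emeasure lborel (\<Union>p\<in>P1. {a p<..<b p})"
proof -
  have fin1: "\<eta>l s < \<infinity>" "\<zeta> e < \<infinity>" "alpha (f i) s < \<infinity>" "0 \<le> s" if "(s, e) \<in> P1" for s e
  proof -
    have A: "(s, e) \<in> A" and s1: "s \<le> 1" using that by (auto simp: P1_def)
    show "0 \<le> s" using atomsD[OF A] by simp
    have "\<eta> s < \<infinity>" using eta_mono[OF s1] fin by (rule le_less_trans)
    then show "\<eta>l s < \<infinity>" "\<zeta> e < \<infinity>" unfolding eta_jump[OF A] by (auto simp: less_top[symmetric])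
    then show "alpha (f i) s < \<infinity>" using alpha_le[OF \<open>0 \<le> s\<close>] by (meson le_less_trans)
  qed
  \<comment> \<open>Distinct atoms have distinct times, so any two are ordered, and
    \<open>alpha_jump\<close> places the interval of the earlier one before that of the later
    one.\<close>
  have disj: "disjoint_family_on (\<lambda>p. {a p<..<b p}) P1"
  proof -
    have "{a p<..<b p} \<inter> {a p'<..<b p'} = {}" if "p \<in> P1" "p' \<in> P1" "fst p < fst p'" for p p'
    proof -
      have "alpha (f i) (fst p) + \<zeta> (snd p) \<le> alpha (f i) (fst p')"
        using that by (intro alpha_jump[OF _ i]) (auto simp: P1_def)
      then have "enn2real (alpha (f i) (fst p) + \<zeta> (snd p)) \<le> a p'"
        unfolding a_def using fin1(3)[of "fst p'" "snd p'"] that by (intro enn2real_mono) auto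
      then have "b p \<le> a p'"
        using fin1(2,3)[of "fst p" "snd p"] that by (simp add: b_def enn2real_plus)
      then show ?thesis by auto
    qed
    moreover have "fst p \<noteq> fst p'" if "p \<in> P1" "p' \<in> P1" "p \<noteq> p'" for p p'
      using that atom_unique(1)[of "fst p" "snd p" "snd p'"] by (auto simp: P1_def prod_eq_iff)
    ultimately show ?thesis unfolding disjoint_family_on_def by (metis Int_commute linorder_neqE_linordered_idom)
  qed
  have "countable A" using point_measure by (simp add: point_measure_def)
  then have count: "countable P1" by (rule countable_subset[rotated]) (auto simp: P1_def)
  show "(\<integral>\<^sup>+p. \<zeta> (snd p) * indicator ({0..1} \<times> D i) p \<partial>\<mu>) = emeasure lborel (\<Union>p\<in>P1. {a p<..<b p})"
  proof -
    have [measurable]: "{0..1} \<times> D i \<in> sets \<mu>" by (intro times_sets D_sets i) auto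
    have "(\<integral>\<^sup>+p. \<zeta> (snd p) * indicator ({0..1} \<times> D i) p \<partial>\<mu>) = (\<integral>\<^sup>+p. \<zeta> (snd p) * indicator ({0..1} \<times> D i) p \<partial>count_space A)"
      by (rule nn_integral_atoms) measurable
    also have "\<dots> = (\<integral>\<^sup>+p. \<zeta> (snd p) \<partial>count_space P1)"
      using atomsD by (subst (1 2) nn_integral_count_space_indicator)
        (simp_all, intro nn_integral_cong, auto simp: indicator_def P1_def)
    also have "\<dots> = (\<integral>\<^sup>+p. emeasure lborel {a p<..<b p} \<partial>count_space P1)"
    proof (rule nn_integral_cong)
      fix p assume "p \<in> space (count_space P1)"
      then have "\<zeta> (snd p) < \<infinity>" using fin1(2)[of "fst p" "snd p"] by simp
      then show "\<zeta> (snd p) = emeasure lborel {a p<..<b p}" by (simp add: a_def b_def ennreal_enn2real_if)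
    qed
    also have "\<dots> = emeasure lborel (\<Union>p\<in>P1. {a p<..<b p})"
      using disj count by (intro emeasure_UN_countable[symmetric]) auto
    finally show ?thesis .
  qed
  fix zz :: "'j \<Rightarrow> real \<Rightarrow> real"
  assume z: "cadlag (zz (f i))" "strict_mono_on {0..} (zz (f i))" "\<And>b. \<exists>t\<ge>0. b < zz (f i) t"
  \<comment> \<open>Here every atom up to local time 1 lies at or below \<open>L_inf\<close>, so the
    restriction in \<open>star_process\<close> removes none of them.\<close>
  have "{p\<in>A. snd p \<in> D i \<and> ennreal (fst p) \<le> L_inf x\<^sub>o c \<mu> \<and> fst p \<le> 1} = P1"
    using le_L_infI fin1 by (auto simp: P1_def)
  then have "(\<integral>\<^sup>+(u, e)\<in>{0..1} \<times> exc_paths x\<^sub>o. \<zeta> e \<partial>star_process x\<^sub>o c D I f \<mu> l x zz i)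
      = (\<integral>\<^sup>+p. (SUP u\<in>{u. 0 \<le> u \<and> ennreal u < \<zeta> (snd p)}.
            ennreal (zz (f i) (enn2real (clock_occ x\<^sub>o c D I f \<mu> l x (f i) (enn2real (\<eta>l (fst p)))) + u)
              - zz (f i) (enn2real (clock_occ x\<^sub>o c D I f \<mu> l x (f i) (enn2real (\<eta>l (fst p)))))))
          \<partial>count_space P1)"
    using star_lifetime_sum[OF i, of zz, OF z] by simp
  also have "\<dots> = (\<integral>\<^sup>+p. emeasure (interval_measure (\<lambda>t. zz (f i) (max 0 t))) {a p<..<b p} \<partial>count_space P1)"
  proof (rule nn_integral_cong)
    fix p assume "p \<in> space (count_space P1)"
    then have p: "(fst p, snd p) \<in> P1" by simp
    have "clock_occ x\<^sub>o c D I f \<mu> l x (f i) (enn2real (\<eta>l (fst p))) = alpha (f i) (fst p)"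
      using p fin1(1)[OF p] by (intro clock_occ_eq_alpha[of _ "snd p"]) (auto simp: P1_def)
    moreover have "{u. 0 \<le> u \<and> ennreal u < \<zeta> (snd p)} = {u. 0 \<le> u \<and> u < enn2real (\<zeta> (snd p))}"
      using fin1(2)[OF p] by (cases "\<zeta> (snd p)") (auto simp: ennreal_less_iff)
    moreover have "mono_on {0..} (zz (f i))" using z(2) by (rule strict_mono_on_imp_mono_on)
    ultimately show "(SUP u\<in>{u. 0 \<le> u \<and> ennreal u < \<zeta> (snd p)}.
            ennreal (zz (f i) (enn2real (clock_occ x\<^sub>o c D I f \<mu> l x (f i) (enn2real (\<eta>l (fst p)))) + u)
              - zz (f i) (enn2real (clock_occ x\<^sub>o c D I f \<mu> l x (f i) (enn2real (\<eta>l (fst p)))))))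
        = emeasure (interval_measure (\<lambda>t. zz (f i) (max 0 t))) {a p<..<b p}"
      unfolding a_def b_def by (simp add: emeasure_interval_measure_Ioo[OF z(1)])
  qed
  also have "\<dots> = emeasure (interval_measure (\<lambda>t. zz (f i) (max 0 t))) (\<Union>p\<in>P1. {a p<..<b p})"
    using disj count by (intro emeasure_UN_countable[symmetric]) auto
  finally show "(\<integral>\<^sup>+(u, e)\<in>{0..1} \<times> exc_paths x\<^sub>o. \<zeta> e \<partial>star_process x\<^sub>o c D I f \<mu> l x zz i)
        = emeasure (interval_measure (\<lambda>t. zz (f i) (max 0 t))) (\<Union>p\<in>P1. {a p<..<b p})" .
qed

end

section \<open>Measurability with respect to the completion of \<open>\<sigma>(X)\<close>\<close>

context time_changed_regenerative_process
begin

lemma space_n: "space n = exc_paths x\<^sub>o"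
  using sets_eq_imp_space_eq[OF sets_n] by (simp add: space_exc_space)

abbreviation \<mu>\<^sub>0 :: "(real \<times> (real \<Rightarrow> 's)) measure" where
  "\<mu>\<^sub>0 \<equiv> restrict_space lborel {0..} \<Otimes>\<^sub>M n"

lemma sets_\<mu>\<^sub>0: "sets \<mu>\<^sub>0 = sets (restrict_space borel {0..} \<Otimes>\<^sub>M exc_space x\<^sub>o)"
  by (intro sets_pair_measure_cong sets_n) (simp add: sets_restrict_space)

lemma zeta_measurable_n [measurable]: "zeta x\<^sub>o \<in> borel_measurable n"
  by (subst measurable_cong_sets[OF sets_n refl]) (rule measurable_zeta)

text \<open>Completeness of the filtration makes \<open>P\<close> itself complete. Every later
  passage to almost surely equal sets or functions rests on this.\<close>

lemma null_subset: "B \<in> null_sets P \<Longrightarrow> A \<subseteq> B \<Longrightarrow> A \<in> null_sets P"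
  using F_complete[of B A] F_le[of 0] null_sets_subset[of B P A] by blast

lemma AE_imp_sets:
  assumes "AE \<omega> in P. \<omega> \<in> A \<longleftrightarrow> \<omega> \<in> B" "A \<subseteq> space P" "B \<in> sets P"
  shows "A \<in> sets P"
proof -
  obtain M where "{\<omega>\<in>space P. \<not> (\<omega> \<in> A \<longleftrightarrow> \<omega> \<in> B)} \<subseteq> M" "emeasure P M = 0" "M \<in> sets P"
    using assms(1) by (rule AE_E)
  then have M: "M \<in> null_sets P" "{\<omega>\<in>space P. \<not> (\<omega> \<in> A \<longleftrightarrow> \<omega> \<in> B)} \<subseteq> M" by auto
  have "A - B \<in> null_sets P" "B - A \<in> null_sets P"
    using M(2) assms(2) sets.sets_into_space[OF assms(3)] by (auto intro!: null_subset[OF M(1)])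
  then have "(B - (B - A)) \<union> (A - B) \<in> sets P" using assms(3) by auto
  also have "(B - (B - A)) \<union> (A - B) = A" by auto
  finally show ?thesis .
qed

lemma X_right_continuous: "\<omega> \<in> space P \<Longrightarrow> 0 \<le> t \<Longrightarrow> ((\<lambda>s. X s \<omega>) \<longlongrightarrow> X t \<omega>) (at_right t)"
  using X_cadlag by (simp add: cadlag_def)

section \<open>The completion of \<sigma>(X) and its independence of the clocks\<close>

definition \<Sigma>X :: "'w measure" where
  "\<Sigma>X = vimage_algebra (space P) (path_of X) path_space"

definition \<Sigma>Z :: "'w measure" where
  "\<Sigma>Z = vimage_algebra (space P) (\<lambda>\<omega>. \<lambda>j\<in>J. path_of (Z j) \<omega>) (Pi\<^sub>M J (\<lambda>_. Pi\<^sub>M {0..} (\<lambda>_. borel)))"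

lemma path_of_X_space: "path_of X \<in> space P \<rightarrow> space path_space"
proof
  fix \<omega> assume \<omega>: "\<omega> \<in> space P"
  have "cadlag (path_of X \<omega>)"
    by (rule cadlag_compose[OF X_cadlag[OF \<omega>], where \<rho> = "\<lambda>t. t"]) (auto simp: path_of_def mono_on_def)
  then show "path_of X \<omega> \<in> space path_space"
    by (auto simp: path_space_def space_restrict_space space_PiM path_of_def)
qed

lemma space_\<Sigma>X [simp]: "space \<Sigma>X = space P" and space_\<Sigma>Z [simp]: "space \<Sigma>Z = space P"
  by (simp_all add: \<Sigma>X_def \<Sigma>Z_def)

lemma sets_\<Sigma>X: "sets \<Sigma>X \<subseteq> sets P" and sets_\<Sigma>Z: "sets \<Sigma>Z \<subseteq> sets P"
  using Z_indep_X unfolding \<Sigma>X_def \<Sigma>Z_def indep_set_def indep_sets_def by (auto split: bool.splits)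

lemma X_\<Sigma>X: "0 \<le> t \<Longrightarrow> X t \<in> borel_measurable \<Sigma>X"
proof -
  assume t: "0 \<le> t"
  have "path_of X \<in> measurable \<Sigma>X path_space"
    unfolding \<Sigma>X_def by (rule measurable_vimage_algebra1[OF path_of_X_space])
  moreover have "(\<lambda>x. x t) \<in> measurable path_space (borel :: 's measure)"
    unfolding path_space_def by (intro measurable_restrict_space1 measurable_component_singleton) (use t in simp)
  ultimately have "(\<lambda>\<omega>. path_of X \<omega> t) \<in> borel_measurable \<Sigma>X" by (rule measurable_compose)
  then show ?thesis using t by (simp add: path_of_def)
qed

lemma Z_\<Sigma>Z: "j \<in> J \<Longrightarrow> 0 \<le> t \<Longrightarrow> Z j t \<in> borel_measurable \<Sigma>Z"
proof -
  assume j: "j \<in> J" and t: "0 \<le> t"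
  have "(\<lambda>\<omega>. \<lambda>j\<in>J. path_of (Z j) \<omega>) \<in> measurable \<Sigma>Z (Pi\<^sub>M J (\<lambda>_. Pi\<^sub>M {0..} (\<lambda>_. borel)))"
    unfolding \<Sigma>Z_def by (rule measurable_vimage_algebra1) (auto simp: space_PiM path_of_def)
  from measurable_compose[OF this measurable_component_singleton[OF j]]
  have "(\<lambda>\<omega>. path_of (Z j) \<omega>) \<in> measurable \<Sigma>Z (Pi\<^sub>M {0..} (\<lambda>_. borel))" using j by simp
  from measurable_compose[OF this measurable_component_singleton[of t]] t
  show ?thesis by (simp add: path_of_def)
qed

definition completed :: "'w set set" where
  "completed = {A\<in>sets P. \<exists>B\<in>sets \<Sigma>X. AE \<omega> in P. \<omega> \<in> A \<longleftrightarrow> \<omega> \<in> B}"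

definition G :: "'w measure" where "G = sigma (space P) completed"

lemma sigma_algebra_completed: "sigma_algebra (space P) completed"
proof (rule sigma_algebra_iff2[THEN iffD2], intro conjI ballI allI impI)
  show "completed \<subseteq> Pow (space P)" using sets.sets_into_space by (auto simp: completed_def)
  show "{} \<in> completed" by (auto simp: completed_def intro!: bexI[of _ "{}"])
  fix A assume "A \<in> completed"
  then obtain B where B: "A \<in> sets P" "B \<in> sets \<Sigma>X" "AE \<omega> in P. \<omega> \<in> A \<longleftrightarrow> \<omega> \<in> B" by (auto simp: completed_def)
  have "AE \<omega> in P. \<omega> \<in> space P - A \<longleftrightarrow> \<omega> \<in> space \<Sigma>X - B"
    using B(3) by eventually_elim auto
  then show "space P - A \<in> completed" unfolding completed_def using B(1) sets.compl_sets[OF B(2)]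
    by (intro CollectI conjI bexI[of _ "space \<Sigma>X - B"]) auto
next
  fix A :: "nat \<Rightarrow> 'w set" assume "range A \<subseteq> completed"
  then have "\<forall>k. \<exists>B\<in>sets \<Sigma>X. AE \<omega> in P. \<omega> \<in> A k \<longleftrightarrow> \<omega> \<in> B" and A: "\<And>k. A k \<in> sets P" by (auto simp: completed_def)
  then obtain B where B: "\<And>k. B k \<in> sets \<Sigma>X" "\<And>k. AE \<omega> in P. \<omega> \<in> A k \<longleftrightarrow> \<omega> \<in> B k" by metis
  have "AE \<omega> in P. \<forall>k. \<omega> \<in> A k \<longleftrightarrow> \<omega> \<in> B k" using B(2) by (simp add: AE_all_countable)
  then have "AE \<omega> in P. \<omega> \<in> (\<Union>k. A k) \<longleftrightarrow> \<omega> \<in> (\<Union>k. B k)" by eventually_elim auto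
  moreover have "(\<Union>k. B k) \<in> sets \<Sigma>X" "(\<Union>k. A k) \<in> sets P" using B A by auto
  ultimately show "(\<Union>k. A k) \<in> completed" unfolding completed_def by (intro CollectI conjI bexI[of _ "\<Union>k. B k"])
qed

lemma sets_G: "sets G = completed"
  unfolding G_def using sigma_algebra_completed by (rule sigma_algebra.sets_measure_of_eq)

lemma space_G [simp]: "space G = space P"
  unfolding G_def using sets.sets_into_space by (intro space_measure_of) (auto simp: completed_def)

lemma sets_G_subset: "sets G \<subseteq> sets P"
  by (auto simp: sets_G completed_def)

text \<open>A null set changes none of the three probabilities, so the product formula for
  \<sigma>(X) extends to its completion.\<close>

lemma G_indep_Z:
  assumes "A \<in> sets G" "C \<in> sets \<Sigma>Z"
  shows "prob (A \<inter> C) = prob A * prob C"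
proof -
  obtain B where B: "A \<in> sets P" "B \<in> sets \<Sigma>X" "AE \<omega> in P. \<omega> \<in> A \<longleftrightarrow> \<omega> \<in> B"
    using assms(1) by (auto simp: sets_G completed_def)
  have [measurable]: "A \<in> sets P" "B \<in> sets P" "C \<in> sets P" using B assms sets_\<Sigma>X sets_\<Sigma>Z by auto
  have "prob (A \<inter> C) = prob (B \<inter> C)"
    using B(3) by (intro finite_measure_eq_AE) auto
  also have "\<dots> = prob B * prob C"
    using Z_indep_X B(2) assms(2) unfolding \<Sigma>X_def \<Sigma>Z_def by (rule indep_setD)
  also have "prob B = prob A" using B(3) by (intro finite_measure_eq_AE) auto
  finally show ?thesis .
qed

lemma sets_G_AE:
  assumes "{\<omega>\<in>space P. R \<omega>} \<in> sets G" "AE \<omega> in P. Q \<omega> \<longleftrightarrow> R \<omega>"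
  shows "{\<omega>\<in>space P. Q \<omega>} \<in> sets G"
proof -
  let ?R = "{\<omega>\<in>space P. R \<omega>}" and ?Q = "{\<omega>\<in>space P. Q \<omega>}"
  obtain B where B: "?R \<in> sets P" "B \<in> sets \<Sigma>X" "AE \<omega> in P. \<omega> \<in> ?R \<longleftrightarrow> \<omega> \<in> B"
    using assms(1) by (auto simp: sets_G completed_def)
  have 1: "AE \<omega> in P. \<omega> \<in> ?Q \<longleftrightarrow> \<omega> \<in> ?R" using assms(2) by eventually_elim simp
  have "?Q \<in> sets P" by (rule AE_imp_sets[OF 1 _ B(1)]) (rule Collect_restrict)
  moreover have "AE \<omega> in P. \<omega> \<in> ?Q \<longleftrightarrow> \<omega> \<in> B" using 1 B(3)
    by eventually_elim (rule trans)
  ultimately show ?thesis unfolding sets_G completed_def using B(2) by (intro CollectI conjI bexI[of _ B])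
qed

lemma measurable_G_AE:
  assumes g: "g \<in> measurable G M" and h: "h \<in> space P \<rightarrow> space M" and AE: "AE \<omega> in P. h \<omega> = g \<omega>"
  shows "h \<in> measurable G M"
proof (rule measurableI)
  fix A assume A: "A \<in> sets M"
  have "{\<omega>\<in>space P. g \<omega> \<in> A} \<in> sets G" using measurable_sets[OF g A] by (simp add: vimage_def Int_def conj_commute)
  moreover have "AE \<omega> in P. h \<omega> \<in> A \<longleftrightarrow> g \<omega> \<in> A" using AE by eventually_elim simp
  ultimately have "{\<omega>\<in>space P. h \<omega> \<in> A} \<in> sets G" by (rule sets_G_AE)
  then show "h -` A \<inter> space G \<in> sets G" by (simp add: vimage_def Int_def conj_commute)
qed (use h in auto)

lemma sets_\<Sigma>X_G: "sets \<Sigma>X \<subseteq> sets G"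
  using sets_\<Sigma>X by (auto simp: sets_G completed_def)

lemma X_G [measurable]: "0 \<le> t \<Longrightarrow> X t \<in> borel_measurable G"
  using X_\<Sigma>X[of t] sets_\<Sigma>X_G by (auto simp: measurable_def)

text \<open>\<open>hitting_event_sandwich\<close> is applied to \<open>P\<close> restricted to
  \<sigma>(X), so that both approximating events lie in \<sigma>(X) and differ by a null
  set.\<close>

lemma avoids_G:
  assumes a: "0 \<le> a" shows "{\<omega>\<in>space P. avoids x\<^sub>o (\<lambda>t. X t \<omega>) a b} \<in> sets G"
proof -
  let ?M = "restr_to_subalg P \<Sigma>X"
  have sub: "subalgebra P \<Sigma>X" using sets_\<Sigma>X by (simp add: subalgebra_def)
  have sp: "space ?M = space P" and st: "sets ?M = sets \<Sigma>X"
    using sub by (simp_all add: space_restr_to_subalg sets_restr_to_subalg)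
  have fin: "finite_measure ?M"
    by (rule finite_measure_restr_to_subalg) (use sub in \<open>auto intro: finite_measure_axioms\<close>)
  let ?H = "{\<omega>\<in>space P. \<exists>t\<in>{a..b}. X t \<omega> = x\<^sub>o}"
  have "\<exists>A\<in>sets ?M. \<exists>B\<in>sets ?M. A \<subseteq> {\<omega>\<in>space ?M. \<exists>t\<in>{a..b}. X t \<omega> = x\<^sub>o}
    \<and> {\<omega>\<in>space ?M. \<exists>t\<in>{a..b}. X t \<omega> = x\<^sub>o} \<subseteq> B \<and> emeasure ?M (B - A) = 0"
  proof (rule finite_measure.hitting_event_sandwich[OF fin _ _ a])
    show "X t \<in> borel_measurable ?M" if "0 \<le> t" for t
      using X_\<Sigma>X[OF that] st sp by (simp add: measurable_def)
    show "((\<lambda>s. X s \<omega>) \<longlongrightarrow> X t \<omega>) (at_right t)" if "\<omega> \<in> space ?M" "0 \<le> t" for \<omega> t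
      using that sp by (intro X_right_continuous) auto
  qed
  then obtain A B where AB: "A \<in> sets \<Sigma>X" "B \<in> sets \<Sigma>X" "A \<subseteq> ?H" "?H \<subseteq> B" "emeasure ?M (B - A) = 0"
    unfolding sp st by blast
  have "B - A \<in> sets \<Sigma>X" using AB by auto
  then have "emeasure P (B - A) = 0" using AB(5) by (simp add: emeasure_restr_to_subalg[OF sub])
  then have "B - A \<in> null_sets P" using \<open>B - A \<in> sets \<Sigma>X\<close> sets_\<Sigma>X by auto
  from AE_not_in[OF this] have "AE \<omega> in P. \<not> avoids x\<^sub>o (\<lambda>t. X t \<omega>) a b \<longleftrightarrow> \<omega> \<in> A"
    using AE_space
  proof eventually_elim
    case (elim \<omega>)
    have "\<not> avoids x\<^sub>o (\<lambda>t. X t \<omega>) a b \<longleftrightarrow> \<omega> \<in> ?H" using elim(2) by (simp add: avoids_def)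
    moreover have "\<omega> \<in> ?H \<longleftrightarrow> \<omega> \<in> A" using elim(1) AB(3,4) by blast
    ultimately show ?case by (rule trans)
  qed
  then have "AE \<omega> in P. avoids x\<^sub>o (\<lambda>t. X t \<omega>) a b \<longleftrightarrow> \<omega> \<notin> A" by eventually_elim auto
  moreover have "A \<in> sets G" using AB(1) sets_\<Sigma>X_G by auto
  then have "{\<omega>\<in>space P. \<omega> \<notin> A} \<in> sets G"
    using sets.compl_sets[of A G] by (simp add: set_diff_eq)
  ultimately show ?thesis by (rule sets_G_AE[rotated])
qed

section \<open>Almost sure regularity of the paths\<close>

lemma I_countable: "countable I" and I_pos: "0 \<notin> I"
  using I_cases by auto

text \<open>The null set in \<open>zeros_occupation\<close> may depend on t. Rational times have a
  common one, and approaching t from the right by rationals extends the identity, since L is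
  continuous and the occupation time grows at most at unit speed.\<close>

lemma AE_occupation:
  "AE \<omega> in P. \<forall>t\<ge>0. emeasure lborel (zero_set x\<^sub>o (\<lambda>t. X t \<omega>) \<inter> {0..t}) = ennreal (c * L t \<omega>)"
proof -
  have "AE \<omega> in P. \<forall>t\<in>\<rat>. 0 \<le> t \<longrightarrow> emeasure lborel (zero_set x\<^sub>o (\<lambda>t. X t \<omega>) \<inter> {0..t}) = ennreal (c * L t \<omega>)"
    using zeros_occupation by (auto simp: AE_ball_countable countable_rat)
  with AE_space show ?thesis
  proof eventually_elim
    case (elim \<omega>)
    let ?Z = "zero_set x\<^sub>o (\<lambda>t. X t \<omega>)"
    have Zb[measurable]: "?Z \<inter> {0..t} \<in> sets borel" for t by (intro zero_set_borel X_cadlag elim(1))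
    show ?case
    proof (intro allI impI)
      fix t :: real assume t: "0 \<le> t"
      have "\<exists>r\<in>\<rat>. t < r \<and> r < t + 1 / real (Suc k)" for k
        using Rats_dense_in_real[of t "t + 1 / real (Suc k)"] by auto
      then obtain r where r: "\<And>k. r k \<in> \<rat>" "\<And>k. t < r k" "\<And>k. r k < t + 1 / real (Suc k)" by metis
      have inv: "(\<lambda>k. t + 1 / real (Suc k)) \<longlonglongrightarrow> t + 0"
        using LIMSEQ_inverse_real_of_nat by (intro tendsto_add tendsto_const) (simp add: inverse_eq_divide)
      have rlim: "r \<longlonglongrightarrow> t"
      proof (rule tendsto_sandwich[OF _ _ tendsto_const])
        show "(\<lambda>k. t + 1 / real (Suc k)) \<longlonglongrightarrow> t" using inv by simp
      qed (use r in \<open>auto intro!: always_eventually less_imp_le simp del: of_nat_Suc\<close>)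
      have "(\<lambda>k. L (r k) \<omega>) \<longlonglongrightarrow> L t \<omega>"
        using L_continuous[OF elim(1)] rlim t r(2)
        by (intro continuous_on_tendsto_compose[where s = "{0..}" and f = "\<lambda>t. L t \<omega>"])
           (auto intro!: always_eventually less_imp_le elim: order.strict_trans1)
      then have lim: "(\<lambda>k. ennreal (c * L (r k) \<omega>)) \<longlonglongrightarrow> ennreal (c * L t \<omega>)"
        by (intro tendsto_ennrealI tendsto_mult tendsto_const)
      have eq: "emeasure lborel (?Z \<inter> {0..r k}) = ennreal (c * L (r k) \<omega>)" for k
        using elim(2) r(1,2)[of k] t by auto
      show "emeasure lborel (?Z \<inter> {0..t}) = ennreal (c * L t \<omega>)"
      proof (rule antisym)
        show "emeasure lborel (?Z \<inter> {0..t}) \<le> ennreal (c * L t \<omega>)"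
        proof (rule LIMSEQ_le_const[OF lim], intro exI allI impI)
          fix k
          show "emeasure lborel (?Z \<inter> {0..t}) \<le> ennreal (c * L (r k) \<omega>)"
            unfolding eq[symmetric] using r(2)[of k] by (intro emeasure_mono) auto
        qed
        have "(\<lambda>k. emeasure lborel (?Z \<inter> {0..t}) + ennreal (1 / real (Suc k))) \<longlonglongrightarrow> emeasure lborel (?Z \<inter> {0..t}) + ennreal 0"
          using LIMSEQ_inverse_real_of_nat by (intro tendsto_add tendsto_const tendsto_ennrealI) (simp add: inverse_eq_divide)
        then have conv: "(\<lambda>k. emeasure lborel (?Z \<inter> {0..t}) + ennreal (1 / real (Suc k))) \<longlonglongrightarrow> emeasure lborel (?Z \<inter> {0..t})"
          by simp
        show "ennreal (c * L t \<omega>) \<le> emeasure lborel (?Z \<inter> {0..t})"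
        proof (rule LIMSEQ_le[OF lim conv], intro exI allI impI)
          fix k
          have "emeasure lborel (?Z \<inter> {0..r k}) \<le> emeasure lborel ((?Z \<inter> {0..t}) \<union> {t..r k})"
            by (intro emeasure_mono) auto
          also have "\<dots> \<le> emeasure lborel (?Z \<inter> {0..t}) + emeasure lborel {t..r k}"
            by (intro emeasure_subadditive) auto
          also have "emeasure lborel {t..r k} \<le> ennreal (1 / real (Suc k))"
            using r(2,3)[of k] by (auto intro!: ennreal_leI simp del: of_nat_Suc)
          finally show "ennreal (c * L (r k) \<omega>) \<le> emeasure lborel (?Z \<inter> {0..t}) + ennreal (1 / real (Suc k))"
            unfolding eq by (simp add: add_left_mono)
        qed
      qed
    qed
  qed
qed

lemma long_n: "{e\<in>exc_paths x\<^sub>o. h < zeta x\<^sub>o e} \<in> sets n"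
  unfolding space_n[symmetric] by measurable

lemma n_long_finite: "0 < h \<Longrightarrow> emeasure n {e\<in>exc_paths x\<^sub>o. ennreal h < zeta x\<^sub>o e} < \<infinity>"
  using n_finite[of h] by (simp add: space_n)

lemma times_\<mu>\<^sub>0:
  assumes "S \<in> sets borel" "S \<subseteq> {0..}" "C \<in> sets n"
  shows "S \<times> C \<in> sets \<mu>\<^sub>0" "emeasure \<mu>\<^sub>0 (S \<times> C) = emeasure lborel S * emeasure n C"
proof -
  interpret n: sigma_finite_measure n by (rule sigma_finite_n)
  have "S \<in> sets (restrict_space lborel {0..})" using assms by (auto simp: sets_restrict_space_iff)
  then show "S \<times> C \<in> sets \<mu>\<^sub>0" "emeasure \<mu>\<^sub>0 (S \<times> C) = emeasure lborel S * emeasure n C"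
    using assms by (auto simp: n.emeasure_pair_measure_Times emeasure_restrict_space)
qed

lemma AE_good_path:
  "AE \<omega> in P. excursion_path_classes x\<^sub>o c (N \<omega>) (\<lambda>t. L t \<omega>) (\<lambda>t. X t \<omega>) I D"
proof -
  have 1: "AE \<omega> in P. \<forall>k. \<forall>s::real\<ge>0. emeasure (N \<omega>) ({s} \<times> {e\<in>exc_paths x\<^sub>o. ennreal (1 / real (Suc k)) < zeta x\<^sub>o e}) < 2"
    unfolding AE_all_countable
    by (intro allI AE_poisson_no_double_time[OF N_poisson sigma_finite_n] long_n n_long_finite) auto
  \<comment> \<open>The slice at local time 0 is a null set of the intensity.\<close>
  have 2: "AE \<omega> in P. emeasure (N \<omega>) ({0} \<times> exc_paths x\<^sub>o) = 0"
    using times_\<mu>\<^sub>0[of "{0}" "exc_paths x\<^sub>o"] sets.top[of n]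
    by (intro AE_poisson_point_process_null[OF N_poisson]) (auto simp: space_n)
  have 3: "AE \<omega> in P. \<forall>i\<in>I. \<forall>i'\<in>I. i \<noteq> i' \<longrightarrow> emeasure (N \<omega>) ({0..} \<times> (D i \<inter> D i')) = 0"
  proof -
    have "AE \<omega> in P. emeasure (N \<omega>) ({0..} \<times> (D i \<inter> D i')) = 0" if "i \<in> I" "i' \<in> I" "i \<noteq> i'" for i i'
      using times_\<mu>\<^sub>0[of "{0..}" "D i \<inter> D i'"] D_sets that D_disjoint[OF that]
      by (intro AE_poisson_point_process_null[OF N_poisson]) auto
    then show ?thesis using I_countable by (auto simp: AE_ball_countable)
  qed
  show ?thesis
    using 1 2 3 eta_right_continuous eta_strict_mono L_inverse X_excursions dL_support AE_occupation AE_space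
  proof eventually_elim
    case (elim \<omega>)
    have st: "sets (N \<omega>) = sets \<mu>\<^sub>0" using elim by (intro sets_poisson_point_process[OF N_poisson])
    show ?case
    proof
      show "sets (N \<omega>) = sets (restrict_space borel {0..} \<Otimes>\<^sub>M exc_space x\<^sub>o)" using st sets_\<mu>\<^sub>0 by simp
      show "point_measure (N \<omega>)" using elim by (intro point_measure_poisson_point_process[OF N_poisson])
      show "0 \<le> c" by (rule c_nonneg)
      show "mono_on {0..} (\<lambda>t. L t \<omega>)" using elim by (intro L_mono)
      show "continuous_on {0..} (\<lambda>t. L t \<omega>)" using elim by (intro L_continuous)
      show "cadlag (\<lambda>t. X t \<omega>)" using elim by (intro X_cadlag)
      show "0 \<le> L t \<omega>" if "0 \<le> t" for t using elim that by (intro L_nonneg)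
      show "D i \<in> sets (exc_space x\<^sub>o)" if "i \<in> I" for i using D_sets[OF that] sets_n by simp
      show "0 \<notin> I" by (rule I_pos)
      \<comment> \<open>The classes overlap in \<open>n\<close>-null sets only, so almost surely no
        atom falls into two of them.\<close>
      show "i = i'" if p: "p \<in> atoms (N \<omega>)" and i: "i \<in> I" "i' \<in> I" "snd p \<in> D i" "snd p \<in> D i'" for p i i'
      proof (rule ccontr)
        assume ne: "i \<noteq> i'"
        have "fst p \<in> {0..}" using p sets_eq_imp_space_eq[OF st]
          by (auto simp: atoms_def space_pair_measure space_restrict_space)
        then have "{p} \<subseteq> {0..} \<times> (D i \<inter> D i')" using i by (auto simp: mem_Times_iff)
        moreover have "{0..} \<times> (D i \<inter> D i') \<in> sets (N \<omega>)"
          unfolding st using D_sets i by (intro times_\<mu>\<^sub>0) auto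
        ultimately have "emeasure (N \<omega>) {p} \<le> emeasure (N \<omega>) ({0..} \<times> (D i \<inter> D i'))"
          by (rule emeasure_mono)
        then show False using elim(3) i ne p by (auto simp: atoms_def)
      qed
    qed (use elim in \<open>auto simp: case_prod_beta\<close>)
  qed
qed

end

lemma (in excursion_path) atom_time_pos:
  assumes A: "(s, e) \<in> A" shows "0 < s"
proof (rule ccontr)
  assume "\<not> 0 < s"
  then have A0: "(0, e) \<in> A" "e \<in> exc_paths x\<^sub>o" using atomsD[OF A] A by auto
  then have "{(0, e)} \<subseteq> {0} \<times> exc_paths x\<^sub>o" by auto
  then have "emeasure \<mu> {(0, e)} \<le> emeasure \<mu> ({0} \<times> exc_paths x\<^sub>o)"
    by (intro emeasure_mono times_sets exc_paths_sets) auto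
  then show False using none_at_0 emeasure_atom[OF A0(1)] by simp
qed

text \<open>With finitely many jumps up to local time 1 and no drift, \<open>\<eta>\<close> would
  vanish on an initial interval and fail to be strictly increasing.\<close>

lemma (in excursion_path) jumps_infinite:
  assumes "c = 0"
  shows "\<not> finite (A \<inter> {0..1} \<times> exc_paths x\<^sub>o)"
proof
  assume fin: "finite (A \<inter> {0..1} \<times> exc_paths x\<^sub>o)"
  note pos = atom_time_pos
  have eta0: "\<eta> s = 0" if "\<And>p. p \<in> A \<Longrightarrow> s < fst p" for s
  proof -
    have "(\<integral>\<^sup>+p. \<zeta> (snd p) * indicator {..s} (fst p) \<partial>count_space A) = (\<integral>\<^sup>+p. 0 \<partial>count_space A)"
      using that by (intro nn_integral_cong) (auto simp: indicator_def not_le[symmetric])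
    then show ?thesis unfolding eta_eq using assms by simp
  qed
  \<comment> \<open>The element 1 keeps T nonempty and bounds d below all atoms after local time
    1.\<close>
  define T where "T = insert 1 (fst ` (A \<inter> {0..1} \<times> exc_paths x\<^sub>o))"
  have T: "finite T" "T \<noteq> {}" "\<And>t. t \<in> T \<Longrightarrow> 0 < t" using fin pos by (auto simp: T_def)
  define d where "d = Min T"
  have d: "0 < d" "\<And>t. t \<in> T \<Longrightarrow> d \<le> t" using T by (auto simp: d_def)
  have early: "s < fst p" if "p \<in> A" "s < d" for p s
  proof (cases "fst p \<le> 1")
    case True
    have "p \<in> A \<inter> {0..1} \<times> exc_paths x\<^sub>o"
      using True that(1) atomsD[of "fst p" "snd p"] by (auto simp: mem_Times_iff)
    then have "fst p \<in> T" unfolding T_def by blast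
    then show ?thesis using d(2)[of "fst p"] that by simp
  next
    case False
    then show ?thesis using d(2)[of 1] that by (simp add: T_def)
  qed
  have "d / 3 < d" "d / 2 < d" using d by auto
  then have "\<eta> (d / 3) = 0" "\<eta> (d / 2) = 0" using early by (intro eta0; blast)+
  then show False using eta_less[of "d / 3" "d / 2"] d by simp
qed

text \<open>Finiteness of \<open>\<eta> 1\<close> is thereby expressed by the local time alone. The
  strict inequality is correct because right continuity keeps \<open>\<eta>\<close> finite slightly
  beyond 1.\<close>

lemma (in excursion_path) eta_1_finite_iff: "\<eta> 1 < \<infinity> \<longleftrightarrow> (\<exists>k::nat. 1 < l (real k))"
proof
  assume fin: "\<eta> 1 < \<infinity>"
  have "\<forall>\<^sub>F r in at_right 1. \<eta> r < \<infinity>" using eta_rc[of 1] fin by (intro order_tendstoD(2)) auto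
  then obtain b where b: "1 < b" "\<And>r. 1 < r \<Longrightarrow> r < b \<Longrightarrow> \<eta> r < \<infinity>"
    unfolding eventually_at_right_field by blast
  define r where "r = (1 + b) / 2"
  have r: "1 < r" "\<eta> r < \<infinity>" using b by (auto simp: r_def)
  then obtain t where t: "0 \<le> t" "\<eta> r = ennreal t" by (cases "\<eta> r") auto
  obtain k :: nat where "t \<le> real k" using real_arch_simple by blast
  then have "l t \<le> l (real k)" using t by (intro mono_onD[OF l_mono]) auto
  then show "\<exists>k::nat. 1 < l (real k)" using l_eta[of r t] r t by (intro exI[of _ k]) auto
next
  assume "\<exists>k::nat. 1 < l (real k)"
  then obtain k :: nat where "1 < l (real k)" by blast
  then have "\<eta> 1 \<le> ennreal (real k)" by (intro eta_less_iff(1)) auto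
  then show "\<eta> 1 < \<infinity>" by (rule le_less_trans) simp
qed

section \<open>Excursion functionals are measurable for the completion of \<sigma>(X)\<close>

context time_changed_regenerative_process
begin

abbreviation XX :: "'w \<Rightarrow> real \<Rightarrow> 's" where "XX \<omega> \<equiv> \<lambda>t. X t \<omega>"

lemma avoids_pred: "0 \<le> a \<Longrightarrow> Measurable.pred G (\<lambda>\<omega>. avoids x\<^sub>o (XX \<omega>) a b)"
  unfolding pred_def using avoids_G by simp

lemma in_exc_pred [measurable]: "Measurable.pred G (\<lambda>\<omega>. in_exc x\<^sub>o (XX \<omega>) t)"
proof -
  have "countable {a\<in>\<rat>. 0 < a \<and> a < t}" by (rule countable_subset[OF _ countable_rat]) auto
  then have "{\<omega>\<in>space G. \<exists>a\<in>{a\<in>\<rat>. 0 < a \<and> a < t}. avoids x\<^sub>o (XX \<omega>) a t} \<in> sets G"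
    using avoids_G by (intro sets.sets_Collect_countable_Ex') auto
  moreover have "(\<exists>a\<in>{a\<in>\<rat>. 0 < a \<and> a < t}. avoids x\<^sub>o (XX \<omega>) a t) \<longleftrightarrow> in_exc x\<^sub>o (XX \<omega>) t" for \<omega>
    by (auto simp: in_exc_def)
  ultimately show ?thesis unfolding pred_def by simp
qed

lemma exc_begin_G [measurable]: "(\<lambda>\<omega>. exc_begin x\<^sub>o (XX \<omega>) t) \<in> borel_measurable G"
proof (rule borel_measurableI_less)
  fix y
  have "countable {a\<in>\<rat>. 0 < a \<and> a < t \<and> a < y}" by (rule countable_subset[OF _ countable_rat]) auto
  then have 1: "{\<omega>\<in>space G. \<exists>a\<in>{a\<in>\<rat>. 0 < a \<and> a < t \<and> a < y}. avoids x\<^sub>o (XX \<omega>) a t} \<in> sets G"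
    using avoids_G by (intro sets.sets_Collect_countable_Ex') auto
  \<comment> \<open>Without an excursion at t the infimum is over the empty set, an unspecified but
    fixed real number; it is treated as a case of its own.\<close>
  have eq: "exc_begin x\<^sub>o (XX \<omega>) t < y \<longleftrightarrow> (if in_exc x\<^sub>o (XX \<omega>) t
      then \<exists>a\<in>{a\<in>\<rat>. 0 < a \<and> a < t \<and> a < y}. avoids x\<^sub>o (XX \<omega>) a t else Inf {} < y)" for \<omega>
  proof (cases "in_exc x\<^sub>o (XX \<omega>) t")
    case True
    then have "{a\<in>\<rat>. 0 < a \<and> a < t \<and> avoids x\<^sub>o (XX \<omega>) a t} \<noteq> {}" by (auto simp: in_exc_def)
    moreover have "bdd_below {a\<in>\<rat>. 0 < a \<and> a < t \<and> avoids x\<^sub>o (XX \<omega>) a t}" by (intro bdd_belowI[of _ 0]) auto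
    ultimately show ?thesis using True by (auto simp: exc_begin_def cInf_less_iff)
  next
    case False
    then have empty: "{a\<in>\<rat>. 0 < a \<and> a < t \<and> avoids x\<^sub>o (XX \<omega>) a t} = {}" by (auto simp: in_exc_def)
    show ?thesis using False unfolding exc_begin_def empty by simp
  qed
  have [measurable]: "Measurable.pred G (\<lambda>\<omega>. \<exists>a\<in>{a\<in>\<rat>. 0 < a \<and> a < t \<and> a < y}. avoids x\<^sub>o (XX \<omega>) a t)"
    unfolding pred_def by (rule 1)
  show "{\<omega>\<in>space G. exc_begin x\<^sub>o (XX \<omega>) t < y} \<in> sets G"
    unfolding eq by measurable
qed

lemma exc_end_G:
  assumes t: "0 \<le> t" shows "(\<lambda>\<omega>. exc_end x\<^sub>o (XX \<omega>) t) \<in> borel_measurable G"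
proof -
  \<comment> \<open>The random index set becomes a fixed countable one, with value 0 at the excluded
    indices.\<close>
  have eq: "exc_end x\<^sub>o (XX \<omega>) t = (SUP b\<in>{b\<in>\<rat>. t \<le> b}. if avoids x\<^sub>o (XX \<omega>) t b then ennreal b else 0)" for \<omega>
    unfolding exc_end_def
  proof (intro antisym SUP_least)
    fix b assume "b \<in> {b\<in>\<rat>. t \<le> b \<and> avoids x\<^sub>o (XX \<omega>) t b}"
    then show "ennreal b \<le> (SUP b\<in>{b\<in>\<rat>. t \<le> b}. if avoids x\<^sub>o (XX \<omega>) t b then ennreal b else 0)"
      by (intro SUP_upper2[of b]) auto
  next
    fix b assume "b \<in> {b\<in>\<rat>. t \<le> b}"
    then show "(if avoids x\<^sub>o (XX \<omega>) t b then ennreal b else 0) \<le> (SUP b\<in>{b\<in>\<rat>. t \<le> b \<and> avoids x\<^sub>o (XX \<omega>) t b}. ennreal b)"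
      by (auto intro: SUP_upper)
  qed
  have cnt: "countable {b\<in>\<rat>. t \<le> b}" by (rule countable_subset[OF _ countable_rat]) auto
  have "(\<lambda>\<omega>. if avoids x\<^sub>o (XX \<omega>) t b then ennreal b else 0) \<in> borel_measurable G" for b
    by (intro measurable_If_set measurable_If avoids_G[simplified] measurable_const; (use avoids_G[OF t] in simp)?)
  then show ?thesis unfolding eq by (intro borel_measurable_SUP cnt)
qed

lemma exc_end_tq_G [measurable]: "(\<lambda>\<omega>. exc_end x\<^sub>o (XX \<omega>) (pos_rat k)) \<in> borel_measurable G"
  using pos_rat_pos[of k] by (intro exc_end_G) simp

lemma exc_new_pred [measurable]: "Measurable.pred G (\<lambda>\<omega>. exc_new x\<^sub>o (XX \<omega>) k)"
proof -
  have [measurable]: "Measurable.pred G (\<lambda>\<omega>. avoids x\<^sub>o (XX \<omega>) (min (pos_rat m) (pos_rat k)) b)" for m b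
    using pos_rat_pos by (intro avoids_pred) (simp add: less_imp_le)
  show ?thesis unfolding exc_new_def by measurable
qed

lemma X_random_time_G:
  assumes [measurable]: "\<rho> \<in> borel_measurable G"
  shows "(\<lambda>\<omega>. X (max 0 (\<rho> \<omega>)) \<omega>) \<in> borel_measurable G"
proof -
  have "(\<lambda>p. X (max 0 (snd p)) (fst p)) \<in> borel_measurable (G \<Otimes>\<^sub>M borel)"
    by (intro measurable_right_continuous_process X_G X_right_continuous) auto
  from measurable_compose[OF _ this, of "\<lambda>\<omega>. (\<omega>, \<rho> \<omega>)" G] show ?thesis by simp
qed

lemma exc_from_pred:
  assumes i: "i \<in> I"
  shows "Measurable.pred G (\<lambda>\<omega>. in_exc x\<^sub>o (XX \<omega>) (pos_rat k) \<and> exc_from x\<^sub>o (XX \<omega>) (pos_rat k) \<in> D i)"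
proof -
  let ?t = "pos_rat k"
  \<comment> \<open>The truncation at 0 keeps the evaluation time where \<open>X\<close> is right
    continuous. Where there is an excursion it changes nothing, as the beginning is
    nonnegative.\<close>
  define \<phi> where "\<phi> \<omega> = (\<lambda>u\<in>{0..}. if ennreal (exc_begin x\<^sub>o (XX \<omega>) ?t + u) < exc_end x\<^sub>o (XX \<omega>) ?t
    then X (max 0 (exc_begin x\<^sub>o (XX \<omega>) ?t + u)) \<omega> else x\<^sub>o)" for \<omega>
  have \<phi>[measurable]: "\<phi> \<in> measurable G (Pi\<^sub>M {0..} (\<lambda>_. borel))"
    unfolding \<phi>_def
  proof (rule measurable_restrict)
    fix u :: real
    have [measurable]: "(\<lambda>\<omega>. X (max 0 (exc_begin x\<^sub>o (XX \<omega>) ?t + u)) \<omega>) \<in> borel_measurable G"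
      by (rule X_random_time_G) measurable
    show "(\<lambda>\<omega>. if ennreal (exc_begin x\<^sub>o (XX \<omega>) ?t + u) < exc_end x\<^sub>o (XX \<omega>) ?t
      then X (max 0 (exc_begin x\<^sub>o (XX \<omega>) ?t + u)) \<omega> else x\<^sub>o) \<in> borel_measurable G"
      by measurable
  qed
  have "D i \<in> sets (exc_space x\<^sub>o)" using D_sets[OF i] sets_n by simp
  \<comment> \<open>\<open>D i\<close> belongs to a trace sigma-algebra; it is replaced by a set of
    the product sigma-algebra that agrees with it on excursion paths.\<close>
  then obtain D' where D': "D' \<in> sets (Pi\<^sub>M {0..} (\<lambda>_. borel))" "D i = D' \<inter> {x. cadlag x} \<inter> exc_paths x\<^sub>o"
    unfolding exc_space_def path_space_def by (auto simp: sets_restrict_space)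
  have exc_cad: "cadlag e" if "e \<in> exc_paths x\<^sub>o" for e
    using that by (simp add: exc_paths_def path_space_def space_restrict_space)
  note [measurable] = D'(1)
  have "{\<omega>\<in>space P. in_exc x\<^sub>o (XX \<omega>) ?t \<and> \<phi> \<omega> \<in> D'} = {\<omega>\<in>space G. in_exc x\<^sub>o (XX \<omega>) ?t \<and> \<phi> \<omega> \<in> D'}" by simp
  also have "\<dots> \<in> sets G" by measurable
  finally have meas: "{\<omega>\<in>space P. in_exc x\<^sub>o (XX \<omega>) ?t \<and> \<phi> \<omega> \<in> D'} \<in> sets G" .
  have "AE \<omega> in P. (in_exc x\<^sub>o (XX \<omega>) ?t \<and> exc_from x\<^sub>o (XX \<omega>) ?t \<in> D i) \<longleftrightarrow> (in_exc x\<^sub>o (XX \<omega>) ?t \<and> \<phi> \<omega> \<in> D')"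
    using AE_good_path
  proof eventually_elim
    case (elim \<omega>)
    interpret p: excursion_path_classes x\<^sub>o c "N \<omega>" "\<lambda>t. L t \<omega>" "XX \<omega>" I D f by (rule elim)
    show ?case
    proof (rule conj_cong[OF refl])
      assume "in_exc x\<^sub>o (XX \<omega>) ?t"
      then obtain e where e: "(L ?t \<omega>, e) \<in> p.A" "0 \<le> exc_begin x\<^sub>o (XX \<omega>) ?t" "exc_from x\<^sub>o (XX \<omega>) ?t = e"
        by (rule p.in_excD) auto
      have "\<phi> \<omega> = e" unfolding e(3)[symmetric] \<phi>_def exc_from_def using e(2) by (intro ext) auto
      moreover have "e \<in> exc_paths x\<^sub>o" using p.atomsD[OF e(1)] by simp
      ultimately show "exc_from x\<^sub>o (XX \<omega>) ?t \<in> D i \<longleftrightarrow> \<phi> \<omega> \<in> D'" using e(3) D'(2) exc_cad by auto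
    qed
  qed
  from sets_G_AE[OF meas this] show ?thesis unfolding pred_def by simp
qed

section \<open>The local time as a functional of the process\<close>

lemma L_G_pos:
  assumes c: "0 < c" and t: "0 \<le> t" shows "(\<lambda>\<omega>. L t \<omega>) \<in> borel_measurable G"
proof (rule measurable_G_AE)
  \<comment> \<open>The occupation time of \<open>x\<^sub>o\<close> up to t, written as an integral
    of a jointly measurable function.\<close>
  define U where "U \<omega> = (\<integral>\<^sup>+s. indicator ({x\<^sub>o} \<times> {0..t}) (X (max 0 s) \<omega>, s) \<partial>lborel)" for \<omega>
  have [measurable]: "(\<lambda>p. X (max 0 (snd p)) (fst p)) \<in> borel_measurable (G \<Otimes>\<^sub>M lborel)"
    using measurable_right_continuous_process[of X G] X_G X_right_continuous
    by (subst measurable_cong_sets[OF sets_pair_measure_cong[OF refl sets_lborel] refl]) auto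
  have [measurable]: "U \<in> borel_measurable G"
    unfolding U_def by (intro lborel.borel_measurable_nn_integral) (simp add: case_prod_beta, measurable)
  show "(\<lambda>\<omega>. enn2real (U \<omega>) / c) \<in> borel_measurable G" by measurable
  show "AE \<omega> in P. L t \<omega> = enn2real (U \<omega>) / c"
    using AE_occupation AE_space
  proof eventually_elim
    case (elim \<omega>)
    have "U \<omega> = (\<integral>\<^sup>+s. indicator (zero_set x\<^sub>o (XX \<omega>) \<inter> {0..t}) s \<partial>lborel)"
      unfolding U_def by (intro nn_integral_cong) (auto simp: indicator_def zero_set_def)
    also have "\<dots> = ennreal (c * L t \<omega>)"
      using zero_set_borel[OF X_cadlag[OF elim(2)]] elim(1) t by (subst nn_integral_indicator) auto
    finally show ?case using c L_nonneg[OF t elim(2)] by simp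
  qed
qed simp

text \<open>A finite excursion measure would leave only finitely many points of \<open>N\<close> up
  to local time 1, which \<open>jumps_infinite\<close> excludes.\<close>

lemma n_infinite:
  assumes "c = 0" shows "emeasure n (space n) = \<infinity>"
proof (rule ccontr)
  assume "\<not> ?thesis"
  then have fin: "emeasure n (space n) < \<infinity>" by (simp add: less_top[symmetric])
  have \<mu>: "{0..1} \<times> exc_paths x\<^sub>o \<in> sets \<mu>\<^sub>0" "emeasure \<mu>\<^sub>0 ({0..1} \<times> exc_paths x\<^sub>o) < \<infinity>"
    using times_\<mu>\<^sub>0[of "{0..1}" "exc_paths x\<^sub>o"] sets.top[of n] fin by (auto simp: space_n)
  have "AE \<omega> in P. \<exists>k::nat. emeasure (N \<omega>) ({0..1} \<times> exc_paths x\<^sub>o) = of_nat k"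
    by (rule AE_poisson_variable_nat[OF poisson_variable_poisson_point_process[OF N_poisson \<mu>]])
  with AE_good_path have "AE \<omega> in P. False"
  proof eventually_elim
    case (elim \<omega>)
    interpret p: excursion_path_classes x\<^sub>o c "N \<omega>" "\<lambda>t. L t \<omega>" "XX \<omega>" I D f by (rule elim)
    obtain k :: nat where "emeasure (N \<omega>) ({0..1} \<times> exc_paths x\<^sub>o) = of_nat k" using elim by blast
    moreover have "{0..1} \<times> exc_paths x\<^sub>o \<in> sets (N \<omega>)" by (intro p.times_sets p.exc_paths_sets) auto
    ultimately have "emeasure (count_space p.A) (p.A \<inter> {0..1} \<times> exc_paths x\<^sub>o) = of_nat k"
      using p.emeasure_count by simp
    then have "finite (p.A \<inter> {0..1} \<times> exc_paths x\<^sub>o)"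
      by (cases "finite (p.A \<inter> {0..1} \<times> exc_paths x\<^sub>o)") (auto simp: emeasure_count_space_infinite)
    then show False using p.jumps_infinite[OF assms] by simp
  qed
  then show False by simp
qed

text \<open>Continuity from below as the length threshold shrinks. It supplies thresholds whose
  masses grow as fast as the law of large numbers requires.\<close>

lemma long_measure_unbounded:
  assumes "c = 0"
  shows "\<exists>h>0. b \<le> measure n {e\<in>exc_paths x\<^sub>o. ennreal h < zeta x\<^sub>o e}"
proof -
  let ?C = "\<lambda>k. {e\<in>exc_paths x\<^sub>o. ennreal (1 / real (Suc k)) < zeta x\<^sub>o e}"
  have "incseq ?C"
  proof (intro incseq_SucI subsetI)
    fix k e assume e: "e \<in> ?C k"
    have "ennreal (1 / real (Suc (Suc k))) \<le> ennreal (1 / real (Suc k))"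
      by (intro ennreal_leI divide_left_mono) auto
    also have "\<dots> < zeta x\<^sub>o e" using e by simp
    finally show "e \<in> ?C (Suc k)" using e by simp
  qed
  then have "(\<lambda>k. emeasure n (?C k)) \<longlonglongrightarrow> emeasure n (\<Union>k. ?C k)"
    using long_n by (intro Lim_emeasure_incseq) auto
  also have "(\<Union>k. ?C k) = space n"
  proof -
    have "\<exists>k::nat. ennreal (1 / real (Suc k)) < zeta x\<^sub>o e" if "e \<in> exc_paths x\<^sub>o" for e
    proof (cases "zeta x\<^sub>o e")
      case (real r)
      then have "0 < r" using that by (simp add: exc_paths_def)
      then obtain k :: nat where "1 / real (Suc k) < r" using nat_approx_posE by blast
      then show ?thesis using real by (auto simp: ennreal_less_iff)
    qed auto
    then show ?thesis by (auto simp: space_n)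
  qed
  finally have "(\<lambda>k. emeasure n (?C k)) \<longlonglongrightarrow> \<infinity>" using n_infinite[OF assms] by simp
  then have "\<forall>\<^sub>F k in sequentially. ennreal b < emeasure n (?C k)"
    by (rule order_tendstoD(1)) simp
  then obtain k where k: "ennreal b < emeasure n (?C k)" by (auto simp: eventually_sequentially)
  have fin: "emeasure n (?C k) = ennreal (measure n (?C k))"
    using n_long_finite[of "1 / real (Suc k)"] by (intro emeasure_eq_ennreal_measure) (auto simp del: of_nat_Suc)
  show ?thesis
  proof (intro exI[of _ "1 / real (Suc k)"] conjI)
    show "b \<le> measure n (?C k)"
      using k unfolding fin by (cases "0 \<le> b") (auto simp: ennreal_less_iff intro: order_trans[of b 0])
  qed simp
qed

text \<open>Without stagnancy, the local time is the normalised number of long excursions.\<close>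

lemma L_G_zero:
  assumes c: "c = 0" and t: "0 \<le> t" shows "(\<lambda>\<omega>. L t \<omega>) \<in> borel_measurable G"
proof -
  \<comment> \<open>Masses of at least 2^k make the variances r / m k of the normalised counts
    summable.\<close>
  have "\<exists>h>0. 2 ^ k \<le> measure n {e\<in>exc_paths x\<^sub>o. ennreal h < zeta x\<^sub>o e}" for k :: nat
    by (rule long_measure_unbounded[OF c])
  then obtain h where h: "\<And>k. 0 < h k" "\<And>k::nat. 2 ^ k \<le> measure n {e\<in>exc_paths x\<^sub>o. ennreal (h k) < zeta x\<^sub>o e}" by metis
  define C where "C k = {e\<in>exc_paths x\<^sub>o. ennreal (h k) < zeta x\<^sub>o e}" for k
  define m where "m k = measure n (C k)" for k
  have C: "C k \<in> sets n" "emeasure n (C k) < \<infinity>" for k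
    using long_n n_long_finite[OF h(1)] by (auto simp: C_def)
  have m: "2 ^ k \<le> m k" "0 < m k" "emeasure n (C k) = ennreal (m k)" for k
    using h(2)[of k] C(2)[of k]
    by (auto simp: m_def C_def[symmetric] intro: emeasure_eq_ennreal_measure order.strict_trans2[of 0 "2 ^ k"])
  have lln: "AE \<omega> in P. (\<forall>k. emeasure (N \<omega>) ({0..r} \<times> C k) < \<infinity>) \<and>
      (\<lambda>k. enn2real (emeasure (N \<omega>) ({0..r} \<times> C k)) / m k) \<longlonglongrightarrow> r" if r: "0 \<le> r" for r
  proof -
    let ?Y = "\<lambda>k \<omega>. emeasure (N \<omega>) ({0..r} \<times> C k)"
    have st: "{0..r} \<times> C k \<in> sets \<mu>\<^sub>0" "emeasure \<mu>\<^sub>0 ({0..r} \<times> C k) = ennreal (r * m k)" for k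
      using times_\<mu>\<^sub>0[of "{0..r}" "C k"] C[of k] r m[of k] by (auto simp: ennreal_mult'')
    have meas: "measure \<mu>\<^sub>0 ({0..r} \<times> C k) = r * m k" for k
      using r m(2)[of k] by (simp add: measure_def st)
    have Y: "poisson_variable (r * m k) (?Y k)" for k
      using poisson_variable_poisson_point_process[OF N_poisson st(1)] by (simp add: st meas)
    then have [measurable]: "?Y k \<in> borel_measurable P" for k by (simp add: poisson_variable_def)
    have nat: "AE \<omega> in P. \<forall>k. \<exists>j::nat. ?Y k \<omega> = of_nat j"
      using AE_poisson_variable_nat[OF Y] by (simp add: AE_all_countable)
    \<comment> \<open>The expected sum of the squared deviations is finite, so almost surely the
      deviations are square summable and tend to 0.\<close>
    have "(\<integral>\<^sup>+\<omega>. (\<Sum>k. ennreal ((enn2real (?Y k \<omega>) / m k - r)\<^sup>2)) \<partial>P)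
        = (\<Sum>k. \<integral>\<^sup>+\<omega>. ennreal ((enn2real (?Y k \<omega>) / m k - r)\<^sup>2) \<partial>P)"
      by (rule nn_integral_suminf) measurable
    also have "\<dots> \<le> (\<Sum>k. ennreal (r * (1/2) ^ k))"
    proof (intro suminf_le summableI)
      fix k
      have eq: "(y / m k - r)\<^sup>2 = (1 / m k)\<^sup>2 * (y - r * m k)\<^sup>2" for y
      proof -
        have "y / m k - r = 1 / m k * (y - r * m k)" using m(2)[of k] by (simp add: field_simps)
        then show ?thesis by (simp only: power_mult_distrib)
      qed
      have "(\<integral>\<^sup>+\<omega>. ennreal ((enn2real (?Y k \<omega>) / m k - r)\<^sup>2) \<partial>P)
          = (\<integral>\<^sup>+\<omega>. ennreal ((1 / m k)\<^sup>2) * ennreal ((enn2real (?Y k \<omega>) - r * m k)\<^sup>2) \<partial>P)"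
        unfolding eq by (simp add: ennreal_mult')
      also have "\<dots> = ennreal ((1 / m k)\<^sup>2) * ennreal (r * m k)"
        by (subst nn_integral_cmult) (simp_all add: poisson_variance[OF Y])
      also have "\<dots> = ennreal (r / m k)"
        using m(2)[of k] r by (simp add: ennreal_mult'[symmetric] power2_eq_square)
      also have "\<dots> \<le> ennreal (r * (1/2) ^ k)"
      proof (intro ennreal_leI)
        have "r / m k \<le> r / 2 ^ k" using r m[of k] by (intro divide_left_mono) auto
        then show "r / m k \<le> r * (1/2) ^ k" by (simp add: power_one_over)
      qed
      finally show "(\<integral>\<^sup>+\<omega>. ennreal ((enn2real (?Y k \<omega>) / m k - r)\<^sup>2) \<partial>P) \<le> ennreal (r * (1/2) ^ k)" .
    qed
    also have "\<dots> = ennreal (r * (1 / (1 - 1/2)))"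
      using r by (intro suminf_ennreal_eq sums_mult geometric_sums) auto
    also have "\<dots> < \<infinity>" by simp
    finally have "(\<integral>\<^sup>+\<omega>. (\<Sum>k. ennreal ((enn2real (?Y k \<omega>) / m k - r)\<^sup>2)) \<partial>P) \<noteq> \<infinity>" by simp
    then have "AE \<omega> in P. (\<Sum>k. ennreal ((enn2real (?Y k \<omega>) / m k - r)\<^sup>2)) \<noteq> \<infinity>"
      by (intro nn_integral_noteq_infinite) measurable
    with nat show ?thesis
    proof eventually_elim
      case (elim \<omega>)
      have "summable (\<lambda>k. (enn2real (?Y k \<omega>) / m k - r)\<^sup>2)"
        using elim(2) by (intro summable_suminf_not_top) auto
      then have "(\<lambda>k. (enn2real (?Y k \<omega>) / m k - r)\<^sup>2) \<longlonglongrightarrow> 0" by (rule summable_LIMSEQ_zero)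
      then have "(\<lambda>k. sqrt ((enn2real (?Y k \<omega>) / m k - r)\<^sup>2)) \<longlonglongrightarrow> sqrt 0" by (rule tendsto_real_sqrt)
      then have "(\<lambda>k. enn2real (?Y k \<omega>) / m k - r) \<longlonglongrightarrow> 0" by (simp add: tendsto_rabs_zero_iff)
      moreover have "?Y k \<omega> < \<infinity>" for k using elim(1) by (metis of_nat_less_top infinity_ennreal_def)
      ultimately show ?case by (simp add: LIM_zero_iff)
    qed
  qed
  define K where "K k \<omega> = (\<Sum>j. if exc_new x\<^sub>o (XX \<omega>) j \<and> exc_begin x\<^sub>o (XX \<omega>) (pos_rat j) < t \<and>
      ennreal (h k) < exc_end x\<^sub>o (XX \<omega>) (pos_rat j) - ennreal (exc_begin x\<^sub>o (XX \<omega>) (pos_rat j)) then 1 else 0 :: ennreal)" for k \<omega>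
  have [measurable]: "K k \<in> borel_measurable G" for k
    unfolding K_def by (rule borel_measurable_suminf_order) measurable
  have "AE \<omega> in P. \<forall>r\<in>\<rat>. 0 \<le> r \<longrightarrow> (\<forall>k. emeasure (N \<omega>) ({0..r} \<times> C k) < \<infinity>) \<and>
      (\<lambda>k. enn2real (emeasure (N \<omega>) ({0..r} \<times> C k)) / m k) \<longlonglongrightarrow> r"
    using lln by (auto simp: AE_ball_countable countable_rat)
  with AE_good_path have lim: "AE \<omega> in P. (\<lambda>k. enn2real (K k \<omega>) / m k) \<longlonglongrightarrow> L t \<omega>"
  proof eventually_elim
    case (elim \<omega>)
    interpret p: excursion_path_classes x\<^sub>o c "N \<omega>" "\<lambda>t. L t \<omega>" "XX \<omega>" I D f by (rule elim)
    have K: "emeasure (N \<omega>) ({0..<L t \<omega>} \<times> C k) \<le> K k \<omega>" "K k \<omega> \<le> emeasure (N \<omega>) ({0..L t \<omega>} \<times> C k)" for k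
      unfolding K_def C_def by (intro p.long_excursions_before t)+
    have sets: "{0..r} \<times> C k \<in> sets (N \<omega>)" "{0..<r} \<times> C k \<in> sets (N \<omega>)" for r k
      unfolding C_def by (intro p.times_sets p.long_sets; auto)+
    have le: "K k \<omega> \<le> emeasure (N \<omega>) ({0..r} \<times> C k)" if "L t \<omega> < r" for r k
      using that by (intro order_trans[OF K(2)] emeasure_mono sets) auto
    have ge: "emeasure (N \<omega>) ({0..r} \<times> C k) \<le> K k \<omega>" if "r < L t \<omega>" for r k
      using that by (intro order_trans[OF _ K(1)] emeasure_mono sets) auto
    have Lt: "0 \<le> L t \<omega>" by (rule p.l_nonneg[OF t])
    have Kfin: "K k \<omega> < \<infinity>" for k
    proof -
      obtain r where r: "r \<in> \<rat>" "L t \<omega> < r" using Rats_dense_in_real[of "L t \<omega>" "L t \<omega> + 1"] by auto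
      then have "0 \<le> r" using Lt by simp
      then show ?thesis using le[OF r(2), of k] elim(2) r(1) by (metis le_less_trans)
    qed
    \<comment> \<open>The limit theorem is available at fixed r only, and
      \<open>L t \<omega>\<close> is random. It is enclosed between rational r, where the counts are
      monotone in r.\<close>
    show "(\<lambda>k. enn2real (K k \<omega>) / m k) \<longlonglongrightarrow> L t \<omega>"
    proof (rule order_tendstoI)
      fix a assume a: "L t \<omega> < a"
      obtain r where r: "r \<in> \<rat>" "L t \<omega> < r" "r < a" using Rats_dense_in_real[OF a] by auto
      have r0: "0 \<le> r" using r Lt by simp
      then have *: "\<And>k. emeasure (N \<omega>) ({0..r} \<times> C k) < \<infinity>" "(\<lambda>k. enn2real (emeasure (N \<omega>) ({0..r} \<times> C k)) / m k) \<longlonglongrightarrow> r"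
        using elim(2) r(1) by auto
      have "\<forall>\<^sub>F k in sequentially. enn2real (emeasure (N \<omega>) ({0..r} \<times> C k)) / m k < a"
        using *(2) r(3) by (rule order_tendstoD(2))
      then show "\<forall>\<^sub>F k in sequentially. enn2real (K k \<omega>) / m k < a"
      proof eventually_elim
        case (elim k)
        have "enn2real (K k \<omega>) \<le> enn2real (emeasure (N \<omega>) ({0..r} \<times> C k))"
          using le[OF r(2), of k] *(1)[of k] by (intro enn2real_mono) auto
        then have "enn2real (K k \<omega>) / m k \<le> enn2real (emeasure (N \<omega>) ({0..r} \<times> C k)) / m k"
          using m(2)[of k] by (intro divide_right_mono) auto
        then show ?case using elim by simp
      qed
    next
      fix a assume a: "a < L t \<omega>"
      show "\<forall>\<^sub>F k in sequentially. a < enn2real (K k \<omega>) / m k"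
      proof (cases "a < 0")
        case True
        have "0 \<le> enn2real (K k \<omega>) / m k" for k using m(2)[of k] by simp
        then show ?thesis using True by (intro always_eventually allI) (metis less_le_trans)
      next
        case False
        obtain r where r: "r \<in> \<rat>" "a < r" "r < L t \<omega>" using Rats_dense_in_real[OF a] by auto
        then have *: "(\<lambda>k. enn2real (emeasure (N \<omega>) ({0..r} \<times> C k)) / m k) \<longlonglongrightarrow> r"
          using elim(2) False by auto
        have "\<forall>\<^sub>F k in sequentially. a < enn2real (emeasure (N \<omega>) ({0..r} \<times> C k)) / m k"
          using * r(2) by (rule order_tendstoD(1))
        then show ?thesis
        proof eventually_elim
          case (elim k)
          have "enn2real (emeasure (N \<omega>) ({0..r} \<times> C k)) \<le> enn2real (K k \<omega>)"
            using ge[OF r(3), of k] Kfin[of k] by (intro enn2real_mono) auto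
          then have "enn2real (emeasure (N \<omega>) ({0..r} \<times> C k)) / m k \<le> enn2real (K k \<omega>) / m k"
            using m(2)[of k] by (intro divide_right_mono) auto
          then show ?case using elim by simp
        qed
      qed
    qed
  qed
  show ?thesis
  proof (rule measurable_G_AE)
    show "(\<lambda>\<omega>. lim (\<lambda>k. enn2real (K k \<omega>) / m k)) \<in> borel_measurable G"
      by (rule borel_measurable_lim_metric) measurable
    show "AE \<omega> in P. L t \<omega> = lim (\<lambda>k. enn2real (K k \<omega>) / m k)"
      using lim by eventually_elim (simp add: limI)
  qed simp
qed

lemma L_G: "0 \<le> t \<Longrightarrow> (\<lambda>\<omega>. L t \<omega>) \<in> borel_measurable G"
  using c_nonneg L_G_pos L_G_zero by (cases "c = 0") auto

lemma L_tq_G [measurable]: "(\<lambda>\<omega>. L (pos_rat k) \<omega>) \<in> borel_measurable G"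
  using pos_rat_pos[of k] by (intro L_G) simp

section \<open>The position of the excursions on the time axis of the clock\<close>

abbreviation clock_at :: "'w \<Rightarrow> 'j \<Rightarrow> real \<Rightarrow> ennreal" where
  "clock_at \<omega> j s \<equiv> excursion_path_classes.alpha x\<^sub>o c (N \<omega>) I D f j s"

lemma clock_at_G: "(\<lambda>\<omega>. clock_at \<omega> j (L (pos_rat k) \<omega>)) \<in> borel_measurable G"
proof (rule measurable_G_AE)
  define cls where "cls i \<omega> = (\<Sum>m. if exc_new x\<^sub>o (XX \<omega>) m \<and> L (pos_rat m) \<omega> < L (pos_rat k) \<omega> \<and>
      (in_exc x\<^sub>o (XX \<omega>) (pos_rat m) \<and> exc_from x\<^sub>o (XX \<omega>) (pos_rat m) \<in> D i)
      then exc_end x\<^sub>o (XX \<omega>) (pos_rat m) - ennreal (exc_begin x\<^sub>o (XX \<omega>) (pos_rat m)) else 0)" for i \<omega>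
  have [measurable]: "cls i \<in> borel_measurable G" if "i \<in> I" for i
  proof -
    note [measurable] = exc_from_pred[OF that]
    show ?thesis unfolding cls_def by (rule borel_measurable_suminf_order) measurable
  qed
  have [measurable]: "(\<lambda>\<omega>. if i \<in> I \<and> f i = j then cls i \<omega> else 0) \<in> borel_measurable G" for i
    by (cases "i \<in> I \<and> f i = j") auto
  show "(\<lambda>\<omega>. (if f 0 = j then ennreal (c * L (pos_rat k) \<omega>) else 0) + (\<Sum>i. if i \<in> I \<and> f i = j then cls i \<omega> else 0)) \<in> borel_measurable G"
    by measurable
  show "AE \<omega> in P. clock_at \<omega> j (L (pos_rat k) \<omega>) = (if f 0 = j then ennreal (c * L (pos_rat k) \<omega>) else 0) + (\<Sum>i. if i \<in> I \<and> f i = j then cls i \<omega> else 0)"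
    using AE_good_path
  proof eventually_elim
    case (elim \<omega>)
    interpret p: excursion_path_classes x\<^sub>o c "N \<omega>" "\<lambda>t. L t \<omega>" "XX \<omega>" I D f by (rule elim)
    have cs: "p.class_sum i (L (pos_rat k) \<omega>) = cls i \<omega>" for i
      unfolding p.class_sum_def
    proof (subst p.sum_new)
      fix q assume q: "q \<in> p.A" "p.\<eta>l (fst q) = \<infinity>"
      \<comment> \<open>Excursions with a smaller local time are completed by a finite real time, so
        they are all visible and \<open>sum_new\<close> applies.\<close>
      have "\<not> fst q < L (pos_rat k) \<omega>"
      proof
        assume "fst q < L (pos_rat k) \<omega>"
        then have "p.\<eta> (fst q) \<le> ennreal (pos_rat k)"
          using pos_rat_pos[of k] p.atomsD[of "fst q" "snd q"] q(1) by (intro p.eta_less_iff(1)) auto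
        then show False using q(2) p.eta_left_le_eta[of "fst q"] by (simp add: top_unique)
      qed
      then show "p.\<zeta> (snd q) * indicator {..<L (pos_rat k) \<omega>} (fst q) * indicator (D i) (snd q) = 0" by simp
    next
      show "(\<Sum>m. if exc_new x\<^sub>o (XX \<omega>) m then p.\<zeta> (snd (L (pos_rat m) \<omega>, exc_from x\<^sub>o (XX \<omega>) (pos_rat m)))
          * indicator {..<L (pos_rat k) \<omega>} (fst (L (pos_rat m) \<omega>, exc_from x\<^sub>o (XX \<omega>) (pos_rat m)))
          * indicator (D i) (snd (L (pos_rat m) \<omega>, exc_from x\<^sub>o (XX \<omega>) (pos_rat m))) else 0) = cls i \<omega>"
        unfolding cls_def
      proof (intro suminf_cong)
        fix m
        show "(if exc_new x\<^sub>o (XX \<omega>) m then p.\<zeta> (snd (L (pos_rat m) \<omega>, exc_from x\<^sub>o (XX \<omega>) (pos_rat m)))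
          * indicator {..<L (pos_rat k) \<omega>} (fst (L (pos_rat m) \<omega>, exc_from x\<^sub>o (XX \<omega>) (pos_rat m)))
          * indicator (D i) (snd (L (pos_rat m) \<omega>, exc_from x\<^sub>o (XX \<omega>) (pos_rat m))) else 0) =
          (if exc_new x\<^sub>o (XX \<omega>) m \<and> L (pos_rat m) \<omega> < L (pos_rat k) \<omega> \<and>
            (in_exc x\<^sub>o (XX \<omega>) (pos_rat m) \<and> exc_from x\<^sub>o (XX \<omega>) (pos_rat m) \<in> D i)
            then exc_end x\<^sub>o (XX \<omega>) (pos_rat m) - ennreal (exc_begin x\<^sub>o (XX \<omega>) (pos_rat m)) else 0)"
        proof (cases "exc_new x\<^sub>o (XX \<omega>) m")
          case True
          then have "in_exc x\<^sub>o (XX \<omega>) (pos_rat m)" by (simp add: exc_new_def)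
          then show ?thesis by (rule p.in_excD) (use True \<open>in_exc x\<^sub>o (XX \<omega>) (pos_rat m)\<close> in \<open>auto simp: indicator_def\<close>)
        qed simp
      qed
    qed
    have "(\<integral>\<^sup>+i. p.class_sum i (L (pos_rat k) \<omega>) \<partial>count_space {i\<in>I. f i = j})
        = (\<integral>\<^sup>+i. (if i \<in> I \<and> f i = j then cls i \<omega> else 0) \<partial>count_space UNIV)"
      by (subst nn_integral_count_space_indicator) (auto intro!: nn_integral_cong simp: cs indicator_def)
    then show ?case unfolding p.alpha_def by (simp add: nn_integral_count_space_nat)
  qed
qed simp

text \<open>On good paths this is the event \<open>\<eta> 1 < \<infinity>\<close>, on which every
  excursion up to local time 1 is finite and visible in \<open>X\<close>.\<close>

definition exceeds_1 :: "'w set" where "exceeds_1 = {\<omega>\<in>space P. \<exists>k::nat. 1 < L (real k) \<omega>}"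

lemma exceeds_1_G: "exceeds_1 \<in> sets G"
proof -
  have [measurable]: "(\<lambda>\<omega>. L (real k) \<omega>) \<in> borel_measurable G" for k :: nat by (intro L_G) simp
  have "exceeds_1 = {\<omega>\<in>space G. \<exists>k::nat. 1 < L (real k) \<omega>}" by (simp add: exceeds_1_def)
  also have "\<dots> \<in> sets G" by measurable
  finally show ?thesis .
qed

definition early_atoms :: "nat \<Rightarrow> 'w \<Rightarrow> (real \<times> (real \<Rightarrow> 's)) set" where
  "early_atoms i \<omega> = {p\<in>atoms (N \<omega>). snd p \<in> D i \<and> fst p \<le> 1}"

text \<open>This is the measurability condition of
  \<open>laplace_subordinator_random_open_set\<close>. The quantifier over atoms becomes one over
  the representatives k.\<close>

lemma selected_G:
  assumes i: "i \<in> I"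
  shows "{\<omega>\<in>exceeds_1. \<exists>p\<in>early_atoms i \<omega>. enn2real (clock_at \<omega> j (fst p)) \<le> r \<and>
    r' < enn2real (clock_at \<omega> j (fst p)) + enn2real (zeta x\<^sub>o (snd p))} \<in> sets G"
proof -
  note [measurable] = exceeds_1_G exc_from_pred[OF i] clock_at_G[of j]
  let ?R = "\<lambda>\<omega>. \<omega> \<in> exceeds_1 \<and> (\<exists>k. exc_new x\<^sub>o (XX \<omega>) k \<and> (in_exc x\<^sub>o (XX \<omega>) (pos_rat k) \<and> exc_from x\<^sub>o (XX \<omega>) (pos_rat k) \<in> D i)
    \<and> L (pos_rat k) \<omega> \<le> 1 \<and> enn2real (clock_at \<omega> j (L (pos_rat k) \<omega>)) \<le> r \<and>
    r' < enn2real (clock_at \<omega> j (L (pos_rat k) \<omega>)) + enn2real (exc_end x\<^sub>o (XX \<omega>) (pos_rat k) - ennreal (exc_begin x\<^sub>o (XX \<omega>) (pos_rat k))))"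
  let ?Q = "\<lambda>\<omega>. \<omega> \<in> exceeds_1 \<and> (\<exists>p\<in>early_atoms i \<omega>. enn2real (clock_at \<omega> j (fst p)) \<le> r \<and>
    r' < enn2real (clock_at \<omega> j (fst p)) + enn2real (zeta x\<^sub>o (snd p)))"
  have "{\<omega>\<in>space P. ?R \<omega>} = {\<omega>\<in>space G. ?R \<omega>}" by simp
  also have "\<dots> \<in> sets G" by measurable
  finally have meas: "{\<omega>\<in>space P. ?R \<omega>} \<in> sets G" .
  have "AE \<omega> in P. ?Q \<omega> \<longleftrightarrow> ?R \<omega>"
    using AE_good_path
  proof eventually_elim
    case (elim \<omega>)
    interpret p: excursion_path_classes x\<^sub>o c "N \<omega>" "\<lambda>t. L t \<omega>" "XX \<omega>" I D f by (rule elim)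
    show ?case
    proof (rule conj_cong[OF refl])
      assume "\<omega> \<in> exceeds_1"
      then have fin: "p.\<eta> 1 < \<infinity>" using p.eta_1_finite_iff by (simp add: exceeds_1_def)
      show "(\<exists>p\<in>early_atoms i \<omega>. enn2real (clock_at \<omega> j (fst p)) \<le> r \<and>
          r' < enn2real (clock_at \<omega> j (fst p)) + enn2real (zeta x\<^sub>o (snd p))) \<longleftrightarrow>
        (\<exists>k. exc_new x\<^sub>o (XX \<omega>) k \<and> (in_exc x\<^sub>o (XX \<omega>) (pos_rat k) \<and> exc_from x\<^sub>o (XX \<omega>) (pos_rat k) \<in> D i)
          \<and> L (pos_rat k) \<omega> \<le> 1 \<and> enn2real (clock_at \<omega> j (L (pos_rat k) \<omega>)) \<le> r \<and>
          r' < enn2real (clock_at \<omega> j (L (pos_rat k) \<omega>)) + enn2real (exc_end x\<^sub>o (XX \<omega>) (pos_rat k) - ennreal (exc_begin x\<^sub>o (XX \<omega>) (pos_rat k))))"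
        (is "?l \<longleftrightarrow> ?r")
      proof
        assume ?l
        then obtain q where q: "q \<in> early_atoms i \<omega>" "enn2real (clock_at \<omega> j (fst q)) \<le> r"
          "r' < enn2real (clock_at \<omega> j (fst q)) + enn2real (zeta x\<^sub>o (snd q))" by blast
        have "p.\<eta>l (fst q) < \<infinity>"
          using p.eta_left_mono[of "fst q" 1] p.eta_left_le_eta[of 1] fin q(1) by (auto simp: early_atoms_def intro: le_less_trans)
        then have "q \<in> {p\<in>p.A. p.\<eta>l (fst p) < \<infinity>}" using q(1) by (simp add: early_atoms_def)
        then obtain k where k: "exc_new x\<^sub>o (XX \<omega>) k" "q = (L (pos_rat k) \<omega>, exc_from x\<^sub>o (XX \<omega>) (pos_rat k))"
          using p.bij_betw_new by (auto simp: bij_betw_def)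
        have "in_exc x\<^sub>o (XX \<omega>) (pos_rat k)" using k by (simp add: exc_new_def)
        moreover from this have "zeta x\<^sub>o (snd q) = exc_end x\<^sub>o (XX \<omega>) (pos_rat k) - ennreal (exc_begin x\<^sub>o (XX \<omega>) (pos_rat k))"
          unfolding k(2) by (rule p.in_excD) simp
        ultimately show ?r using q k by (intro exI[of _ k]) (auto simp: early_atoms_def)
      next
        assume ?r
        then obtain k where k: "in_exc x\<^sub>o (XX \<omega>) (pos_rat k)" "exc_from x\<^sub>o (XX \<omega>) (pos_rat k) \<in> D i"
          "L (pos_rat k) \<omega> \<le> 1" "enn2real (clock_at \<omega> j (L (pos_rat k) \<omega>)) \<le> r"
          "r' < enn2real (clock_at \<omega> j (L (pos_rat k) \<omega>)) + enn2real (exc_end x\<^sub>o (XX \<omega>) (pos_rat k) - ennreal (exc_begin x\<^sub>o (XX \<omega>) (pos_rat k)))" by blast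
        obtain e where "(L (pos_rat k) \<omega>, e) \<in> p.A" "exc_from x\<^sub>o (XX \<omega>) (pos_rat k) = e"
          "p.\<zeta> e = exc_end x\<^sub>o (XX \<omega>) (pos_rat k) - ennreal (exc_begin x\<^sub>o (XX \<omega>) (pos_rat k))"
          using k(1) by (rule p.in_excD)
        then show ?l using k by (intro bexI[of _ "(L (pos_rat k) \<omega>, e)"]) (simp_all add: early_atoms_def)
      qed
    qed
  qed
  from sets_G_AE[OF meas this] have "{\<omega>\<in>space P. ?Q \<omega>} \<in> sets G" .
  also have "{\<omega>\<in>space P. ?Q \<omega>} = {\<omega>\<in>exceeds_1. \<exists>p\<in>early_atoms i \<omega>. enn2real (clock_at \<omega> j (fst p)) \<le> r \<and>
    r' < enn2real (clock_at \<omega> j (fst p)) + enn2real (zeta x\<^sub>o (snd p))}" by (auto simp: exceeds_1_def)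
  finally show ?thesis .
qed

end

section \<open>Computation of the Laplace exponent\<close>

lemma (in excursion_path) eta_0_finite: "\<eta> 0 < \<infinity>"
proof -
  have "(0, e) \<notin> A" for e using atom_time_pos[of 0 e] by blast
  then have "\<eta> 0 = \<eta>l 0" by (intro eta_no_jump) auto
  also have "\<eta>l 0 = 0" unfolding eta_left_def by (simp add: bot_ennreal)
  finally show ?thesis by simp
qed

text \<open>The finite lifetimes up to local time 1 are summable and only finitely many excursions
  there are longer than 1. Hence up to local time 1 \<open>\<eta>\<close> can become infinite only
  through an infinite jump, not by accumulation, and it is finite before the first such
  jump.\<close>

lemma (in excursion_path) infinite_excursion:
  assumes W: "(\<integral>\<^sup>+p. (if \<zeta> (snd p) < \<infinity> then \<zeta> (snd p) else 0) * indicator {0..1} (fst p) \<partial>\<mu>) < \<infinity>"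
    and fin: "emeasure \<mu> ({0..1} \<times> {e\<in>exc_paths x\<^sub>o. 1 < \<zeta> e}) < \<infinity>"
  shows "\<not> \<eta> 1 < \<infinity> \<Longrightarrow> \<exists>s e. (s, e) \<in> A \<and> s \<le> 1 \<and> \<zeta> e = \<infinity> \<and> \<eta>l s < \<infinity>"
    and "\<And>s e. (s, e) \<in> A \<Longrightarrow> s \<le> 1 \<Longrightarrow> ennreal s \<le> L_inf x\<^sub>o c \<mu> \<Longrightarrow> \<eta>l s < \<infinity>"
proof -
  have [measurable]: "{0..1::real} \<times> exc_paths x\<^sub>o \<in> sets \<mu>" by (intro times_sets exc_paths_sets) auto
  let ?z = "\<lambda>p. (if \<zeta> (snd p) < \<infinity> then \<zeta> (snd p) else 0) * indicator {0..1} (fst p)"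
  have "(\<integral>\<^sup>+p. ?z p \<partial>\<mu>) = (\<integral>\<^sup>+p. (if \<zeta> (snd p) < \<infinity> then \<zeta> (snd p) else 0) * indicator ({0..1} \<times> exc_paths x\<^sub>o) p \<partial>\<mu>)"
    by (intro nn_integral_cong) (auto simp: space_\<mu> indicator_def)
  also have "\<dots> = (\<integral>\<^sup>+p. (if \<zeta> (snd p) < \<infinity> then \<zeta> (snd p) else 0) * indicator ({0..1} \<times> exc_paths x\<^sub>o) p \<partial>count_space A)"
    by (rule nn_integral_atoms) measurable
  also have "\<dots> = (\<integral>\<^sup>+p. ?z p \<partial>count_space A)"
    using atomsD by (intro nn_integral_cong) (auto simp: indicator_def)
  finally have W': "(\<integral>\<^sup>+p. ?z p \<partial>count_space A) < \<infinity>" using W by simp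
  have left_fin: "\<eta>l s < \<infinity>" if s: "0 \<le> s" "s \<le> 1" "\<And>s' e. (s', e) \<in> A \<Longrightarrow> s' < s \<Longrightarrow> \<zeta> e < \<infinity>" for s
  proof -
    have "(\<integral>\<^sup>+p. \<zeta> (snd p) * indicator {..<s} (fst p) \<partial>count_space A) \<le> (\<integral>\<^sup>+p. ?z p \<partial>count_space A)"
      using s atomsD by (intro nn_integral_mono) (auto simp: indicator_def)
    then have "(\<integral>\<^sup>+p. \<zeta> (snd p) * indicator {..<s} (fst p) \<partial>count_space A) < \<infinity>" using W' by (rule le_less_trans)
    then show ?thesis unfolding eta_left_eq[OF s(1)] by simp
  qed
  show "\<eta>l s < \<infinity>" if A: "(s, e) \<in> A" and s: "s \<le> 1" "ennreal s \<le> L_inf x\<^sub>o c \<mu>" for s e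
  proof (rule left_fin)
    show "0 \<le> s" using atomsD[OF A] by simp
    fix s' e' assume A': "(s', e') \<in> A" "s' < s"
    then have "ennreal s' < ennreal s" using atomsD[OF A'(1)] by (simp add: ennreal_less_iff)
    then have "\<eta> s' < \<infinity>" using s(2) atomsD[OF A'(1)] by (intro eta_finite_below_L_inf) auto
    then show "\<zeta> e' < \<infinity>" unfolding eta_jump[OF A'(1)] by simp
  qed fact
  assume inf: "\<not> \<eta> 1 < \<infinity>"
  define S where "S = {s. s \<le> 1 \<and> (\<exists>e. (s, e) \<in> A \<and> \<zeta> e = \<infinity>)}"
  have "finite (A \<inter> ({0..1} \<times> {e\<in>exc_paths x\<^sub>o. 1 < \<zeta> e}))"
  proof (rule ccontr)
    assume "infinite (A \<inter> ({0..1} \<times> {e\<in>exc_paths x\<^sub>o. 1 < \<zeta> e}))"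
    then have "emeasure (count_space A) (A \<inter> ({0..1} \<times> {e\<in>exc_paths x\<^sub>o. 1 < \<zeta> e})) = \<infinity>"
      by (intro emeasure_count_space_infinite) auto
    moreover have "{0..1} \<times> {e\<in>exc_paths x\<^sub>o. 1 < \<zeta> e} \<in> sets \<mu>" by (intro times_sets long_sets) auto
    ultimately show False using fin by (simp add: emeasure_count)
  qed
  moreover have "S \<subseteq> fst ` (A \<inter> ({0..1} \<times> {e\<in>exc_paths x\<^sub>o. 1 < \<zeta> e}))"
    using atomsD by (force simp: S_def)
  ultimately have finS: "finite S" by (meson finite_imageI finite_subset)
  have "S \<noteq> {}"
  proof
    assume "S = {}"
    then have "\<zeta> e < \<infinity>" if "(s, e) \<in> A" "s \<le> 1" for s e using that by (auto simp: S_def less_top[symmetric])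
    then have "(\<integral>\<^sup>+p. \<zeta> (snd p) * indicator {..1} (fst p) \<partial>count_space A) \<le> (\<integral>\<^sup>+p. ?z p \<partial>count_space A)"
      using atomsD by (intro nn_integral_mono) (auto simp: indicator_def)
    then have "(\<integral>\<^sup>+p. \<zeta> (snd p) * indicator {..1} (fst p) \<partial>count_space A) < \<infinity>" using W' by (rule le_less_trans)
    then show False using inf unfolding eta_eq by simp
  qed
  define s where "s = Min S"
  have "s \<in> S" using finS \<open>S \<noteq> {}\<close> by (simp add: s_def)
  then obtain e where e: "s \<le> 1" "(s, e) \<in> A" "\<zeta> e = \<infinity>" by (auto simp: S_def)
  have "\<eta>l s < \<infinity>"
  proof (rule left_fin)
    fix s' e' assume "(s', e') \<in> A" "s' < s"
    moreover have "s \<le> s'" if "s' \<in> S" using that finS by (simp add: s_def)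
    ultimately have "s' \<notin> S" by auto
    then show "\<zeta> e' < \<infinity>" using \<open>(s', e') \<in> A\<close> \<open>s' < s\<close> e(1) by (auto simp: S_def less_top[symmetric])
  qed (use e atomsD in auto)
  then show "\<exists>s e. (s, e) \<in> A \<and> s \<le> 1 \<and> \<zeta> e = \<infinity> \<and> \<eta>l s < \<infinity>" using e by blast
qed

section \<open>The exponential formula for lifetimes and the finiteness of exponents\<close>

context time_changed_regenerative_process
begin

lemma laplace_lifetime:
  assumes h: "h \<in> borel_measurable n" and S: "S \<in> sets borel" "S \<subseteq> {0..}"
  shows "(\<integral>\<^sup>+\<omega>. ennreal (exp_neg 1 (\<integral>\<^sup>+p. h (snd p) * indicator S (fst p) \<partial>N \<omega>)) \<partial>P)
       = ennreal (exp_neg 1 (emeasure lborel S * (\<integral>\<^sup>+e. ennreal (1 - exp_neg 1 (h e)) \<partial>n)))"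
    and "(\<lambda>\<omega>. \<integral>\<^sup>+p. h (snd p) * indicator S (fst p) \<partial>N \<omega>) \<in> borel_measurable P"
proof -
  interpret n: sigma_finite_measure n by (rule sigma_finite_n)
  interpret l: sigma_finite_measure "restrict_space lborel {0..} :: real measure"
    by (rule sigma_finite_measure_restrict_space) (auto intro: lborel.sigma_finite_measure_axioms)
  interpret pair: pair_sigma_finite "restrict_space lborel {0..} :: real measure" n ..
  have [measurable]: "S \<in> sets (restrict_space lborel {0..})" using S by (auto simp: sets_restrict_space_iff)
  note [measurable] = h
  have meas: "(\<lambda>p. h (snd p) * indicator S (fst p)) \<in> borel_measurable \<mu>\<^sub>0" by measurable
  show "(\<lambda>\<omega>. \<integral>\<^sup>+p. h (snd p) * indicator S (fst p) \<partial>N \<omega>) \<in> borel_measurable P"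
    by (rule measurable_nn_integral_poisson[OF N_poisson _ meas]) (rule pair.sigma_finite_measure_axioms)
  have meas': "(\<lambda>p. indicator S (fst p) * ennreal (1 - exp_neg 1 (h (snd p)))) \<in> borel_measurable \<mu>\<^sub>0"
    by measurable
  have "(\<integral>\<^sup>+p. ennreal (1 - exp_neg 1 (h (snd p) * indicator S (fst p))) \<partial>\<mu>\<^sub>0)
      = (\<integral>\<^sup>+p. indicator S (fst p) * ennreal (1 - exp_neg 1 (h (snd p))) \<partial>\<mu>\<^sub>0)"
    by (intro nn_integral_cong) (auto simp: indicator_def)
  also have "\<dots> = (\<integral>\<^sup>+s. (\<integral>\<^sup>+e. indicator S s * ennreal (1 - exp_neg 1 (h e)) \<partial>n) \<partial>restrict_space lborel {0..})"
    unfolding n.nn_integral_fst[OF meas', symmetric] by simp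
  also have "\<dots> = (\<integral>\<^sup>+s. indicator S s * (\<integral>\<^sup>+e. ennreal (1 - exp_neg 1 (h e)) \<partial>n) \<partial>restrict_space lborel {0..})"
    by (intro nn_integral_cong nn_integral_cmult) measurable
  also have "\<dots> = (\<integral>\<^sup>+s. indicator S s \<partial>restrict_space lborel {0..}) * (\<integral>\<^sup>+e. ennreal (1 - exp_neg 1 (h e)) \<partial>n)"
    by (rule nn_integral_multc) measurable
  also have "(\<integral>\<^sup>+s. indicator S s \<partial>restrict_space lborel {0..}) = emeasure lborel S"
    using S by (simp add: emeasure_restrict_space)
  finally show "(\<integral>\<^sup>+\<omega>. ennreal (exp_neg 1 (\<integral>\<^sup>+p. h (snd p) * indicator S (fst p) \<partial>N \<omega>)) \<partial>P)
       = ennreal (exp_neg 1 (emeasure lborel S * (\<integral>\<^sup>+e. ennreal (1 - exp_neg 1 (h e)) \<partial>n)))"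
    using laplace_functional[OF N_poisson pair.sigma_finite_measure_axioms meas] by simp
qed

text \<open>Otherwise the lifetimes would not be summable on any interval \<open>[0,s]\<close>, against the right
  continuity of \<open>\<eta>\<close> at \<open>0\<close>.\<close>

lemma exponent_finite:
  assumes a: "0 < a"
  shows "(\<integral>\<^sup>+e. ennreal (1 - exp_neg 1 (ennreal a * zeta x\<^sub>o e)) \<partial>n) < \<infinity>"
proof (rule ccontr)
  assume "\<not> ?thesis"
  then have inf: "(\<integral>\<^sup>+e. ennreal (1 - exp_neg 1 (ennreal a * zeta x\<^sub>o e)) \<partial>n) = \<infinity>" by (simp add: less_top[symmetric])
  have hm: "(\<lambda>e. ennreal a * zeta x\<^sub>o e) \<in> borel_measurable n" by measurable
  \<comment> \<open>An infinite exponent makes the Laplace transform over any time interval of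
    positive length vanish, so the sum of lifetimes is almost surely infinite there, however short
    the interval.\<close>
  have "AE \<omega> in P. (\<integral>\<^sup>+p. ennreal a * zeta x\<^sub>o (snd p) * indicator {0..1 / real (Suc k)} (fst p) \<partial>N \<omega>) = \<infinity>" for k
  proof -
    let ?I = "\<lambda>\<omega>. \<integral>\<^sup>+p. ennreal a * zeta x\<^sub>o (snd p) * indicator {0..1 / real (Suc k)} (fst p) \<partial>N \<omega>"
    have [measurable]: "?I \<in> borel_measurable P" by (rule laplace_lifetime(2)[OF hm]) auto
    have "ennreal (1 / real (Suc k)) * \<infinity> = \<infinity>" by (simp add: ennreal_mult_top)
    then have "(\<integral>\<^sup>+\<omega>. ennreal (exp_neg 1 (?I \<omega>)) \<partial>P) = 0"
      by (subst laplace_lifetime(1)[OF hm]) (simp_all add: inf del: of_nat_Suc)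
    moreover have meas: "(\<lambda>\<omega>. ennreal (exp_neg 1 (?I \<omega>))) \<in> borel_measurable P" by measurable
    ultimately have "AE \<omega> in P. ennreal (exp_neg 1 (?I \<omega>)) = 0"
      by (simp only: nn_integral_0_iff_AE[OF meas])
    then show ?thesis
    proof eventually_elim
      case (elim \<omega>)
      then have "exp_neg 1 (?I \<omega>) \<le> 0" by (simp only: ennreal_eq_0_iff)
      then have "exp_neg 1 (?I \<omega>) = 0" by (intro antisym exp_neg_nonneg)
      then show ?case by (simp add: exp_neg_eq_0_iff)
    qed
  qed
  then have "AE \<omega> in P. \<forall>k. (\<integral>\<^sup>+p. ennreal a * zeta x\<^sub>o (snd p) * indicator {0..1 / real (Suc k)} (fst p) \<partial>N \<omega>) = \<infinity>"
    by (simp add: AE_all_countable)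
  with AE_good_path have "AE \<omega> in P. False"
  proof eventually_elim
    case (elim \<omega>)
    interpret p: excursion_path_classes x\<^sub>o c "N \<omega>" "\<lambda>t. L t \<omega>" "XX \<omega>" I D f by (rule elim)
    have "\<forall>\<^sub>F r in at_right 0. p.\<eta> r < \<infinity>" using p.eta_rc[of 0] p.eta_0_finite by (intro order_tendstoD(2)) auto
    then obtain b :: real where b: "0 < b" "\<And>r. 0 < r \<Longrightarrow> r < b \<Longrightarrow> p.\<eta> r < \<infinity>"
      unfolding eventually_at_right_field by blast
    obtain k where k: "1 / real (Suc k) < b" using b(1) nat_approx_posE by blast
    let ?r = "1 / real (Suc k)"
    have [measurable]: "{0..?r} \<times> exc_paths x\<^sub>o \<in> sets (N \<omega>)" by (intro p.times_sets p.exc_paths_sets) auto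
    have "\<infinity> = (\<integral>\<^sup>+p. ennreal a * (zeta x\<^sub>o (snd p) * indicator ({0..?r} \<times> exc_paths x\<^sub>o) p) \<partial>N \<omega>)"
      unfolding elim(2)[rule_format, of k, symmetric]
      by (intro nn_integral_cong) (auto simp: p.space_\<mu> indicator_def)
    also have "\<dots> = ennreal a * (\<integral>\<^sup>+p. zeta x\<^sub>o (snd p) * indicator ({0..?r} \<times> exc_paths x\<^sub>o) p \<partial>N \<omega>)"
      by (rule nn_integral_cmult) measurable
    also have "(\<integral>\<^sup>+p. zeta x\<^sub>o (snd p) * indicator ({0..?r} \<times> exc_paths x\<^sub>o) p \<partial>N \<omega>) \<le> p.\<eta> ?r"
      unfolding eta_def by (simp add: case_prod_beta)
    finally have "\<infinity> \<le> ennreal a * p.\<eta> ?r" by (simp add: mult_left_mono)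
    moreover have "ennreal a * p.\<eta> ?r < \<infinity>" using b(2)[of ?r] k by (simp add: ennreal_mult_less_top del: of_nat_Suc)
    ultimately show False by simp
  qed
  then show False by simp
qed

text \<open>Let W be the sum up to local time 1 with infinite lifetimes counted as 0. Then E exp (-
  a W) is at most the probability that W is finite, and it tends to 1 as a tends to 0, because the
  exponent tends to 0.\<close>

lemma AE_finite_lifetimes:
  "AE \<omega> in P. (\<integral>\<^sup>+p. (if zeta x\<^sub>o (snd p) < \<infinity> then zeta x\<^sub>o (snd p) else 0) * indicator {0..1} (fst p) \<partial>N \<omega>) < \<infinity>"
proof -
  let ?z = "\<lambda>e. if zeta x\<^sub>o e < \<infinity> then zeta x\<^sub>o e else 0"
  let ?W = "\<lambda>\<omega>. \<integral>\<^sup>+p. ?z (snd p) * indicator {0..1} (fst p) \<partial>N \<omega>"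
  have W[measurable]: "?W \<in> borel_measurable P"
    by (rule laplace_lifetime(2)[of ?z "{0..1}"]) auto
  let ?a = "\<lambda>k. 1 / real (Suc k)"
  let ?J = "\<lambda>k. \<integral>\<^sup>+e. ennreal (1 - exp_neg 1 (ennreal (?a k) * ?z e)) \<partial>n"
  have a0: "(\<lambda>k. ennreal (?a k)) \<longlonglongrightarrow> ennreal 0"
    using LIMSEQ_inverse_real_of_nat by (intro tendsto_ennrealI) (simp add: inverse_eq_divide)
  have le: "ennreal (exp_neg 1 (?J k)) \<le> emeasure P {\<omega>\<in>space P. ?W \<omega> < \<infinity>}" for k
  proof -
    have hm: "(\<lambda>e. ennreal (?a k) * ?z e) \<in> borel_measurable n" by measurable
    have "ennreal (exp_neg 1 (?J k)) = (\<integral>\<^sup>+\<omega>. ennreal (exp_neg 1 (\<integral>\<^sup>+p. ennreal (?a k) * ?z (snd p) * indicator {0..1} (fst p) \<partial>N \<omega>)) \<partial>P)"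
      by (subst laplace_lifetime(1)[OF hm]) (auto simp del: of_nat_Suc)
    also have "\<dots> \<le> (\<integral>\<^sup>+\<omega>. indicator {\<omega>\<in>space P. ?W \<omega> < \<infinity>} \<omega> \<partial>P)"
    proof (rule nn_integral_mono_AE, use AE_good_path AE_space in eventually_elim)
      case (elim \<omega>)
      interpret p: excursion_path_classes x\<^sub>o c "N \<omega>" "\<lambda>t. L t \<omega>" "XX \<omega>" I D f by (rule elim)
      have "(\<integral>\<^sup>+p. ennreal (?a k) * ?z (snd p) * indicator {0..1} (fst p) \<partial>N \<omega>) = ennreal (?a k) * ?W \<omega>"
        unfolding mult.assoc by (rule nn_integral_cmult) measurable
      then show ?case using elim(2)
        by (cases "?W \<omega> < \<infinity>") (auto simp: less_top[symmetric] ennreal_mult_top exp_neg_def indicator_def simp del: of_nat_Suc)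
    qed
    also have "\<dots> = emeasure P {\<omega>\<in>space P. ?W \<omega> < \<infinity>}" by (intro nn_integral_indicator) measurable
    finally show ?thesis .
  qed
  have "?J \<longlonglongrightarrow> (\<integral>\<^sup>+e. 0 \<partial>n)"
  \<comment> \<open>The integrand at a = 1 with the full lifetime dominates;
    \<open>exponent_finite\<close> makes it integrable.\<close>
  proof (rule nn_integral_dominated_convergence[where w = "\<lambda>e. ennreal (1 - exp_neg 1 (ennreal 1 * zeta x\<^sub>o e))"])
    show "AE e in n. ennreal (1 - exp_neg 1 (ennreal (?a k) * ?z e)) \<le> ennreal (1 - exp_neg 1 (ennreal 1 * zeta x\<^sub>o e))" for k
    proof (intro AE_I2 ennreal_leI diff_left_mono exp_neg_antimono mult_mono)
      show "?a k \<le> 1" by simp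
    qed auto
    show "(\<integral>\<^sup>+e. ennreal (1 - exp_neg 1 (ennreal 1 * zeta x\<^sub>o e)) \<partial>n) < \<infinity>" by (rule exponent_finite) simp
    show "AE e in n. (\<lambda>k. ennreal (1 - exp_neg 1 (ennreal (?a k) * ?z e))) \<longlonglongrightarrow> 0"
    proof (intro AE_I2)
      fix e
      have "(\<lambda>k. ?z e * ennreal (?a k)) \<longlonglongrightarrow> ?z e * ennreal 0"
        by (intro ennreal_tendsto_cmult a0) auto
      then have "(\<lambda>k. ennreal (?a k) * ?z e) \<longlonglongrightarrow> 0" by (simp add: mult.commute)
      then have "(\<lambda>k. ennreal (1 - exp_neg 1 (ennreal (?a k) * ?z e))) \<longlonglongrightarrow> ennreal (1 - exp_neg 1 0)"
        by (intro tendsto_ennrealI tendsto_diff tendsto_const tendsto_exp_neg)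
      then show "(\<lambda>k. ennreal (1 - exp_neg 1 (ennreal (?a k) * ?z e))) \<longlonglongrightarrow> 0" by simp
    qed
    show "(\<lambda>e. ennreal (1 - exp_neg 1 (ennreal (?a k) * ?z e))) \<in> borel_measurable n" for k
      by measurable
  qed auto
  then have "(\<lambda>k. ennreal (exp_neg 1 (?J k))) \<longlonglongrightarrow> ennreal (exp_neg 1 0)"
    by (intro tendsto_ennrealI tendsto_exp_neg) (simp only: nn_integral_const mult_zero_left)
  then have "1 \<le> emeasure P {\<omega>\<in>space P. ?W \<omega> < \<infinity>}"
    unfolding exp_neg_zero ennreal_1 by (rule LIMSEQ_le_const2) (use le in blast)
  then have "prob {\<omega>\<in>space P. ?W \<omega> < \<infinity>} = 1"
    unfolding emeasure_eq_measure by (intro antisym prob_le_1) (simp only: ennreal_1[symmetric] ennreal_le_iff measure_nonneg)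
  from AE_prob_1[OF this] show ?thesis
    by eventually_elim (drule CollectD, erule conjunct2)
qed

lemma AE_finite_long: "AE \<omega> in P. emeasure (N \<omega>) ({0..1} \<times> {e\<in>exc_paths x\<^sub>o. 1 < zeta x\<^sub>o e}) < \<infinity>"
proof -
  have "{0..1} \<times> {e\<in>exc_paths x\<^sub>o. 1 < zeta x\<^sub>o e} \<in> sets \<mu>\<^sub>0"
    "emeasure \<mu>\<^sub>0 ({0..1} \<times> {e\<in>exc_paths x\<^sub>o. 1 < zeta x\<^sub>o e}) < \<infinity>"
    using times_\<mu>\<^sub>0[of "{0..1}" "{e\<in>exc_paths x\<^sub>o. 1 < zeta x\<^sub>o e}"] long_n[of 1] n_long_finite[of 1] by auto
  from AE_poisson_variable_nat[OF poisson_variable_poisson_point_process[OF N_poisson this]]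
  show ?thesis by eventually_elim (auto simp: of_nat_less_top)
qed

lemma AE_good_clock:
  assumes "j \<in> J"
  shows "AE \<omega> in P. cadlag (\<lambda>t. Z j t \<omega>) \<and> strict_mono_on {0..} (\<lambda>t. Z j t \<omega>) \<and> (\<forall>b. \<exists>t\<ge>0. b < Z j t \<omega>)"
  using AE_subordinator[OF Z_subordinator[OF assms]] Z_strict_mono[OF assms]
    AE_subordinator_unbounded[OF Z_subordinator[OF assms] Z_strict_mono[OF assms]]
  by eventually_elim auto

end

text \<open>A monotone z attains the same supremum along rational u. The countable fixed index set
  makes the supremum measurable when z and r are random.\<close>

lemma SUP_increments_rational:
  assumes mono: "mono_on {0..} z" and a: "(0::real) \<le> a"
  shows "(SUP u\<in>{u. 0 \<le> u \<and> ennreal u < r}. ennreal (z (a + u) - z a))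
       = (SUP u\<in>{u\<in>\<rat>. 0 \<le> u}. if ennreal u < r then ennreal (z (a + u) - z a) else 0)"
proof (rule antisym)
  show "(SUP u\<in>{u. 0 \<le> u \<and> ennreal u < r}. ennreal (z (a + u) - z a))
       \<le> (SUP u\<in>{u\<in>\<rat>. 0 \<le> u}. if ennreal u < r then ennreal (z (a + u) - z a) else 0)"
  proof (rule SUP_least)
    fix u assume u: "u \<in> {u. 0 \<le> u \<and> ennreal u < r}"
    then obtain w where w: "ennreal u < w" "w < r" using dense by blast
    then obtain w' where w': "0 \<le> w'" "w = ennreal w'" by (cases w) auto
    have "u < w'" using w(1) u w' by (simp add: ennreal_less_iff)
    then obtain v where v: "v \<in> \<rat>" "u < v" "v < w'" using Rats_dense_in_real by blast
    have "ennreal v \<le> ennreal w'" using v by (intro ennreal_leI) simp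
    then have vr: "ennreal v < r" using w(2) w'(2) by (simp add: le_less_trans)
    have "z (a + u) \<le> z (a + v)" using u v a by (intro mono_onD[OF mono]) auto
    then have "ennreal (z (a + u) - z a) \<le> (if ennreal v < r then ennreal (z (a + v) - z a) else 0)"
      using vr by (simp add: ennreal_leI)
    also have "\<dots> \<le> (SUP u\<in>{u\<in>\<rat>. 0 \<le> u}. if ennreal u < r then ennreal (z (a + u) - z a) else 0)"
      using u v by (intro SUP_upper) auto
    finally show "ennreal (z (a + u) - z a) \<le> (SUP u\<in>{u\<in>\<rat>. 0 \<le> u}. if ennreal u < r then ennreal (z (a + u) - z a) else 0)" .
  qed
  show "(SUP u\<in>{u\<in>\<rat>. 0 \<le> u}. if ennreal u < r then ennreal (z (a + u) - z a) else 0)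
      \<le> (SUP u\<in>{u. 0 \<le> u \<and> ennreal u < r}. ennreal (z (a + u) - z a))"
    by (rule SUP_least) (auto intro: SUP_upper)
qed

section \<open>Measurability of the transformed lifetime\<close>

context time_changed_regenerative_process
begin

abbreviation \<Gamma> :: "nat \<Rightarrow> 'w \<Rightarrow> ennreal" where
  "\<Gamma> i \<equiv> star_lifetime x\<^sub>o c D I f N L X Z i 1"

lemma measurable_P_AE:
  assumes g: "g \<in> measurable P M" and h: "h \<in> space P \<rightarrow> space M" and AE: "AE \<omega> in P. h \<omega> = g \<omega>"
  shows "h \<in> measurable P M"
proof (rule measurableI)
  fix A assume A: "A \<in> sets M"
  have AE': "AE \<omega> in P. \<omega> \<in> h -` A \<inter> space P \<longleftrightarrow> \<omega> \<in> g -` A \<inter> space P"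
    using AE by eventually_elim simp
  show "h -` A \<inter> space P \<in> sets P"
    by (rule AE_imp_sets[OF AE' Int_lower2 measurable_sets[OF g A]])
qed (use h in auto)

lemma G_to_P: "h \<in> measurable G M \<Longrightarrow> h \<in> measurable P M"
  using sets_G_subset by (auto simp: measurable_def)

text \<open>The Laplace exponent is a Bochner integral, which carries meaning only for a measurable
  integrand. \<Gamma> is a series, over the representatives, of clock increments taken at random
  times.\<close>

lemma measurable_\<Gamma>:
  assumes i: "i \<in> I" shows "\<Gamma> i \<in> borel_measurable P"
proof -
  let ?j = "f i"
  have j: "?j \<in> J" using f_range i by simp
  obtain M where M: "{\<omega>\<in>space P. \<not> (cadlag (\<lambda>t. Z ?j t \<omega>) \<and> strict_mono_on {0..} (\<lambda>t. Z ?j t \<omega>) \<and> (\<forall>b. \<exists>t\<ge>0. b < Z ?j t \<omega>))} \<subseteq> M"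
    "emeasure P M = 0" "M \<in> sets P"
    using AE_good_clock[OF j] by (rule AE_E)
  \<comment> \<open>The clock is set to 0 on a null set, so that every path is right continuous and
    evaluation at a random time is measurable.\<close>
  define Z' where "Z' t \<omega> = (if \<omega> \<in> M then 0 else Z ?j t \<omega>)" for t \<omega>
  note [measurable] = M(3)
  have Z'_meas: "Z' t \<in> borel_measurable P" if "0 \<le> t" for t
  proof -
    have [measurable]: "Z ?j t \<in> borel_measurable P" using Z_subordinator[OF j] that by (rule measurable_subordinator)
    show ?thesis unfolding Z'_def by measurable
  qed
  have Z'_rc: "((\<lambda>s. Z' s \<omega>) \<longlongrightarrow> Z' t \<omega>) (at_right t)" if "\<omega> \<in> space P" "0 \<le> t" for \<omega> t
    using M(1) that by (auto simp: Z'_def cadlag_def)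
  have Z'_random[measurable]: "(\<lambda>\<omega>. Z' (max 0 (\<rho> \<omega>)) \<omega>) \<in> borel_measurable P" if "\<rho> \<in> borel_measurable P" for \<rho>
  proof -
    have "(\<lambda>p. Z' (max 0 (snd p)) (fst p)) \<in> borel_measurable (P \<Otimes>\<^sub>M borel)"
      by (rule measurable_right_continuous_process[OF Z'_meas Z'_rc])
    from measurable_compose[OF _ this, of "\<lambda>\<omega>. (\<omega>, \<rho> \<omega>)" P] that show ?thesis by simp
  qed
  define a where "a k \<omega> = enn2real (clock_at \<omega> ?j (L (pos_rat k) \<omega>))" for k \<omega>
  have a0: "0 \<le> a k \<omega>" for k \<omega> by (simp add: a_def)
  have [measurable]: "(\<lambda>\<omega>. clock_at \<omega> ?j (L (pos_rat k) \<omega>)) \<in> borel_measurable P" for k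
    by (rule G_to_P[OF clock_at_G])
  have [measurable]: "a k \<in> borel_measurable P" for k unfolding a_def by measurable
  define inc where "inc k \<omega> = (SUP u\<in>{u\<in>\<rat>. 0 \<le> u}. if ennreal u < exc_end x\<^sub>o (XX \<omega>) (pos_rat k) - ennreal (exc_begin x\<^sub>o (XX \<omega>) (pos_rat k))
    then ennreal (Z' (max 0 (a k \<omega> + u)) \<omega> - Z' (max 0 (a k \<omega>)) \<omega>) else 0)" for k \<omega>
  note [measurable] = G_to_P[OF exc_end_tq_G] G_to_P[OF exc_begin_G] G_to_P[OF L_tq_G]
    G_to_P[OF exc_new_pred] G_to_P[OF exc_from_pred[OF i]]
  have [measurable]: "inc k \<in> borel_measurable P" for k
  proof -
    have "countable {u::real. u \<in> \<rat> \<and> 0 \<le> u}" by (rule countable_subset[OF _ countable_rat]) auto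
    then show ?thesis unfolding inc_def by (rule borel_measurable_SUP) measurable
  qed
  define g where "g \<omega> = (\<Sum>k. if exc_new x\<^sub>o (XX \<omega>) k \<and> (in_exc x\<^sub>o (XX \<omega>) (pos_rat k) \<and> exc_from x\<^sub>o (XX \<omega>) (pos_rat k) \<in> D i)
    \<and> L (pos_rat k) \<omega> \<le> 1 then inc k \<omega> else 0)" for \<omega>
  have g: "g \<in> borel_measurable P" unfolding g_def by (rule borel_measurable_suminf_order) measurable
  have "AE \<omega> in P. \<omega> \<notin> M" using M by (intro AE_not_in) auto
  with AE_good_path AE_finite_lifetimes AE_finite_long AE_space have "AE \<omega> in P. \<Gamma> i \<omega> = g \<omega>"
  proof eventually_elim
    case (elim \<omega>)
    interpret p: excursion_path_classes x\<^sub>o c "N \<omega>" "\<lambda>t. L t \<omega>" "XX \<omega>" I D f by (rule elim)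
    have good: "cadlag (\<lambda>t. Z ?j t \<omega>)" "strict_mono_on {0..} (\<lambda>t. Z ?j t \<omega>)" "\<And>b. \<exists>t\<ge>0. b < Z ?j t \<omega>"
      using M(1) elim(4,5) by blast+
    have mono: "mono_on {0..} (\<lambda>t. Z ?j t \<omega>)" using good(2) by (rule strict_mono_on_imp_mono_on)
    let ?cl = "\<lambda>p. enn2real (clock_occ x\<^sub>o c D I f (N \<omega>) (\<lambda>t. L t \<omega>) (XX \<omega>) ?j (enn2real (p.\<eta>l (fst p))))"
    let ?g = "\<lambda>p. SUP u\<in>{u. 0 \<le> u \<and> ennreal u < zeta x\<^sub>o (snd p)}. ennreal (Z ?j (?cl p + u) \<omega> - Z ?j (?cl p) \<omega>)"
    let ?S = "{p\<in>p.A. snd p \<in> D i \<and> ennreal (fst p) \<le> L_inf x\<^sub>o c (N \<omega>) \<and> fst p \<le> 1}"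
    define \<phi> where "\<phi> p = (if p \<in> ?S then ?g p else 0)" for p
    have "\<Gamma> i \<omega> = (\<integral>\<^sup>+p. ?g p \<partial>count_space ?S)"
      unfolding star_lifetime_def by (rule p.star_lifetime_sum[OF i, of "\<lambda>j t. Z j t \<omega>", OF good])
    also have "\<dots> = (\<integral>\<^sup>+p. \<phi> p \<partial>count_space ?S)"
      by (intro nn_integral_cong) (simp add: \<phi>_def)
    also have "\<dots> = (\<integral>\<^sup>+p. \<phi> p \<partial>count_space p.A)"
      by (intro nn_integral_count_space_eq) (auto simp: \<phi>_def)
    also have "\<dots> = (\<Sum>k. if exc_new x\<^sub>o (XX \<omega>) k then \<phi> (L (pos_rat k) \<omega>, exc_from x\<^sub>o (XX \<omega>) (pos_rat k)) else 0)"
    proof (rule p.sum_new)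
      fix q assume q: "q \<in> p.A" "p.\<eta>l (fst q) = \<infinity>"
      \<comment> \<open>Almost surely an atom up to \<open>L_inf\<close> and local time 1 is reached
        in finite time, so the series misses no transformed excursion.\<close>
      have "q \<notin> ?S"
        using p.infinite_excursion(2)[OF elim(2,3), of "fst q" "snd q"] q by auto
      then show "\<phi> q = 0" unfolding \<phi>_def by (rule if_not_P)
    qed
    also have "\<dots> = g \<omega>"
      unfolding g_def
    proof (intro suminf_cong)
      fix k
      show "(if exc_new x\<^sub>o (XX \<omega>) k then \<phi> (L (pos_rat k) \<omega>, exc_from x\<^sub>o (XX \<omega>) (pos_rat k)) else 0) =
        (if exc_new x\<^sub>o (XX \<omega>) k \<and> (in_exc x\<^sub>o (XX \<omega>) (pos_rat k) \<and> exc_from x\<^sub>o (XX \<omega>) (pos_rat k) \<in> D i)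
          \<and> L (pos_rat k) \<omega> \<le> 1 then inc k \<omega> else 0)"
      proof (cases "exc_new x\<^sub>o (XX \<omega>) k")
        case True
        then have in_e: "in_exc x\<^sub>o (XX \<omega>) (pos_rat k)" by (simp add: exc_new_def)
        then obtain e where e: "(L (pos_rat k) \<omega>, e) \<in> p.A" "exc_from x\<^sub>o (XX \<omega>) (pos_rat k) = e"
            "p.\<eta>l (L (pos_rat k) \<omega>) < ennreal (pos_rat k)"
            "p.\<zeta> e = exc_end x\<^sub>o (XX \<omega>) (pos_rat k) - ennreal (exc_begin x\<^sub>o (XX \<omega>) (pos_rat k))"
          by (rule p.in_excD)
        have fin: "p.\<eta>l (L (pos_rat k) \<omega>) < \<infinity>" using e(3) by (rule less_le_trans) simp
        have s0: "0 \<le> L (pos_rat k) \<omega>" using p.atomsD[OF e(1)] by simp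
        have Linf: "ennreal (L (pos_rat k) \<omega>) \<le> L_inf x\<^sub>o c (N \<omega>)" by (rule p.le_L_infI[OF s0 fin])
        have cl: "?cl (L (pos_rat k) \<omega>, e) = a k \<omega>"
          unfolding a_def using p.clock_occ_eq_alpha[OF e(1) fin] by simp
        have "?g (L (pos_rat k) \<omega>, e) = inc k \<omega>"
        proof -
          have "Z' (max 0 (a k \<omega> + u)) \<omega> = Z ?j (a k \<omega> + u) \<omega>" "Z' (max 0 (a k \<omega>)) \<omega> = Z ?j (a k \<omega>) \<omega>"
            if "0 \<le> u" for u
            using that a0[of k \<omega>] elim(5) by (simp_all add: Z'_def)
          then show ?thesis
            unfolding inc_def cl snd_conv e(4) SUP_increments_rational[OF mono a0[of k \<omega>]]
            by (intro SUP_cong refl) auto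
        qed
        then show ?thesis using True in_e e(1,2) Linf by (simp add: \<phi>_def)
      qed simp
    qed
    finally show ?case .
  qed
  then show ?thesis by (intro measurable_P_AE[OF g]) auto
qed

section \<open>The conditioning event and the final computation\<close>

lemma
  assumes i: "i \<in> I"
  defines "E \<equiv> {e\<in>exc_paths x\<^sub>o. zeta x\<^sub>o e = \<infinity> \<and> e \<notin> D i}"
    and "A \<equiv> {\<omega>\<in>space P. emeasure (N \<omega>) ({0..1} \<times> {e\<in>exc_paths x\<^sub>o. zeta x\<^sub>o e = \<infinity> \<and> e \<notin> D i}) = 0}"
  shows sets_E: "E \<in> sets n" and emeasure_E: "emeasure n E < \<infinity>"
    and sets_class_event: "A \<in> sets P" and prob_class_event: "prob A = exp (- measure n E)"
proof -
  note [measurable] = D_sets[OF i]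
  have "E = {e\<in>space n. zeta x\<^sub>o e = \<infinity>} - D i" by (auto simp: E_def space_n)
  also have "\<dots> \<in> sets n" by measurable
  finally show E: "E \<in> sets n" .
  \<comment> \<open>Infinite excursions are in particular longer than 1, and those have finite
    mass.\<close>
  have "emeasure n E \<le> emeasure n {e\<in>exc_paths x\<^sub>o. ennreal 1 < zeta x\<^sub>o e}"
    by (intro emeasure_mono long_n) (auto simp: E_def)
  then show Efin: "emeasure n E < \<infinity>" using n_long_finite[of 1] by (simp add: le_less_trans)
  have B: "{0..1} \<times> E \<in> sets \<mu>\<^sub>0" "emeasure \<mu>\<^sub>0 ({0..1} \<times> E) = emeasure n E"
    using times_\<mu>\<^sub>0[of "{0..1}" E] E by auto
  have pv: "poisson_variable (measure \<mu>\<^sub>0 ({0..1} \<times> E)) (\<lambda>\<omega>. emeasure (N \<omega>) ({0..1} \<times> E))"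
    using poisson_variable_poisson_point_process[OF N_poisson B(1)] B(2) Efin by simp
  then have [measurable]: "(\<lambda>\<omega>. emeasure (N \<omega>) ({0..1} \<times> E)) \<in> borel_measurable P" by (simp add: poisson_variable_def)
  show "A \<in> sets P" unfolding A_def E_def[symmetric] by measurable
  have "prob {\<omega>\<in>space P. emeasure (N \<omega>) ({0..1} \<times> E) = of_nat 0}
      = measure \<mu>\<^sub>0 ({0..1} \<times> E) ^ 0 / fact 0 * exp (- measure \<mu>\<^sub>0 ({0..1} \<times> E))"
    using pv unfolding poisson_variable_def by blast
  then show "prob A = exp (- measure n E)"
    unfolding A_def E_def[symmetric] by (simp add: measure_def B(2))
qed

text \<open>The first infinite excursion up to local time \<open>1\<close> makes both sides vanish. On the
  complementary event \<open>exceeds_1\<close> the lifetimes are the increments of the clock over the disjoint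
  intervals that the excursions of class \<open>i\<close> occupy on the clock's time axis, and these
  intervals are independent of the clock.\<close>

lemma laplace_on_class_event:
  assumes i: "i \<in> I" and q: "0 < q"
  defines "E \<equiv> {e\<in>exc_paths x\<^sub>o. zeta x\<^sub>o e = \<infinity> \<and> e \<notin> D i}"
    and "A \<equiv> {\<omega>\<in>space P. emeasure (N \<omega>) ({0..1} \<times> {e\<in>exc_paths x\<^sub>o. zeta x\<^sub>o e = \<infinity> \<and> e \<notin> D i}) = 0}"
    and "\<psi> \<equiv> laplace_exponent P (\<lambda>t \<omega>. ennreal (Z (f i) t \<omega>)) q"
  shows "(\<integral>\<^sup>+\<omega>. indicator A \<omega> * ennreal (exp_neg q (\<Gamma> i \<omega>)) \<partial>P)
       = ennreal (exp_neg 1 ((\<integral>\<^sup>+e. indicator (D i) e * ennreal (1 - exp_neg \<psi> (zeta x\<^sub>o e)) \<partial>n) + emeasure n E))"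
proof -
  let ?j = "f i"
  have j: "?j \<in> J" using f_range i by simp
  have \<psi>: "0 < \<psi>" unfolding \<psi>_def by (rule laplace_exponent_subordinator_pos[OF Z_subordinator[OF j] Z_strict_mono[OF j] q])
  note [measurable] = D_sets[OF i]
  define a where "a \<omega> p = enn2real (clock_at \<omega> ?j (fst p))" for \<omega> and p :: "real \<times> (real \<Rightarrow> 's)"
  define b where "b \<omega> p = enn2real (clock_at \<omega> ?j (fst p)) + enn2real (zeta x\<^sub>o (snd p))" for \<omega> and p :: "real \<times> (real \<Rightarrow> 's)"
  define V where "V \<omega> = (\<Union>p\<in>early_atoms i \<omega>. {a \<omega> p<..<b \<omega> p})" for \<omega>
  \<comment> \<open>The value infinity at every infinite excursion, of any class, turns the
    indicator of \<open>exceeds_1\<close> into part of the Poisson integral.\<close>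
  define h where "h e = (if zeta x\<^sub>o e = \<infinity> then \<infinity> else ennreal \<psi> * (zeta x\<^sub>o e * indicator (D i) e))" for e
  have [measurable]: "h \<in> borel_measurable n" unfolding h_def by measurable
  have AE1: "AE \<omega> in P. indicator A \<omega> * ennreal (exp_neg q (\<Gamma> i \<omega>)) =
      indicator exceeds_1 \<omega> * ennreal (exp_neg 1 (ennreal q * emeasure (interval_measure (\<lambda>t. Z ?j (max 0 t) \<omega>)) (V \<omega>)))"
    using AE_good_path AE_finite_lifetimes AE_finite_long AE_good_clock[OF j] AE_space
  proof eventually_elim
    case (elim \<omega>)
    interpret p: excursion_path_classes x\<^sub>o c "N \<omega>" "\<lambda>t. L t \<omega>" "XX \<omega>" I D f by (rule elim)
    have good: "cadlag (\<lambda>t. Z ?j t \<omega>)" "strict_mono_on {0..} (\<lambda>t. Z ?j t \<omega>)" "\<And>b. \<exists>t\<ge>0. b < Z ?j t \<omega>"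
      using elim(4) by auto
    have Eset: "{0..1} \<times> E \<in> sets (N \<omega>)"
      using sets_E[OF i] sets_n by (intro p.times_sets) (auto simp: E_def)
    show ?case
    proof (cases "\<omega> \<in> exceeds_1")
      case True
      then have fin: "p.\<eta> 1 < \<infinity>" using p.eta_1_finite_iff by (simp add: exceeds_1_def)
      have "p.A \<inter> ({0..1} \<times> E) = {}"
      proof -
        have "p.\<zeta> e < \<infinity>" if "(s, e) \<in> p.A" "s \<le> 1" for s e
          using p.eta_mono[OF that(2)] fin p.eta_jump[OF that(1)] by (auto simp: top_unique less_top[symmetric])
        then show ?thesis by (force simp: E_def)
      qed
      then have "emeasure (N \<omega>) ({0..1} \<times> E) = 0" using p.emeasure_count[OF Eset] by simp
      then have "\<omega> \<in> A" using elim(5) by (simp add: A_def E_def)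
      moreover have "\<Gamma> i \<omega> = emeasure (interval_measure (\<lambda>t. Z ?j (max 0 t) \<omega>)) (V \<omega>)"
        using p.star_lifetime_eq[OF i fin, of "\<lambda>j t. Z j t \<omega>", OF good]
        by (simp add: star_lifetime_def V_def early_atoms_def a_def b_def)
      ultimately show ?thesis using True by (simp add: exp_neg_eq[of q])
    next
      case False
      have "exp_neg q (\<Gamma> i \<omega>) = 0" if "\<omega> \<in> A"
      proof -
        have "\<not> p.\<eta> 1 < \<infinity>" using False elim(5) p.eta_1_finite_iff by (simp add: exceeds_1_def)
        then obtain s e where se: "(s, e) \<in> p.A" "s \<le> 1" "p.\<zeta> e = \<infinity>" "p.\<eta>l s < \<infinity>"
          using p.infinite_excursion(1)[OF elim(2,3)] by blast
        have "e \<in> D i"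
        proof (rule ccontr)
          assume "e \<notin> D i"
          then have "{(s, e)} \<subseteq> {0..1} \<times> E" using se p.atomsD[OF se(1)] by (simp add: E_def)
          then have "emeasure (N \<omega>) {(s, e)} \<le> emeasure (N \<omega>) ({0..1} \<times> E)" using Eset by (rule emeasure_mono)
          then show False using that p.emeasure_atom[OF se(1)] by (simp add: A_def E_def)
        qed
        then have "\<Gamma> i \<omega> = \<infinity>"
          unfolding star_lifetime_def
          using p.star_lifetime_infinite[OF i, of "\<lambda>j t. Z j t \<omega>", OF good se(1) _ se(2,3,4)] by simp
        then show ?thesis using q by (simp add: exp_neg_def ennreal_mult_top)
      qed
      then show ?thesis using False by (cases "\<omega> \<in> A") auto
    qed
  qed
  have AE2: "AE \<omega> in P. indicator exceeds_1 \<omega> * ennreal (exp_neg 1 (ennreal \<psi> * emeasure lborel (V \<omega>))) =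
      ennreal (exp_neg 1 (\<integral>\<^sup>+p. h (snd p) * indicator {0..1} (fst p) \<partial>N \<omega>))"
    using AE_good_path AE_finite_lifetimes AE_finite_long AE_space
  proof eventually_elim
    case (elim \<omega>)
    interpret p: excursion_path_classes x\<^sub>o c "N \<omega>" "\<lambda>t. L t \<omega>" "XX \<omega>" I D f by (rule elim)
    have hm: "(\<lambda>p. h (snd p) * indicator {0..1} (fst p)) \<in> borel_measurable (N \<omega>)"
    proof -
      have "(\<lambda>p. h (snd p)) \<in> borel_measurable \<mu>\<^sub>0" by measurable
      then have [measurable]: "(\<lambda>p. h (snd p)) \<in> borel_measurable (N \<omega>)"
        unfolding measurable_cong_sets[OF sets_poisson_point_process[OF N_poisson elim(4)] refl] .
      show ?thesis by measurable
    qed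
    show ?case
    proof (cases "\<omega> \<in> exceeds_1")
      case True
      then have fin: "p.\<eta> 1 < \<infinity>" using p.eta_1_finite_iff by (simp add: exceeds_1_def)
      have [measurable]: "{0..1} \<times> D i \<in> sets (N \<omega>)" by (intro p.times_sets p.D_sets i) auto
      have "ennreal \<psi> * emeasure lborel (V \<omega>) = ennreal \<psi> * (\<integral>\<^sup>+p. p.\<zeta> (snd p) * indicator ({0..1} \<times> D i) p \<partial>N \<omega>)"
        using p.lifetime_eq[OF i fin] by (simp add: V_def early_atoms_def a_def b_def)
      also have "\<dots> = (\<integral>\<^sup>+p. ennreal \<psi> * (p.\<zeta> (snd p) * indicator ({0..1} \<times> D i) p) \<partial>N \<omega>)"
        by (rule nn_integral_cmult[symmetric]) measurable
      also have "\<dots> = (\<integral>\<^sup>+p. ennreal \<psi> * (p.\<zeta> (snd p) * indicator ({0..1} \<times> D i) p) \<partial>count_space p.A)"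
        by (rule p.nn_integral_atoms) measurable
      also have "\<dots> = (\<integral>\<^sup>+p. h (snd p) * indicator {0..1} (fst p) \<partial>count_space p.A)"
      proof (rule nn_integral_cong)
        fix q assume "q \<in> space (count_space p.A)"
        then have qA: "(fst q, snd q) \<in> p.A" by simp
        have "p.\<zeta> (snd q) < \<infinity>" if "fst q \<le> 1"
          using p.eta_mono[OF that] fin p.eta_jump[OF qA] by (auto simp: top_unique less_top[symmetric])
        then show "ennreal \<psi> * (p.\<zeta> (snd q) * indicator ({0..1} \<times> D i) q) = h (snd q) * indicator {0..1} (fst q)"
          using p.atomsD[OF qA] by (auto simp: h_def indicator_def mem_Times_iff)
      qed
      also have "\<dots> = (\<integral>\<^sup>+p. h (snd p) * indicator {0..1} (fst p) \<partial>N \<omega>)"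
        by (rule p.nn_integral_atoms[OF hm, symmetric])
      finally show ?thesis using True by simp
    next
      case False
      then have "\<not> p.\<eta> 1 < \<infinity>" using elim(4) p.eta_1_finite_iff by (simp add: exceeds_1_def)
      then obtain s e where se: "(s, e) \<in> p.A" "s \<le> 1" "p.\<zeta> e = \<infinity>"
        using p.infinite_excursion(1)[OF elim(2,3)] by blast
      have "h (snd (s, e)) * indicator {0..1} (fst (s, e)) \<le> (\<integral>\<^sup>+p. h (snd p) * indicator {0..1} (fst p) \<partial>count_space p.A)"
        using se(1) by (rule nn_integral_ge_point)
      also have "\<dots> = (\<integral>\<^sup>+p. h (snd p) * indicator {0..1} (fst p) \<partial>N \<omega>)"
        by (rule p.nn_integral_atoms[OF hm, symmetric])
      finally have "(\<integral>\<^sup>+p. h (snd p) * indicator {0..1} (fst p) \<partial>N \<omega>) = \<infinity>"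
        using se p.atomsD[OF se(1)] by (simp add: h_def top_unique)
      then show ?thesis using False by simp
    qed
  qed
  have "(\<integral>\<^sup>+\<omega>. indicator A \<omega> * ennreal (exp_neg q (\<Gamma> i \<omega>)) \<partial>P)
      = (\<integral>\<^sup>+\<omega>. indicator exceeds_1 \<omega> * ennreal (exp_neg 1 (ennreal q * emeasure (interval_measure (\<lambda>t. Z ?j (max 0 t) \<omega>)) (V \<omega>))) \<partial>P)"
    by (rule nn_integral_cong_AE[OF AE1])
  \<comment> \<open>Here independence enters: the intervals are described in \<open>G\<close>, the
    clock in \<open>\<Sigma>Z\<close>.\<close>
  also have "\<dots> = (\<integral>\<^sup>+\<omega>. indicator exceeds_1 \<omega> * ennreal (exp_neg 1 (ennreal \<psi> * emeasure lborel (V \<omega>))) \<partial>P)"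
    unfolding V_def \<psi>_def
  proof (rule laplace_subordinator_random_open_set[where \<Sigma> = \<Sigma>Z and G = G])
    show "subordinator P (Z ?j)" by (rule Z_subordinator[OF j])
    show "Z ?j t \<in> borel_measurable \<Sigma>Z" if "0 \<le> t" for t using j that by (rule Z_\<Sigma>Z)
    show "prob (A \<inter> C) = prob A * prob C" if "A \<in> sets G" "C \<in> sets \<Sigma>Z" for A C using that by (rule G_indep_Z)
    show "{\<omega>\<in>exceeds_1. \<exists>p\<in>early_atoms i \<omega>. a \<omega> p \<le> r \<and> r' < b \<omega> p} \<in> sets G" for r r'
      unfolding a_def b_def by (rule selected_G[OF i])
    show "0 \<le> laplace_exponent P (\<lambda>t \<omega>. ennreal (Z ?j t \<omega>)) q" using \<psi> by (simp add: \<psi>_def)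
  qed (use q sets_\<Sigma>Z sets_G_subset exceeds_1_G in \<open>simp_all add: a_def\<close>)
  also have "\<dots> = (\<integral>\<^sup>+\<omega>. ennreal (exp_neg 1 (\<integral>\<^sup>+p. h (snd p) * indicator {0..1} (fst p) \<partial>N \<omega>)) \<partial>P)"
    by (rule nn_integral_cong_AE[OF AE2])
  also have "\<dots> = ennreal (exp_neg 1 (\<integral>\<^sup>+e. ennreal (1 - exp_neg 1 (h e)) \<partial>n))"
    by (subst laplace_lifetime(1)) auto
  \<comment> \<open>At an infinite excursion the integrand is 1. Inside class \<open>i\<close> this
    equals 1 - \<open>exp_neg\<close> \<psi> \<infinity>, as \<psi> > 0; outside it contributes the
    mass of E.\<close>
  also have "(\<integral>\<^sup>+e. ennreal (1 - exp_neg 1 (h e)) \<partial>n)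
      = (\<integral>\<^sup>+e. indicator (D i) e * ennreal (1 - exp_neg \<psi> (zeta x\<^sub>o e)) + indicator E e \<partial>n)"
    using \<psi> by (intro nn_integral_cong)
      (auto simp: h_def E_def space_n indicator_def exp_neg_eq[of \<psi>] ennreal_mult_top)
  also have "\<dots> = (\<integral>\<^sup>+e. indicator (D i) e * ennreal (1 - exp_neg \<psi> (zeta x\<^sub>o e)) \<partial>n) + emeasure n E"
    using sets_E[OF i] by (subst nn_integral_add) (auto simp: E_def)
  finally show ?thesis .
qed

text \<open>\<open>class_law\<close> divides by the probability exp (- n(E)) of its conditioning
  event, where E consists of the infinite excursions outside class \<open>i\<close>. This removes
  the term n(E) from the exponent found in \<open>laplace_on_class_event\<close>.\<close>

lemma laplace_exponent_star_lifetime: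
  assumes i: "i \<in> I" and q: "0 \<le> q"
  shows "laplace_exponent (class_law P x\<^sub>o D N i) (star_lifetime x\<^sub>o c D I f N L X Z i) q
       = lifetime_exponent x\<^sub>o n D i (laplace_exponent P (\<lambda>t \<omega>. ennreal (Z (f i) t \<omega>)) q)"
proof -
  define E where "E = {e\<in>exc_paths x\<^sub>o. zeta x\<^sub>o e = \<infinity> \<and> e \<notin> D i}"
  define A where "A = {\<omega>\<in>space P. emeasure (N \<omega>) ({0..1} \<times> {e\<in>exc_paths x\<^sub>o. zeta x\<^sub>o e = \<infinity> \<and> e \<notin> D i}) = 0}"
  let ?\<psi> = "laplace_exponent P (\<lambda>t \<omega>. ennreal (Z (f i) t \<omega>)) q"
  let ?R = "\<integral>\<^sup>+e. indicator (D i) e * ennreal (1 - exp_neg ?\<psi> (zeta x\<^sub>o e)) \<partial>n"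
  have j: "f i \<in> J" using f_range i by simp
  have A[measurable]: "A \<in> sets P" unfolding A_def by (rule sets_class_event[OF i])
  have pA: "prob A = exp (- measure n E)" unfolding A_def E_def by (rule prob_class_event[OF i])
  have eA: "emeasure P A = ennreal (exp (- measure n E))" using pA by (simp add: emeasure_eq_measure)
  then have eA0: "emeasure P A \<noteq> 0" "emeasure P A \<noteq> \<infinity>" by (auto simp: ennreal_eq_0_iff not_le)
  interpret U: prob_space "uniform_measure P A" by (rule prob_space_uniform_measure[OF eA0])
  have law: "class_law P x\<^sub>o D N i = uniform_measure P A" by (simp only: class_law_def A_def)
  note [measurable] = D_sets[OF i]
  have rhs: "lifetime_exponent x\<^sub>o n D i ?\<psi> = enn2real ?R"
  proof -
    have "lifetime_exponent x\<^sub>o n D i ?\<psi> = enn2real (\<integral>\<^sup>+t. ennreal (1 - exp_neg ?\<psi> t) \<partial>distr (density n (indicator (D i))) borel (zeta x\<^sub>o))"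
      unfolding lifetime_exponent_def by (rule integral_eq_nn_integral) auto
    also have "(\<integral>\<^sup>+t. ennreal (1 - exp_neg ?\<psi> t) \<partial>distr (density n (indicator (D i))) borel (zeta x\<^sub>o)) = ?R"
      by (subst nn_integral_distr, simp, simp, subst nn_integral_density) auto
    finally show ?thesis .
  qed
  show ?thesis
  \<comment> \<open>For \<open>q = 0\<close> the inner exponent is 0 as well, and 0 * \<infinity> =
    0 makes both sides vanish even when infinite lifetimes occur.\<close>
  proof (cases "q = 0")
    case True
    have "laplace_exponent (class_law P x\<^sub>o D N i) (star_lifetime x\<^sub>o c D I f N L X Z i) 0 = 0"
      unfolding law by (rule U.laplace_exponent_0)
    moreover have "exp_neg 0 y = 1" for y by (simp add: exp_neg_def)
    ultimately show ?thesis unfolding rhs using True by simp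
  next
    case False
    then have q: "0 < q" using q by simp
    have \<psi>: "0 < ?\<psi>" by (rule laplace_exponent_subordinator_pos[OF Z_subordinator[OF j] Z_strict_mono[OF j] q])
    \<comment> \<open>Finiteness of the exponent ensures that \<open>enn2real\<close> loses nothing
      below.\<close>
    have "?R \<le> (\<integral>\<^sup>+e. ennreal (1 - exp_neg 1 (ennreal ?\<psi> * zeta x\<^sub>o e)) \<partial>n)"
      by (intro nn_integral_mono) (auto simp: indicator_def exp_neg_eq[of ?\<psi>])
    also have "\<dots> < \<infinity>" by (rule exponent_finite[OF \<psi>])
    finally have R: "?R = ennreal (enn2real ?R)" by simp
    have "emeasure n E < \<infinity>" unfolding E_def by (rule emeasure_E[OF i])
    then have Ef: "emeasure n E = ennreal (measure n E)"
      by (intro emeasure_eq_ennreal_measure) simp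
    note [measurable] = measurable_\<Gamma>[OF i]
    have "(\<integral>\<omega>. exp_neg q (\<Gamma> i \<omega>) \<partial>uniform_measure P A) = enn2real (\<integral>\<^sup>+\<omega>. ennreal (exp_neg q (\<Gamma> i \<omega>)) \<partial>uniform_measure P A)"
      by (rule integral_eq_nn_integral) auto
    also have "(\<integral>\<^sup>+\<omega>. ennreal (exp_neg q (\<Gamma> i \<omega>)) \<partial>uniform_measure P A)
        = (\<integral>\<^sup>+\<omega>. ennreal (exp_neg q (\<Gamma> i \<omega>)) * indicator A \<omega> \<partial>P) / emeasure P A"
      by (rule nn_integral_uniform_measure) measurable
    also have "(\<integral>\<^sup>+\<omega>. ennreal (exp_neg q (\<Gamma> i \<omega>)) * indicator A \<omega> \<partial>P) = ennreal (exp_neg 1 (?R + emeasure n E))"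
      unfolding A_def E_def laplace_on_class_event[OF i q, symmetric] by (simp only: mult.commute)
    also have "?R + emeasure n E = ennreal (enn2real ?R + measure n E)"
      by (subst R, subst Ef, subst ennreal_plus) auto
    also have "ennreal (exp_neg 1 \<dots>) / emeasure P A = ennreal (exp (- (enn2real ?R + measure n E)) / exp (- measure n E))"
    proof -
      have "exp_neg 1 (ennreal (enn2real ?R + measure n E)) = exp (- (enn2real ?R + measure n E))"
        by (rule exp_neg_ennreal) simp
      then show ?thesis unfolding eA by (simp only:) (rule divide_ennreal; simp)
    qed
    also have "exp (- (enn2real ?R + measure n E)) / exp (- measure n E) = exp (- enn2real ?R)"
      by (simp add: exp_diff[symmetric])
    finally have int: "(\<integral>\<omega>. exp_neg q (\<Gamma> i \<omega>) \<partial>uniform_measure P A) = exp (- enn2real ?R)"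
      by simp
    show ?thesis unfolding law rhs by (subst laplace_exponent_def) (simp only: int ln_exp minus_minus)
  qed
qed

end

theorem proposition4p1:
  fixes P :: "'w measure"
    and F :: "ennreal \<Rightarrow> 'w measure"
    and X :: "real \<Rightarrow> 'w \<Rightarrow> 's::polish_space"
    and x\<^sub>o :: 's
    and n :: "(real \<Rightarrow> 's) measure"
    and N :: "'w \<Rightarrow> (real \<times> (real \<Rightarrow> 's)) measure"
    and L :: "real \<Rightarrow> 'w \<Rightarrow> real"
    and c :: real
    and I :: "nat set"
    and D :: "nat \<Rightarrow> (real \<Rightarrow> 's) set"
    and J :: "'j set"
    and Z :: "'j \<Rightarrow> real \<Rightarrow> 'w \<Rightarrow> real"
    and f :: "nat \<Rightarrow> 'j"
    and i :: nat and j :: 'j and q :: real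
  assumes "time_changed_regenerative_process P F X x\<^sub>o n N L c I D J Z f"
    and "i \<in> I" and "f i = j" and "0 \<le> q"
  shows "laplace_exponent (class_law P x\<^sub>o D N i) (star_lifetime x\<^sub>o c D I f N L X Z i) q =
           lifetime_exponent x\<^sub>o n D i (laplace_exponent P (\<lambda>t \<omega>. ennreal (Z j t \<omega>)) q)"
proof -
  interpret time_changed_regenerative_process P F X x\<^sub>o n N L c I D J Z f by fact
  show ?thesis using laplace_exponent_star_lifetime[OF assms(2,4)] assms(3) by simp
qed

end
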